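(* Let $(\mathcal{R},\partial)$ be a commutative differential ring with ring of constants $\mathcal{C}$ and a quasi-integration $\mathrm{Q}$, let $\mathcal{R}_{\mathrm{J}}=\mathrm{Q}\mathcal{R}$, $\mathcal{R}_{\mathrm{T}}=\ker\mathrm{Q}$, and let $\mathrm{IDR}(\mathcal{R})$ and $\iota$ be as defined in the context. Let $(\mathcal{S},\partial,\int)$ be a commutative integro-differential ring, with evaluation $\mathrm{E}=\mathrm{id}-\int\partial$, such that $(\mathcal{S},\partial)$ is a differential ring extension of $(\mathcal{R},\partial)$. Let $\eta:\mathrm{IDR}(\mathcal{R})\to\mathcal{S}$ be the unique integro-differential ring homomorphism with $\eta(\iota(f))=f$ for all $f\in\mathcal{R}$, let $\bar{\mathcal{R}}:=\eta(\mathrm{IDR}(\mathcal{R}))$, and assume $\mathrm{Const}_\partial(\bar{\mathcal{R}})=\mathcal{C}$. Assume that $\mathcal{R}_{\mathrm{T}}$ is a free $\mathcal{C}$-module with basis $\{a_i\mid i\in I\}\subseteq\mathcal{R}_{\mathrm{T}}$. Let the ideal $J\subseteq\mathrm{IDR}(\mathcal{R})$ be generated by all constants $$1\otimes\big(\varepsilon(f\otimes\tau(W))-\mathrm{E}(f\sigma(W))\big)\otimes1\otimes1_{\mathcal{T}}\quad\text{and}\quad1\otimes1\otimes\big(\varepsilon(\tau(U)\odot\tau(V))-\mathrm{E}(\sigma(U)\sigma(V))\big)\otimes1_{\mathcal{T}}$$ with $f\in\mathcal{R}_{\mathrm{J}}$, $W\in\langle I\rangle$, and $U,V\in\langle I\rangle^*$.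 Assume further that the differential ring $(\mathcal{R},\partial)$ is such that, for every nonzero element, the differential ideal generated by it contains a nonzero constant. Then the integro-differential ring homomorphism $\tilde{\eta}:\mathrm{IDR}(\mathcal{R})/J\to\bar{\mathcal{R}}$ induced by $\eta$ (the unique one with $\tilde{\eta}([\iota(f)]_J)=f$ for all $f\in\mathcal{R}$) is an integro-differential ring isomorphism.
   Context: Rings and algebras have a unit, homomorphisms preserve it. A differential ring is a ring with an additive map $\partial$ satisfying the Leibniz rule; its ring of constants is $\mathrm{Const}_\partial=\ker\partial$; a differential ideal is an ideal closed under $\partial$. A differential ring extension of $(\mathcal{R},\partial)$ is a differential ring containing $\mathcal{R}$ as a subring whose derivation restricts to that of $\mathcal{R}$. An integro-differential ring $(\mathcal{S},\partial,\int)$ is a differential ring with a $\mathrm{Const}_\partial(\mathcal{S})$-linear map $\int:\mathcal{S}\to\mathcal{S}$ such that $\partial\int=\mathrm{id}$. Integro-differential ring homomorphisms are ring homomorphisms commuting with $\partial$ and $\int$. An ideal generated by constants is closed under $\partial$ and $\int$, so the quotient by it is an integro-differential ring. The map $\eta$ in the claim exists and is unique by the universal property of $\mathrm{IDR}(\mathcal{R})$; the assumption $\mathrm{Const}_\partial(\bar{\mathcal{R}})=\mathcal{C}$ ensures that the evaluations in the generators of $J$ lie in $\mathcal{C}$, and $J\subseteq\ker\eta$, so $\tilde{\eta}$ is well defined. Words: $\langle I\rangle$ is the free monoid of words over $I$, $\langle I\rangle^*$ the set of nonempty words. For $W=w_1\dots w_n$: $\sigma(W):=\int\big(a_{w_1}\int\big(a_{w_2}\cdots\int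 a_{w_n}\big)\cdots\big)\in\mathcal{S}$ and $\tau(W):=a_{w_1}\otimes\dots\otimes a_{w_n}\in\mathcal{T}$; for the empty word $\sigma(W)=1$, $\tau(W)=1_{\mathcal{T}}$. Setting for $\mathrm{IDR}(\mathcal{R})$: $\mathcal{C}=\ker\partial$ in $\mathcal{R}$, and all tensor and symmetric products are over $\mathcal{C}$. A quasi-integration is a $\mathcal{C}$-linear $\mathrm{Q}:\mathcal{R}\to\mathcal{R}$ with $\partial\mathrm{Q}\partial=\partial$ and $\mathrm{Q}\partial\mathrm{Q}=\mathrm{Q}$; then $\mathcal{R}=\mathcal{C}\oplus\mathcal{R}_{\mathrm{J}}=(\partial\mathcal{R})\oplus\mathcal{R}_{\mathrm{T}}$. $\mathcal{T}=\bigoplus_{n\ge0}\mathcal{R}_{\mathrm{T}}^{\otimes n}$ with empty tensor $1_{\mathcal{T}}$; $\widetilde{\mathcal{T}}=\bigoplus_{n\ge1}\mathcal{R}_{\mathrm{T}}^{\otimes n}$. The shuffle product $\sqcup\!\sqcup$ on $\mathcal{T}$ is the $\mathcal{C}$-bilinear product with $t\sqcup\!\sqcup s=t\otimes s$ if $t$ or $s$ has length $0$ and $t\sqcup\!\sqcup s=t_1\otimes((t_2\otimes\dots\otimes t_n)\sqcup\!\sqcup s)+s_1\otimes(t\sqcup\!\sqcup(s_2\otimes\dots\otimes s_m))$ for pure tensors of lengths $n,m\ge1$. For a pure tensor $f=f_1\otimes\dots\otimes f_n$, $f_i^j:=f_i\otimes\dots\otimes f_j$, and $f_i^j=1_{\mathcal{T}}$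 if $i=j+1$. $M_1=\mathcal{R}_{\mathrm{J}}\otimes\mathcal{T}$, $M_2=\widetilde{\mathcal{T}}^{\odot2}$ (symmetric square). $\varepsilon(M_1),\varepsilon(M_2)$ are isomorphic copies with isomorphisms $\varepsilon$; for $r\in\mathcal{R}_{\mathrm{J}}$, $\varepsilon(r)$ means $\varepsilon(r\otimes1_{\mathcal{T}})$. $\mathcal{C}_1=\mathrm{Sym}(\varepsilon(M_1))$ and $\mathcal{C}_2=\mathrm{Sym}(\varepsilon(M_2))/J_2$ (unital symmetric $\mathcal{C}$-algebras), where $J_2$ is the ideal generated by all $$\varepsilon((f\sqcup\!\sqcup g)\odot h)-\varepsilon(f\odot(g\sqcup\!\sqcup h))+\sum_{j=0}^{m-1}\Big(\sum_{i=\max(0,1-j)}^{n-1}\varepsilon(f_{i+1}^n\odot g_{j+1}^m)\cdot\varepsilon((f_1^i\sqcup\!\sqcup g_1^j)\odot h)-\sum_{k=\max(0,1-j)}^{l-1}\varepsilon(f\odot(g_1^j\sqcup\!\sqcup h_1^k))\cdot\varepsilon(g_{j+1}^m\odot h_{k+1}^l)\Big)$$ for $n,m,l\ge1$ and pure tensors $f\in\mathcal{R}_{\mathrm{T}}^{\otimes n}$, $g\in\mathcal{R}_{\mathrm{T}}^{\otimes m}$, $h\in\mathcal{R}_{\mathrm{T}}^{\otimes l}$. Elements $\varepsilon(\cdot)$ of $\mathcal{C}_2$ denote classes. The product on $\mathcal{C}_2\otimes\mathcal{T}$ is the $\mathcal{C}$-bilinear map with, for $c,d\in\mathcal{C}_2$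 and pure tensors $f,g$ of lengths $n,m\ge0$, $$(c\otimes f)\cdot(d\otimes g)=(c\cdot d)\otimes(f\sqcup\!\sqcup g)+\sum_{i=0}^{n-1}\sum_{j=0}^{m-1}\big(c\cdot d\cdot\varepsilon(f_{i+1}^n\odot g_{j+1}^m)\big)\otimes(f_1^i\sqcup\!\sqcup g_1^j);$$ this makes $\mathcal{C}_2\otimes\mathcal{T}$ a commutative $\mathcal{C}$-algebra with unit $1\otimes1_{\mathcal{T}}$. $\mathrm{IDR}(\mathcal{R}):=\mathcal{R}\otimes\mathcal{C}_1\otimes\mathcal{C}_2\otimes\mathcal{T}$ is the tensor product of the commutative $\mathcal{C}$-algebras $\mathcal{R}$, $\mathcal{C}_1$ and $\mathcal{C}_2\otimes\mathcal{T}$; $\iota(f)=f\otimes1\otimes1\otimes1_{\mathcal{T}}$. For $f_0\in\mathcal{R}$, $c=c_1\otimes c_2\in\mathcal{C}_1\otimes\mathcal{C}_2$ and a pure tensor $f\in\mathcal{R}_{\mathrm{T}}^{\otimes n}$, its $\mathcal{C}$-linear maps $\partial,\int$ are: $\partial(f_0\otimes c\otimes f)=(\partial f_0)\otimes c\otimes f$ if $n=0$ and $(\partial f_0)\otimes c\otimes f+(f_0f_1)\otimes c\otimes f_2^n$ if $n>0$. For $n=0$: $\int(f_0\otimes c\otimes f)=(\mathrm{Q}f_0)\otimes c\otimes f-1\otimes(c_1\cdot\varepsilon(\mathrm{Q}f_0))\otimes c_2\otimes f+1\otimes c\otimes((f_0-\partial\mathrm{Q}f_0)\otimes f)$. For $n>0$,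 recursively: $\int(f_0\otimes c\otimes f)=(\mathrm{Q}f_0)\otimes c\otimes f-1\otimes(c_1\cdot\varepsilon((\mathrm{Q}f_0)\otimes f))\otimes c_2\otimes1_{\mathcal{T}}-\int(((\mathrm{Q}f_0)f_1)\otimes c\otimes f_2^n)+1\otimes c\otimes((f_0-\partial\mathrm{Q}f_0)\otimes f)$. With these, $\mathrm{IDR}(\mathcal{R})$ is a commutative integro-differential ring. *)

theory Defs
  imports "HOL-Algebra.Algebra" "HOL-Library.Multiset"
begin

section \<open>Commutative differential and integro-differential rings\<close>

record 'a diff_ring = "'a ring" +
  der :: "'a \<Rightarrow> 'a"

record 'a integro_diff_ring = "'a diff_ring" +
  integ :: "'a \<Rightarrow> 'a"

locale diff_ring = cring R for R :: "('a, 'z) diff_ring_scheme" (structure) +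
  assumes der_closed: "x \<in> carrier R \<Longrightarrow> der R x \<in> carrier R"
    and der_add: "\<lbrakk>x \<in> carrier R; y \<in> carrier R\<rbrakk> \<Longrightarrow> der R (x \<oplus> y) = der R x \<oplus> der R y"
    and der_mult: "\<lbrakk>x \<in> carrier R; y \<in> carrier R\<rbrakk> \<Longrightarrow>
      der R (x \<otimes> y) = der R x \<otimes> y \<oplus> x \<otimes> der R y"

definition constants :: "('a, 'z) diff_ring_scheme \<Rightarrow> 'a set"
  where "constants R = {x \<in> carrier R. der R x = \<zero>\<^bsub>R\<^esub>}"

abbreviation const_ring :: "('a, 'z) diff_ring_scheme \<Rightarrow> ('a, 'z) diff_ring_scheme"
  where "const_ring R \<equiv> R\<lparr>carrier := constants R\<rparr>"

locale integro_diff_ring = diff_ring R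
  for R :: "('a, 'z) integro_diff_ring_scheme" (structure) +
  assumes integ_closed: "x \<in> carrier R \<Longrightarrow> integ R x \<in> carrier R"
    and integ_add: "\<lbrakk>x \<in> carrier R; y \<in> carrier R\<rbrakk> \<Longrightarrow>
      integ R (x \<oplus> y) = integ R x \<oplus> integ R y"
    and integ_const: "\<lbrakk>c \<in> constants R; x \<in> carrier R\<rbrakk> \<Longrightarrow>
      integ R (c \<otimes> x) = c \<otimes> integ R x"
    and der_integ: "x \<in> carrier R \<Longrightarrow> der R (integ R x) = x"

definition evaluation :: "('a, 'z) integro_diff_ring_scheme \<Rightarrow> 'a \<Rightarrow> 'a"
  where "evaluation S x = x \<ominus>\<^bsub>S\<^esub> integ S (der S x)"

text \<open>A homomorphism goes between two integro-differential rings; as in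
  \<^locale>\<open>ring_hom_ring\<close>, this is part of the predicate.\<close>

locale integro_diff_ring_hom = A?: integro_diff_ring A + B?: integro_diff_ring B
  for A :: "('a, 'y) integro_diff_ring_scheme" (structure)
    and B :: "('b, 'z) integro_diff_ring_scheme" (structure) and h +
  assumes hom: "h \<in> ring_hom A B"
    and hom_der: "x \<in> carrier A \<Longrightarrow> h (der A x) = der B (h x)"
    and hom_integ: "x \<in> carrier A \<Longrightarrow> h (integ A x) = integ B (h x)"

locale integro_diff_ring_iso = integro_diff_ring_hom +
  assumes bij: "bij_betw h (carrier A) (carrier B)"

definition diff_ring_extension ::
    "('a, 'y) diff_ring_scheme \<Rightarrow> ('a, 'z) diff_ring_scheme \<Rightarrow> bool"
  where "diff_ring_extension R S \<longleftrightarrow>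
    diff_ring R \<and> diff_ring S \<and>
    carrier R \<subseteq> carrier S \<and> \<zero>\<^bsub>R\<^esub> = \<zero>\<^bsub>S\<^esub> \<and> \<one>\<^bsub>R\<^esub> = \<one>\<^bsub>S\<^esub> \<and>
    (\<forall>x\<in>carrier R. \<forall>y\<in>carrier R.
       x \<oplus>\<^bsub>R\<^esub> y = x \<oplus>\<^bsub>S\<^esub> y \<and> x \<otimes>\<^bsub>R\<^esub> y = x \<otimes>\<^bsub>S\<^esub> y) \<and>
    (\<forall>x\<in>carrier R. der R x = der S x)"

definition diff_ideal :: "'a set \<Rightarrow> ('a, 'z) diff_ring_scheme \<Rightarrow> bool"
  where "diff_ideal I R \<longleftrightarrow> ideal I R \<and> (\<forall>x\<in>I. der R x \<in> I)"

definition gen_diff_ideal :: "('a, 'z) diff_ring_scheme \<Rightarrow> 'a set \<Rightarrow> 'a set"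
  where "gen_diff_ideal R Y = Inter {I. diff_ideal I R \<and> Y \<subseteq> I}"

text \<open>The quotient by an ideal that is closed under the derivation and the integral.\<close>

definition integro_diff_quot ::
    "('a, 'z) integro_diff_ring_scheme \<Rightarrow> 'a set \<Rightarrow> 'a set integro_diff_ring"
  where "integro_diff_quot A J =
    \<lparr>carrier = carrier (A Quot J),
     monoid.mult = monoid.mult (A Quot J), monoid.one = monoid.one (A Quot J),
     ring.zero = ring.zero (A Quot J), ring.add = ring.add (A Quot J),
     der = (\<lambda>Y. \<Union>x\<in>Y. J +>\<^bsub>A\<^esub> der A x),
     integ = (\<lambda>Y. \<Union>x\<in>Y. J +>\<^bsub>A\<^esub> integ A x)\<rparr>"

definition quasi_integration :: "('a, 'z) diff_ring_scheme \<Rightarrow> ('a \<Rightarrow> 'a) \<Rightarrow> bool"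
  where "quasi_integration R Q \<longleftrightarrow>
    (\<forall>x\<in>carrier R. Q x \<in> carrier R) \<and>
    (\<forall>x\<in>carrier R. \<forall>y\<in>carrier R. Q (x \<oplus>\<^bsub>R\<^esub> y) = Q x \<oplus>\<^bsub>R\<^esub> Q y) \<and>
    (\<forall>c\<in>constants R. \<forall>x\<in>carrier R. Q (c \<otimes>\<^bsub>R\<^esub> x) = c \<otimes>\<^bsub>R\<^esub> Q x) \<and>
    (\<forall>x\<in>carrier R. der R (Q (der R x)) = der R x) \<and>
    (\<forall>x\<in>carrier R. Q (der R (Q x)) = Q x)"


section \<open>Modules and algebras over a commutative ring\<close>

text \<open>Modules and algebras share the record type of the library. For a structure that is only
  used as a module the fields \<open>mult\<close> and \<open>one\<close> carry no meaning.\<close>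

definition linear_map ::
    "('c, 'z) ring_scheme \<Rightarrow> ('c, 'm, 'y) module_scheme \<Rightarrow> ('c, 'n, 'x) module_scheme
      \<Rightarrow> ('m \<Rightarrow> 'n) \<Rightarrow> bool"
  where "linear_map C M N \<phi> \<longleftrightarrow>
    \<phi> \<in> carrier M \<rightarrow>\<^sub>E carrier N \<and>
    (\<forall>x\<in>carrier M. \<forall>y\<in>carrier M. \<phi> (x \<oplus>\<^bsub>M\<^esub> y) = \<phi> x \<oplus>\<^bsub>N\<^esub> \<phi> y) \<and>
    (\<forall>c\<in>carrier C. \<forall>x\<in>carrier M. \<phi> (c \<odot>\<^bsub>M\<^esub> x) = c \<odot>\<^bsub>N\<^esub> \<phi> x)"

definition bilinear_map ::
    "('c, 'z) ring_scheme \<Rightarrow> ('c, 'm, 'y) module_scheme \<Rightarrow> ('c, 'n, 'x) module_scheme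
      \<Rightarrow> ('c, 'p, 'w) module_scheme \<Rightarrow> ('m \<Rightarrow> 'n \<Rightarrow> 'p) \<Rightarrow> bool"
  where "bilinear_map C M N P \<mu> \<longleftrightarrow>
    (\<lambda>(x, y). \<mu> x y) \<in> extensional (carrier M \<times> carrier N) \<and>
    (\<forall>x\<in>carrier M. linear_map C N P (\<lambda>y. \<mu> x y)) \<and>
    (\<forall>y\<in>carrier N. linear_map C M P (\<lambda>x. \<mu> x y))"

definition gen_submodule ::
    "('c, 'z) ring_scheme \<Rightarrow> ('c, 'm, 'y) module_scheme \<Rightarrow> 'm set \<Rightarrow> 'm set"
  where "gen_submodule C M Y = Inter {H. submodule H C M \<and> Y \<subseteq> H}"

definition module_basis ::
    "('c, 'z) ring_scheme \<Rightarrow> ('c, 'm, 'y) module_scheme \<Rightarrow> 'i set \<Rightarrow> ('i \<Rightarrow> 'm) \<Rightarrow> bool"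
  where "module_basis C M I a \<longleftrightarrow>
    a ` I \<subseteq> carrier M \<and>
    gen_submodule C M (a ` I) = carrier M \<and>
    (\<forall>F c. finite F \<and> F \<subseteq> I \<and> c \<in> F \<rightarrow> carrier C \<and>
       (\<Oplus>\<^bsub>M\<^esub>i\<in>F. c i \<odot>\<^bsub>M\<^esub> a i) = \<zero>\<^bsub>M\<^esub> \<longrightarrow> (\<forall>i\<in>F. c i = \<zero>\<^bsub>C\<^esub>))"

text \<open>A subset of a ring as a module under multiplication, and the whole ring as an algebra.\<close>

definition ring_submodule :: "('a, 'z) ring_scheme \<Rightarrow> 'a set \<Rightarrow> ('a, 'a) module"
  where "ring_submodule R Y =
    \<lparr>carrier = Y, monoid.mult = monoid.mult R, monoid.one = \<one>\<^bsub>R\<^esub>,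
     ring.zero = \<zero>\<^bsub>R\<^esub>, ring.add = ring.add R, smult = monoid.mult R\<rparr>"

text \<open>The quotient of a module by a submodule, or of an algebra by an ideal.\<close>

definition module_quot ::
    "('c, 'm, 'y) module_scheme \<Rightarrow> 'm set \<Rightarrow> ('c, 'm set) module"
  where "module_quot M H =
    \<lparr>carrier = carrier (M Quot H),
     monoid.mult = monoid.mult (M Quot H), monoid.one = monoid.one (M Quot H),
     ring.zero = ring.zero (M Quot H), ring.add = ring.add (M Quot H),
     smult = (\<lambda>c Y. \<Union>x\<in>Y. H +>\<^bsub>M\<^esub> (c \<odot>\<^bsub>M\<^esub> x))\<rparr>"

definition free_module :: "('c, 'z) ring_scheme \<Rightarrow> 'x set \<Rightarrow> ('c, 'x \<Rightarrow> 'c) module"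
  where "free_module C Y =
    \<lparr>carrier = {p. (\<forall>x\<in>Y. p x \<in> carrier C) \<and> (\<forall>x. x \<notin> Y \<longrightarrow> p x = \<zero>\<^bsub>C\<^esub>) \<and>
       finite {x. p x \<noteq> \<zero>\<^bsub>C\<^esub>}},
     monoid.mult = undefined, monoid.one = undefined,
     ring.zero = (\<lambda>x. \<zero>\<^bsub>C\<^esub>), ring.add = (\<lambda>p q x. p x \<oplus>\<^bsub>C\<^esub> q x),
     smult = (\<lambda>c p x. c \<otimes>\<^bsub>C\<^esub> p x)\<rparr>"

definition single :: "('c, 'z) ring_scheme \<Rightarrow> 'x \<Rightarrow> 'x \<Rightarrow> 'c"
  where "single C x = (\<lambda>y. if y = x then \<one>\<^bsub>C\<^esub> else \<zero>\<^bsub>C\<^esub>)"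


subsection \<open>Tensor products\<close>

definition bilinear_relations ::
    "('c, 'z) ring_scheme \<Rightarrow> ('c, 'm, 'y) module_scheme \<Rightarrow> ('c, 'n, 'x) module_scheme
      \<Rightarrow> ('m \<times> 'n \<Rightarrow> 'c) set"
  where "bilinear_relations C M N =
    (let F = free_module C (carrier M \<times> carrier N); s = single C in
      {s (x \<oplus>\<^bsub>M\<^esub> x', y) \<ominus>\<^bsub>F\<^esub> (s (x, y) \<oplus>\<^bsub>F\<^esub> s (x', y)) | x x' y.
         x \<in> carrier M \<and> x' \<in> carrier M \<and> y \<in> carrier N} \<union>
      {s (x, y \<oplus>\<^bsub>N\<^esub> y') \<ominus>\<^bsub>F\<^esub> (s (x, y) \<oplus>\<^bsub>F\<^esub> s (x, y')) | x y y'.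
         x \<in> carrier M \<and> y \<in> carrier N \<and> y' \<in> carrier N} \<union>
      {s (c \<odot>\<^bsub>M\<^esub> x, y) \<ominus>\<^bsub>F\<^esub> c \<odot>\<^bsub>F\<^esub> s (x, y) | c x y.
         c \<in> carrier C \<and> x \<in> carrier M \<and> y \<in> carrier N} \<union>
      {s (x, c \<odot>\<^bsub>N\<^esub> y) \<ominus>\<^bsub>F\<^esub> c \<odot>\<^bsub>F\<^esub> s (x, y) | c x y.
         c \<in> carrier C \<and> x \<in> carrier M \<and> y \<in> carrier N})"

definition tensor_rel ::
    "('c, 'z) ring_scheme \<Rightarrow> ('c, 'm, 'y) module_scheme \<Rightarrow> ('c, 'n, 'x) module_scheme
      \<Rightarrow> ('m \<times> 'n \<Rightarrow> 'c) set"
  where "tensor_rel C M N =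
    gen_submodule C (free_module C (carrier M \<times> carrier N)) (bilinear_relations C M N)"

definition tensor ::
    "('c, 'z) ring_scheme \<Rightarrow> ('c, 'm, 'y) module_scheme \<Rightarrow> ('c, 'n, 'x) module_scheme
      \<Rightarrow> ('c, ('m \<times> 'n \<Rightarrow> 'c) set) module"
  where "tensor C M N =
    module_quot (free_module C (carrier M \<times> carrier N)) (tensor_rel C M N)"

definition pure_tensor ::
    "('c, 'z) ring_scheme \<Rightarrow> ('c, 'm, 'y) module_scheme \<Rightarrow> ('c, 'n, 'x) module_scheme
      \<Rightarrow> 'm \<Rightarrow> 'n \<Rightarrow> ('m \<times> 'n \<Rightarrow> 'c) set"
  where "pure_tensor C M N x y =
    tensor_rel C M N +>\<^bsub>free_module C (carrier M \<times> carrier N)\<^esub> single C (x, y)"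

definition tensor_algebra_mult ::
    "('c, 'z) ring_scheme \<Rightarrow> ('c, 'm, 'y) module_scheme \<Rightarrow> ('c, 'n, 'x) module_scheme
      \<Rightarrow> ('m \<times> 'n \<Rightarrow> 'c) set \<Rightarrow> ('m \<times> 'n \<Rightarrow> 'c) set \<Rightarrow> ('m \<times> 'n \<Rightarrow> 'c) set"
  where "tensor_algebra_mult C A B =
    (THE \<mu>. bilinear_map C (tensor C A B) (tensor C A B) (tensor C A B) \<mu> \<and>
       (\<forall>a\<in>carrier A. \<forall>b\<in>carrier B. \<forall>a'\<in>carrier A. \<forall>b'\<in>carrier B.
          \<mu> (pure_tensor C A B a b) (pure_tensor C A B a' b') =
            pure_tensor C A B (a \<otimes>\<^bsub>A\<^esub> a') (b \<otimes>\<^bsub>B\<^esub> b')))"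

text \<open>The tensor product of two commutative algebras, as an algebra.\<close>

definition tensor_algebras ::
    "('c, 'z) ring_scheme \<Rightarrow> ('c, 'm, 'y) module_scheme \<Rightarrow> ('c, 'n, 'x) module_scheme
      \<Rightarrow> ('c, ('m \<times> 'n \<Rightarrow> 'c) set) module"
  where "tensor_algebras C A B = (tensor C A B)
    \<lparr>monoid.mult := tensor_algebra_mult C A B, monoid.one := pure_tensor C A B \<one>\<^bsub>A\<^esub> \<one>\<^bsub>B\<^esub>\<rparr>"


subsection \<open>Symmetric square and symmetric algebra\<close>

definition sym_square_rel ::
    "('c, 'z) ring_scheme \<Rightarrow> ('c, 'm, 'y) module_scheme \<Rightarrow> ('m \<times> 'm \<Rightarrow> 'c) set"
  where "sym_square_rel C M =
    (let F = free_module C (carrier M \<times> carrier M) in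
      gen_submodule C F (bilinear_relations C M M \<union>
        {single C (x, y) \<ominus>\<^bsub>F\<^esub> single C (y, x) | x y. x \<in> carrier M \<and> y \<in> carrier M}))"

definition sym_square ::
    "('c, 'z) ring_scheme \<Rightarrow> ('c, 'm, 'y) module_scheme \<Rightarrow> ('c, ('m \<times> 'm \<Rightarrow> 'c) set) module"
  where "sym_square C M =
    module_quot (free_module C (carrier M \<times> carrier M)) (sym_square_rel C M)"

definition sym_tensor ::
    "('c, 'z) ring_scheme \<Rightarrow> ('c, 'm, 'y) module_scheme \<Rightarrow> 'm \<Rightarrow> 'm \<Rightarrow> ('m \<times> 'm \<Rightarrow> 'c) set"
  where "sym_tensor C M x y =
    sym_square_rel C M +>\<^bsub>free_module C (carrier M \<times> carrier M)\<^esub> single C (x, y)"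

text \<open>The polynomial algebra over \<open>C\<close> with set of indeterminates \<open>Y\<close>; monomials are
  multisets of indeterminates.\<close>

definition poly_algebra :: "('c, 'z) ring_scheme \<Rightarrow> 'x set \<Rightarrow> ('c, 'x multiset \<Rightarrow> 'c) module"
  where "poly_algebra C Y = (free_module C {m. set_mset m \<subseteq> Y})
    \<lparr>monoid.mult := (\<lambda>p q m. \<Oplus>\<^bsub>C\<^esub>k\<in>{k. k \<subseteq># m}. p k \<otimes>\<^bsub>C\<^esub> q (m - k)),
     monoid.one := single C {#}\<rparr>"

text \<open>The symmetric algebra \<open>Sym(M)\<close> is the polynomial algebra in one indeterminate for each
  element of \<open>M\<close> modulo the relations that make the indeterminate depend linearly on the element;
  \<open>sym_emb\<close> is the canonical embedding of \<open>M\<close>.\<close>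

definition sym_ideal ::
    "('c, 'z) ring_scheme \<Rightarrow> ('c, 'm, 'y) module_scheme \<Rightarrow> ('m multiset \<Rightarrow> 'c) set"
  where "sym_ideal C M =
    (let P = poly_algebra C (carrier M); v = (\<lambda>x. single C {#x#}) in
      Idl\<^bsub>P\<^esub> ({v (x \<oplus>\<^bsub>M\<^esub> y) \<ominus>\<^bsub>P\<^esub> (v x \<oplus>\<^bsub>P\<^esub> v y) | x y. x \<in> carrier M \<and> y \<in> carrier M} \<union>
        {v (c \<odot>\<^bsub>M\<^esub> x) \<ominus>\<^bsub>P\<^esub> c \<odot>\<^bsub>P\<^esub> v x | c x. c \<in> carrier C \<and> x \<in> carrier M}))"

definition sym_algebra ::
    "('c, 'z) ring_scheme \<Rightarrow> ('c, 'm, 'y) module_scheme \<Rightarrow> ('c, ('m multiset \<Rightarrow> 'c) set) module"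
  where "sym_algebra C M = module_quot (poly_algebra C (carrier M)) (sym_ideal C M)"

definition sym_emb ::
    "('c, 'z) ring_scheme \<Rightarrow> ('c, 'm, 'y) module_scheme \<Rightarrow> 'm \<Rightarrow> ('m multiset \<Rightarrow> 'c) set"
  where "sym_emb C M x = sym_ideal C M +>\<^bsub>poly_algebra C (carrier M)\<^esub> single C {#x#}"


subsection \<open>The direct sum of all tensor powers\<close>

text \<open>\<open>\<Oplus>\<^sub>n M\<^sup>\<otimes>\<^sup>n\<close> is the free module on the lists over \<open>M\<close> modulo linearity in every
  entry. These relations are homogeneous in the length of the lists, so that the \<open>n\<close>-th tensor
  power is spanned by the classes of the lists of length \<open>n\<close>; the class of a list is the pure
  tensor of its entries.\<close>

definition tensor_powers_rel ::
    "('c, 'z) ring_scheme \<Rightarrow> ('c, 'm, 'y) module_scheme \<Rightarrow> ('m list \<Rightarrow> 'c) set"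
  where "tensor_powers_rel C M =
    (let F = free_module C (lists (carrier M)); s = single C in
      gen_submodule C F
       ({s (us @ [x \<oplus>\<^bsub>M\<^esub> y] @ vs) \<ominus>\<^bsub>F\<^esub> (s (us @ [x] @ vs) \<oplus>\<^bsub>F\<^esub> s (us @ [y] @ vs)) | us vs x y.
           us \<in> lists (carrier M) \<and> vs \<in> lists (carrier M) \<and>
           x \<in> carrier M \<and> y \<in> carrier M} \<union>
        {s (us @ [c \<odot>\<^bsub>M\<^esub> x] @ vs) \<ominus>\<^bsub>F\<^esub> c \<odot>\<^bsub>F\<^esub> s (us @ [x] @ vs) | us vs c x.
           us \<in> lists (carrier M) \<and> vs \<in> lists (carrier M) \<and>
           c \<in> carrier C \<and> x \<in> carrier M}))"

definition tensor_powers ::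
    "('c, 'z) ring_scheme \<Rightarrow> ('c, 'm, 'y) module_scheme \<Rightarrow> ('c, ('m list \<Rightarrow> 'c) set) module"
  where "tensor_powers C M =
    module_quot (free_module C (lists (carrier M))) (tensor_powers_rel C M)"

definition pure_tensor_list ::
    "('c, 'z) ring_scheme \<Rightarrow> ('c, 'm, 'y) module_scheme \<Rightarrow> 'm list \<Rightarrow> ('m list \<Rightarrow> 'c) set"
  where "pure_tensor_list C M f =
    tensor_powers_rel C M +>\<^bsub>free_module C (lists (carrier M))\<^esub> single C f"


section \<open>The construction of IDR(R)\<close>

type_synonym 'a tens = "('a list \<Rightarrow> 'a) set"
type_synonym 'a m1 = "('a \<times> 'a tens \<Rightarrow> 'a) set"
type_synonym 'a m2 = "('a tens \<times> 'a tens \<Rightarrow> 'a) set"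
type_synonym 'a c1 = "('a m1 multiset \<Rightarrow> 'a) set"
type_synonym 'a sym_m2 = "('a m2 multiset \<Rightarrow> 'a) set"
type_synonym 'a c2 = "'a sym_m2 set"
type_synonym 'a c2t = "('a c2 \<times> 'a tens \<Rightarrow> 'a) set"
type_synonym 'a c1c2t = "('a c1 \<times> 'a c2t \<Rightarrow> 'a) set"
type_synonym 'a idr = "('a \<times> 'a c1c2t \<Rightarrow> 'a) set"

definition RJ :: "'a diff_ring \<Rightarrow> ('a \<Rightarrow> 'a) \<Rightarrow> 'a set"
  where "RJ R Q = Q ` carrier R"

definition RT :: "'a diff_ring \<Rightarrow> ('a \<Rightarrow> 'a) \<Rightarrow> 'a set"
  where "RT R Q = {x \<in> carrier R. Q x = \<zero>\<^bsub>R\<^esub>}"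

subsection \<open>The tensors and the shuffle product\<close>

definition T_mod :: "'a diff_ring \<Rightarrow> ('a \<Rightarrow> 'a) \<Rightarrow> ('a, 'a tens) module"
  where "T_mod R Q = tensor_powers (const_ring R) (ring_submodule R (RT R Q))"

definition T_pure :: "'a diff_ring \<Rightarrow> ('a \<Rightarrow> 'a) \<Rightarrow> 'a list \<Rightarrow> 'a tens"
  where "T_pure R Q f = pure_tensor_list (const_ring R) (ring_submodule R (RT R Q)) f"

text \<open>The submodule of tensors without part of length 0.\<close>

definition T_pos :: "'a diff_ring \<Rightarrow> ('a \<Rightarrow> 'a) \<Rightarrow> ('a, 'a tens) module"
  where "T_pos R Q = (T_mod R Q)
    \<lparr>carrier := gen_submodule (const_ring R) (T_mod R Q)
       (T_pure R Q ` (lists (RT R Q) - {[]}))\<rparr>"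

text \<open>The recursion that defines the shuffle product of two pure tensors, with the sum of the
  resulting pure tensors written as a list (repetitions count).\<close>

fun shuffle_lists :: "'a list \<Rightarrow> 'a list \<Rightarrow> 'a list list"
  where
    "shuffle_lists [] s = [s]"
  | "shuffle_lists (t1 # t) [] = [t1 # t]"
  | "shuffle_lists (t1 # t) (s1 # s) =
      map (Cons t1) (shuffle_lists t (s1 # s)) @ map (Cons s1) (shuffle_lists (t1 # t) s)"

definition T_sum :: "'a diff_ring \<Rightarrow> ('a \<Rightarrow> 'a) \<Rightarrow> 'a list list \<Rightarrow> 'a tens"
  where "T_sum R Q ws = foldr (\<lambda>w t. T_pure R Q w \<oplus>\<^bsub>T_mod R Q\<^esub> t) ws \<zero>\<^bsub>T_mod R Q\<^esub>"

definition shuffle :: "'a diff_ring \<Rightarrow> ('a \<Rightarrow> 'a) \<Rightarrow> 'a tens \<Rightarrow> 'a tens \<Rightarrow> 'a tens"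
  where "shuffle R Q =
    (THE \<mu>. bilinear_map (const_ring R) (T_mod R Q) (T_mod R Q) (T_mod R Q) \<mu> \<and>
       (\<forall>t\<in>lists (RT R Q). \<forall>s\<in>lists (RT R Q).
          \<mu> (T_pure R Q t) (T_pure R Q s) = T_sum R Q (shuffle_lists t s)))"

subsection \<open>The algebras of constants\<close>

definition M1 :: "'a diff_ring \<Rightarrow> ('a \<Rightarrow> 'a) \<Rightarrow> ('a, 'a m1) module"
  where "M1 R Q = tensor (const_ring R) (ring_submodule R (RJ R Q)) (T_mod R Q)"

definition C1_alg :: "'a diff_ring \<Rightarrow> ('a \<Rightarrow> 'a) \<Rightarrow> ('a, 'a c1) module"
  where "C1_alg R Q = sym_algebra (const_ring R) (M1 R Q)"

text \<open>\<open>eps1 R Q r t\<close> is \<open>\<epsilon>(r \<otimes> t)\<close> in the first algebra.\<close>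

definition eps1 :: "'a diff_ring \<Rightarrow> ('a \<Rightarrow> 'a) \<Rightarrow> 'a \<Rightarrow> 'a tens \<Rightarrow> 'a c1"
  where "eps1 R Q r t = sym_emb (const_ring R) (M1 R Q)
    (pure_tensor (const_ring R) (ring_submodule R (RJ R Q)) (T_mod R Q) r t)"

definition M2 :: "'a diff_ring \<Rightarrow> ('a \<Rightarrow> 'a) \<Rightarrow> ('a, 'a m2) module"
  where "M2 R Q = sym_square (const_ring R) (T_pos R Q)"

definition Sym_M2 :: "'a diff_ring \<Rightarrow> ('a \<Rightarrow> 'a) \<Rightarrow> ('a, 'a sym_m2) module"
  where "Sym_M2 R Q = sym_algebra (const_ring R) (M2 R Q)"

text \<open>\<open>\<epsilon>(s \<odot> t)\<close> before passing to the quotient by \<open>J\<^sub>2\<close>.\<close>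

definition pre_eps2 :: "'a diff_ring \<Rightarrow> ('a \<Rightarrow> 'a) \<Rightarrow> 'a tens \<Rightarrow> 'a tens \<Rightarrow> 'a sym_m2"
  where "pre_eps2 R Q s t =
    sym_emb (const_ring R) (M2 R Q) (sym_tensor (const_ring R) (T_pos R Q) s t)"

text \<open>For a pure tensor \<open>f\<close> given as a list, \<open>f\<^sub>1\<^sup>i\<close> is \<open>take i f\<close> and \<open>f\<^sub>i\<^sub>+\<^sub>1\<^sup>n\<close> is \<open>drop i f\<close>.
  The truncated subtraction \<open>1 - j\<close> on natural numbers is \<open>max(0, 1 - j)\<close>.\<close>

definition J2_gen ::
    "'a diff_ring \<Rightarrow> ('a \<Rightarrow> 'a) \<Rightarrow> 'a list \<Rightarrow> 'a list \<Rightarrow> 'a list \<Rightarrow> 'a sym_m2"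
  where "J2_gen R Q f g h =
    (let S = Sym_M2 R Q; p = T_pure R Q; sh = shuffle R Q; e = pre_eps2 R Q in
      e (sh (p f) (p g)) (p h) \<ominus>\<^bsub>S\<^esub> e (p f) (sh (p g) (p h)) \<oplus>\<^bsub>S\<^esub>
      (\<Oplus>\<^bsub>S\<^esub>j\<in>{0..<length g}.
         (\<Oplus>\<^bsub>S\<^esub>i\<in>{1 - j..<length f}.
            e (p (drop i f)) (p (drop j g)) \<otimes>\<^bsub>S\<^esub> e (sh (p (take i f)) (p (take j g))) (p h))
         \<ominus>\<^bsub>S\<^esub>
         (\<Oplus>\<^bsub>S\<^esub>k\<in>{1 - j..<length h}.
            e (p f) (sh (p (take j g)) (p (take k h))) \<otimes>\<^bsub>S\<^esub> e (p (drop j g)) (p (drop k h)))))"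

definition J2 :: "'a diff_ring \<Rightarrow> ('a \<Rightarrow> 'a) \<Rightarrow> 'a sym_m2 set"
  where "J2 R Q = Idl\<^bsub>Sym_M2 R Q\<^esub> {J2_gen R Q f g h | f g h.
    f \<in> lists (RT R Q) - {[]} \<and> g \<in> lists (RT R Q) - {[]} \<and> h \<in> lists (RT R Q) - {[]}}"

definition C2_alg :: "'a diff_ring \<Rightarrow> ('a \<Rightarrow> 'a) \<Rightarrow> ('a, 'a c2) module"
  where "C2_alg R Q = module_quot (Sym_M2 R Q) (J2 R Q)"

definition eps2 :: "'a diff_ring \<Rightarrow> ('a \<Rightarrow> 'a) \<Rightarrow> 'a tens \<Rightarrow> 'a tens \<Rightarrow> 'a c2"
  where "eps2 R Q s t = J2 R Q +>\<^bsub>Sym_M2 R Q\<^esub> pre_eps2 R Q s t"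

subsection \<open>The algebra on \<open>C\<^sub>2 \<otimes> T\<close>\<close>

definition C2T_mod :: "'a diff_ring \<Rightarrow> ('a \<Rightarrow> 'a) \<Rightarrow> ('a, 'a c2t) module"
  where "C2T_mod R Q = tensor (const_ring R) (C2_alg R Q) (T_mod R Q)"

definition C2T_pure :: "'a diff_ring \<Rightarrow> ('a \<Rightarrow> 'a) \<Rightarrow> 'a c2 \<Rightarrow> 'a tens \<Rightarrow> 'a c2t"
  where "C2T_pure R Q = pure_tensor (const_ring R) (C2_alg R Q) (T_mod R Q)"

definition C2T_mult :: "'a diff_ring \<Rightarrow> ('a \<Rightarrow> 'a) \<Rightarrow> 'a c2t \<Rightarrow> 'a c2t \<Rightarrow> 'a c2t"
  where "C2T_mult R Q =
    (THE \<mu>. bilinear_map (const_ring R) (C2T_mod R Q) (C2T_mod R Q) (C2T_mod R Q) \<mu> \<and>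
       (\<forall>c\<in>carrier (C2_alg R Q). \<forall>d\<in>carrier (C2_alg R Q).
        \<forall>f\<in>lists (RT R Q). \<forall>g\<in>lists (RT R Q).
          \<mu> (C2T_pure R Q c (T_pure R Q f)) (C2T_pure R Q d (T_pure R Q g)) =
            C2T_pure R Q (c \<otimes>\<^bsub>C2_alg R Q\<^esub> d) (shuffle R Q (T_pure R Q f) (T_pure R Q g))
            \<oplus>\<^bsub>C2T_mod R Q\<^esub>
            (\<Oplus>\<^bsub>C2T_mod R Q\<^esub>i\<in>{0..<length f}. \<Oplus>\<^bsub>C2T_mod R Q\<^esub>j\<in>{0..<length g}.
               C2T_pure R Q
                 (c \<otimes>\<^bsub>C2_alg R Q\<^esub> d \<otimes>\<^bsub>C2_alg R Q\<^esub>
                   eps2 R Q (T_pure R Q (drop i f)) (T_pure R Q (drop j g)))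
                 (shuffle R Q (T_pure R Q (take i f)) (T_pure R Q (take j g))))))"

definition C2T_alg :: "'a diff_ring \<Rightarrow> ('a \<Rightarrow> 'a) \<Rightarrow> ('a, 'a c2t) module"
  where "C2T_alg R Q = (C2T_mod R Q)
    \<lparr>monoid.mult := C2T_mult R Q, monoid.one := C2T_pure R Q \<one>\<^bsub>C2_alg R Q\<^esub> (T_pure R Q [])\<rparr>"

subsection \<open>The integro-differential ring\<close>

definition C1C2T_alg :: "'a diff_ring \<Rightarrow> ('a \<Rightarrow> 'a) \<Rightarrow> ('a, 'a c1c2t) module"
  where "C1C2T_alg R Q = tensor_algebras (const_ring R) (C1_alg R Q) (C2T_alg R Q)"

definition IDR_alg :: "'a diff_ring \<Rightarrow> ('a \<Rightarrow> 'a) \<Rightarrow> ('a, 'a idr) module"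
  where "IDR_alg R Q =
    tensor_algebras (const_ring R) (ring_submodule R (carrier R)) (C1C2T_alg R Q)"

text \<open>The element \<open>f\<^sub>0 \<otimes> c\<^sub>1 \<otimes> c\<^sub>2 \<otimes> t\<close>.\<close>

definition IDR_pure :: "'a diff_ring \<Rightarrow> ('a \<Rightarrow> 'a) \<Rightarrow> 'a \<Rightarrow> 'a c1 \<Rightarrow> 'a c2 \<Rightarrow> 'a tens \<Rightarrow> 'a idr"
  where "IDR_pure R Q f0 c1 c2 t =
    pure_tensor (const_ring R) (ring_submodule R (carrier R)) (C1C2T_alg R Q) f0
      (pure_tensor (const_ring R) (C1_alg R Q) (C2T_alg R Q) c1 (C2T_pure R Q c2 t))"

definition IDR_der :: "'a diff_ring \<Rightarrow> ('a \<Rightarrow> 'a) \<Rightarrow> 'a idr \<Rightarrow> 'a idr"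
  where "IDR_der R Q =
    (THE D. linear_map (const_ring R) (IDR_alg R Q) (IDR_alg R Q) D \<and>
       (\<forall>f0\<in>carrier R. \<forall>c1\<in>carrier (C1_alg R Q). \<forall>c2\<in>carrier (C2_alg R Q).
          D (IDR_pure R Q f0 c1 c2 (T_pure R Q [])) =
            IDR_pure R Q (der R f0) c1 c2 (T_pure R Q []) \<and>
          (\<forall>f1\<in>RT R Q. \<forall>f\<in>lists (RT R Q).
             D (IDR_pure R Q f0 c1 c2 (T_pure R Q (f1 # f))) =
               IDR_pure R Q (der R f0) c1 c2 (T_pure R Q (f1 # f)) \<oplus>\<^bsub>IDR_alg R Q\<^esub>
               IDR_pure R Q (f0 \<otimes>\<^bsub>R\<^esub> f1) c1 c2 (T_pure R Q f))))"

definition IDR_integ :: "'a diff_ring \<Rightarrow> ('a \<Rightarrow> 'a) \<Rightarrow> 'a idr \<Rightarrow> 'a idr"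
  where "IDR_integ R Q =
    (THE K. linear_map (const_ring R) (IDR_alg R Q) (IDR_alg R Q) K \<and>
       (\<forall>f0\<in>carrier R. \<forall>c1\<in>carrier (C1_alg R Q). \<forall>c2\<in>carrier (C2_alg R Q).
          K (IDR_pure R Q f0 c1 c2 (T_pure R Q [])) =
            IDR_pure R Q (Q f0) c1 c2 (T_pure R Q [])
            \<ominus>\<^bsub>IDR_alg R Q\<^esub>
            IDR_pure R Q \<one>\<^bsub>R\<^esub> (c1 \<otimes>\<^bsub>C1_alg R Q\<^esub> eps1 R Q (Q f0) (T_pure R Q []))
              c2 (T_pure R Q [])
            \<oplus>\<^bsub>IDR_alg R Q\<^esub>
            IDR_pure R Q \<one>\<^bsub>R\<^esub> c1 c2 (T_pure R Q [f0 \<ominus>\<^bsub>R\<^esub> der R (Q f0)]) \<and>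
          (\<forall>f1\<in>RT R Q. \<forall>f\<in>lists (RT R Q).
             K (IDR_pure R Q f0 c1 c2 (T_pure R Q (f1 # f))) =
               IDR_pure R Q (Q f0) c1 c2 (T_pure R Q (f1 # f))
               \<ominus>\<^bsub>IDR_alg R Q\<^esub>
               IDR_pure R Q \<one>\<^bsub>R\<^esub> (c1 \<otimes>\<^bsub>C1_alg R Q\<^esub> eps1 R Q (Q f0) (T_pure R Q (f1 # f)))
                 c2 (T_pure R Q [])
               \<ominus>\<^bsub>IDR_alg R Q\<^esub>
               K (IDR_pure R Q (Q f0 \<otimes>\<^bsub>R\<^esub> f1) c1 c2 (T_pure R Q f))
               \<oplus>\<^bsub>IDR_alg R Q\<^esub>
               IDR_pure R Q \<one>\<^bsub>R\<^esub> c1 c2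
                 (T_pure R Q ((f0 \<ominus>\<^bsub>R\<^esub> der R (Q f0)) # f1 # f)))))"

definition IDR :: "'a diff_ring \<Rightarrow> ('a \<Rightarrow> 'a) \<Rightarrow> 'a idr integro_diff_ring"
  where "IDR R Q =
    \<lparr>carrier = carrier (IDR_alg R Q),
     monoid.mult = monoid.mult (IDR_alg R Q), monoid.one = monoid.one (IDR_alg R Q),
     ring.zero = ring.zero (IDR_alg R Q), ring.add = ring.add (IDR_alg R Q),
     der = IDR_der R Q, integ = IDR_integ R Q\<rparr>"

definition iota :: "'a diff_ring \<Rightarrow> ('a \<Rightarrow> 'a) \<Rightarrow> 'a \<Rightarrow> 'a idr"
  where "iota R Q f =
    IDR_pure R Q f \<one>\<^bsub>C1_alg R Q\<^esub> \<one>\<^bsub>C2_alg R Q\<^esub> (T_pure R Q [])"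


section \<open>Words, nested integrals, and the ideal of evaluations\<close>

fun nested_integral :: "('a, 'z) integro_diff_ring_scheme \<Rightarrow> ('i \<Rightarrow> 'a) \<Rightarrow> 'i list \<Rightarrow> 'a"
  where
    "nested_integral S a [] = \<one>\<^bsub>S\<^esub>"
  | "nested_integral S a (w # W) = integ S (a w \<otimes>\<^bsub>S\<^esub> nested_integral S a W)"

definition word_tensor :: "'a diff_ring \<Rightarrow> ('a \<Rightarrow> 'a) \<Rightarrow> ('i \<Rightarrow> 'a) \<Rightarrow> 'i list \<Rightarrow> 'a tens"
  where "word_tensor R Q a W = T_pure R Q (map a W)"

text \<open>The evaluations are elements of \<open>C\<close> and act by scalar multiplication on the units of the
  two algebras.\<close>

definition eval_ideal ::
    "'a diff_ring \<Rightarrow> ('a \<Rightarrow> 'a) \<Rightarrow> 'a integro_diff_ring \<Rightarrow> 'i set \<Rightarrow> ('i \<Rightarrow> 'a) \<Rightarrow> 'a idr set"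
  where "eval_ideal R Q S I a =
    (let C1 = C1_alg R Q; C2 = C2_alg R Q; \<sigma> = nested_integral S a; \<tau> = word_tensor R Q a in
      Idl\<^bsub>IDR R Q\<^esub>
       ({IDR_pure R Q \<one>\<^bsub>R\<^esub>
           (eps1 R Q f (\<tau> W) \<ominus>\<^bsub>C1\<^esub> evaluation S (f \<otimes>\<^bsub>S\<^esub> \<sigma> W) \<odot>\<^bsub>C1\<^esub> \<one>\<^bsub>C1\<^esub>)
           \<one>\<^bsub>C2\<^esub> (T_pure R Q []) | f W. f \<in> RJ R Q \<and> W \<in> lists I} \<union>
        {IDR_pure R Q \<one>\<^bsub>R\<^esub> \<one>\<^bsub>C1\<^esub>
           (eps2 R Q (\<tau> U) (\<tau> V) \<ominus>\<^bsub>C2\<^esub> evaluation S (\<sigma> U \<otimes>\<^bsub>S\<^esub> \<sigma> V) \<odot>\<^bsub>C2\<^esub> \<one>\<^bsub>C2\<^esub>)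
           (T_pure R Q []) | U V. U \<in> lists I - {[]} \<and> V \<in> lists I - {[]}}))"

end

(*
  Every element of IDR(R) is congruent modulo J to a finite sum of terms r * tau(W) with r in R and
  words W: the algebras of constants are generated by the elements eps(f (x) tau(W)) and
  eps(tau(U) . tau(V)), which are scalars modulo J. On tau(W) the map eta takes the value sigma(W).
  Moreover, E(f tau(W)) = eps(f (x) tau(W)) and E(tau(U) tau(V)) = eps(tau(U) . tau(V)) hold in
  IDR(R), because E kills all tensors of positive length; applying eta gives that J is contained in
  the kernel of eta. So the kernel is J as soon as the nested integrals sigma(W) are linearly
  independent over R. A relation among them with a minimal number of coefficients at words of
  maximal length may be assumed to have a nonzero constant among these coefficients, since such
  coefficients form a differential ideal. Differentiating shortens the relation, hence kills it by
  induction, and this exhibits a nontrivial constant combination of the a_i as a derivative in R,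
  which is impossible since the kernel of Q meets the image of the derivation trivially.

  The products, the derivation and the integral of IDR(R) are given by definite descriptions, so that
  they carry no information until a map with the described values on pure tensors is shown to exist.
*)
theory Submission
  imports Defs
begin

text \<open>Products and integrals are prescribed by formulas in several arguments at pure tensors,
  and such a formula defines a map only if it is linear in each argument. Extending all arguments at
  once is not possible, so they are extended one at a time: the others are carried along as
  parameters, and linearity in a parameter, known at generators, passes to all elements by
  induction. Extensionality outside the carrier then turns uniqueness on the carrier into uniqueness
  of the described function.

  The commutative ring axioms for IDR(R) come with the hypothesis on \<open>\<eta>\<close>, since a
  homomorphism goes between two integro-differential rings. The hypothesis on the constants of the
  image enters where an evaluation has to be an element of \<open>R\<close> at all: it is the image
  of a constant of IDR(R).

  The normal forms modulo \<open>J\<close> are used twice. Independence of the nested integrals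
  makes the induced map injective, and the value of any integro-differential homomorphism that fixes
  \<open>R\<close> is forced on them, which gives uniqueness.\<close>

section \<open>Linear maps\<close>

text \<open>\<open>linear_map\<close> and \<open>bilinear_map\<close> fix the values outside the
  carrier so that definite descriptions can single out one function. Here only the values on the
  carrier count, which makes compositions and sums of linear maps linear without restricting them
  again.\<close>

definition linear_on ::
    "('c, 'z) ring_scheme \<Rightarrow> ('c, 'm, 'y) module_scheme \<Rightarrow> ('c, 'n, 'x) module_scheme
      \<Rightarrow> ('m \<Rightarrow> 'n) \<Rightarrow> bool"
  where "linear_on C M N f \<longleftrightarrow>
    (\<forall>x\<in>carrier M. f x \<in> carrier N) \<and>
    (\<forall>x\<in>carrier M. \<forall>y\<in>carrier M. f (x \<oplus>\<^bsub>M\<^esub> y) = f x \<oplus>\<^bsub>N\<^esub> f y) \<and>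
    (\<forall>c\<in>carrier C. \<forall>x\<in>carrier M. f (c \<odot>\<^bsub>M\<^esub> x) = c \<odot>\<^bsub>N\<^esub> f x)"

definition bilinear_on ::
    "('c, 'z) ring_scheme \<Rightarrow> ('c, 'm, 'y) module_scheme \<Rightarrow> ('c, 'n, 'x) module_scheme
      \<Rightarrow> ('c, 'p, 'w) module_scheme \<Rightarrow> ('m \<Rightarrow> 'n \<Rightarrow> 'p) \<Rightarrow> bool"
  where "bilinear_on C M N P f \<longleftrightarrow>
    (\<forall>x\<in>carrier M. linear_on C N P (f x)) \<and>
    (\<forall>y\<in>carrier N. linear_on C M P (\<lambda>x. f x y))"

lemma linear_onI:
  assumes "\<And>x. x \<in> carrier M \<Longrightarrow> f x \<in> carrier N"
    and "\<And>x y. \<lbrakk>x \<in> carrier M; y \<in> carrier M\<rbrakk> \<Longrightarrow> f (x \<oplus>\<^bsub>M\<^esub> y) = f x \<oplus>\<^bsub>N\<^esub> f y"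
    and "\<And>c x. \<lbrakk>c \<in> carrier C; x \<in> carrier M\<rbrakk> \<Longrightarrow> f (c \<odot>\<^bsub>M\<^esub> x) = c \<odot>\<^bsub>N\<^esub> f x"
  shows "linear_on C M N f"
  using assms by (simp add: linear_on_def)

lemma
  assumes "linear_on C M N f"
  shows linear_on_closed: "x \<in> carrier M \<Longrightarrow> f x \<in> carrier N"
    and linear_on_add: "\<lbrakk>x \<in> carrier M; y \<in> carrier M\<rbrakk> \<Longrightarrow> f (x \<oplus>\<^bsub>M\<^esub> y) = f x \<oplus>\<^bsub>N\<^esub> f y"
    and linear_on_smult: "\<lbrakk>c \<in> carrier C; x \<in> carrier M\<rbrakk> \<Longrightarrow> f (c \<odot>\<^bsub>M\<^esub> x) = c \<odot>\<^bsub>N\<^esub> f x"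
  using assms by (simp_all add: linear_on_def)

lemma linear_on_cong:
  assumes "linear_on C M N f" and "module C M" and "\<And>x. x \<in> carrier M \<Longrightarrow> f x = g x"
  shows "linear_on C M N g"
proof -
  interpret M: module C M by fact
  show ?thesis using assms(1,3) by (simp add: linear_on_def)
qed

lemma linear_on_comp:
  assumes "linear_on C M N f" and "linear_on C N P g"
  shows "linear_on C M P (\<lambda>x. g (f x))"
  using assms by (simp add: linear_on_def)

lemma linear_on_zero:
  assumes "linear_on C M N f" and "module C M" and "module C N"
  shows "f \<zero>\<^bsub>M\<^esub> = \<zero>\<^bsub>N\<^esub>"
proof -
  interpret M: module C M by fact
  interpret N: module C N by fact
  have "f (\<zero>\<^bsub>C\<^esub> \<odot>\<^bsub>M\<^esub> \<zero>\<^bsub>M\<^esub>) = \<zero>\<^bsub>C\<^esub> \<odot>\<^bsub>N\<^esub> f \<zero>\<^bsub>M\<^esub>"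
    by (rule linear_on_smult[OF assms(1)]) auto
  thus ?thesis using linear_on_closed[OF assms(1), of "\<zero>\<^bsub>M\<^esub>"] by simp
qed

lemma linear_on_a_inv:
  assumes "linear_on C M N f" and "module C M" and "module C N" and "x \<in> carrier M"
  shows "f (\<ominus>\<^bsub>M\<^esub> x) = \<ominus>\<^bsub>N\<^esub> f x"
proof -
  interpret M: module C M by fact
  interpret N: module C N by fact
  have "f x \<oplus>\<^bsub>N\<^esub> f (\<ominus>\<^bsub>M\<^esub> x) = \<zero>\<^bsub>N\<^esub>"
    using linear_on_add[OF assms(1), of x "\<ominus>\<^bsub>M\<^esub> x"] linear_on_zero[OF assms(1-3)] assms(4)
    by (simp add: M.r_neg)
  thus ?thesis using assms(4) linear_on_closed[OF assms(1)]
    by (metis M.a_inv_closed N.add.inv_equality N.a_comm)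
qed

lemma linear_on_diff:
  assumes "linear_on C M N f" and "module C M" and "module C N"
    and "x \<in> carrier M" and "y \<in> carrier M"
  shows "f (x \<ominus>\<^bsub>M\<^esub> y) = f x \<ominus>\<^bsub>N\<^esub> f y"
proof -
  interpret M: module C M by fact
  show ?thesis unfolding a_minus_def
    using assms linear_on_add[OF assms(1)] linear_on_a_inv[OF assms(1-3)] by simp
qed

lemma minus_eq_zero_iff:
  assumes "abelian_group M" "x \<in> carrier M" "y \<in> carrier M"
  shows "x \<ominus>\<^bsub>M\<^esub> y = \<zero>\<^bsub>M\<^esub> \<longleftrightarrow> x = y"
proof -
  interpret abelian_group M by fact
  show ?thesis using assms(2,3) unfolding a_minus_def
    by (metis a_inv_closed add.inv_equality minus_minus r_neg)
qed

lemma linear_on_plus: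
  assumes "module C N" "linear_on C M N f" "linear_on C M N g"
  shows "linear_on C M N (\<lambda>x. f x \<oplus>\<^bsub>N\<^esub> g x)"
proof -
  interpret N: module C N by fact
  show ?thesis
    using assms(2,3) by (auto simp: linear_on_def N.smult_r_distr N.a_ac)
qed

lemma linear_on_uminus:
  assumes "module C N" "linear_on C M N f"
  shows "linear_on C M N (\<lambda>x. \<ominus>\<^bsub>N\<^esub> f x)"
proof -
  interpret N: module C N by fact
  show ?thesis
    using assms(2) by (auto simp: linear_on_def N.smult_r_minus N.minus_add)
qed

lemma linear_on_minus:
  assumes "module C N" "linear_on C M N f" "linear_on C M N g"
  shows "linear_on C M N (\<lambda>x. f x \<ominus>\<^bsub>N\<^esub> g x)"
  unfolding a_minus_def by (intro linear_on_plus linear_on_uminus assms)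

lemma linear_on_scale:
  assumes "module C N" "c \<in> carrier C" "linear_on C M N f"
  shows "linear_on C M N (\<lambda>x. c \<odot>\<^bsub>N\<^esub> f x)"
proof -
  interpret N: module C N by fact
  \<comment> \<open>Two scalars may be exchanged: this is where commutativity of \<open>C\<close>
    enters.\<close>
  have "c \<odot>\<^bsub>N\<^esub> (d \<odot>\<^bsub>N\<^esub> y) = d \<odot>\<^bsub>N\<^esub> (c \<odot>\<^bsub>N\<^esub> y)" if "d \<in> carrier C" "y \<in> carrier N" for d y
    using assms(2) that by (simp add: N.smult_assoc1[symmetric] N.m_comm)
  thus ?thesis
    using assms(2,3) by (auto simp: linear_on_def N.smult_r_distr)
qed

lemma linear_on_null:
  assumes "module C N"
  shows "linear_on C M N (\<lambda>x. \<zero>\<^bsub>N\<^esub>)"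
proof -
  interpret N: module C N by fact
  show ?thesis by (auto simp: linear_on_def)
qed

lemma linear_on_finsum:
  assumes "module C N" "finite A" "\<And>i. i \<in> A \<Longrightarrow> linear_on C M N (f i)"
  shows "linear_on C M N (\<lambda>x. \<Oplus>\<^bsub>N\<^esub>i\<in>A. f i x)"
proof -
  interpret N: module C N by fact
  have cl: "f i x \<in> carrier N" if "i \<in> A" "x \<in> carrier M" for i x
    using that assms(3) linear_on_closed by metis
  show ?thesis
  proof (rule linear_onI)
    fix x y assume xy: "x \<in> carrier M" "y \<in> carrier M"
    show "(\<Oplus>\<^bsub>N\<^esub>i\<in>A. f i x) \<in> carrier N"
      using xy cl by (intro N.finsum_closed) auto
    have "(\<Oplus>\<^bsub>N\<^esub>i\<in>A. f i (x \<oplus>\<^bsub>M\<^esub> y)) = (\<Oplus>\<^bsub>N\<^esub>i\<in>A. f i x \<oplus>\<^bsub>N\<^esub> f i y)"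
      using xy cl by (intro N.finsum_cong') (auto simp: linear_on_add[OF assms(3)])
    also have "\<dots> = (\<Oplus>\<^bsub>N\<^esub>i\<in>A. f i x) \<oplus>\<^bsub>N\<^esub> (\<Oplus>\<^bsub>N\<^esub>i\<in>A. f i y)"
      using xy cl by (intro N.finsum_addf) auto
    finally show "(\<Oplus>\<^bsub>N\<^esub>i\<in>A. f i (x \<oplus>\<^bsub>M\<^esub> y)) =
      (\<Oplus>\<^bsub>N\<^esub>i\<in>A. f i x) \<oplus>\<^bsub>N\<^esub> (\<Oplus>\<^bsub>N\<^esub>i\<in>A. f i y)" .
  next
    fix c x assume cx: "c \<in> carrier C" "x \<in> carrier M"
    have "(\<Oplus>\<^bsub>N\<^esub>i\<in>A. f i (c \<odot>\<^bsub>M\<^esub> x)) = (\<Oplus>\<^bsub>N\<^esub>i\<in>A. c \<odot>\<^bsub>N\<^esub> f i x)"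
      using cx cl by (intro N.finsum_cong') (auto simp: linear_on_smult[OF assms(3)])
    also have "\<dots> = c \<odot>\<^bsub>N\<^esub> (\<Oplus>\<^bsub>N\<^esub>i\<in>A. f i x)"
      using cx cl assms(2) by (intro N.finsum_smult_ldistr[symmetric]) auto
    finally show "(\<Oplus>\<^bsub>N\<^esub>i\<in>A. f i (c \<odot>\<^bsub>M\<^esub> x)) = c \<odot>\<^bsub>N\<^esub> (\<Oplus>\<^bsub>N\<^esub>i\<in>A. f i x)" .
  qed
qed

lemma linear_on_finsum_apply:
  assumes M: "module C M" and N: "module C N" and l: "linear_on C M N f"
    and "finite B" "\<And>i. i \<in> B \<Longrightarrow> g i \<in> carrier M"
  shows "f (\<Oplus>\<^bsub>M\<^esub>i\<in>B. g i) = (\<Oplus>\<^bsub>N\<^esub>i\<in>B. f (g i))"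
proof -
  interpret M: module C M by fact
  interpret N: module C N by fact
  show ?thesis
    using assms(4,5)
  proof (induction B)
    case empty
    show ?case using linear_on_zero[OF l M N] by simp
  next
    case (insert i B)
    have "(\<Oplus>\<^bsub>M\<^esub>i\<in>insert i B. g i) = g i \<oplus>\<^bsub>M\<^esub> (\<Oplus>\<^bsub>M\<^esub>i\<in>B. g i)"
      using insert by (intro M.finsum_insert) auto
    moreover have "(\<Oplus>\<^bsub>N\<^esub>i\<in>insert i B. f (g i)) = f (g i) \<oplus>\<^bsub>N\<^esub> (\<Oplus>\<^bsub>N\<^esub>i\<in>B. f (g i))"
      using insert linear_on_closed[OF l] by (intro N.finsum_insert) auto
    moreover have "(\<Oplus>\<^bsub>M\<^esub>i\<in>B. g i) \<in> carrier M"
      using insert by (intro M.finsum_closed) auto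
    ultimately show ?case using insert by (simp add: linear_on_add[OF l])
  qed
qed

text \<open>Negatives come for free from scalars, because -x is (-1) times x.\<close>

lemma submoduleI':
  assumes "module C M" "H \<subseteq> carrier M" "\<zero>\<^bsub>M\<^esub> \<in> H"
    and "\<And>x y. \<lbrakk>x \<in> H; y \<in> H\<rbrakk> \<Longrightarrow> x \<oplus>\<^bsub>M\<^esub> y \<in> H"
    and sm: "\<And>c x. \<lbrakk>c \<in> carrier C; x \<in> H\<rbrakk> \<Longrightarrow> c \<odot>\<^bsub>M\<^esub> x \<in> H"
  shows "submodule H C M"
proof -
  interpret M: module C M by fact
  show ?thesis
  proof (rule M.submoduleI)
    fix x assume x: "x \<in> H"
    have "\<ominus>\<^bsub>M\<^esub> x = (\<ominus>\<^bsub>C\<^esub> \<one>\<^bsub>C\<^esub>) \<odot>\<^bsub>M\<^esub> x"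
      using x assms(2) by (subst M.smult_l_minus) auto
    thus "\<ominus>\<^bsub>M\<^esub> x \<in> H" using sm[OF _ x] by simp
  qed (use assms in auto)
qed

lemma gen_submodule_superset: "Y \<subseteq> gen_submodule C M Y"
  by (auto simp: gen_submodule_def)

lemma gen_submodule_minimal: "\<lbrakk>submodule H C M; Y \<subseteq> H\<rbrakk> \<Longrightarrow> gen_submodule C M Y \<subseteq> H"
  by (auto simp: gen_submodule_def)

lemma gen_submodule_closed:
  assumes "module C M" "Y \<subseteq> carrier M"
  shows "gen_submodule C M Y \<subseteq> carrier M"
  using assms gen_submodule_minimal[OF module.carrier_is_submodule] by metis

lemma gen_submodule_is_submodule:
  assumes "module C M" "Y \<subseteq> carrier M"
  shows "submodule (gen_submodule C M Y) C M"
proof (rule submoduleI'[OF assms(1) gen_submodule_closed[OF assms]])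
  interpret M: module C M by fact
  show "\<zero>\<^bsub>M\<^esub> \<in> gen_submodule C M Y"
    by (auto simp: gen_submodule_def submodule_def dest!: subgroup.one_closed)
  fix x y assume "x \<in> gen_submodule C M Y" "y \<in> gen_submodule C M Y"
  thus "x \<oplus>\<^bsub>M\<^esub> y \<in> gen_submodule C M Y"
    by (auto simp: gen_submodule_def M.submoduleE)
next
  interpret M: module C M by fact
  fix c x assume "c \<in> carrier C" "x \<in> gen_submodule C M Y"
  thus "c \<odot>\<^bsub>M\<^esub> x \<in> gen_submodule C M Y"
    by (auto simp: gen_submodule_def M.submoduleE)
qed

text \<open>The elements of the carrier with property \<open>P\<close> form a submodule that
  contains the generators.\<close>

lemma gen_submodule_induct [consumes 3, case_names zero gen add smult]:
  assumes "module C M" "Y \<subseteq> carrier M" and x: "x \<in> gen_submodule C M Y"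
    and zero: "P \<zero>\<^bsub>M\<^esub>" and gen: "\<And>y. y \<in> Y \<Longrightarrow> P y"
    and add: "\<And>x y. \<lbrakk>x \<in> carrier M; y \<in> carrier M; P x; P y\<rbrakk> \<Longrightarrow> P (x \<oplus>\<^bsub>M\<^esub> y)"
    and smult: "\<And>c x. \<lbrakk>c \<in> carrier C; x \<in> carrier M; P x\<rbrakk> \<Longrightarrow> P (c \<odot>\<^bsub>M\<^esub> x)"
  shows "P x"
proof -
  interpret M: module C M by fact
  have "submodule {x \<in> carrier M. P x} C M"
    by (rule submoduleI') (use assms in auto)
  hence "gen_submodule C M Y \<subseteq> {x \<in> carrier M. P x}"
    by (rule gen_submodule_minimal) (use assms in auto)
  thus ?thesis using x by auto
qed

section \<open>Free modules and modules given by generators and relations\<close>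

lemma free_module_simps:
  "carrier (free_module C Y) = {p. (\<forall>x\<in>Y. p x \<in> carrier C) \<and> (\<forall>x. x \<notin> Y \<longrightarrow> p x = \<zero>\<^bsub>C\<^esub>) \<and>
       finite {x. p x \<noteq> \<zero>\<^bsub>C\<^esub>}}"
  "\<zero>\<^bsub>free_module C Y\<^esub> = (\<lambda>x. \<zero>\<^bsub>C\<^esub>)"
  "p \<oplus>\<^bsub>free_module C Y\<^esub> q = (\<lambda>x. p x \<oplus>\<^bsub>C\<^esub> q x)"
  "c \<odot>\<^bsub>free_module C Y\<^esub> p = (\<lambda>x. c \<otimes>\<^bsub>C\<^esub> p x)"
  by (simp_all add: free_module_def)

lemma free_module_coeff:
  assumes "cring C" "p \<in> carrier (free_module C Y)"
  shows "p x \<in> carrier C"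
proof -
  interpret C: cring C by fact
  show ?thesis using assms(2) by (cases "x \<in> Y") (auto simp: free_module_simps)
qed

lemma module_free_module:
  assumes "cring C"
  shows "module C (free_module C Y)"
proof -
  interpret C: cring C by fact
  let ?F = "free_module C Y"
  note co = free_module_coeff[OF assms, of _ Y]
  have add: "p \<oplus>\<^bsub>?F\<^esub> q \<in> carrier ?F" if "p \<in> carrier ?F" "q \<in> carrier ?F" for p q
  proof -
    have "{x. p x \<oplus>\<^bsub>C\<^esub> q x \<noteq> \<zero>\<^bsub>C\<^esub>} \<subseteq> {x. p x \<noteq> \<zero>\<^bsub>C\<^esub>} \<union> {x. q x \<noteq> \<zero>\<^bsub>C\<^esub>}" by auto
    thus ?thesis using that by (auto simp: free_module_simps intro: finite_subset)
  qed
  have smult: "c \<odot>\<^bsub>?F\<^esub> p \<in> carrier ?F" if "c \<in> carrier C" "p \<in> carrier ?F" for c p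
  proof -
    have "{x. c \<otimes>\<^bsub>C\<^esub> p x \<noteq> \<zero>\<^bsub>C\<^esub>} \<subseteq> {x. p x \<noteq> \<zero>\<^bsub>C\<^esub>}" using that by auto
    thus ?thesis using that by (auto simp: free_module_simps intro: finite_subset)
  qed
  have inv: "\<exists>q\<in>carrier ?F. q \<oplus>\<^bsub>?F\<^esub> p = \<zero>\<^bsub>?F\<^esub>" if "p \<in> carrier ?F" for p
  proof
    show "(\<ominus>\<^bsub>C\<^esub> \<one>\<^bsub>C\<^esub>) \<odot>\<^bsub>?F\<^esub> p \<in> carrier ?F" by (rule smult) (use that in auto)
    show "(\<ominus>\<^bsub>C\<^esub> \<one>\<^bsub>C\<^esub>) \<odot>\<^bsub>?F\<^esub> p \<oplus>\<^bsub>?F\<^esub> p = \<zero>\<^bsub>?F\<^esub>"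
      using co[OF that] by (simp add: free_module_simps C.l_minus C.l_neg)
  qed
  have ab: "abelian_group ?F"
  proof (rule abelian_groupI)
    show "\<zero>\<^bsub>?F\<^esub> \<in> carrier ?F" by (simp add: free_module_simps)
  next
    fix p q r assume "p \<in> carrier ?F" "q \<in> carrier ?F" "r \<in> carrier ?F"
    thus "p \<oplus>\<^bsub>?F\<^esub> q \<oplus>\<^bsub>?F\<^esub> r = p \<oplus>\<^bsub>?F\<^esub> (q \<oplus>\<^bsub>?F\<^esub> r)"
      using co by (simp add: free_module_simps(3) C.a_ac)
  next
    fix p q assume "p \<in> carrier ?F" "q \<in> carrier ?F"
    thus "p \<oplus>\<^bsub>?F\<^esub> q = q \<oplus>\<^bsub>?F\<^esub> p" using co by (simp add: free_module_simps(3) C.a_ac)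
  next
    fix p assume "p \<in> carrier ?F"
    thus "\<zero>\<^bsub>?F\<^esub> \<oplus>\<^bsub>?F\<^esub> p = p" using co by (simp add: free_module_simps(2,3))
  qed (use add inv in auto)
  show ?thesis
  proof (rule moduleI[OF assms ab smult])
    fix a b p q assume "a \<in> carrier C" "b \<in> carrier C" "p \<in> carrier ?F" "q \<in> carrier ?F"
    thus "(a \<oplus>\<^bsub>C\<^esub> b) \<odot>\<^bsub>?F\<^esub> p = a \<odot>\<^bsub>?F\<^esub> p \<oplus>\<^bsub>?F\<^esub> b \<odot>\<^bsub>?F\<^esub> p"
      and "a \<odot>\<^bsub>?F\<^esub> (p \<oplus>\<^bsub>?F\<^esub> q) = a \<odot>\<^bsub>?F\<^esub> p \<oplus>\<^bsub>?F\<^esub> a \<odot>\<^bsub>?F\<^esub> q"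
      and "(a \<otimes>\<^bsub>C\<^esub> b) \<odot>\<^bsub>?F\<^esub> p = a \<odot>\<^bsub>?F\<^esub> (b \<odot>\<^bsub>?F\<^esub> p)"
      using co by (simp_all add: free_module_simps(3,4) C.l_distr C.r_distr C.m_assoc)
  next
    fix p assume "p \<in> carrier ?F"
    thus "\<one>\<^bsub>C\<^esub> \<odot>\<^bsub>?F\<^esub> p = p" using co by (simp add: free_module_simps(4))
  qed
qed

lemma single_closed:
  assumes "cring C" "y \<in> Y"
  shows "single C y \<in> carrier (free_module C Y)"
proof -
  interpret C: cring C by fact
  have "{x. single C y x \<noteq> \<zero>\<^bsub>C\<^esub>} \<subseteq> {y}" by (auto simp: single_def)
  thus ?thesis using assms(2) by (auto simp: free_module_simps single_def intro: finite_subset)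
qed

text \<open>Finite support permits removing one term at a time; the induction is on the number of
  nonzero coefficients.\<close>

lemma free_module_induct [consumes 2, case_names zero single add]:
  assumes "cring C" and p: "p \<in> carrier (free_module C Y)"
    and zero: "P \<zero>\<^bsub>free_module C Y\<^esub>"
    and single: "\<And>c y. \<lbrakk>c \<in> carrier C; y \<in> Y\<rbrakk> \<Longrightarrow> P (c \<odot>\<^bsub>free_module C Y\<^esub> single C y)"
    and add: "\<And>p q. \<lbrakk>p \<in> carrier (free_module C Y); q \<in> carrier (free_module C Y); P p; P q\<rbrakk>
      \<Longrightarrow> P (p \<oplus>\<^bsub>free_module C Y\<^esub> q)"
  shows "P p"
  using p
proof (induction "card {x. p x \<noteq> \<zero>\<^bsub>C\<^esub>}" arbitrary: p rule: less_induct)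
  case less
  interpret C: cring C by fact
  let ?F = "free_module C Y"
  interpret F: module C ?F using assms(1) by (rule module_free_module)
  show ?case
  proof (cases "{x. p x \<noteq> \<zero>\<^bsub>C\<^esub>} = {}")
    case True
    hence "p = \<zero>\<^bsub>?F\<^esub>" by (auto simp: free_module_simps)
    thus ?thesis using zero by simp
  next
    case False
    then obtain y where y: "p y \<noteq> \<zero>\<^bsub>C\<^esub>" by auto
    hence yY: "y \<in> Y" using less.prems by (auto simp: free_module_simps)
    define q where "q = p(y := \<zero>\<^bsub>C\<^esub>)"
    have supp: "{x. q x \<noteq> \<zero>\<^bsub>C\<^esub>} = {x. p x \<noteq> \<zero>\<^bsub>C\<^esub>} - {y}" by (auto simp: q_def)
    have fin: "finite {x. p x \<noteq> \<zero>\<^bsub>C\<^esub>}" using less.prems by (simp add: free_module_simps)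
    have q: "q \<in> carrier ?F"
      using less.prems supp unfolding free_module_simps by (auto simp: q_def)
    have py: "p y \<in> carrier C" by (rule free_module_coeff[OF assms(1) less.prems])
    have "card {x. q x \<noteq> \<zero>\<^bsub>C\<^esub>} < card {x. p x \<noteq> \<zero>\<^bsub>C\<^esub>}"
      unfolding supp using y fin by (intro psubset_card_mono) auto
    hence "P q" using q by (rule less.hyps)
    moreover have "P (p y \<odot>\<^bsub>?F\<^esub> single C y)" by (rule single[OF py yY])
    ultimately have "P (q \<oplus>\<^bsub>?F\<^esub> p y \<odot>\<^bsub>?F\<^esub> single C y)"
      by (intro add q F.smult_closed py single_closed assms(1) yY)
    moreover have "q \<oplus>\<^bsub>?F\<^esub> p y \<odot>\<^bsub>?F\<^esub> single C y = p"
      using py free_module_coeff[OF assms(1) less.prems]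
      by (auto simp: free_module_simps(3,4) q_def single_def)
    ultimately show ?thesis by simp
  qed
qed

definition lin_ext ::
    "('c, 'z) ring_scheme \<Rightarrow> ('c, 'n, 'x) module_scheme \<Rightarrow> ('y \<Rightarrow> 'n) \<Rightarrow> ('y \<Rightarrow> 'c) \<Rightarrow> 'n"
  where "lin_ext C N f p = (\<Oplus>\<^bsub>N\<^esub>y\<in>{y. p y \<noteq> \<zero>\<^bsub>C\<^esub>}. p y \<odot>\<^bsub>N\<^esub> f y)"

text \<open>Two families and their sum have different supports. Enlarging the index set to a common
  finite superset lets their sums be compared term by term.\<close>

lemma lin_ext_superset:
  assumes "module C N" "f \<in> Y \<rightarrow> carrier N" "p \<in> carrier (free_module C Y)"
    and "finite Z" "{y. p y \<noteq> \<zero>\<^bsub>C\<^esub>} \<subseteq> Z" "Z \<subseteq> Y"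
  shows "lin_ext C N f p = (\<Oplus>\<^bsub>N\<^esub>y\<in>Z. p y \<odot>\<^bsub>N\<^esub> f y)"
proof -
  interpret N: module C N by fact
  have co: "p y \<in> carrier C" for y
    using free_module_coeff[OF N.R.is_cring assms(3)] .
  show ?thesis unfolding lin_ext_def
    using assms(2,4-6) co
    by (intro N.add.finprod_mono_neutral_cong_left) (auto simp: Pi_iff subset_iff)
qed

lemma linear_on_lin_ext:
  assumes "module C N" "f \<in> Y \<rightarrow> carrier N"
  shows "linear_on C (free_module C Y) N (lin_ext C N f)"
proof (rule linear_onI)
  interpret N: module C N by fact
  note co = free_module_coeff[OF N.R.is_cring, of _ Y]
  let ?F = "free_module C Y"
  interpret F: module C ?F using N.R.is_cring by (rule module_free_module)
  have sY: "{y. p y \<noteq> \<zero>\<^bsub>C\<^esub>} \<subseteq> Y" and fin: "finite {y. p y \<noteq> \<zero>\<^bsub>C\<^esub>}" if "p \<in> carrier ?F" for p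
    using that by (auto simp: free_module_simps)
  have cl: "p y \<odot>\<^bsub>N\<^esub> f y \<in> carrier N" if "p \<in> carrier ?F" "y \<in> Y" for p y
    using that co assms(2) by auto
  fix p assume p: "p \<in> carrier ?F"
  show "lin_ext C N f p \<in> carrier N"
    unfolding lin_ext_def using cl[OF p] sY[OF p] by (intro N.finsum_closed) auto
  fix q assume q: "q \<in> carrier ?F"
  let ?Z = "{y. p y \<noteq> \<zero>\<^bsub>C\<^esub>} \<union> {y. q y \<noteq> \<zero>\<^bsub>C\<^esub>}"
  have pq: "p \<oplus>\<^bsub>?F\<^esub> q \<in> carrier ?F" using p q by simp
  have Z: "finite ?Z" "?Z \<subseteq> Y" using sY fin p q by auto
  have "lin_ext C N f (p \<oplus>\<^bsub>?F\<^esub> q) = (\<Oplus>\<^bsub>N\<^esub>y\<in>?Z. (p \<oplus>\<^bsub>?F\<^esub> q) y \<odot>\<^bsub>N\<^esub> f y)"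
    by (rule lin_ext_superset[OF assms pq Z(1) _ Z(2)]) (auto simp: free_module_simps(3))
  also have "\<dots> = (\<Oplus>\<^bsub>N\<^esub>y\<in>?Z. p y \<odot>\<^bsub>N\<^esub> f y \<oplus>\<^bsub>N\<^esub> q y \<odot>\<^bsub>N\<^esub> f y)"
    using Z(2) p q cl co assms(2)
    by (intro N.finsum_cong') (auto simp: free_module_simps(3) Pi_iff subset_iff intro!: N.smult_l_distr)
  also have "\<dots> = (\<Oplus>\<^bsub>N\<^esub>y\<in>?Z. p y \<odot>\<^bsub>N\<^esub> f y) \<oplus>\<^bsub>N\<^esub> (\<Oplus>\<^bsub>N\<^esub>y\<in>?Z. q y \<odot>\<^bsub>N\<^esub> f y)"
    using Z(2) p q cl by (intro N.finsum_addf) auto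
  also have "(\<Oplus>\<^bsub>N\<^esub>y\<in>?Z. p y \<odot>\<^bsub>N\<^esub> f y) = lin_ext C N f p"
    by (rule lin_ext_superset[OF assms p Z(1) _ Z(2), symmetric]) auto
  also have "(\<Oplus>\<^bsub>N\<^esub>y\<in>?Z. q y \<odot>\<^bsub>N\<^esub> f y) = lin_ext C N f q"
    by (rule lin_ext_superset[OF assms q Z(1) _ Z(2), symmetric]) auto
  finally show "lin_ext C N f (p \<oplus>\<^bsub>?F\<^esub> q) = lin_ext C N f p \<oplus>\<^bsub>N\<^esub> lin_ext C N f q" .
next
  interpret N: module C N by fact
  note co = free_module_coeff[OF N.R.is_cring, of _ Y]
  let ?F = "free_module C Y"
  interpret F: module C ?F using N.R.is_cring by (rule module_free_module)
  fix c p assume c: "c \<in> carrier C" and p: "p \<in> carrier ?F"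
  let ?Z = "{y. p y \<noteq> \<zero>\<^bsub>C\<^esub>}"
  have cp: "c \<odot>\<^bsub>?F\<^esub> p \<in> carrier ?F" using c p by simp
  have Z: "finite ?Z" "?Z \<subseteq> Y" using p by (auto simp: free_module_simps)
  have "lin_ext C N f (c \<odot>\<^bsub>?F\<^esub> p) = (\<Oplus>\<^bsub>N\<^esub>y\<in>?Z. (c \<odot>\<^bsub>?F\<^esub> p) y \<odot>\<^bsub>N\<^esub> f y)"
    by (rule lin_ext_superset[OF assms cp Z(1) _ Z(2)]) (auto simp: free_module_simps(4) c)
  also have "\<dots> = (\<Oplus>\<^bsub>N\<^esub>y\<in>?Z. c \<odot>\<^bsub>N\<^esub> (p y \<odot>\<^bsub>N\<^esub> f y))"
    using Z(2) p co c assms(2)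
    by (intro N.finsum_cong') (auto simp: free_module_simps(4) Pi_iff subset_iff intro!: N.smult_assoc1)
  also have "\<dots> = c \<odot>\<^bsub>N\<^esub> (\<Oplus>\<^bsub>N\<^esub>y\<in>?Z. p y \<odot>\<^bsub>N\<^esub> f y)"
    using Z p co c assms(2)
    by (intro N.finsum_smult_ldistr[symmetric]) (auto simp: Pi_iff subset_iff)
  finally show "lin_ext C N f (c \<odot>\<^bsub>?F\<^esub> p) = c \<odot>\<^bsub>N\<^esub> lin_ext C N f p" by (simp add: lin_ext_def)
qed

lemma lin_ext_single:
  assumes "module C N" "f \<in> Y \<rightarrow> carrier N" "y \<in> Y"
  shows "lin_ext C N f (single C y) = f y"
proof -
  interpret N: module C N by fact
  have "lin_ext C N f (single C y) = (\<Oplus>\<^bsub>N\<^esub>x\<in>{y}. single C y x \<odot>\<^bsub>N\<^esub> f x)"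
    by (rule lin_ext_superset[OF assms(1,2) single_closed[OF N.R.is_cring assms(3)]])
      (auto simp: single_def assms(3))
  also have "\<dots> = f y"
    using assms(2,3) by (subst N.finsum_insert) (auto simp: single_def Pi_iff)
  finally show ?thesis .
qed


section \<open>Quotients of modules\<close>

locale module_quotient = module C M for C :: "('c, 'z) ring_scheme" (structure)
    and M :: "('c, 'm, 'y) module_scheme" +
  fixes H assumes sub: "submodule H C M"
begin

lemma abelian_subgroup: "abelian_subgroup H M"
  using sub M.abelian_group_axioms
  by (intro abelian_subgroupI3 additive_subgroupI) (auto simp: submodule_def)

sublocale H: abelian_subgroup H M by (rule abelian_subgroup)

lemma quot_carrier: "carrier (module_quot M H) = (\<lambda>x. H +>\<^bsub>M\<^esub> x) ` carrier M"
  by (auto simp: module_quot_def FactRing_def A_RCOSETS_def RCOSETS_def a_r_coset_def)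

lemma quot_zero: "\<zero>\<^bsub>module_quot M H\<^esub> = H"
  by (simp add: module_quot_def FactRing_def)

lemma quot_add:
  "\<lbrakk>x \<in> carrier M; y \<in> carrier M\<rbrakk> \<Longrightarrow>
    (H +>\<^bsub>M\<^esub> x) \<oplus>\<^bsub>module_quot M H\<^esub> (H +>\<^bsub>M\<^esub> y) = H +>\<^bsub>M\<^esub> (x \<oplus>\<^bsub>M\<^esub> y)"
  by (simp add: module_quot_def FactRing_def H.a_rcos_sum)

lemma coset_eq_iff:
  assumes "x \<in> carrier M" "y \<in> carrier M"
  shows "H +>\<^bsub>M\<^esub> x = H +>\<^bsub>M\<^esub> y \<longleftrightarrow> x \<ominus>\<^bsub>M\<^esub> y \<in> H"
proof
  assume "H +>\<^bsub>M\<^esub> x = H +>\<^bsub>M\<^esub> y"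
  thus "x \<ominus>\<^bsub>M\<^esub> y \<in> H"
    using assms H.a_rcos_self H.a_rcos_module_imp unfolding a_minus_def by metis
next
  assume "x \<ominus>\<^bsub>M\<^esub> y \<in> H"
  hence "x \<in> H +>\<^bsub>M\<^esub> y" using assms H.a_rcos_module_rev unfolding a_minus_def by metis
  thus "H +>\<^bsub>M\<^esub> x = H +>\<^bsub>M\<^esub> y"
    using H.a_repr_independence' assms by metis
qed

lemma coset_zero_iff:
  assumes "x \<in> carrier M"
  shows "H +>\<^bsub>M\<^esub> x = H \<longleftrightarrow> x \<in> H"
  using coset_eq_iff[of x "\<zero>\<^bsub>M\<^esub>"] assms H.a_subset
  by (metis H.zero_closed M.minus_closed H.a_subgroup M.a_coset_join2 M.a_coset_join1)

text \<open>The scalar action on cosets is a union over all representatives. It is one coset because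
  the submodule is closed under scalars, so that every representative yields the same class.\<close>

lemma quot_smult:
  assumes c: "c \<in> carrier C" and x: "x \<in> carrier M"
  shows "c \<odot>\<^bsub>module_quot M H\<^esub> (H +>\<^bsub>M\<^esub> x) = H +>\<^bsub>M\<^esub> (c \<odot>\<^bsub>M\<^esub> x)"
proof -
  have "H +>\<^bsub>M\<^esub> (c \<odot>\<^bsub>M\<^esub> y) = H +>\<^bsub>M\<^esub> (c \<odot>\<^bsub>M\<^esub> x)" if y: "y \<in> H +>\<^bsub>M\<^esub> x" for y
  proof -
    have yM: "y \<in> carrier M" using y x H.a_subset M.a_r_coset_subset_G by blast
    have "y \<ominus>\<^bsub>M\<^esub> x \<in> H" using y x H.a_rcos_module_imp unfolding a_minus_def by metis
    hence "c \<odot>\<^bsub>M\<^esub> (y \<ominus>\<^bsub>M\<^esub> x) \<in> H" using submodule.smult_closed[OF sub] c by metis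
    moreover have "c \<odot>\<^bsub>M\<^esub> (y \<ominus>\<^bsub>M\<^esub> x) = c \<odot>\<^bsub>M\<^esub> y \<ominus>\<^bsub>M\<^esub> c \<odot>\<^bsub>M\<^esub> x"
      using c x yM by (simp add: a_minus_def smult_r_distr smult_r_minus)
    ultimately show ?thesis using c x yM by (simp add: coset_eq_iff)
  qed
  hence "(\<lambda>y. H +>\<^bsub>M\<^esub> (c \<odot>\<^bsub>M\<^esub> y)) ` (H +>\<^bsub>M\<^esub> x) = {H +>\<^bsub>M\<^esub> (c \<odot>\<^bsub>M\<^esub> x)}"
    using H.a_rcos_self[OF x] by blast
  thus ?thesis unfolding module_quot_def by simp
qed

lemma quot_module: "module C (module_quot M H)"
proof (rule moduleI[OF R.is_cring])
  note q = quot_carrier quot_add quot_smult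
  have z: "\<zero>\<^bsub>module_quot M H\<^esub> = H +>\<^bsub>M\<^esub> \<zero>\<^bsub>M\<^esub>"
    using coset_zero_iff[of "\<zero>\<^bsub>M\<^esub>"] quot_zero by simp
  show "abelian_group (module_quot M H)"
  proof (rule abelian_groupI)
    fix U assume "U \<in> carrier (module_quot M H)"
    then obtain x where x: "x \<in> carrier M" "U = H +>\<^bsub>M\<^esub> x" by (auto simp: quot_carrier)
    show "\<exists>Y\<in>carrier (module_quot M H). Y \<oplus>\<^bsub>module_quot M H\<^esub> U = \<zero>\<^bsub>module_quot M H\<^esub>"
      by (rule bexI[of _ "H +>\<^bsub>M\<^esub> (\<ominus>\<^bsub>M\<^esub> x)"]) (auto simp: q x z M.l_neg)
  qed (auto simp: q z M.a_ac)
qed (auto simp: quot_carrier quot_add quot_smult smult_l_distr smult_r_distr smult_assoc1)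

lemma quot_proj: "linear_on C M (module_quot M H) (\<lambda>x. H +>\<^bsub>M\<^esub> x)"
  by (rule linear_onI) (simp_all add: quot_carrier quot_add quot_smult)

lemma quot_factor:
  assumes N: "module C N" and f: "linear_on C M N f" and ker: "\<And>x. x \<in> H \<Longrightarrow> f x = \<zero>\<^bsub>N\<^esub>"
  obtains g where "linear_on C (module_quot M H) N g"
    and "\<And>x. x \<in> carrier M \<Longrightarrow> g (H +>\<^bsub>M\<^esub> x) = f x"
proof
  interpret N: module C N by fact
  \<comment> \<open>The map \<open>f\<close> is constant on cosets, so the image of a coset is a
    singleton.\<close>
  define g where "g Y = the_elem (f ` Y)" for Y
  show g: "g (H +>\<^bsub>M\<^esub> x) = f x" if x: "x \<in> carrier M" for x
  proof -
    have "f y = f x" if y: "y \<in> H +>\<^bsub>M\<^esub> x" for y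
    proof -
      have yM: "y \<in> carrier M" using y x H.a_subset M.a_r_coset_subset_G by blast
      have "y \<ominus>\<^bsub>M\<^esub> x \<in> H" using y x H.a_rcos_module_imp unfolding a_minus_def by metis
      hence "f y \<ominus>\<^bsub>N\<^esub> f x = \<zero>\<^bsub>N\<^esub>"
        using ker linear_on_diff[OF f module_axioms N] x yM by metis
      thus ?thesis using x yM linear_on_closed[OF f] by (simp add: minus_eq_zero_iff[OF N.abelian_group_axioms])
    qed
    moreover have "x \<in> H +>\<^bsub>M\<^esub> x" using x by (rule H.a_rcos_self)
    ultimately have "f ` (H +>\<^bsub>M\<^esub> x) = {f x}" by blast
    thus ?thesis by (simp add: g_def)
  qed
  show "linear_on C (module_quot M H) N g"
    by (rule linear_onI) (auto simp: quot_carrier quot_add quot_smult g linear_on_closed[OF f]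
        linear_on_add[OF f] linear_on_smult[OF f])
qed

end

text \<open>Tensor products, tensor powers and symmetric squares are all free modules modulo a
  generated submodule. Their universal properties are obtained once and for all for arbitrary
  generators \<open>Y\<close> and relations \<open>G\<close>.\<close>

definition presented ::
    "('c, 'z) ring_scheme \<Rightarrow> 'x set \<Rightarrow> ('x \<Rightarrow> 'c) set \<Rightarrow> ('c, ('x \<Rightarrow> 'c) set) module"
  where "presented C Y G = module_quot (free_module C Y) (gen_submodule C (free_module C Y) G)"

definition pres_gen ::
    "('c, 'z) ring_scheme \<Rightarrow> 'x set \<Rightarrow> ('x \<Rightarrow> 'c) set \<Rightarrow> 'x \<Rightarrow> ('x \<Rightarrow> 'c) set"
  where "pres_gen C Y G y = gen_submodule C (free_module C Y) G +>\<^bsub>free_module C Y\<^esub> single C y"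

locale presentation = cring C for C :: "('c, 'z) ring_scheme" (structure) +
  fixes Y :: "'x set" and G :: "('x \<Rightarrow> 'c) set"
  assumes rel: "G \<subseteq> carrier (free_module C Y)"
begin

abbreviation "F \<equiv> free_module C Y"
abbreviation "P \<equiv> presented C Y G"
abbreviation "gen \<equiv> pres_gen C Y G"

sublocale F: module C F by (rule module_free_module) (rule is_cring)
sublocale q: module_quotient C F "gen_submodule C F G"
  by (intro module_quotient.intro module_quotient_axioms.intro gen_submodule_is_submodule
      F.module_axioms rel)

lemma module_presented: "module C P"
  unfolding presented_def by (rule q.quot_module)

sublocale P: module C P by (rule module_presented)

lemma gen_closed: "y \<in> Y \<Longrightarrow> gen y \<in> carrier P"
  unfolding presented_def pres_gen_def q.quot_carrier
  by (intro imageI single_closed is_cring)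

definition proj where "proj p = gen_submodule C F G +>\<^bsub>F\<^esub> p"

lemma linear_proj: "linear_on C F P proj"
  unfolding presented_def proj_def by (rule q.quot_proj)

lemma proj_single: "proj (single C y) = gen y"
  by (simp add: proj_def pres_gen_def)

lemma proj_rel:
  assumes "g \<in> G" shows "proj g = \<zero>\<^bsub>P\<^esub>"
  using assms rel gen_submodule_superset[of G C F] q.coset_zero_iff[of g] q.quot_zero
  by (auto simp: proj_def presented_def)

text \<open>The scalar sits at the generator: sums of such terms already exhaust the module, and the
  property has only to be additive.\<close>

lemma presented_induct [consumes 1, case_names zero gen add]:
  assumes x: "x \<in> carrier P" and zero: "p \<zero>\<^bsub>P\<^esub>"
    and gen: "\<And>c y. \<lbrakk>c \<in> carrier C; y \<in> Y\<rbrakk> \<Longrightarrow> p (c \<odot>\<^bsub>P\<^esub> gen y)"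
    and add: "\<And>x y. \<lbrakk>x \<in> carrier P; y \<in> carrier P; p x; p y\<rbrakk> \<Longrightarrow> p (x \<oplus>\<^bsub>P\<^esub> y)"
  shows "p x"
proof -
  obtain t where t: "t \<in> carrier F" "x = proj t"
    using x by (auto simp: presented_def q.quot_carrier proj_def)
  note l = linear_proj
  have "p (proj t)"
    using is_cring t(1)
  proof (induction rule: free_module_induct)
    case zero
    show ?case using assms(2) linear_on_zero[OF l F.module_axioms module_presented] by simp
  next
    case (single c y)
    thus ?case using gen[OF single] single_closed[OF is_cring single(2)]
      by (simp add: linear_on_smult[OF l] proj_single)
  next
    case (add s t)
    thus ?case using assms(4) linear_on_closed[OF l] by (simp add: linear_on_add[OF l])
  qed
  thus ?thesis using t by simp
qed

lemma linear_on_presented_eqI: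
  assumes "module C N" "linear_on C P N f" "linear_on C P N g"
    and "\<And>y. y \<in> Y \<Longrightarrow> f (gen y) = g (gen y)" and "x \<in> carrier P"
  shows "f x = g x"
  using assms(5)
proof (induction rule: presented_induct)
  case zero
  show ?case using linear_on_zero[OF _ module_presented assms(1)] assms(2,3) by metis
next
  case (gen c y)
  thus ?case using assms(4) gen_closed
    by (simp add: linear_on_smult[OF assms(2)] linear_on_smult[OF assms(3)])
next
  case (add x y)
  thus ?case by (simp add: linear_on_add[OF assms(2)] linear_on_add[OF assms(3)])
qed

lemma presented_ext:
  assumes N: "module C N" and f: "f \<in> Y \<rightarrow> carrier N"
    and rels: "\<And>g. g \<in> G \<Longrightarrow> lin_ext C N f g = \<zero>\<^bsub>N\<^esub>"
  obtains \<phi> where "linear_on C P N \<phi>" and "\<And>y. y \<in> Y \<Longrightarrow> \<phi> (gen y) = f y"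
proof -
  interpret N: module C N by fact
  let ?e = "lin_ext C N f"
  note l = linear_on_lin_ext[OF N f]
  have ker: "?e x = \<zero>\<^bsub>N\<^esub>" if "x \<in> gen_submodule C F G" for x
    using F.module_axioms rel that
  proof (induction rule: gen_submodule_induct)
    case zero
    show ?case by (rule linear_on_zero[OF l F.module_axioms N])
  next
    case (gen g)
    thus ?case by (rule rels)
  next
    case (add x y)
    thus ?case by (simp add: linear_on_add[OF l])
  next
    case (smult c x)
    thus ?case by (simp add: linear_on_smult[OF l])
  qed
  obtain g where "linear_on C P N g"
    and "\<And>x. x \<in> carrier F \<Longrightarrow> g (proj x) = ?e x"
    using q.quot_factor[OF N l ker] unfolding presented_def proj_def by metis
  thus ?thesis
    using that lin_ext_single[OF N f] single_closed[OF is_cring] by (metis proj_single)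
qed

text \<open>Extends in the second argument while \<open>z\<close> stays a parameter. For each
  \<open>z\<close> the extension exists separately; that these extensions fit together linearly in
  \<open>z\<close> is true at the generators and passes to the whole module by induction.\<close>

lemma presented_ext_bilinear:
  assumes N: "module C N" and Z: "module C Z"
    and f: "\<And>z. z \<in> carrier Z \<Longrightarrow> f z \<in> Y \<rightarrow> carrier N"
    and rels: "\<And>z g. \<lbrakk>z \<in> carrier Z; g \<in> G\<rbrakk> \<Longrightarrow> lin_ext C N (f z) g = \<zero>\<^bsub>N\<^esub>"
    and lin: "\<And>y. y \<in> Y \<Longrightarrow> linear_on C Z N (\<lambda>z. f z y)"
  obtains \<phi> where "bilinear_on C Z P N \<phi>"
    and "\<And>z y. \<lbrakk>z \<in> carrier Z; y \<in> Y\<rbrakk> \<Longrightarrow> \<phi> z (gen y) = f z y"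
proof -
  interpret N: module C N by fact
  interpret Z: module C Z by fact
  have "\<forall>z\<in>carrier Z. \<exists>\<phi>. linear_on C P N \<phi> \<and> (\<forall>y\<in>Y. \<phi> (gen y) = f z y)"
  proof
    fix z assume z: "z \<in> carrier Z"
    show "\<exists>\<phi>. linear_on C P N \<phi> \<and> (\<forall>y\<in>Y. \<phi> (gen y) = f z y)"
      using presented_ext[OF N f[OF z] rels[OF z]] by metis
  qed
  then obtain \<phi> where \<phi>: "\<And>z. z \<in> carrier Z \<Longrightarrow> linear_on C P N (\<phi> z)"
    and \<phi>g: "\<And>z y. \<lbrakk>z \<in> carrier Z; y \<in> Y\<rbrakk> \<Longrightarrow> \<phi> z (gen y) = f z y"
    by metis
  have "linear_on C Z N (\<lambda>z. \<phi> z x)" if x: "x \<in> carrier P" for x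
    using x
  proof (induction rule: presented_induct)
    case zero
    show ?case
      by (rule linear_on_cong[OF linear_on_null[OF N] Z])
        (simp add: linear_on_zero[OF \<phi> module_presented N])
  next
    case (gen c y)
    have "linear_on C Z N (\<lambda>z. c \<odot>\<^bsub>N\<^esub> f z y)"
      using lin[OF gen(2)] gen(1) by (intro linear_on_scale N)
    thus ?case
      by (rule linear_on_cong[OF _ Z])
        (use gen in \<open>simp add: linear_on_smult[OF \<phi>] gen_closed \<phi>g\<close>)
  next
    case (add x y)
    have "linear_on C Z N (\<lambda>z. \<phi> z x \<oplus>\<^bsub>N\<^esub> \<phi> z y)"
      using add by (intro linear_on_plus N)
    thus ?case
      by (rule linear_on_cong[OF _ Z]) (use add in \<open>simp add: linear_on_add[OF \<phi>]\<close>)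
  qed
  thus ?thesis using that[of \<phi>] \<phi> \<phi>g by (auto simp: bilinear_on_def)
qed

end


text \<open>Relations are stored as differences in the free module. Applied to the projection, these
  equivalences turn relations into identities between generators; applied to \<open>lin_ext\<close>,
  they turn identities between values into vanishing on the relations.\<close>

lemma linear_on_free_rel_iff:
  assumes "module C N" "linear_on C (free_module C Y) N f" "u \<in> Y" "v \<in> Y"
  shows "f (single C u \<ominus>\<^bsub>free_module C Y\<^esub> single C v) = \<zero>\<^bsub>N\<^esub> \<longleftrightarrow>
      f (single C u) = f (single C v)"
    and "w \<in> Y \<Longrightarrow>
      f (single C u \<ominus>\<^bsub>free_module C Y\<^esub> (single C v \<oplus>\<^bsub>free_module C Y\<^esub> single C w)) = \<zero>\<^bsub>N\<^esub> \<longleftrightarrow>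
      f (single C u) = f (single C v) \<oplus>\<^bsub>N\<^esub> f (single C w)"
    and "c \<in> carrier C \<Longrightarrow>
      f (single C u \<ominus>\<^bsub>free_module C Y\<^esub> (c \<odot>\<^bsub>free_module C Y\<^esub> single C v)) = \<zero>\<^bsub>N\<^esub> \<longleftrightarrow>
      f (single C u) = c \<odot>\<^bsub>N\<^esub> f (single C v)"
proof -
  interpret N: module C N by fact
  have C: "cring C" by (rule N.R.is_cring)
  interpret F: module C "free_module C Y" using C by (rule module_free_module)
  note s = single_closed[OF C, of _ Y]
  note d = linear_on_diff[OF assms(2) F.module_axioms assms(1)]
  note e = minus_eq_zero_iff[OF N.abelian_group_axioms]
  note cl = linear_on_closed[OF assms(2) s]
  show "f (single C u \<ominus>\<^bsub>free_module C Y\<^esub> single C v) = \<zero>\<^bsub>N\<^esub> \<longleftrightarrow>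
      f (single C u) = f (single C v)"
    using s assms(3,4) cl by (simp add: d e)
  show "f (single C u \<ominus>\<^bsub>free_module C Y\<^esub> (single C v \<oplus>\<^bsub>free_module C Y\<^esub> single C w)) = \<zero>\<^bsub>N\<^esub> \<longleftrightarrow>
      f (single C u) = f (single C v) \<oplus>\<^bsub>N\<^esub> f (single C w)" if "w \<in> Y"
    using s assms(3,4) cl that by (simp add: d e linear_on_add[OF assms(2)])
  show "f (single C u \<ominus>\<^bsub>free_module C Y\<^esub> (c \<odot>\<^bsub>free_module C Y\<^esub> single C v)) = \<zero>\<^bsub>N\<^esub> \<longleftrightarrow>
      f (single C u) = c \<odot>\<^bsub>N\<^esub> f (single C v)" if "c \<in> carrier C"
    using s assms(3,4) cl that by (simp add: d e linear_on_smult[OF assms(2)])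
qed

section \<open>Tensor products, tensor powers and symmetric squares\<close>

lemma bilinear_relations_closed:
  assumes "module C M" "module C N"
  shows "bilinear_relations C M N \<subseteq> carrier (free_module C (carrier M \<times> carrier N))"
proof -
  interpret M: module C M by fact
  interpret N: module C N by fact
  let ?F = "free_module C (carrier M \<times> carrier N)"
  interpret F: module C ?F using M.R.is_cring by (rule module_free_module)
  have s: "x \<in> carrier M \<Longrightarrow> y \<in> carrier N \<Longrightarrow> single C (x, y) \<in> carrier ?F" for x y
    by (intro single_closed M.R.is_cring) auto
  show ?thesis
    unfolding bilinear_relations_def Let_def
    by (auto intro!: F.minus_closed F.a_closed F.smult_closed s M.smult_closed N.smult_closed)
qed

lemma bilinear_relations_mem:
  fixes C :: "('c, 'z) ring_scheme" and M :: "('c, 'm, 'y) module_scheme"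
    and N :: "('c, 'n, 'x) module_scheme"
  defines "F \<equiv> free_module C (carrier M \<times> carrier N)"
  shows "\<lbrakk>x \<in> carrier M; x' \<in> carrier M; y \<in> carrier N\<rbrakk> \<Longrightarrow>
      single C (x \<oplus>\<^bsub>M\<^esub> x', y) \<ominus>\<^bsub>F\<^esub> (single C (x, y) \<oplus>\<^bsub>F\<^esub> single C (x', y))
        \<in> bilinear_relations C M N"
    and "\<lbrakk>x \<in> carrier M; y \<in> carrier N; y' \<in> carrier N\<rbrakk> \<Longrightarrow>
      single C (x, y \<oplus>\<^bsub>N\<^esub> y') \<ominus>\<^bsub>F\<^esub> (single C (x, y) \<oplus>\<^bsub>F\<^esub> single C (x, y'))
        \<in> bilinear_relations C M N"
    and "\<lbrakk>c \<in> carrier C; x \<in> carrier M; y \<in> carrier N\<rbrakk> \<Longrightarrow>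
      single C (c \<odot>\<^bsub>M\<^esub> x, y) \<ominus>\<^bsub>F\<^esub> c \<odot>\<^bsub>F\<^esub> single C (x, y) \<in> bilinear_relations C M N"
    and "\<lbrakk>c \<in> carrier C; x \<in> carrier M; y \<in> carrier N\<rbrakk> \<Longrightarrow>
      single C (x, c \<odot>\<^bsub>N\<^esub> y) \<ominus>\<^bsub>F\<^esub> c \<odot>\<^bsub>F\<^esub> single C (x, y) \<in> bilinear_relations C M N"
  unfolding bilinear_relations_def Let_def F_def by blast+

locale tensor_product = M: module C M + N: module C N
  for C :: "('c, 'z) ring_scheme" (structure)
    and M :: "('c, 'm, 'y) module_scheme" and N :: "('c, 'n, 'x) module_scheme"
begin

sublocale pr: presentation C "carrier M \<times> carrier N" "bilinear_relations C M N"
  by (intro presentation.intro presentation_axioms.intro M.R.is_cring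
      bilinear_relations_closed M.module_axioms N.module_axioms)

lemma tensor_eq: "tensor C M N = pr.P"
  and pure_tensor_eq: "pure_tensor C M N x y = pr.gen (x, y)"
  by (simp_all add: tensor_def presented_def pure_tensor_def pres_gen_def tensor_rel_def)

lemma module_tensor: "module C (tensor C M N)"
  unfolding tensor_eq by (rule pr.module_presented)

sublocale T: module C "tensor C M N" by (rule module_tensor)

lemma pure_tensor_bilinear: "bilinear_on C M N (tensor C M N) (pure_tensor C M N)"
proof -
  note rel = linear_on_free_rel_iff[OF pr.module_presented pr.linear_proj, unfolded pr.proj_single]
  have rel0: "pr.proj g = \<zero>\<^bsub>pr.P\<^esub>" if "g \<in> bilinear_relations C M N" for g
    using pr.proj_rel[OF that] .
  show ?thesis
    unfolding bilinear_on_def pure_tensor_eq tensor_eq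
  proof (intro conjI ballI linear_onI)
    fix x y y' assume "x \<in> carrier M" "y \<in> carrier N" "y' \<in> carrier N"
    thus "pr.gen (x, y \<oplus>\<^bsub>N\<^esub> y') = pr.gen (x, y) \<oplus>\<^bsub>pr.P\<^esub> pr.gen (x, y')"
      by (subst rel(2)[symmetric])
        (auto intro!: rel0 bilinear_relations_mem)
  next
    fix x x' y assume "x \<in> carrier M" "x' \<in> carrier M" "y \<in> carrier N"
    thus "pr.gen (x \<oplus>\<^bsub>M\<^esub> x', y) = pr.gen (x, y) \<oplus>\<^bsub>pr.P\<^esub> pr.gen (x', y)"
      by (subst rel(2)[symmetric])
        (auto intro!: rel0 bilinear_relations_mem)
  next
    fix c x y assume "c \<in> carrier C" "x \<in> carrier M" "y \<in> carrier N"
    thus "pr.gen (x, c \<odot>\<^bsub>N\<^esub> y) = c \<odot>\<^bsub>pr.P\<^esub> pr.gen (x, y)"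
      by (subst rel(3)[symmetric])
        (auto intro!: rel0 bilinear_relations_mem)
  next
    fix c x y assume "c \<in> carrier C" "x \<in> carrier M" "y \<in> carrier N"
    thus "pr.gen (c \<odot>\<^bsub>M\<^esub> x, y) = c \<odot>\<^bsub>pr.P\<^esub> pr.gen (x, y)"
      by (subst rel(3)[symmetric])
        (auto intro!: rel0 bilinear_relations_mem)
  qed (auto intro!: pr.gen_closed)
qed

lemma pure_tensor_linear_left: "y \<in> carrier N \<Longrightarrow> linear_on C M (tensor C M N) (\<lambda>x. pure_tensor C M N x y)"
  and pure_tensor_linear_right: "x \<in> carrier M \<Longrightarrow> linear_on C N (tensor C M N) (pure_tensor C M N x)"
  using pure_tensor_bilinear by (auto simp: bilinear_on_def)

lemma pure_tensor_closed [simp]: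
  "\<lbrakk>x \<in> carrier M; y \<in> carrier N\<rbrakk> \<Longrightarrow> pure_tensor C M N x y \<in> carrier (tensor C M N)"
  using pure_tensor_linear_right linear_on_closed by metis

text \<open>Zero and all scalar multiples of pure tensors are pure tensors again, because a scalar
  can be moved into the left factor.\<close>

lemma tensor_induct [consumes 1, case_names pure add]:
  assumes x: "t \<in> carrier (tensor C M N)"
    and pure: "\<And>x y. \<lbrakk>x \<in> carrier M; y \<in> carrier N\<rbrakk> \<Longrightarrow> p (pure_tensor C M N x y)"
    and add: "\<And>s t. \<lbrakk>s \<in> carrier (tensor C M N); t \<in> carrier (tensor C M N); p s; p t\<rbrakk> \<Longrightarrow>
      p (s \<oplus>\<^bsub>tensor C M N\<^esub> t)"
  shows "p t"
  using x[unfolded tensor_eq]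
proof (induction rule: pr.presented_induct)
  case zero
  have "pure_tensor C M N \<zero>\<^bsub>M\<^esub> \<zero>\<^bsub>N\<^esub> = \<zero>\<^bsub>tensor C M N\<^esub>"
    using linear_on_zero[OF pure_tensor_linear_left M.module_axioms module_tensor] by simp
  thus ?case using pure[of "\<zero>\<^bsub>M\<^esub>" "\<zero>\<^bsub>N\<^esub>"] by (simp add: tensor_eq)
next
  case (gen c u)
  obtain x y where u: "u = (x, y)" "x \<in> carrier M" "y \<in> carrier N" using gen by auto
  have "c \<odot>\<^bsub>tensor C M N\<^esub> pure_tensor C M N x y = pure_tensor C M N (c \<odot>\<^bsub>M\<^esub> x) y"
    using linear_on_smult[OF pure_tensor_linear_left] u gen by simp
  thus ?case using pure[of "c \<odot>\<^bsub>M\<^esub> x" y] u gen by (simp add: tensor_eq pure_tensor_eq)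
next
  case (add s t)
  thus ?case using assms(3) by (simp add: tensor_eq)
qed

lemma linear_on_tensor_eqI:
  assumes "module C P" "linear_on C (tensor C M N) P f" "linear_on C (tensor C M N) P g"
    and "\<And>x y. \<lbrakk>x \<in> carrier M; y \<in> carrier N\<rbrakk> \<Longrightarrow>
      f (pure_tensor C M N x y) = g (pure_tensor C M N x y)"
    and "t \<in> carrier (tensor C M N)"
  shows "f t = g t"
  using assms(5)
  by (induction rule: tensor_induct)
    (simp_all add: assms(4) linear_on_add[OF assms(2)] linear_on_add[OF assms(3)])

lemma tensor_rel_zero:
  assumes P: "module C P" and f: "bilinear_on C M N P f" and g: "g \<in> bilinear_relations C M N"
  shows "lin_ext C P (\<lambda>(x, y). f x y) g = \<zero>\<^bsub>P\<^esub>"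
proof -
  have 1: "(\<lambda>(x, y). f x y) \<in> carrier M \<times> carrier N \<rightarrow> carrier P"
    using f by (auto simp: bilinear_on_def linear_on_def)
  note rel = linear_on_free_rel_iff[OF P linear_on_lin_ext[OF P 1]]
  note s = lin_ext_single[OF P 1]
  show ?thesis
    using g f
    unfolding bilinear_relations_def Let_def
    by (auto simp: rel s bilinear_on_def linear_on_def)
qed

lemma tensor_ext:
  assumes P: "module C P" and f: "bilinear_on C M N P f"
  obtains \<phi> where "linear_on C (tensor C M N) P \<phi>"
    and "\<And>x y. \<lbrakk>x \<in> carrier M; y \<in> carrier N\<rbrakk> \<Longrightarrow> \<phi> (pure_tensor C M N x y) = f x y"
proof -
  have 1: "(\<lambda>(x, y). f x y) \<in> carrier M \<times> carrier N \<rightarrow> carrier P"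
    using f by (auto simp: bilinear_on_def linear_on_def)
  show ?thesis
    by (rule pr.presented_ext[OF P 1 tensor_rel_zero[OF P f]])
      (use that in \<open>auto simp: tensor_eq pure_tensor_eq\<close>)
qed

text \<open>Serves for products on a tensor product: \<open>z\<close> is the left factor of the
  product while the right factor is being extended from pure tensors.\<close>

lemma tensor_ext_bilinear:
  assumes P: "module C P" and Z: "module C Z"
    and f: "\<And>z. z \<in> carrier Z \<Longrightarrow> bilinear_on C M N P (f z)"
    and lin: "\<And>x y. \<lbrakk>x \<in> carrier M; y \<in> carrier N\<rbrakk> \<Longrightarrow> linear_on C Z P (\<lambda>z. f z x y)"
  obtains \<phi> where "bilinear_on C Z (tensor C M N) P \<phi>"
    and "\<And>z x y. \<lbrakk>z \<in> carrier Z; x \<in> carrier M; y \<in> carrier N\<rbrakk> \<Longrightarrow>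
      \<phi> z (pure_tensor C M N x y) = f z x y"
proof -
  have 1: "(\<lambda>(x, y). f z x y) \<in> carrier M \<times> carrier N \<rightarrow> carrier P" if "z \<in> carrier Z" for z
    using f[OF that] by (auto simp: bilinear_on_def linear_on_def)
  have 2: "linear_on C Z P (\<lambda>z. (\<lambda>(x, y). f z x y) u)" if "u \<in> carrier M \<times> carrier N" for u
    using that lin by auto
  show ?thesis
    by (rule pr.presented_ext_bilinear[OF P Z 1 tensor_rel_zero[OF P f] 2])
      (use that in \<open>auto simp: tensor_eq pure_tensor_eq\<close>)
qed

end

section \<open>Direct sum of all tensor powers\<close>

definition multilinear_on ::
    "('c, 'z) ring_scheme \<Rightarrow> ('c, 'm, 'y) module_scheme \<Rightarrow> ('c, 'n, 'x) module_scheme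
      \<Rightarrow> ('m list \<Rightarrow> 'n) \<Rightarrow> bool"
  where "multilinear_on C M N f \<longleftrightarrow>
    (\<forall>l\<in>lists (carrier M). f l \<in> carrier N) \<and>
    (\<forall>us\<in>lists (carrier M). \<forall>vs\<in>lists (carrier M). linear_on C M N (\<lambda>x. f (us @ [x] @ vs)))"

text \<open>The generating set inside \<open>tensor_powers_rel\<close>, named so that it can serve
  as the relations of a presentation.\<close>

definition tensor_powers_relations ::
    "('c, 'z) ring_scheme \<Rightarrow> ('c, 'm, 'y) module_scheme \<Rightarrow> ('m list \<Rightarrow> 'c) set"
  where "tensor_powers_relations C M =
    (let F = free_module C (lists (carrier M)); s = single C in
       {s (us @ [x \<oplus>\<^bsub>M\<^esub> y] @ vs) \<ominus>\<^bsub>F\<^esub> (s (us @ [x] @ vs) \<oplus>\<^bsub>F\<^esub> s (us @ [y] @ vs)) | us vs x y.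
           us \<in> lists (carrier M) \<and> vs \<in> lists (carrier M) \<and>
           x \<in> carrier M \<and> y \<in> carrier M} \<union>
        {s (us @ [c \<odot>\<^bsub>M\<^esub> x] @ vs) \<ominus>\<^bsub>F\<^esub> c \<odot>\<^bsub>F\<^esub> s (us @ [x] @ vs) | us vs c x.
           us \<in> lists (carrier M) \<and> vs \<in> lists (carrier M) \<and>
           c \<in> carrier C \<and> x \<in> carrier M})"

lemma tensor_powers_relations_cases:
  fixes C :: "('c, 'z) ring_scheme" and M :: "('c, 'm, 'y) module_scheme"
  defines "F \<equiv> free_module C (lists (carrier M))"
  assumes "g \<in> tensor_powers_relations C M"
  obtains (add) us vs x y where "us \<in> lists (carrier M)" "vs \<in> lists (carrier M)"
      "x \<in> carrier M" "y \<in> carrier M"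
      "g = single C (us @ [x \<oplus>\<^bsub>M\<^esub> y] @ vs) \<ominus>\<^bsub>F\<^esub>
        (single C (us @ [x] @ vs) \<oplus>\<^bsub>F\<^esub> single C (us @ [y] @ vs))"
    | (smult) us vs c x where "us \<in> lists (carrier M)" "vs \<in> lists (carrier M)"
      "c \<in> carrier C" "x \<in> carrier M"
      "g = single C (us @ [c \<odot>\<^bsub>M\<^esub> x] @ vs) \<ominus>\<^bsub>F\<^esub> c \<odot>\<^bsub>F\<^esub> single C (us @ [x] @ vs)"
  using assms(2) unfolding tensor_powers_relations_def Let_def F_def by blast

lemma tensor_powers_relations_mem:
  fixes C :: "('c, 'z) ring_scheme" and M :: "('c, 'm, 'y) module_scheme"
  defines "F \<equiv> free_module C (lists (carrier M))"
  assumes "us \<in> lists (carrier M)" "vs \<in> lists (carrier M)" "x \<in> carrier M"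
  shows "y \<in> carrier M \<Longrightarrow> single C (us @ [x \<oplus>\<^bsub>M\<^esub> y] @ vs) \<ominus>\<^bsub>F\<^esub>
        (single C (us @ [x] @ vs) \<oplus>\<^bsub>F\<^esub> single C (us @ [y] @ vs)) \<in> tensor_powers_relations C M"
    and "c \<in> carrier C \<Longrightarrow> single C (us @ [c \<odot>\<^bsub>M\<^esub> x] @ vs) \<ominus>\<^bsub>F\<^esub>
        c \<odot>\<^bsub>F\<^esub> single C (us @ [x] @ vs) \<in> tensor_powers_relations C M"
  using assms(2-) unfolding tensor_powers_relations_def Let_def F_def by blast+

lemma tensor_powers_relations_closed:
  assumes "module C M"
  shows "tensor_powers_relations C M \<subseteq> carrier (free_module C (lists (carrier M)))"
    (is "_ \<subseteq> carrier ?F")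
proof
  interpret M: module C M by fact
  interpret F: module C ?F using M.R.is_cring by (rule module_free_module)
  have s: "l \<in> lists (carrier M) \<Longrightarrow> single C l \<in> carrier ?F" for l
    by (intro single_closed M.R.is_cring) auto
  fix g assume "g \<in> tensor_powers_relations C M"
  thus "g \<in> carrier ?F"
    by (cases rule: tensor_powers_relations_cases)
      (auto intro!: F.minus_closed F.a_closed F.smult_closed s M.smult_closed)
qed

locale tensor_algebra = M: module C M
  for C :: "('c, 'z) ring_scheme" (structure) and M :: "('c, 'm, 'y) module_scheme"
begin

sublocale pr: presentation C "lists (carrier M)" "tensor_powers_relations C M"
  by (intro presentation.intro presentation_axioms.intro M.R.is_cring
      tensor_powers_relations_closed M.module_axioms)

abbreviation "T \<equiv> tensor_powers C M"
abbreviation "tpure \<equiv> pure_tensor_list C M"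

lemma tensor_powers_eq: "T = pr.P"
  and pure_tensor_list_eq: "tpure l = pr.gen l"
  by (simp_all add: tensor_powers_def presented_def pure_tensor_list_def pres_gen_def
      tensor_powers_rel_def tensor_powers_relations_def Let_def)

lemma module_tensor_powers: "module C T"
  unfolding tensor_powers_eq by (rule pr.module_presented)

sublocale T: module C T by (rule module_tensor_powers)

lemma tpure_closed [simp]: "l \<in> lists (carrier M) \<Longrightarrow> tpure l \<in> carrier T"
  unfolding pure_tensor_list_eq tensor_powers_eq by (rule pr.gen_closed)

lemma tpure_multilinear: "multilinear_on C M T tpure"
proof -
  note rel = linear_on_free_rel_iff[OF pr.module_presented pr.linear_proj, unfolded pr.proj_single]
  have l: "us @ [x] @ vs \<in> lists (carrier M)"
    if "us \<in> lists (carrier M)" "vs \<in> lists (carrier M)" "x \<in> carrier M" for us vs x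
    using that by auto
  show ?thesis
    unfolding multilinear_on_def
  proof (intro conjI ballI linear_onI)
    fix us vs x y assume a: "us \<in> lists (carrier M)" "vs \<in> lists (carrier M)"
      "x \<in> carrier M" "y \<in> carrier M"
    show "tpure (us @ [x \<oplus>\<^bsub>M\<^esub> y] @ vs) = tpure (us @ [x] @ vs) \<oplus>\<^bsub>T\<^esub> tpure (us @ [y] @ vs)"
      unfolding pure_tensor_list_eq tensor_powers_eq
      by (rule rel(2)[THEN iffD1, OF l l l pr.proj_rel[OF tensor_powers_relations_mem(1)]])
        (use a in simp_all)
  next
    fix us vs c x assume a: "us \<in> lists (carrier M)" "vs \<in> lists (carrier M)"
      "c \<in> carrier C" "x \<in> carrier M"
    show "tpure (us @ [c \<odot>\<^bsub>M\<^esub> x] @ vs) = c \<odot>\<^bsub>T\<^esub> tpure (us @ [x] @ vs)"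
      unfolding pure_tensor_list_eq tensor_powers_eq
      by (rule rel(3)[THEN iffD1, OF l l _ pr.proj_rel[OF tensor_powers_relations_mem(2)]])
        (use a in simp_all)
  qed (use l in \<open>auto simp del: append_Cons\<close>)
qed

lemma tensor_powers_induct [consumes 1, case_names zero pure add]:
  assumes "t \<in> carrier T" "p \<zero>\<^bsub>T\<^esub>"
    and "\<And>c l. \<lbrakk>c \<in> carrier C; l \<in> lists (carrier M)\<rbrakk> \<Longrightarrow> p (c \<odot>\<^bsub>T\<^esub> tpure l)"
    and "\<And>s t. \<lbrakk>s \<in> carrier T; t \<in> carrier T; p s; p t\<rbrakk> \<Longrightarrow> p (s \<oplus>\<^bsub>T\<^esub> t)"
  shows "p t"
  using pr.presented_induct[of t p] assms unfolding tensor_powers_eq pure_tensor_list_eq by blast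

lemma linear_on_tensor_powers_eqI:
  assumes "module C N" "linear_on C T N f" "linear_on C T N g"
    and "\<And>l. l \<in> lists (carrier M) \<Longrightarrow> f (tpure l) = g (tpure l)" and "x \<in> carrier T"
  shows "f x = g x"
  using pr.linear_on_presented_eqI[of N f g x] assms
  unfolding tensor_powers_eq pure_tensor_list_eq by blast

lemma tensor_powers_rel_zero:
  assumes N: "module C N" and f: "multilinear_on C M N f" and g: "g \<in> tensor_powers_relations C M"
  shows "lin_ext C N f g = \<zero>\<^bsub>N\<^esub>"
proof -
  have 1: "f \<in> lists (carrier M) \<rightarrow> carrier N"
    using f by (auto simp: multilinear_on_def)
  note rel = linear_on_free_rel_iff[OF N linear_on_lin_ext[OF N 1]]
  note s = lin_ext_single[OF N 1]
  have l: "us @ [x] @ vs \<in> lists (carrier M)"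
    if "us \<in> lists (carrier M)" "vs \<in> lists (carrier M)" "x \<in> carrier M" for us vs x
    using that by auto
  have lin: "linear_on C M N (\<lambda>x. f (us @ [x] @ vs))"
    if "us \<in> lists (carrier M)" "vs \<in> lists (carrier M)" for us vs
    using f that unfolding multilinear_on_def by blast
  show ?thesis
    using g
  proof (cases rule: tensor_powers_relations_cases)
    case (add us vs x y)
    note l = l[OF add(1,2)]
    show ?thesis unfolding add(5)
      using rel(2)[OF l l l] s[OF l] add linear_on_add[OF lin[OF add(1,2)]] by simp
  next
    case (smult us vs c x)
    note l = l[OF smult(1,2)]
    show ?thesis unfolding smult(5)
      using rel(3)[OF l l] s[OF l] smult linear_on_smult[OF lin[OF smult(1,2)]] by simp
  qed
qed

text \<open>A linear map on the direct sum amounts to a multilinear map for every length.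
  \<open>multilinear_on\<close> handles all lengths at once; the empty list has no entry, so its
  value is an arbitrary element of \<open>N\<close>.\<close>

lemma tensor_powers_ext:
  assumes N: "module C N" and f: "multilinear_on C M N f"
  obtains \<phi> where "linear_on C T N \<phi>" and "\<And>l. l \<in> lists (carrier M) \<Longrightarrow> \<phi> (tpure l) = f l"
proof -
  have 1: "f \<in> lists (carrier M) \<rightarrow> carrier N"
    using f by (auto simp: multilinear_on_def)
  show ?thesis
    by (rule pr.presented_ext[OF N 1 tensor_powers_rel_zero[OF N f]])
      (use that in \<open>simp_all add: tensor_powers_eq pure_tensor_list_eq\<close>)
qed

lemma tensor_powers_ext_bilinear:
  assumes N: "module C N" and Z: "module C Z"
    and f: "\<And>z. z \<in> carrier Z \<Longrightarrow> multilinear_on C M N (f z)"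
    and lin: "\<And>l. l \<in> lists (carrier M) \<Longrightarrow> linear_on C Z N (\<lambda>z. f z l)"
  obtains \<phi> where "bilinear_on C Z T N \<phi>"
    and "\<And>z l. \<lbrakk>z \<in> carrier Z; l \<in> lists (carrier M)\<rbrakk> \<Longrightarrow> \<phi> z (tpure l) = f z l"
proof -
  have 1: "f z \<in> lists (carrier M) \<rightarrow> carrier N" if "z \<in> carrier Z" for z
    using f[OF that] by (auto simp: multilinear_on_def)
  show ?thesis
    by (rule pr.presented_ext_bilinear[OF N Z 1 tensor_powers_rel_zero[OF N f] lin])
      (use that in \<open>simp_all add: tensor_powers_eq pure_tensor_list_eq\<close>)
qed

end

section \<open>Symmetric square\<close>

locale symmetric_square = M: module C M
  for C :: "('c, 'z) ring_scheme" (structure) and M :: "('c, 'm, 'y) module_scheme"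
begin

sublocale MM: tensor_product C M M ..

sublocale pr: presentation C "carrier M \<times> carrier M" "bilinear_relations C M M \<union>
    {single C (x, y) \<ominus>\<^bsub>free_module C (carrier M \<times> carrier M)\<^esub> single C (y, x) | x y.
      x \<in> carrier M \<and> y \<in> carrier M}"
proof (intro presentation.intro presentation_axioms.intro M.R.is_cring)
  show "bilinear_relations C M M \<union>
    {single C (x, y) \<ominus>\<^bsub>free_module C (carrier M \<times> carrier M)\<^esub> single C (y, x) | x y.
      x \<in> carrier M \<and> y \<in> carrier M} \<subseteq> carrier (free_module C (carrier M \<times> carrier M))"
    using MM.pr.rel
    by (auto intro!: MM.pr.F.minus_closed single_closed M.R.is_cring)
qed

lemma sym_square_eq: "sym_square C M = pr.P"
  and sym_tensor_eq: "sym_tensor C M x y = pr.gen (x, y)"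
  by (simp_all add: sym_square_def presented_def sym_tensor_def pres_gen_def
      sym_square_rel_def Let_def)

lemma module_sym_square: "module C (sym_square C M)"
  unfolding sym_square_eq by (rule pr.module_presented)

lemma sym_tensor_bilinear: "bilinear_on C M M (sym_square C M) (sym_tensor C M)"
proof -
  note rel = linear_on_free_rel_iff[OF pr.module_presented pr.linear_proj, unfolded pr.proj_single]
  have rel0: "pr.proj g = \<zero>\<^bsub>pr.P\<^esub>" if "g \<in> bilinear_relations C M M" for g
    using pr.proj_rel[of g] that by blast
  show ?thesis
    unfolding bilinear_on_def sym_tensor_eq sym_square_eq
  proof (intro conjI ballI linear_onI)
    fix x y y' assume "x \<in> carrier M" "y \<in> carrier M" "y' \<in> carrier M"
    thus "pr.gen (x, y \<oplus>\<^bsub>M\<^esub> y') = pr.gen (x, y) \<oplus>\<^bsub>pr.P\<^esub> pr.gen (x, y')"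
      by (subst rel(2)[symmetric])
        (auto intro!: rel0 bilinear_relations_mem)
  next
    fix x x' y assume "x \<in> carrier M" "x' \<in> carrier M" "y \<in> carrier M"
    thus "pr.gen (x \<oplus>\<^bsub>M\<^esub> x', y) = pr.gen (x, y) \<oplus>\<^bsub>pr.P\<^esub> pr.gen (x', y)"
      by (subst rel(2)[symmetric])
        (auto intro!: rel0 bilinear_relations_mem)
  next
    fix c x y assume "c \<in> carrier C" "x \<in> carrier M" "y \<in> carrier M"
    thus "pr.gen (x, c \<odot>\<^bsub>M\<^esub> y) = c \<odot>\<^bsub>pr.P\<^esub> pr.gen (x, y)"
      by (subst rel(3)[symmetric])
        (auto intro!: rel0 bilinear_relations_mem)
  next
    fix c x y assume "c \<in> carrier C" "x \<in> carrier M" "y \<in> carrier M"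
    thus "pr.gen (c \<odot>\<^bsub>M\<^esub> x, y) = c \<odot>\<^bsub>pr.P\<^esub> pr.gen (x, y)"
      by (subst rel(3)[symmetric])
        (auto intro!: rel0 bilinear_relations_mem)
  qed (auto intro!: pr.gen_closed)
qed

lemma sym_square_induct [consumes 1, case_names zero pure add]:
  assumes "t \<in> carrier (sym_square C M)" "p \<zero>\<^bsub>sym_square C M\<^esub>"
    and "\<And>x y. \<lbrakk>x \<in> carrier M; y \<in> carrier M\<rbrakk> \<Longrightarrow> p (sym_tensor C M x y)"
    and "\<And>s t. \<lbrakk>s \<in> carrier (sym_square C M); t \<in> carrier (sym_square C M); p s; p t\<rbrakk> \<Longrightarrow>
      p (s \<oplus>\<^bsub>sym_square C M\<^esub> t)"
  shows "p t"
  using assms(1)[unfolded sym_square_eq]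
proof (induction rule: pr.presented_induct)
  case zero
  show ?case using assms(2) by (simp add: sym_square_eq)
next
  case (gen c u)
  obtain x y where u: "u = (x, y)" "x \<in> carrier M" "y \<in> carrier M" using gen by auto
  have "c \<odot>\<^bsub>sym_square C M\<^esub> sym_tensor C M x y = sym_tensor C M (c \<odot>\<^bsub>M\<^esub> x) y"
    using sym_tensor_bilinear u gen by (simp add: bilinear_on_def linear_on_def)
  thus ?case using assms(3)[of "c \<odot>\<^bsub>M\<^esub> x" y] u gen by (simp add: sym_square_eq sym_tensor_eq)
next
  case (add s t)
  thus ?case using assms(4) by (simp add: sym_square_eq)
qed

end

section \<open>Polynomial and symmetric algebras\<close>

lemma linear_on_free_eqI:
  assumes "module C N" "linear_on C (free_module C Y) N f" "linear_on C (free_module C Y) N g"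
    and "\<And>y. y \<in> Y \<Longrightarrow> f (single C y) = g (single C y)" and "p \<in> carrier (free_module C Y)"
  shows "f p = g p"
proof -
  interpret N: module C N by fact
  have C: "cring C" by (rule N.R.is_cring)
  interpret F: module C "free_module C Y" using C by (rule module_free_module)
  show ?thesis
    using C assms(5)
  proof (induction rule: free_module_induct)
    case zero
    show ?case using linear_on_zero[OF _ F.module_axioms assms(1)] assms(2,3) by metis
  next
    case (single c y)
    thus ?case using single_closed[OF C, of y Y] assms(4)
      by (simp add: linear_on_smult[OF assms(2)] linear_on_smult[OF assms(3)])
  next
    case (add p q)
    thus ?case by (simp add: linear_on_add[OF assms(2)] linear_on_add[OF assms(3)])
  qed
qed

text \<open>Many structures here are record updates of others, or copies in another record type,
  with the same carrier and operations. This and the following congruences transfer the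
  axioms.\<close>

lemma abelian_group_cong:
  assumes "abelian_group M" "carrier N = carrier M" "ring.add N = ring.add M"
    "ring.zero N = ring.zero M"
  shows "abelian_group N"
proof -
  interpret M: abelian_group M by fact
  show ?thesis
    by (rule abelian_groupI) (auto simp: assms(2-4) M.a_ac intro: M.l_neg M.a_inv_closed)
qed

lemma a_inv_cong:
  assumes "abelian_group M" "carrier N = carrier M" "ring.add N = ring.add M"
    "ring.zero N = ring.zero M" "x \<in> carrier M"
  shows "\<ominus>\<^bsub>N\<^esub> x = \<ominus>\<^bsub>M\<^esub> x"
proof -
  interpret M: abelian_group M by fact
  interpret N: abelian_group N by (rule abelian_group_cong[OF assms(1-4)])
  show ?thesis
    using assms(5) M.l_neg[of x] M.a_inv_closed[of x]
    by (intro N.minus_equality) (simp_all add: assms(2-4))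
qed

lemma a_minus_cong:
  assumes "abelian_group M" "carrier N = carrier M" "ring.add N = ring.add M"
    "ring.zero N = ring.zero M" "y \<in> carrier M"
  shows "x \<ominus>\<^bsub>N\<^esub> y = x \<ominus>\<^bsub>M\<^esub> y"
  using a_inv_cong[OF assms] assms(3) by (simp add: a_minus_def)

lemma module_cong:
  assumes "module C M" "carrier N = carrier M" "ring.add N = ring.add M"
    "ring.zero N = ring.zero M" "smult N = smult M"
  shows "module C N"
proof -
  interpret M: module C M by fact
  have "abelian_group N"
    by (rule abelian_group_cong[OF M.abelian_group_axioms assms(2-4)])
  thus ?thesis
    by (intro moduleI M.R.is_cring)
      (simp_all add: assms(2-5) M.smult_l_distr M.smult_r_distr M.smult_assoc1)
qed

lemma cring_cong:
  assumes "cring M" "carrier N = carrier M" "ring.add N = ring.add M"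
    "ring.zero N = ring.zero M" "monoid.mult N = monoid.mult M" "monoid.one N = monoid.one M"
  shows "cring N"
proof -
  interpret M: cring M by fact
  have "abelian_group N"
    by (rule abelian_group_cong[OF M.abelian_group_axioms assms(2-4)])
  thus ?thesis
  proof (intro cringI comm_monoidI)
    fix x y z assume "x \<in> carrier N" "y \<in> carrier N" "z \<in> carrier N"
    thus "(x \<oplus>\<^bsub>N\<^esub> y) \<otimes>\<^bsub>N\<^esub> z = x \<otimes>\<^bsub>N\<^esub> z \<oplus>\<^bsub>N\<^esub> y \<otimes>\<^bsub>N\<^esub> z"
      by (simp add: assms(2-6) M.l_distr)
  qed (simp_all add: assms(2-6) M.m_ac)
qed

lemma poly_algebra_simps:
  "carrier (poly_algebra C Y) = carrier (free_module C {m. set_mset m \<subseteq> Y})"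
  "ring.add (poly_algebra C Y) = ring.add (free_module C {m. set_mset m \<subseteq> Y})"
  "ring.zero (poly_algebra C Y) = ring.zero (free_module C {m. set_mset m \<subseteq> Y})"
  "smult (poly_algebra C Y) = smult (free_module C {m. set_mset m \<subseteq> Y})"
  "monoid.one (poly_algebra C Y) = single C {#}"
  "p \<otimes>\<^bsub>poly_algebra C Y\<^esub> q = (\<lambda>m. \<Oplus>\<^bsub>C\<^esub>k\<in>{k. k \<subseteq># m}. p k \<otimes>\<^bsub>C\<^esub> q (m - k))"
  by (simp_all add: poly_algebra_def)

section \<open>Polynomial algebras\<close>

locale poly_alg = cring C for C :: "('c, 'z) ring_scheme" (structure) +
  fixes Y :: "'x set"
begin

abbreviation "P \<equiv> poly_algebra C Y"
abbreviation "F \<equiv> free_module C {m. set_mset m \<subseteq> Y}"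

sublocale F: module C F by (rule module_free_module) (rule is_cring)

lemma module_poly: "module C P"
  by (rule module_cong[OF F.module_axioms]) (simp_all add: poly_algebra_simps)

sublocale P: module C P by (rule module_poly)

lemma coeff: "p \<in> carrier P \<Longrightarrow> p m \<in> carrier C"
  unfolding poly_algebra_simps by (rule free_module_coeff[OF is_cring])

lemma linear_on_poly: "linear_on C P N f \<longleftrightarrow> linear_on C F N f"
  "linear_on C M P g \<longleftrightarrow> linear_on C M F g"
  by (simp_all add: linear_on_def poly_algebra_simps)

text \<open>Coefficients of a product are sums over all submultisets, and a sum over an infinite
  index set would be zero by convention.\<close>

lemma finite_sub: "finite {k. k \<subseteq># (m :: 'x multiset)}"
proof (induction m)
  case empty
  have "{k. k \<subseteq># ({#} :: 'x multiset)} = {{#}}" by auto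
  thus ?case by simp
next
  case (add x m)
  have "{k. k \<subseteq># add_mset x m} \<subseteq> {k. k \<subseteq># m} \<union> add_mset x ` {k. k \<subseteq># m}"
  proof
    fix k assume k: "k \<in> {k. k \<subseteq># add_mset x m}"
    show "k \<in> {k. k \<subseteq># m} \<union> add_mset x ` {k. k \<subseteq># m}"
    proof (cases "x \<in># k")
      case True
      then obtain k' where "k = add_mset x k'" by (metis multi_member_split)
      thus ?thesis using k by auto
    next
      case False
      hence "k \<subseteq># m" using k
        by (metis mem_Collect_eq subset_eq_diff_conv diff_single_trivial add_mset_add_single
            minus_add_mset_if_not_in_lhs)
      thus ?thesis by simp
    qed
  qed
  thus ?case using add by (meson finite_UnI finite_imageI finite_subset)
qed

lemma mult_closed:
  assumes p: "p \<in> carrier P" and q: "q \<in> carrier P"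
  shows "p \<otimes>\<^bsub>P\<^esub> q \<in> carrier P"
proof -
  let ?r = "p \<otimes>\<^bsub>P\<^esub> q"
  have zero: "?r m = \<zero>" if "\<And>k. k \<subseteq># m \<Longrightarrow> p k = \<zero> \<or> q (m - k) = \<zero>" for m
  proof -
    have "?r m = (\<Oplus>k\<in>{k. k \<subseteq># m}. \<zero>)"
      unfolding poly_algebra_simps
      by (intro add.finprod_cong') (use that coeff[OF p] coeff[OF q] in force)+
    thus ?thesis by simp
  qed
  have 1: "?r m \<in> carrier C" for m
    unfolding poly_algebra_simps using coeff p q by (intro finsum_closed) auto
  have 2: "?r m = \<zero>" if m: "\<not> set_mset m \<subseteq> Y" for m
  proof (rule zero)
    fix k assume "k \<subseteq># m"
    hence "m = k + (m - k)" by simp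
    hence "\<not> set_mset k \<subseteq> Y \<or> \<not> set_mset (m - k) \<subseteq> Y" using m by (metis Un_least set_mset_union)
    thus "p k = \<zero> \<or> q (m - k) = \<zero>"
      using p q by (auto simp: poly_algebra_simps free_module_simps)
  qed
  \<comment> \<open>A nonzero coefficient of the product comes from splitting the monomial into
    monomials of the two supports, so the support lies in a finite set of sums.\<close>
  have 3: "{m. ?r m \<noteq> \<zero>} \<subseteq> (\<lambda>(k, l). k + l) ` ({m. p m \<noteq> \<zero>} \<times> {m. q m \<noteq> \<zero>})"
  proof
    fix m assume "m \<in> {m. ?r m \<noteq> \<zero>}"
    then obtain k where "k \<subseteq># m" "p k \<noteq> \<zero>" "q (m - k) \<noteq> \<zero>" using zero by blast
    thus "m \<in> (\<lambda>(k, l). k + l) ` ({m. p m \<noteq> \<zero>} \<times> {m. q m \<noteq> \<zero>})"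
      by (intro image_eqI[of _ _ "(k, m - k)"]) auto
  qed
  have "finite {m. ?r m \<noteq> \<zero>}"
    using p q by (intro finite_subset[OF 3]) (auto simp: poly_algebra_simps free_module_simps)
  thus ?thesis
    using 1 2 unfolding poly_algebra_simps(1) free_module_simps(1) by blast
qed

lemma mult_bilinear: "bilinear_on C P P P (\<lambda>p q. p \<otimes>\<^bsub>P\<^esub> q)"
  unfolding bilinear_on_def
proof (intro conjI ballI linear_onI mult_closed)
  fix p q r assume pqr: "p \<in> carrier P" "q \<in> carrier P" "r \<in> carrier P"
  note [simp] = pqr[THEN coeff]
  show "p \<otimes>\<^bsub>P\<^esub> (q \<oplus>\<^bsub>P\<^esub> r) = p \<otimes>\<^bsub>P\<^esub> q \<oplus>\<^bsub>P\<^esub> p \<otimes>\<^bsub>P\<^esub> r"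
    unfolding poly_algebra_simps free_module_simps
    by (rule ext, subst finsum_addf[symmetric]) (auto simp: r_distr intro!: add.finprod_cong')
  show "(q \<oplus>\<^bsub>P\<^esub> r) \<otimes>\<^bsub>P\<^esub> p = q \<otimes>\<^bsub>P\<^esub> p \<oplus>\<^bsub>P\<^esub> r \<otimes>\<^bsub>P\<^esub> p"
    unfolding poly_algebra_simps free_module_simps
    by (rule ext, subst finsum_addf[symmetric]) (auto simp: l_distr intro!: add.finprod_cong')
next
  fix c p q assume c: "c \<in> carrier C" and pq: "p \<in> carrier P" "q \<in> carrier P"
  note [simp] = pq[THEN coeff] c
  show "p \<otimes>\<^bsub>P\<^esub> (c \<odot>\<^bsub>P\<^esub> q) = c \<odot>\<^bsub>P\<^esub> (p \<otimes>\<^bsub>P\<^esub> q)"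
    unfolding poly_algebra_simps free_module_simps
    by (rule ext, subst finsum_rdistr[OF finite_sub c])
      (auto simp: m_ac intro!: add.finprod_cong')
  show "(c \<odot>\<^bsub>P\<^esub> q) \<otimes>\<^bsub>P\<^esub> p = c \<odot>\<^bsub>P\<^esub> (q \<otimes>\<^bsub>P\<^esub> p)"
    unfolding poly_algebra_simps free_module_simps
    by (rule ext, subst finsum_rdistr[OF finite_sub c])
      (auto simp: m_ac intro!: add.finprod_cong')
qed (use mult_closed in auto)

lemma single_mult: "single C m \<otimes>\<^bsub>P\<^esub> single C n = single C (m + n)"
proof
  fix x
  \<comment> \<open>With a case distinction on \<open>k\<close>, the sum over all splittings has at
    most one nonzero term, the one with \<open>k = m\<close>.\<close>
  have "(single C m \<otimes>\<^bsub>P\<^esub> single C n) x = (\<Oplus>k\<in>{k. k \<subseteq># x}. if m = k then single C n (x - m) else \<zero>)"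
    unfolding poly_algebra_simps
    by (intro add.finprod_cong') (auto simp: single_def)
  also have "\<dots> = single C (m + n) x"
  proof (cases "m \<subseteq># x")
    case True
    hence "(\<Oplus>k\<in>{k. k \<subseteq># x}. if m = k then single C n (x - m) else \<zero>) = single C n (x - m)"
      by (intro add.finprod_singleton[of m _ "\<lambda>_. single C n (x - m)"])
        (auto simp: finite_sub single_def)
    thus ?thesis using True by (auto simp: single_def)
  next
    case False
    hence "(\<Oplus>k\<in>{k. k \<subseteq># x}. if m = k then single C n (x - m) else \<zero>) = (\<Oplus>k\<in>{k. k \<subseteq># x}. \<zero>)"
      by (intro add.finprod_cong') auto
    thus ?thesis using False by (auto simp: single_def)
  qed
  finally show "(single C m \<otimes>\<^bsub>P\<^esub> single C n) x = single C (m + n) x" .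
qed

lemma single_poly: "set_mset m \<subseteq> Y \<Longrightarrow> single C m \<in> carrier P"
  unfolding poly_algebra_simps by (rule single_closed[OF is_cring]) simp

lemma linear_on_poly_eqI:
  assumes "module C N" "linear_on C P N f" "linear_on C P N g"
    and "\<And>m. set_mset m \<subseteq> Y \<Longrightarrow> f (single C m) = g (single C m)" and "p \<in> carrier P"
  shows "f p = g p"
  by (rule linear_on_free_eqI[OF assms(1), of "{m. set_mset m \<subseteq> Y}"])
    (use assms in \<open>simp_all add: linear_on_poly poly_algebra_simps\<close>)

lemma mult_linear_left: "q \<in> carrier P \<Longrightarrow> linear_on C P P (\<lambda>p. p \<otimes>\<^bsub>P\<^esub> q)"
  and mult_linear_right: "p \<in> carrier P \<Longrightarrow> linear_on C P P (\<lambda>q. p \<otimes>\<^bsub>P\<^esub> q)"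
  using mult_bilinear by (auto simp: bilinear_on_def)

text \<open>The ring laws are linear in each argument, so they hold if they hold for monomials,
  where they are laws of multiset addition. Associativity is extended from monomials one argument at
  a time.\<close>

lemma algebra_poly: "algebra C P"
proof -
  note lin = mult_linear_left mult_linear_right
  note c1 = linear_on_comp[of C P P _ P "\<lambda>p. p \<otimes>\<^bsub>P\<^esub> _", OF _ mult_linear_left]
  note c2 = linear_on_comp[of C P P _ P "\<lambda>q. _ \<otimes>\<^bsub>P\<^esub> q", OF _ mult_linear_right]
  note eqI = linear_on_poly_eqI[OF module_poly]
  have a1: "(p \<otimes>\<^bsub>P\<^esub> single C n) \<otimes>\<^bsub>P\<^esub> single C k = p \<otimes>\<^bsub>P\<^esub> (single C n \<otimes>\<^bsub>P\<^esub> single C k)"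
    if "p \<in> carrier P" "set_mset n \<subseteq> Y" "set_mset k \<subseteq> Y" for p n k
    by (rule eqI[OF c1 mult_linear_left])
      (use that in \<open>auto simp: single_mult add.assoc intro!: lin single_poly mult_closed\<close>)
  have a2: "(p \<otimes>\<^bsub>P\<^esub> q) \<otimes>\<^bsub>P\<^esub> single C k = p \<otimes>\<^bsub>P\<^esub> (q \<otimes>\<^bsub>P\<^esub> single C k)"
    if "p \<in> carrier P" "q \<in> carrier P" "set_mset k \<subseteq> Y" for p q k
    by (rule eqI[OF c1 c2, where p = q])
      (use that in \<open>auto simp: a1 intro!: lin single_poly mult_closed\<close>)
  have assoc: "(p \<otimes>\<^bsub>P\<^esub> q) \<otimes>\<^bsub>P\<^esub> r = p \<otimes>\<^bsub>P\<^esub> (q \<otimes>\<^bsub>P\<^esub> r)"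
    if "p \<in> carrier P" "q \<in> carrier P" "r \<in> carrier P" for p q r
    by (rule eqI[OF mult_linear_right c2, where p = r])
      (use that in \<open>auto simp: a2 intro!: lin single_poly mult_closed\<close>)
  have k1: "p \<otimes>\<^bsub>P\<^esub> single C k = single C k \<otimes>\<^bsub>P\<^esub> p" if "p \<in> carrier P" "set_mset k \<subseteq> Y" for p k
    by (rule eqI[OF lin, where p = p])
      (use that in \<open>auto simp: single_mult add.commute intro!: single_poly\<close>)
  have comm: "p \<otimes>\<^bsub>P\<^esub> q = q \<otimes>\<^bsub>P\<^esub> p" if "p \<in> carrier P" "q \<in> carrier P" for p q
    by (rule eqI[OF lin(2,1), where p = q]) (use that in \<open>auto simp: k1\<close>)
  have one_cl: "\<one>\<^bsub>P\<^esub> \<in> carrier P"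
    using single_poly[of "{#}"] by (simp add: poly_algebra_simps(5))
  have id: "linear_on C P P (\<lambda>p. p)" by (rule linear_onI) auto
  have one: "\<one>\<^bsub>P\<^esub> \<otimes>\<^bsub>P\<^esub> p = p" if "p \<in> carrier P" for p
    by (rule eqI[OF mult_linear_right id])
      (use that one_cl in \<open>auto simp: poly_algebra_simps(5) single_mult\<close>)
  have "cring P"
  proof (intro cringI comm_monoidI P.abelian_group_axioms)
    fix p q r assume "p \<in> carrier P" "q \<in> carrier P" "r \<in> carrier P"
    thus "(p \<oplus>\<^bsub>P\<^esub> q) \<otimes>\<^bsub>P\<^esub> r = p \<otimes>\<^bsub>P\<^esub> r \<oplus>\<^bsub>P\<^esub> q \<otimes>\<^bsub>P\<^esub> r"
      by (simp add: linear_on_add[OF mult_linear_left])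
  qed (use mult_closed one_cl assoc comm one in auto)
  thus ?thesis
    by (intro algebraI is_cring)
      (simp_all add: P.smult_l_distr P.smult_r_distr P.smult_assoc1
        linear_on_smult[OF mult_linear_left])
qed

end

section \<open>Quotients of algebras by ideals\<close>

locale algebra_quotient = algebra C A for C :: "('c, 'z) ring_scheme" (structure)
    and A :: "('c, 'm, 'y) module_scheme" +
  fixes H assumes ideal: "ideal H A"
begin

lemma ideal_submodule: "submodule H C A"
proof -
  interpret H: ideal H A by (rule ideal)
  show ?thesis
  proof (rule submoduleI'[OF module_axioms])
    fix c x assume c: "c \<in> carrier C" and x: "x \<in> H"
    have xA: "x \<in> carrier A" using x by (rule H.a_Hcarr)
    \<comment> \<open>An ideal absorbs ring elements; the scalar \<open>c\<close> becomes one as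
      \<open>c\<close> times the unit.\<close>
    have "(c \<odot>\<^bsub>A\<^esub> \<one>\<^bsub>A\<^esub>) \<otimes>\<^bsub>A\<^esub> x \<in> H" using x c by (intro H.I_l_closed) auto
    also have "(c \<odot>\<^bsub>A\<^esub> \<one>\<^bsub>A\<^esub>) \<otimes>\<^bsub>A\<^esub> x = c \<odot>\<^bsub>A\<^esub> x" using c xA by (simp add: smult_assoc2)
    finally show "c \<odot>\<^bsub>A\<^esub> x \<in> H" .
  qed (use H.a_subset in auto)
qed

sublocale quot: module_quotient C A H
  by (intro module_quotient.intro module_axioms module_quotient_axioms.intro ideal_submodule)

lemma quot_mult:
  "\<lbrakk>x \<in> carrier A; y \<in> carrier A\<rbrakk> \<Longrightarrow>
    (H +>\<^bsub>A\<^esub> x) \<otimes>\<^bsub>module_quot A H\<^esub> (H +>\<^bsub>A\<^esub> y) = H +>\<^bsub>A\<^esub> (x \<otimes>\<^bsub>A\<^esub> y)"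
  by (simp add: module_quot_def FactRing_def ideal.rcoset_mult_add[OF ideal])

lemma quot_one: "\<one>\<^bsub>module_quot A H\<^esub> = H +>\<^bsub>A\<^esub> \<one>\<^bsub>A\<^esub>"
  by (simp add: module_quot_def FactRing_def)

lemma algebra_quot: "algebra C (module_quot A H)"
proof -
  interpret M: module C "module_quot A H" by (rule quot.quot_module)
  have "cring (A Quot H)"
    using ideal.quotient_is_cring[OF ideal M_cring] .
  hence cr: "cring (module_quot A H)"
    by (rule cring_cong) (simp_all add: module_quot_def)
  show ?thesis
  proof (rule algebraI[OF R_cring cr])
    fix c u v assume c: "c \<in> carrier C" and uv: "u \<in> carrier (module_quot A H)"
      "v \<in> carrier (module_quot A H)"
    then obtain x y where "x \<in> carrier A" "y \<in> carrier A" "u = H +>\<^bsub>A\<^esub> x" "v = H +>\<^bsub>A\<^esub> y"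
      by (auto simp: quot.quot_carrier)
    thus "c \<odot>\<^bsub>module_quot A H\<^esub> u \<otimes>\<^bsub>module_quot A H\<^esub> v =
        c \<odot>\<^bsub>module_quot A H\<^esub> (u \<otimes>\<^bsub>module_quot A H\<^esub> v)"
      using c by (simp add: quot_mult quot.quot_smult smult_assoc2)
  qed (simp_all add: M.smult_l_distr M.smult_r_distr M.smult_assoc1)
qed

end

section \<open>Symmetric algebras\<close>

locale symmetric_algebra = M: module C M
  for C :: "('c, 'z) ring_scheme" (structure) and M :: "('c, 'm, 'y) module_scheme"
begin

sublocale p: poly_alg C "carrier M" by (intro poly_alg.intro M.R.is_cring)

lemma var_closed: "x \<in> carrier M \<Longrightarrow> single C {#x#} \<in> carrier p.P"
  by (rule p.single_poly) simp

definition relations where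
  "relations = {single C {#x \<oplus>\<^bsub>M\<^esub> y#} \<ominus>\<^bsub>p.P\<^esub> (single C {#x#} \<oplus>\<^bsub>p.P\<^esub> single C {#y#}) | x y.
        x \<in> carrier M \<and> y \<in> carrier M} \<union>
      {single C {#c \<odot>\<^bsub>M\<^esub> x#} \<ominus>\<^bsub>p.P\<^esub> c \<odot>\<^bsub>p.P\<^esub> single C {#x#} | c x.
        c \<in> carrier C \<and> x \<in> carrier M}"

lemma relations_mem:
  "\<lbrakk>x \<in> carrier M; y \<in> carrier M\<rbrakk> \<Longrightarrow>
    single C {#x \<oplus>\<^bsub>M\<^esub> y#} \<ominus>\<^bsub>p.P\<^esub> (single C {#x#} \<oplus>\<^bsub>p.P\<^esub> single C {#y#}) \<in> relations"
  "\<lbrakk>c \<in> carrier C; x \<in> carrier M\<rbrakk> \<Longrightarrow>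
    single C {#c \<odot>\<^bsub>M\<^esub> x#} \<ominus>\<^bsub>p.P\<^esub> c \<odot>\<^bsub>p.P\<^esub> single C {#x#} \<in> relations"
  unfolding relations_def by blast+

lemma relations_closed: "relations \<subseteq> carrier p.P"
  unfolding relations_def
  by (auto intro!: p.P.minus_closed p.P.a_closed p.P.smult_closed var_closed)

lemma sym_ideal_eq: "sym_ideal C M = Idl\<^bsub>p.P\<^esub> relations"
  by (simp add: sym_ideal_def relations_def Let_def)

sublocale q: algebra_quotient C p.P "sym_ideal C M"
proof (intro algebra_quotient.intro p.algebra_poly algebra_quotient_axioms.intro)
  show "ideal (sym_ideal C M) p.P"
    unfolding sym_ideal_eq
    by (rule ring.genideal_ideal[OF cring.axioms(1)[OF algebra.M_cring[OF p.algebra_poly]]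
          relations_closed])
qed

lemma algebra_sym: "algebra C (sym_algebra C M)"
  unfolding sym_algebra_def by (rule q.algebra_quot)

lemma sym_emb_linear: "linear_on C M (sym_algebra C M) (sym_emb C M)"
proof (rule linear_onI)
  have rel: "g \<in> sym_ideal C M" if "g \<in> relations" for g
    using that ring.genideal_self[OF cring.axioms(1)[OF algebra.M_cring[OF p.algebra_poly]]
        relations_closed] unfolding sym_ideal_eq by blast
  note a = q.quot.quot_add q.quot.quot_smult
  fix x assume x: "x \<in> carrier M"
  show "sym_emb C M x \<in> carrier (sym_algebra C M)"
    unfolding sym_algebra_def sym_emb_def q.quot.quot_carrier using var_closed[OF x] by blast
  show "sym_emb C M (x \<oplus>\<^bsub>M\<^esub> y) = sym_emb C M x \<oplus>\<^bsub>sym_algebra C M\<^esub> sym_emb C M y"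
    if y: "y \<in> carrier M" for y
    unfolding sym_algebra_def sym_emb_def using x y var_closed
    by (subst a) (auto simp: q.quot.coset_eq_iff intro!: rel relations_mem)
  show "sym_emb C M (c \<odot>\<^bsub>M\<^esub> x) = c \<odot>\<^bsub>sym_algebra C M\<^esub> sym_emb C M x" if c: "c \<in> carrier C" for c
    unfolding sym_algebra_def sym_emb_def using x c var_closed
    by (subst a) (auto simp: q.quot.coset_eq_iff intro!: rel relations_mem)
qed

text \<open>The symmetric algebra is generated as an algebra by the scalars and the image of
  \<open>M\<close>. In this way a property of all constants of IDR(R) is reduced to the generators
  written with epsilon.\<close>

lemma sym_algebra_induct [consumes 1, case_names scalar emb add mult]:
  assumes x: "x \<in> carrier (sym_algebra C M)"
    and scalar: "\<And>c. c \<in> carrier C \<Longrightarrow> p (c \<odot>\<^bsub>sym_algebra C M\<^esub> \<one>\<^bsub>sym_algebra C M\<^esub>)"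
    and emb: "\<And>m. m \<in> carrier M \<Longrightarrow> p (sym_emb C M m)"
    and add: "\<And>x y. \<lbrakk>x \<in> carrier (sym_algebra C M); y \<in> carrier (sym_algebra C M); p x; p y\<rbrakk> \<Longrightarrow>
      p (x \<oplus>\<^bsub>sym_algebra C M\<^esub> y)"
    and mult: "\<And>x y. \<lbrakk>x \<in> carrier (sym_algebra C M); y \<in> carrier (sym_algebra C M); p x; p y\<rbrakk> \<Longrightarrow>
      p (x \<otimes>\<^bsub>sym_algebra C M\<^esub> y)"
  shows "p x"
proof -
  let ?S = "sym_algebra C M"
  interpret S: algebra C ?S by (rule algebra_sym)
  define \<pi> where "\<pi> t = sym_ideal C M +>\<^bsub>p.P\<^esub> t" for t
  have lin: "linear_on C p.P ?S \<pi>" unfolding \<pi>_def sym_algebra_def by (rule q.quot.quot_proj)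
  have mul: "\<pi> (s \<otimes>\<^bsub>p.P\<^esub> t) = \<pi> s \<otimes>\<^bsub>?S\<^esub> \<pi> t" if "s \<in> carrier p.P" "t \<in> carrier p.P" for s t
    using that unfolding \<pi>_def sym_algebra_def by (simp add: q.quot_mult)
  have one: "\<pi> (single C {#}) = \<one>\<^bsub>?S\<^esub>"
    unfolding \<pi>_def sym_algebra_def q.quot_one by (simp add: poly_algebra_simps)
  have mono: "p (\<pi> (single C m))" if "set_mset m \<subseteq> carrier M" for m
    using that
  proof (induction m)
    case empty
    show ?case using scalar[of \<one>] by (simp add: one)
  next
    case (add y m)
    have "p (\<pi> (single C {#y#}) \<otimes>\<^bsub>?S\<^esub> \<pi> (single C m))"
      using add emb[of y] linear_on_closed[OF lin] var_closed p.single_poly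
      by (intro mult) (auto simp: \<pi>_def sym_emb_def)
    moreover have "single C {#y#} \<otimes>\<^bsub>p.P\<^esub> single C m = single C (add_mset y m)"
      by (simp add: p.single_mult)
    ultimately show ?case
      using add.prems mul[OF var_closed p.single_poly, of y m] by simp
  qed
  obtain t where t: "t \<in> carrier p.P" "x = \<pi> t"
    using x unfolding sym_algebra_def q.quot.quot_carrier \<pi>_def by blast
  have "p (\<pi> t)"
    using M.R.is_cring t(1)[unfolded poly_algebra_simps]
  proof (induction rule: free_module_induct)
    case zero
    show ?case
      using scalar[of \<zero>] linear_on_zero[OF lin p.module_poly S.module_axioms]
      by (simp add: poly_algebra_simps)
  next
    case (single c m)
    hence m: "set_mset m \<subseteq> carrier M" by simp
    have cl: "\<pi> (single C m) \<in> carrier ?S" using m by (intro linear_on_closed[OF lin] p.single_poly)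
    \<comment> \<open>The scalar is turned into a factor, so that closure under products covers
      it.\<close>
    have "p ((c \<odot>\<^bsub>?S\<^esub> \<one>\<^bsub>?S\<^esub>) \<otimes>\<^bsub>?S\<^esub> \<pi> (single C m))"
      using single(1) cl by (intro mult scalar mono m) auto
    also have "(c \<odot>\<^bsub>?S\<^esub> \<one>\<^bsub>?S\<^esub>) \<otimes>\<^bsub>?S\<^esub> \<pi> (single C m) = \<pi> (c \<odot>\<^bsub>p.P\<^esub> single C m)"
      using single(1) cl p.single_poly[OF m] by (simp add: S.smult_assoc2 linear_on_smult[OF lin])
    finally show ?case by (simp add: poly_algebra_simps)
  next
    case (add s t)
    hence "p (\<pi> s \<oplus>\<^bsub>?S\<^esub> \<pi> t)"
      by (intro assms(4) linear_on_closed[OF lin]) (auto simp: poly_algebra_simps)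
    also have "\<pi> s \<oplus>\<^bsub>?S\<^esub> \<pi> t = \<pi> (s \<oplus>\<^bsub>p.P\<^esub> t)"
      using add by (intro linear_on_add[OF lin, symmetric]) (auto simp: poly_algebra_simps)
    finally show ?case by (simp add: poly_algebra_simps)
  qed
  thus ?thesis using t by simp
qed

end

section \<open>Maps determined on generators\<close>

lemma linear_map_imp_linear_on: "linear_map C M N f \<Longrightarrow> linear_on C M N f"
  by (auto simp: linear_map_def linear_on_def)

lemma bilinear_map_imp_bilinear_on: "bilinear_map C M N P f \<Longrightarrow> bilinear_on C M N P f"
  by (auto simp: bilinear_map_def bilinear_on_def intro: linear_map_imp_linear_on)

lemma linear_on_restrict:
  assumes "module C M" "linear_on C M N f"
  shows "linear_map C M N (restrict f (carrier M))"
proof -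
  interpret M: module C M by fact
  show ?thesis using assms(2) by (auto simp: linear_map_def linear_on_def)
qed

text \<open>A definite description needs one function, while the specification speaks only of the
  carrier. Restriction makes the map extensional, and two extensional maps that agree on the carrier
  are equal.\<close>

lemma the_linear_map:
  assumes M: "module C M" and f: "linear_on C M N f" and Pf: "p (restrict f (carrier M))"
    and uniq: "\<And>f g x. \<lbrakk>linear_on C M N f; linear_on C M N g; p f; p g; x \<in> carrier M\<rbrakk> \<Longrightarrow> f x = g x"
  shows "linear_map C M N (THE f. linear_map C M N f \<and> p f) \<and> p (THE f. linear_map C M N f \<and> p f)"
proof (rule theI[where P = "\<lambda>f. linear_map C M N f \<and> p f"])
  show "linear_map C M N (restrict f (carrier M)) \<and> p (restrict f (carrier M))"
    using linear_on_restrict[OF M f] Pf by simp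
next
  fix g assume g: "linear_map C M N g \<and> p g"
  show "g = restrict f (carrier M)"
  proof
    fix x
    show "g x = restrict f (carrier M) x"
    proof (cases "x \<in> carrier M")
      case True
      thus ?thesis
        using uniq[of g "restrict f (carrier M)" x] g Pf linear_on_restrict[OF M f]
          linear_map_imp_linear_on by metis
    next
      case False
      thus ?thesis using g by (auto simp: linear_map_def PiE_def extensional_def)
    qed
  qed
qed

text \<open>The property must depend only on the values on the carriers, as the candidate has to be
  altered outside of them to become extensional.\<close>

lemma the_bilinear_map:
  assumes M: "module C M" and N: "module C N" and f: "bilinear_on C M N P f"
    and p: "\<And>g. (\<And>x y. \<lbrakk>x \<in> carrier M; y \<in> carrier N\<rbrakk> \<Longrightarrow> g x y = f x y) \<Longrightarrow> p g"
    and uniq: "\<And>f g x y. \<lbrakk>bilinear_on C M N P f; bilinear_on C M N P g; p f; p g;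
      x \<in> carrier M; y \<in> carrier N\<rbrakk> \<Longrightarrow> f x y = g x y"
  shows "bilinear_map C M N P (THE f. bilinear_map C M N P f \<and> p f) \<and>
    p (THE f. bilinear_map C M N P f \<and> p f)"
proof (rule theI[where P = "\<lambda>f. bilinear_map C M N P f \<and> p f"])
  interpret M: module C M by fact
  interpret N: module C N by fact
  \<comment> \<open>Extensionality is demanded of the uncurried map, hence \<open>undefined\<close>
    as soon as one of the arguments leaves its carrier.\<close>
  let ?f = "\<lambda>x y. if x \<in> carrier M \<and> y \<in> carrier N then f x y else undefined"
  have b: "bilinear_map C M N P ?f"
    using f
    by (auto simp: bilinear_map_def bilinear_on_def linear_map_def linear_on_def extensional_def)
  have pf: "p ?f" by (rule p) simp
  show "bilinear_map C M N P ?f \<and> p ?f" using b pf by blast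
  fix g assume g: "bilinear_map C M N P g \<and> p g"
  show "g = ?f"
  proof (intro ext)
    fix x y
    show "g x y = ?f x y"
    proof (cases "x \<in> carrier M \<and> y \<in> carrier N")
      case True
      show ?thesis
      proof (rule uniq)
        show "bilinear_on C M N P g" "p g" using g bilinear_map_imp_bilinear_on by blast+
        show "bilinear_on C M N P ?f" using b by (rule bilinear_map_imp_bilinear_on)
        show "p ?f" by (rule pf)
      qed (use True in auto)
    next
      case False
      have "(\<lambda>(x, y). g x y) \<in> extensional (carrier M \<times> carrier N)"
        using g by (simp add: bilinear_map_def)
      hence "(\<lambda>(x, y). g x y) (x, y) = undefined"
        using False by (intro extensional_arb) auto
      thus ?thesis using False by auto
    qed
  qed
qed

context tensor_product begin

text \<open>Four arguments are involved. Extending the left factor gives a linear map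
  \<open>\<phi> a' b'\<close> for each pure right factor; the right factor is extended afterwards,
  with the left one as a parameter.\<close>

lemma tensor_algebra_mult_spec:
  assumes A: "bilinear_on C M M M (\<lambda>x y. x \<otimes>\<^bsub>M\<^esub> y)" and B: "bilinear_on C N N N (\<lambda>x y. x \<otimes>\<^bsub>N\<^esub> y)"
  shows "bilinear_on C (tensor C M N) (tensor C M N) (tensor C M N) (tensor_algebra_mult C M N)"
    and "\<lbrakk>a \<in> carrier M; b \<in> carrier N; a' \<in> carrier M; b' \<in> carrier N\<rbrakk> \<Longrightarrow>
      tensor_algebra_mult C M N (pure_tensor C M N a b) (pure_tensor C M N a' b') =
        pure_tensor C M N (a \<otimes>\<^bsub>M\<^esub> a') (b \<otimes>\<^bsub>N\<^esub> b')"
proof -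
  let ?T = "tensor C M N" and ?p = "pure_tensor C M N"
  note mod = module_tensor
  have lA: "linear_on C M M (\<lambda>x. x \<otimes>\<^bsub>M\<^esub> y)" "linear_on C M M (\<lambda>x. y \<otimes>\<^bsub>M\<^esub> x)"
    if "y \<in> carrier M" for y using A that by (auto simp: bilinear_on_def)
  have lB: "linear_on C N N (\<lambda>x. x \<otimes>\<^bsub>N\<^esub> y)" "linear_on C N N (\<lambda>x. y \<otimes>\<^bsub>N\<^esub> x)"
    if "y \<in> carrier N" for y using B that by (auto simp: bilinear_on_def)
  have cA: "x \<otimes>\<^bsub>M\<^esub> y \<in> carrier M" if "x \<in> carrier M" "y \<in> carrier M" for x y
    using linear_on_closed[OF lA(1)] that by metis
  have cB: "x \<otimes>\<^bsub>N\<^esub> y \<in> carrier N" if "x \<in> carrier N" "y \<in> carrier N" for x y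
    using linear_on_closed[OF lB(1)] that by metis
  have "\<exists>\<phi>. linear_on C ?T ?T \<phi> \<and>
      (\<forall>a\<in>carrier M. \<forall>b\<in>carrier N. \<phi> (?p a b) = ?p (a \<otimes>\<^bsub>M\<^esub> a') (b \<otimes>\<^bsub>N\<^esub> b'))"
    if "a' \<in> carrier M" "b' \<in> carrier N" for a' b'
  proof -
    have "bilinear_on C M N ?T (\<lambda>a b. ?p (a \<otimes>\<^bsub>M\<^esub> a') (b \<otimes>\<^bsub>N\<^esub> b'))"
      unfolding bilinear_on_def
      using that
      by (intro conjI ballI linear_on_comp[OF lB(1) pure_tensor_linear_right]
          linear_on_comp[OF lA(1) pure_tensor_linear_left] cA cB)
    from tensor_ext[OF mod this] show ?thesis by metis
  qed
  then obtain \<phi> where \<phi>: "\<And>a' b'. \<lbrakk>a' \<in> carrier M; b' \<in> carrier N\<rbrakk> \<Longrightarrow> linear_on C ?T ?T (\<phi> a' b')"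
    and \<phi>p: "\<And>a b a' b'. \<lbrakk>a' \<in> carrier M; b' \<in> carrier N; a \<in> carrier M; b \<in> carrier N\<rbrakk> \<Longrightarrow>
      \<phi> a' b' (?p a b) = ?p (a \<otimes>\<^bsub>M\<^esub> a') (b \<otimes>\<^bsub>N\<^esub> b')"
    by metis
  \<comment> \<open>At a pure tensor \<open>z\<close> the value is bilinear in \<open>a'\<close> and
    \<open>b'\<close> by the formula, and sums preserve this.\<close>
  have bil: "bilinear_on C M N ?T (\<lambda>a' b'. \<phi> a' b' z)" if "z \<in> carrier ?T" for z
    unfolding bilinear_on_def
  proof (intro conjI ballI)
    fix a' assume a': "a' \<in> carrier M"
    show "linear_on C N ?T (\<lambda>b'. \<phi> a' b' z)"
      using that
    proof (induction rule: tensor_induct)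
      case (pure x y)
      show ?case
        by (rule linear_on_cong[OF linear_on_comp[OF lB(2)[OF pure(2)]
                pure_tensor_linear_right[OF cA[OF pure(1) a']]] N.module_axioms])
          (use pure a' in \<open>simp add: \<phi>p\<close>)
    next
      case (add s t)
      show ?case
        by (rule linear_on_cong[OF linear_on_plus[OF mod add(3,4)] N.module_axioms])
          (use add a' in \<open>simp add: linear_on_add[OF \<phi>]\<close>)
    qed
  next
    fix b' assume b': "b' \<in> carrier N"
    show "linear_on C M ?T (\<lambda>a'. \<phi> a' b' z)"
      using that
    proof (induction rule: tensor_induct)
      case (pure x y)
      show ?case
        by (rule linear_on_cong[OF linear_on_comp[OF lA(2)[OF pure(1)]
                pure_tensor_linear_left[OF cB[OF pure(2) b']]] M.module_axioms])
          (use pure b' in \<open>simp add: \<phi>p\<close>)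
    next
      case (add s t)
      show ?case
        by (rule linear_on_cong[OF linear_on_plus[OF mod add(3,4)] M.module_axioms])
          (use add b' in \<open>simp add: linear_on_add[OF \<phi>]\<close>)
    qed
  qed
  obtain \<mu> where \<mu>: "bilinear_on C ?T ?T ?T \<mu>"
    and \<mu>p: "\<And>z a' b'. \<lbrakk>z \<in> carrier ?T; a' \<in> carrier M; b' \<in> carrier N\<rbrakk> \<Longrightarrow> \<mu> z (?p a' b') = \<phi> a' b' z"
    using tensor_ext_bilinear[OF mod mod, of "\<lambda>z a' b'. \<phi> a' b' z"] bil \<phi> by metis
  let ?Q = "\<lambda>\<mu>. \<forall>a\<in>carrier M. \<forall>b\<in>carrier N. \<forall>a'\<in>carrier M. \<forall>b'\<in>carrier N.
          \<mu> (?p a b) (?p a' b') = ?p (a \<otimes>\<^bsub>M\<^esub> a') (b \<otimes>\<^bsub>N\<^esub> b')"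
  have "bilinear_map C ?T ?T ?T (tensor_algebra_mult C M N) \<and> ?Q (tensor_algebra_mult C M N)"
    unfolding tensor_algebra_mult_def
  proof (rule the_bilinear_map[OF mod mod \<mu>])
    fix g assume "\<And>x y. \<lbrakk>x \<in> carrier ?T; y \<in> carrier ?T\<rbrakk> \<Longrightarrow> g x y = \<mu> x y"
    thus "?Q g" by (simp add: \<mu>p \<phi>p)
  next
    fix f g s t
    assume f: "bilinear_on C ?T ?T ?T f" "?Q f" and g: "bilinear_on C ?T ?T ?T g" "?Q g"
      and st: "s \<in> carrier ?T" "t \<in> carrier ?T"
    have l: "linear_on C ?T ?T (h u)" "linear_on C ?T ?T (\<lambda>x. h x u)"
      if "bilinear_on C ?T ?T ?T h" "u \<in> carrier ?T" for h u
      using that by (auto simp: bilinear_on_def)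
    \<comment> \<open>Uniqueness follows in two steps as well: for a pure left factor, and from
      there for all.\<close>
    have 1: "f (?p a b) t = g (?p a b) t" if "a \<in> carrier M" "b \<in> carrier N" for a b
      by (rule linear_on_tensor_eqI[OF mod l(1)[OF f(1)] l(1)[OF g(1)]])
        (use that st f(2) g(2) in auto)
    show "f s t = g s t"
      by (rule linear_on_tensor_eqI[OF mod l(2)[OF f(1)] l(2)[OF g(1)]]) (use st 1 in auto)
  qed
  thus "bilinear_on C ?T ?T ?T (tensor_algebra_mult C M N)"
    and "\<lbrakk>a \<in> carrier M; b \<in> carrier N; a' \<in> carrier M; b' \<in> carrier N\<rbrakk> \<Longrightarrow>
      tensor_algebra_mult C M N (?p a b) (?p a' b') = ?p (a \<otimes>\<^bsub>M\<^esub> a') (b \<otimes>\<^bsub>N\<^esub> b')"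
    using bilinear_map_imp_bilinear_on by blast+
qed

end

section \<open>Multilinear maps into tensor products\<close>

context tensor_product begin

text \<open>Maps chosen separately for each \<open>z\<close> depend linearly on \<open>z\<close> as
  soon as they do so at pure tensors. This permits extending one argument after another.\<close>

lemma param_linear_tensor:
  assumes P: "module C P" and Z: "module C Z"
    and \<phi>: "\<And>z. z \<in> carrier Z \<Longrightarrow> linear_on C (tensor C M N) P (\<phi> z)"
    and pure: "\<And>x y. \<lbrakk>x \<in> carrier M; y \<in> carrier N\<rbrakk> \<Longrightarrow>
      linear_on C Z P (\<lambda>z. \<phi> z (pure_tensor C M N x y))"
    and t: "t \<in> carrier (tensor C M N)"
  shows "linear_on C Z P (\<lambda>z. \<phi> z t)"
  using t
proof (induction rule: tensor_induct)
  case (pure x y)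
  thus ?case by (rule assms(4))
next
  case (add s t)
  show ?case
    by (rule linear_on_cong[OF linear_on_plus[OF P add(3,4)] Z])
      (use add in \<open>simp add: linear_on_add[OF \<phi>]\<close>)
qed

end

context tensor_algebra begin

lemma param_linear_T:
  assumes P: "module C P" and Z: "module C Z"
    and \<phi>: "\<And>z. z \<in> carrier Z \<Longrightarrow> linear_on C T P (\<phi> z)"
    and pure: "\<And>l. l \<in> lists (carrier M) \<Longrightarrow> linear_on C Z P (\<lambda>z. \<phi> z (tpure l))"
    and t: "t \<in> carrier T"
  shows "linear_on C Z P (\<lambda>z. \<phi> z t)"
  using t
proof (induction rule: tensor_powers_induct)
  case zero
  show ?case
    by (rule linear_on_cong[OF linear_on_null[OF P] Z])
      (simp add: linear_on_zero[OF \<phi> module_tensor_powers P])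
next
  case (pure c l)
  show ?case
    by (rule linear_on_cong[OF linear_on_scale[OF P pure(1) assms(4)[OF pure(2)]] Z])
      (use pure in \<open>simp add: linear_on_smult[OF \<phi>]\<close>)
next
  case (add s t)
  show ?case
    by (rule linear_on_cong[OF linear_on_plus[OF P add(3,4)] Z])
      (use add in \<open>simp add: linear_on_add[OF \<phi>]\<close>)
qed

lemma multilinear_onI:
  assumes "\<And>l. l \<in> lists (carrier M) \<Longrightarrow> f l \<in> carrier N"
    and "\<And>us vs. \<lbrakk>us \<in> lists (carrier M); vs \<in> lists (carrier M)\<rbrakk> \<Longrightarrow>
      linear_on C M N (\<lambda>x. f (us @ [x] @ vs))"
  shows "multilinear_on C M N f"
  using assms unfolding multilinear_on_def by blast

lemma
  assumes "multilinear_on C M N f"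
  shows multilinear_on_closed: "l \<in> lists (carrier M) \<Longrightarrow> f l \<in> carrier N"
    and multilinear_on_linear: "\<lbrakk>us \<in> lists (carrier M); vs \<in> lists (carrier M)\<rbrakk> \<Longrightarrow>
      linear_on C M N (\<lambda>x. f (us @ [x] @ vs))"
  using assms unfolding multilinear_on_def by blast+

lemma insert_in_lists:
  "\<lbrakk>us \<in> lists (carrier M); vs \<in> lists (carrier M); x \<in> carrier M\<rbrakk> \<Longrightarrow>
    us @ [x] @ vs \<in> lists (carrier M)"
  by simp

lemma multilinear_on_cong:
  assumes f: "multilinear_on C M N f" and eq: "\<And>l. l \<in> lists (carrier M) \<Longrightarrow> f l = g l"
  shows "multilinear_on C M N g"
proof (rule multilinear_onI)
  fix us vs assume us: "us \<in> lists (carrier M)" "vs \<in> lists (carrier M)"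
  show "linear_on C M N (\<lambda>x. g (us @ [x] @ vs))"
    by (rule linear_on_cong[OF multilinear_on_linear[OF f us] M.module_axioms])
      (rule eq[OF insert_in_lists[OF us]])
qed (use eq multilinear_on_closed[OF f] in metis)

lemma param_multilinear_T:
  assumes P: "module C P"
    and \<phi>: "\<And>s. s \<in> lists (carrier M) \<Longrightarrow> linear_on C T P (\<phi> s)"
    and pure: "\<And>l. l \<in> lists (carrier M) \<Longrightarrow> multilinear_on C M P (\<lambda>s. \<phi> s (tpure l))"
    and t: "t \<in> carrier T"
  shows "multilinear_on C M P (\<lambda>s. \<phi> s t)"
proof (rule multilinear_onI)
  fix us vs assume us: "us \<in> lists (carrier M)" "vs \<in> lists (carrier M)"
  show "linear_on C M P (\<lambda>x. \<phi> (us @ [x] @ vs) t)"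
    by (rule param_linear_T[OF P M.module_axioms \<phi>[OF insert_in_lists[OF us]]
          multilinear_on_linear[OF pure us] t])
qed (use \<phi> t linear_on_closed in metis)

text \<open>The marked entry \<open>x\<close> falls to the right of the cut at \<open>i\<close> if
  \<open>i\<close> is at most the length of \<open>us\<close>, and to the left otherwise. In the
  second case the right part is still nonempty because \<open>i\<close> is smaller than the total
  length; this matters where the right part becomes an argument of \<open>eps2\<close>, which
  accepts only tensors of positive length.\<close>

lemma linear_take_drop:
  assumes us: "us \<in> lists (carrier M)" and vs: "vs \<in> lists (carrier M)"
    and i: "i < Suc (length us + length vs)"
    and 1: "\<And>us vs v. \<lbrakk>us \<in> lists (carrier M); vs \<in> lists (carrier M); v \<in> lists (carrier M); v \<noteq> []\<rbrakk>
      \<Longrightarrow> linear_on C M N (\<lambda>x. G (us @ [x] @ vs) v)"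
    and 2: "\<And>us vs u. \<lbrakk>us \<in> lists (carrier M); vs \<in> lists (carrier M); u \<in> lists (carrier M)\<rbrakk>
      \<Longrightarrow> linear_on C M N (\<lambda>x. G u (us @ [x] @ vs))"
  shows "linear_on C M N (\<lambda>x. G (take i (us @ [x] @ vs)) (drop i (us @ [x] @ vs)))"
proof (cases "i \<le> length us")
  case True
  have "take i us \<in> lists (carrier M)" "drop i us \<in> lists (carrier M)"
    using us by (auto dest: in_set_takeD in_set_dropD)
  from 2[OF this(2) vs this(1)] show ?thesis using True by simp
next
  case False
  \<comment> \<open>\<open>k\<close> is the number of entries of \<open>vs\<close> to the left of
    the cut.\<close>
  define k where "k = i - Suc (length us)"
  have e: "take i (us @ [x] @ vs) = us @ [x] @ take k vs" "drop i (us @ [x] @ vs) = drop k vs" for x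
    using False by (simp_all add: k_def Suc_diff_Suc[symmetric] take_Cons' drop_Cons')
  have "take k vs \<in> lists (carrier M)" "drop k vs \<in> lists (carrier M)"
    using vs by (auto dest: in_set_takeD in_set_dropD)
  moreover have "drop k vs \<noteq> []" using i False by (simp add: k_def)
  ultimately have "linear_on C M N (\<lambda>x. G (us @ [x] @ take k vs) (drop k vs))"
    using us by (intro 1)
  thus ?thesis unfolding e .
qed

text \<open>Extends the left list, then the right one; in between, the extended maps are still
  multilinear in the right list by \<open>param_multilinear_T\<close>.\<close>

lemma T_bilinear_ext:
  assumes N: "module C N"
    and 1: "\<And>s. s \<in> lists (carrier M) \<Longrightarrow> multilinear_on C M N (\<lambda>t. f t s)"
    and 2: "\<And>t. t \<in> lists (carrier M) \<Longrightarrow> multilinear_on C M N (\<lambda>s. f t s)"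
  obtains \<mu> where "bilinear_on C T T N \<mu>"
    and "\<And>t s. \<lbrakk>t \<in> lists (carrier M); s \<in> lists (carrier M)\<rbrakk> \<Longrightarrow> \<mu> (tpure t) (tpure s) = f t s"
proof -
  have "\<exists>\<phi>. linear_on C T N \<phi> \<and> (\<forall>t\<in>lists (carrier M). \<phi> (tpure t) = f t s)"
    if "s \<in> lists (carrier M)" for s
    using tensor_powers_ext[OF N 1[OF that]] by metis
  then obtain \<phi> where \<phi>: "\<And>s. s \<in> lists (carrier M) \<Longrightarrow> linear_on C T N (\<phi> s)"
    and \<phi>p: "\<And>s t. \<lbrakk>s \<in> lists (carrier M); t \<in> lists (carrier M)\<rbrakk> \<Longrightarrow> \<phi> s (tpure t) = f t s"
    by metis
  have ml: "multilinear_on C M N (\<lambda>s. \<phi> s (tpure l))" if l: "l \<in> lists (carrier M)" for l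
    by (rule multilinear_on_cong[OF 2[OF l]]) (rule \<phi>p[OF _ l, symmetric])
  have "multilinear_on C M N (\<lambda>s. \<phi> s t)" if "t \<in> carrier T" for t
    by (rule param_multilinear_T[OF N \<phi> ml that])
  from tensor_powers_ext_bilinear[OF N module_tensor_powers this \<phi>]
  obtain \<mu> where "bilinear_on C T T N \<mu>"
    "\<And>t s. \<lbrakk>t \<in> carrier T; s \<in> lists (carrier M)\<rbrakk> \<Longrightarrow> \<mu> t (tpure s) = \<phi> s t" by metis
  thus ?thesis using \<phi>p that by simp
qed

end

section \<open>Tensor products with the direct sum of tensor powers\<close>

locale tensor_with_powers = T: tensor_algebra C M + A: module C A
  for C :: "('c, 'z) ring_scheme" (structure) and M :: "('c, 'm, 'y) module_scheme"
    and A :: "('c, 'n, 'x) module_scheme"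
begin

sublocale AT: tensor_product C A "tensor_powers C M"
  by (intro tensor_product.intro A.module_axioms T.module_tensor_powers)

abbreviation "AT \<equiv> tensor C A (tensor_powers C M)"
abbreviation "atp c l \<equiv> pure_tensor C A (tensor_powers C M) c (pure_tensor_list C M l)"

lemma atp_closed [simp]:
  "\<lbrakk>c \<in> carrier A; l \<in> lists (carrier M)\<rbrakk> \<Longrightarrow> atp c l \<in> carrier AT"
  by (intro AT.pure_tensor_closed T.tpure_closed)

lemma atp_linear_left: "l \<in> lists (carrier M) \<Longrightarrow> linear_on C A AT (\<lambda>c. atp c l)"
  by (intro AT.pure_tensor_linear_left T.tpure_closed)

text \<open>Zero and scalar multiples are absorbed by the factor in \<open>A\<close>, which leaves
  pure tensors of a coefficient and a list.\<close>

lemma AT_induct [consumes 1, case_names pure add]: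
  assumes x: "t \<in> carrier AT"
    and pure: "\<And>c l. \<lbrakk>c \<in> carrier A; l \<in> lists (carrier M)\<rbrakk> \<Longrightarrow> p (atp c l)"
    and add: "\<And>s t. \<lbrakk>s \<in> carrier AT; t \<in> carrier AT; p s; p t\<rbrakk> \<Longrightarrow> p (s \<oplus>\<^bsub>AT\<^esub> t)"
  shows "p t"
  using x
proof (induction rule: AT.tensor_induct)
  case (pure a t)
  note l = AT.pure_tensor_linear_right[OF pure(1)]
  show ?case
    using pure(2)
  proof (induction rule: T.tensor_powers_induct)
    case zero
    have "atp \<zero>\<^bsub>A\<^esub> [] = \<zero>\<^bsub>AT\<^esub>"
      by (rule linear_on_zero[OF atp_linear_left A.module_axioms AT.module_tensor]) simp
    thus ?case
      using assms(2)[of "\<zero>\<^bsub>A\<^esub>" "[]"] linear_on_zero[OF l T.module_tensor_powers AT.module_tensor]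
      by simp
  next
    case (pure c w)
    have "pure_tensor C A (tensor_powers C M) a (c \<odot>\<^bsub>tensor_powers C M\<^esub> pure_tensor_list C M w)
        = atp (c \<odot>\<^bsub>A\<^esub> a) w"
      using pure \<open>a \<in> carrier A\<close>
      by (simp add: linear_on_smult[OF l] linear_on_smult[OF atp_linear_left])
    thus ?case using assms(2)[of "c \<odot>\<^bsub>A\<^esub> a" w] pure \<open>a \<in> carrier A\<close> by simp
  next
    case (add s t)
    thus ?case using assms(3) \<open>a \<in> carrier A\<close> by (simp add: linear_on_add[OF l])
  qed
next
  case (add s t)
  thus ?case by (rule assms(3))
qed

lemma linear_on_AT_eqI:
  assumes "linear_on C AT P f" "linear_on C AT P g"
    and "\<And>c l. \<lbrakk>c \<in> carrier A; l \<in> lists (carrier M)\<rbrakk> \<Longrightarrow> f (atp c l) = g (atp c l)"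
    and "t \<in> carrier AT"
  shows "f t = g t"
  using assms(4)
  by (induction rule: AT_induct)
    (simp_all add: assms(3) linear_on_add[OF assms(1)] linear_on_add[OF assms(2)])

lemma param_linear_AT:
  assumes P: "module C P" and Z: "module C Z"
    and \<phi>: "\<And>z. z \<in> carrier Z \<Longrightarrow> linear_on C AT P (\<phi> z)"
    and pure: "\<And>c l. \<lbrakk>c \<in> carrier A; l \<in> lists (carrier M)\<rbrakk> \<Longrightarrow> linear_on C Z P (\<lambda>z. \<phi> z (atp c l))"
    and t: "t \<in> carrier AT"
  shows "linear_on C Z P (\<lambda>z. \<phi> z t)"
  using t
proof (induction rule: AT_induct)
  case (pure x y)
  thus ?case by (rule assms(4))
next
  case (add s t)
  show ?case
    by (rule linear_on_cong[OF linear_on_plus[OF P add(3,4)] Z])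
      (use add in \<open>simp add: linear_on_add[OF \<phi>]\<close>)
qed

lemma AT_ext:
  assumes P: "module C P"
    and 1: "\<And>l. l \<in> lists (carrier M) \<Longrightarrow> linear_on C A P (\<lambda>c. f c l)"
    and 2: "\<And>c. c \<in> carrier A \<Longrightarrow> multilinear_on C M P (f c)"
  obtains \<phi> where "linear_on C AT P \<phi>"
    and "\<And>c l. \<lbrakk>c \<in> carrier A; l \<in> lists (carrier M)\<rbrakk> \<Longrightarrow> \<phi> (atp c l) = f c l"
proof -
  obtain \<nu> where \<nu>: "bilinear_on C A (tensor_powers C M) P \<nu>"
    and \<nu>p: "\<And>c l. \<lbrakk>c \<in> carrier A; l \<in> lists (carrier M)\<rbrakk> \<Longrightarrow> \<nu> c (pure_tensor_list C M l) = f c l"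
    using T.tensor_powers_ext_bilinear[OF P A.module_axioms 2 1] by metis
  obtain \<phi> where \<phi>: "linear_on C AT P \<phi>"
    and \<phi>p: "\<And>x y. \<lbrakk>x \<in> carrier A; y \<in> carrier (tensor_powers C M)\<rbrakk> \<Longrightarrow>
      \<phi> (pure_tensor C A (tensor_powers C M) x y) = \<nu> x y"
    using AT.tensor_ext[OF P \<nu>] by metis
  show ?thesis by (rule that[OF \<phi>]) (simp add: \<phi>p \<nu>p)
qed

text \<open>The left factor given by \<open>c\<close> and \<open>t\<close> is extended for fixed
  \<open>d\<close> and \<open>s\<close>; then \<open>s\<close> is extended to a tensor, and finally
  \<open>d\<close> together with this tensor to the right factor. Linearity in \<open>d\<close> and
  multilinearity in \<open>s\<close> of the intermediate maps hold at pure left factors by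
  assumption and pass to all left factors.\<close>

lemma AT_bilinear_ext:
  assumes P: "module C P"
    and c: "\<And>t d s. \<lbrakk>t \<in> lists (carrier M); d \<in> carrier A; s \<in> lists (carrier M)\<rbrakk> \<Longrightarrow>
      linear_on C A P (\<lambda>c. f c t d s)"
    and t: "\<And>c d s. \<lbrakk>c \<in> carrier A; d \<in> carrier A; s \<in> lists (carrier M)\<rbrakk> \<Longrightarrow>
      multilinear_on C M P (\<lambda>t. f c t d s)"
    and d: "\<And>c t s. \<lbrakk>c \<in> carrier A; t \<in> lists (carrier M); s \<in> lists (carrier M)\<rbrakk> \<Longrightarrow>
      linear_on C A P (\<lambda>d. f c t d s)"
    and s: "\<And>c t d. \<lbrakk>c \<in> carrier A; t \<in> lists (carrier M); d \<in> carrier A\<rbrakk> \<Longrightarrow>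
      multilinear_on C M P (\<lambda>s. f c t d s)"
  obtains \<mu> where "bilinear_on C AT AT P \<mu>"
    and "\<And>c t d s. \<lbrakk>c \<in> carrier A; t \<in> lists (carrier M); d \<in> carrier A; s \<in> lists (carrier M)\<rbrakk> \<Longrightarrow>
      \<mu> (atp c t) (atp d s) = f c t d s"
proof -
  note mA = A.module_axioms and mM = T.M.module_axioms
  have "\<exists>\<phi>. linear_on C AT P \<phi> \<and> (\<forall>c\<in>carrier A. \<forall>t\<in>lists (carrier M). \<phi> (atp c t) = f c t d s)"
    if "d \<in> carrier A" "s \<in> lists (carrier M)" for d s
    by (rule AT_ext[OF P c[OF _ that] t[OF _ that]]) blast+
  then obtain \<phi> where \<phi>: "\<And>d s. \<lbrakk>d \<in> carrier A; s \<in> lists (carrier M)\<rbrakk> \<Longrightarrow> linear_on C AT P (\<phi> d s)"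
    and \<phi>p: "\<And>c t d s. \<lbrakk>d \<in> carrier A; s \<in> lists (carrier M); c \<in> carrier A; t \<in> lists (carrier M)\<rbrakk> \<Longrightarrow>
      \<phi> d s (atp c t) = f c t d s"
    by metis
  have d': "linear_on C A P (\<lambda>d. \<phi> d s z)" if "s \<in> lists (carrier M)" "z \<in> carrier AT" for s z
  proof (rule param_linear_AT[OF P mA \<phi>[OF _ that(1)] _ that(2)])
    fix c l assume "c \<in> carrier A" "l \<in> lists (carrier M)"
    thus "linear_on C A P (\<lambda>d. \<phi> d s (atp c l))"
      using that by (intro linear_on_cong[OF d[of c l s] mA]) (auto simp: \<phi>p)
  qed
  have s': "linear_on C M P (\<lambda>x. \<phi> d (us @ [x] @ vs) z)"
    if "d \<in> carrier A" "us \<in> lists (carrier M)" "vs \<in> lists (carrier M)" "z \<in> carrier AT" for d us vs z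
  proof (rule param_linear_AT[OF P mM \<phi>[OF that(1) T.insert_in_lists[OF that(2,3)]] _ that(4)])
    fix c l assume cl: "c \<in> carrier A" "l \<in> lists (carrier M)"
    show "linear_on C M P (\<lambda>x. \<phi> d (us @ [x] @ vs) (atp c l))"
      by (rule linear_on_cong[OF T.multilinear_on_linear[OF s[OF cl that(1)] that(2,3)] mM])
        (use that cl T.insert_in_lists[OF that(2,3)] in \<open>simp only: \<phi>p\<close>)
  qed
  have s'': "multilinear_on C M P (\<lambda>s. \<phi> d s z)" if "d \<in> carrier A" "z \<in> carrier AT" for d z
    by (intro T.multilinear_onI s' linear_on_closed[OF \<phi>] that)
  have "\<exists>\<nu>. bilinear_on C A (tensor_powers C M) P \<nu> \<and>
      (\<forall>d\<in>carrier A. \<forall>l\<in>lists (carrier M). \<nu> d (pure_tensor_list C M l) = \<phi> d l z)"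
    if "z \<in> carrier AT" for z
    by (rule T.tensor_powers_ext_bilinear[OF P mA s''[OF _ that] d'[OF _ that]]) blast+
  then obtain \<nu> where \<nu>: "\<And>z. z \<in> carrier AT \<Longrightarrow> bilinear_on C A (tensor_powers C M) P (\<nu> z)"
    and \<nu>p: "\<And>z d l. \<lbrakk>z \<in> carrier AT; d \<in> carrier A; l \<in> lists (carrier M)\<rbrakk> \<Longrightarrow>
      \<nu> z d (pure_tensor_list C M l) = \<phi> d l z"
    by metis
  \<comment> \<open>Linearity in the left factor has to survive the extension in \<open>s\<close>;
    it is known for lists and passes to tensors.\<close>
  have lin: "linear_on C AT P (\<lambda>z. \<nu> z d y)" if "d \<in> carrier A" "y \<in> carrier (tensor_powers C M)" for d y
  proof (rule T.param_linear_T[OF P AT.module_tensor _ _ that(2)])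
    show "linear_on C (tensor_powers C M) P (\<nu> z d)" if "z \<in> carrier AT" for z
      using \<nu>[OF that] \<open>d \<in> carrier A\<close> by (auto simp: bilinear_on_def)
    show "linear_on C AT P (\<lambda>z. \<nu> z d (pure_tensor_list C M l))" if "l \<in> lists (carrier M)" for l
      by (rule linear_on_cong[OF \<phi>[OF \<open>d \<in> carrier A\<close> that] AT.module_tensor])
        (use that \<open>d \<in> carrier A\<close> in \<open>simp add: \<nu>p\<close>)
  qed
  obtain \<mu> where \<mu>: "bilinear_on C AT AT P \<mu>"
    and \<mu>p: "\<And>z x y. \<lbrakk>z \<in> carrier AT; x \<in> carrier A; y \<in> carrier (tensor_powers C M)\<rbrakk> \<Longrightarrow>
      \<mu> z (pure_tensor C A (tensor_powers C M) x y) = \<nu> z x y"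
    using AT.tensor_ext_bilinear[OF P AT.module_tensor \<nu> lin] by metis
  show ?thesis by (rule that[OF \<mu>]) (simp add: \<mu>p \<nu>p \<phi>p)
qed

end

lemmas (in algebra) A_m_closed = cring.cring_simprules(5)[OF M_cring]
lemmas (in algebra) A_one_closed = cring.cring_simprules(6)[OF M_cring]
lemmas (in algebra) A_m_comm = cring.cring_simprules(14)[OF M_cring]

lemma (in algebra) mult_bilinear: "bilinear_on R M M M (\<lambda>x y. x \<otimes>\<^bsub>M\<^esub> y)"
proof -
  have "x \<otimes>\<^bsub>M\<^esub> (c \<odot>\<^bsub>M\<^esub> y) = c \<odot>\<^bsub>M\<^esub> (x \<otimes>\<^bsub>M\<^esub> y)"
    if "c \<in> carrier R" "x \<in> carrier M" "y \<in> carrier M" for c x y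
    using smult_assoc2[of c y x] that by (simp add: A_m_comm A_m_closed)
  thus ?thesis
    by (auto simp: bilinear_on_def linear_on_def smult_assoc2 A_m_closed
        ring.ring_simprules(13,23)[OF cring.axioms(1)[OF M_cring]])
qed

lemma (in algebra) mult_linear:
  "y \<in> carrier M \<Longrightarrow> linear_on R M M (\<lambda>x. x \<otimes>\<^bsub>M\<^esub> y)"
  "y \<in> carrier M \<Longrightarrow> linear_on R M M (\<lambda>x. y \<otimes>\<^bsub>M\<^esub> x)"
  using mult_bilinear by (auto simp: bilinear_on_def)

section \<open>Quasi-integrations\<close>

text \<open>Covers the constants acting on subsets of \<open>R\<close> as well as \<open>R\<close>
  acting on itself and on \<open>S\<close>. The operations are compared only on the carrier of the
  scalars, because an extension is required to agree with the smaller ring only there.\<close>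

lemma module_ring_submodule:
  assumes C: "cring C" and R: "cring R" and CR: "carrier C \<subseteq> carrier R"
    and zero: "\<zero>\<^bsub>C\<^esub> = \<zero>\<^bsub>R\<^esub>" and one: "\<one>\<^bsub>C\<^esub> = \<one>\<^bsub>R\<^esub>"
    and add: "\<And>x y. \<lbrakk>x \<in> carrier C; y \<in> carrier C\<rbrakk> \<Longrightarrow> x \<oplus>\<^bsub>C\<^esub> y = x \<oplus>\<^bsub>R\<^esub> y"
    and mult: "\<And>x y. \<lbrakk>x \<in> carrier C; y \<in> carrier C\<rbrakk> \<Longrightarrow> x \<otimes>\<^bsub>C\<^esub> y = x \<otimes>\<^bsub>R\<^esub> y"
    and Y: "Y \<subseteq> carrier R" "\<zero>\<^bsub>R\<^esub> \<in> Y"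
      "\<And>x y. \<lbrakk>x \<in> Y; y \<in> Y\<rbrakk> \<Longrightarrow> x \<oplus>\<^bsub>R\<^esub> y \<in> Y"
      "\<And>c y. \<lbrakk>c \<in> carrier C; y \<in> Y\<rbrakk> \<Longrightarrow> c \<otimes>\<^bsub>R\<^esub> y \<in> Y"
  shows "module C (ring_submodule R Y)"
proof -
  interpret C: cring C by fact
  interpret R: cring R by fact
  have m: "c \<in> carrier R" if "c \<in> carrier C" for c using CR that by auto
  have y: "x \<in> carrier R" if "x \<in> Y" for x using Y that by auto
  \<comment> \<open>The negative of 1 formed in \<open>C\<close> is also a negative of 1 in
    \<open>R\<close>; it provides the additive inverses in \<open>Y\<close>.\<close>
  have n: "\<ominus>\<^bsub>C\<^esub> \<one>\<^bsub>C\<^esub> \<oplus>\<^bsub>R\<^esub> \<one>\<^bsub>R\<^esub> = \<zero>\<^bsub>R\<^esub>"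
    using add[of "\<ominus>\<^bsub>C\<^esub> \<one>\<^bsub>C\<^esub>" "\<one>\<^bsub>C\<^esub>"] zero one C.one_closed C.l_neg[of "\<one>\<^bsub>C\<^esub>"] by auto
  have inv: "(\<ominus>\<^bsub>C\<^esub> \<one>\<^bsub>C\<^esub>) \<otimes>\<^bsub>R\<^esub> x \<oplus>\<^bsub>R\<^esub> x = \<zero>\<^bsub>R\<^esub>" if "x \<in> Y" for x
  proof -
    have "(\<ominus>\<^bsub>C\<^esub> \<one>\<^bsub>C\<^esub> \<oplus>\<^bsub>R\<^esub> \<one>\<^bsub>R\<^esub>) \<otimes>\<^bsub>R\<^esub> x = (\<ominus>\<^bsub>C\<^esub> \<one>\<^bsub>C\<^esub>) \<otimes>\<^bsub>R\<^esub> x \<oplus>\<^bsub>R\<^esub> \<one>\<^bsub>R\<^esub> \<otimes>\<^bsub>R\<^esub> x"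
      using y[OF that] m by (intro R.l_distr) auto
    thus ?thesis using n y[OF that] by simp
  qed
  show ?thesis
  proof (rule moduleI[OF C])
    show "abelian_group (ring_submodule R Y)"
    proof (rule abelian_groupI)
      fix x assume "x \<in> carrier (ring_submodule R Y)"
      hence "x \<in> Y" by (simp add: ring_submodule_def)
      thus "\<exists>z\<in>carrier (ring_submodule R Y). z \<oplus>\<^bsub>ring_submodule R Y\<^esub> x = \<zero>\<^bsub>ring_submodule R Y\<^esub>"
        using inv Y(4)[of "\<ominus>\<^bsub>C\<^esub> \<one>\<^bsub>C\<^esub>" x] by (auto simp: ring_submodule_def)
    qed (auto simp: ring_submodule_def Y y R.a_ac)
  qed (auto simp: ring_submodule_def Y y m add mult one R.l_distr R.r_distr R.m_assoc)
qed

lemma ring_submodule_simps [simp]: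
  "carrier (ring_submodule R Y) = Y" "x \<oplus>\<^bsub>ring_submodule R Y\<^esub> y = x \<oplus>\<^bsub>R\<^esub> y"
  "\<zero>\<^bsub>ring_submodule R Y\<^esub> = \<zero>\<^bsub>R\<^esub>" "x \<odot>\<^bsub>ring_submodule R Y\<^esub> y = x \<otimes>\<^bsub>R\<^esub> y"
  "x \<otimes>\<^bsub>ring_submodule R Y\<^esub> y = x \<otimes>\<^bsub>R\<^esub> y" "\<one>\<^bsub>ring_submodule R Y\<^esub> = \<one>\<^bsub>R\<^esub>"
  by (simp_all add: ring_submodule_def)

context diff_ring begin

lemma der_zero [simp]: "der R \<zero> = \<zero>"
  using der_add[of \<zero> \<zero>] der_closed[of \<zero>] by (simp add: add.r_cancel_one')

lemma der_one [simp]: "der R \<one> = \<zero>"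
  using der_mult[of \<one> \<one>] der_closed[of \<one>] by simp

lemma der_a_inv: "x \<in> carrier R \<Longrightarrow> der R (\<ominus> x) = \<ominus> der R x"
  using der_add[of "\<ominus> x" x] der_closed by (intro minus_equality[symmetric]) (simp_all add: l_neg)

lemma constants_closed: "c \<in> constants R \<Longrightarrow> c \<in> carrier R"
  and constantsD: "c \<in> constants R \<Longrightarrow> der R c = \<zero>"
  by (simp_all add: constants_def)

lemma der_const_mult: "\<lbrakk>c \<in> constants R; x \<in> carrier R\<rbrakk> \<Longrightarrow> der R (c \<otimes> x) = c \<otimes> der R x"
  by (simp add: der_mult constants_def der_closed)

lemma cring_constants: "cring (const_ring R)"
proof (rule cringI)
  show "abelian_group (const_ring R)"
  proof (rule abelian_groupI)
    fix x assume "x \<in> carrier (const_ring R)"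
    hence "\<ominus> x \<in> carrier (const_ring R)" "\<ominus> x \<oplus>\<^bsub>const_ring R\<^esub> x = \<zero>\<^bsub>const_ring R\<^esub>"
      by (auto simp: constants_def der_a_inv l_neg)
    thus "\<exists>y\<in>carrier (const_ring R). y \<oplus>\<^bsub>const_ring R\<^esub> x = \<zero>\<^bsub>const_ring R\<^esub>" by blast
  qed (auto simp: constants_def der_add a_ac)
  show "Group.comm_monoid (const_ring R)"
    by (rule comm_monoidI) (auto simp: constants_def der_mult m_ac)
qed (auto simp: constants_def l_distr)

end

locale quasi_int = diff_ring R for R :: "'a diff_ring" (structure) +
  fixes Q :: "'a \<Rightarrow> 'a" assumes quasi: "quasi_integration R Q"
begin

lemma Q_closed [simp]: "x \<in> carrier R \<Longrightarrow> Q x \<in> carrier R"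
  and Q_add: "\<lbrakk>x \<in> carrier R; y \<in> carrier R\<rbrakk> \<Longrightarrow> Q (x \<oplus> y) = Q x \<oplus> Q y"
  and Q_const: "\<lbrakk>c \<in> constants R; x \<in> carrier R\<rbrakk> \<Longrightarrow> Q (c \<otimes> x) = c \<otimes> Q x"
  and der_Q_der: "x \<in> carrier R \<Longrightarrow> der R (Q (der R x)) = der R x"
  and Q_der_Q: "x \<in> carrier R \<Longrightarrow> Q (der R (Q x)) = Q x"
  using quasi by (auto simp: quasi_integration_def)

lemma Q_zero [simp]: "Q \<zero> = \<zero>"
  using Q_add[of \<zero> \<zero>] Q_closed[of \<zero>] by (simp add: add.r_cancel_one')

abbreviation "K \<equiv> const_ring R"
abbreviation "MT \<equiv> ring_submodule R (RT R Q)"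
abbreviation "MJ \<equiv> ring_submodule R (RJ R Q)"
abbreviation "MR \<equiv> ring_submodule R (carrier R)"

lemma cring_K: "cring K" by (rule cring_constants)

lemma RT_closed: "x \<in> RT R Q \<Longrightarrow> x \<in> carrier R"
  and RJ_closed: "x \<in> RJ R Q \<Longrightarrow> x \<in> carrier R"
  by (auto simp: RT_def RJ_def)

lemma module_submodule:
  assumes "Y \<subseteq> carrier R" "\<zero> \<in> Y" "\<And>x y. \<lbrakk>x \<in> Y; y \<in> Y\<rbrakk> \<Longrightarrow> x \<oplus> y \<in> Y"
    "\<And>c y. \<lbrakk>c \<in> constants R; y \<in> Y\<rbrakk> \<Longrightarrow> c \<otimes> y \<in> Y"
  shows "module K (ring_submodule R Y)"
  by (rule module_ring_submodule[OF cring_K is_cring])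
    (use assms constants_closed in auto)

lemma module_MT: "module K MT"
  by (rule module_submodule) (auto simp: RT_def Q_add Q_const constants_closed)

lemma module_MJ: "module K MJ"
proof (rule module_submodule)
  show "\<zero> \<in> RJ R Q" unfolding RJ_def by (rule image_eqI[of _ _ \<zero>]) auto
  fix x y assume "x \<in> RJ R Q" "y \<in> RJ R Q"
  thus "x \<oplus> y \<in> RJ R Q" unfolding RJ_def by (auto simp flip: Q_add)
next
  fix c x assume "c \<in> constants R" "x \<in> RJ R Q"
  thus "c \<otimes> x \<in> RJ R Q" unfolding RJ_def using constants_closed by (auto simp flip: Q_const)
qed (auto simp: RJ_closed)

lemma module_MR: "module K MR"
  by (rule module_submodule) (auto simp: constants_closed)

end

section \<open>Linear independence of nested integrals\<close>

locale nested_integrals = quasi_int R Q + S: integro_diff_ring S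
  for R :: "'a diff_ring" (structure) and Q :: "'a \<Rightarrow> 'a" and S :: "'a integro_diff_ring" +
  fixes I :: "'i set" and a :: "'i \<Rightarrow> 'a"
  assumes extension: "diff_ring_extension R S"
    and basis: "module_basis K MT I a"
begin

lemma R_sub_S: "x \<in> carrier R \<Longrightarrow> x \<in> carrier S"
  and zero_eq: "\<zero> = \<zero>\<^bsub>S\<^esub>" and one_eq: "\<one> = \<one>\<^bsub>S\<^esub>"
  and add_eq: "\<lbrakk>x \<in> carrier R; y \<in> carrier R\<rbrakk> \<Longrightarrow> x \<oplus> y = x \<oplus>\<^bsub>S\<^esub> y"
  and mult_eq: "\<lbrakk>x \<in> carrier R; y \<in> carrier R\<rbrakk> \<Longrightarrow> x \<otimes> y = x \<otimes>\<^bsub>S\<^esub> y"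
  and der_eq: "x \<in> carrier R \<Longrightarrow> der R x = der S x"
  using extension by (auto simp: diff_ring_extension_def)

abbreviation "SM \<equiv> ring_submodule S (carrier S)"
abbreviation "FR \<equiv> free_module R (lists I)"
abbreviation "nint \<equiv> nested_integral S a"

lemma module_SM: "module R SM"
  by (rule module_ring_submodule[OF is_cring S.is_cring])
    (auto simp: R_sub_S zero_eq one_eq add_eq mult_eq)

lemma module_MR_R: "module R MR"
  by (rule module_ring_submodule[OF is_cring is_cring]) auto

lemma module_FR: "module R FR" by (rule module_free_module[OF is_cring])

lemma a_RT: "i \<in> I \<Longrightarrow> a i \<in> RT R Q"
  using basis by (auto simp: module_basis_def)

lemma a_R: "i \<in> I \<Longrightarrow> a i \<in> carrier R"
  using a_RT RT_closed by blast

lemma nint_closed: "W \<in> lists I \<Longrightarrow> nint W \<in> carrier S"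
  by (induction W) (auto intro!: S.integ_closed simp: a_R R_sub_S)

text \<open>The combination of the nested integrals with coefficients \<open>p W\<close> in
  \<open>R\<close>, regarded as an \<open>R\<close>-linear map on finitely supported families. A
  relation among nested integrals is an element of its kernel.\<close>

definition \<theta>S where "\<theta>S = lin_ext R SM nint"

lemma \<theta>S_linear: "linear_on R FR SM \<theta>S"
  unfolding \<theta>S_def by (rule linear_on_lin_ext[OF module_SM]) (auto intro: nint_closed)

lemma \<theta>S_single: "W \<in> lists I \<Longrightarrow> \<theta>S (single R W) = nint W"
  unfolding \<theta>S_def by (rule lin_ext_single[OF module_SM]) (auto intro: nint_closed)

lemma \<theta>S_term:
  "\<lbrakk>r \<in> carrier R; W \<in> lists I\<rbrakk> \<Longrightarrow> \<theta>S (r \<odot>\<^bsub>FR\<^esub> single R W) = r \<otimes>\<^bsub>S\<^esub> nint W"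
  using linear_on_smult[OF \<theta>S_linear] single_closed[OF is_cring, of W "lists I"] \<theta>S_single
  by simp

lemma FR_coeff: "p \<in> carrier FR \<Longrightarrow> p W \<in> carrier R"
  by (rule free_module_coeff[OF is_cring])

lemma FR_finite: "p \<in> carrier FR \<Longrightarrow> finite {W. p W \<noteq> \<zero>}"
  and FR_outside: "\<lbrakk>p \<in> carrier FR; W \<notin> lists I\<rbrakk> \<Longrightarrow> p W = \<zero>"
  by (simp_all add: free_module_simps)

text \<open>The coefficients are arbitrary elements of \<open>R\<close>, not only constants:
  differentiating a nested integral strips its first letter \<open>i\<close> and leaves the factor
  \<open>a i\<close>, so \<open>L\<close> collects what the words with a common tail
  contribute.\<close>

definition L where "L = lin_ext R MR a"

lemma L_linear: "linear_on R (free_module R I) MR L"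
  unfolding L_def by (rule linear_on_lin_ext[OF module_MR_R]) (auto intro: a_R)

lemma L_zero: "L (\<lambda>i. \<zero>) = \<zero>"
  using linear_on_zero[OF L_linear module_free_module[OF is_cring] module_MR_R]
  by (simp add: free_module_simps)

lemma slice_closed:
  assumes "p \<in> carrier FR"
  shows "(\<lambda>i. p (i # W)) \<in> carrier (free_module R I)"
proof -
  have "{i. p (i # W) \<noteq> \<zero>} \<subseteq> hd ` {W. p W \<noteq> \<zero>}" by force
  hence "finite {i. p (i # W) \<noteq> \<zero>}" using FR_finite[OF assms] finite_subset by blast
  thus ?thesis using assms FR_coeff[OF assms] FR_outside[OF assms] by (simp add: free_module_simps)
qed

lemma slice_L_closed: "p \<in> carrier FR \<Longrightarrow> L (\<lambda>i. p (i # W)) \<in> carrier R"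
  using linear_on_closed[OF L_linear slice_closed] by simp

text \<open>The coefficients of the derivative of \<open>\<Sum>\<^sub>W p\<^sub>W \<sigma>(W)\<close>.\<close>

definition \<Delta> where "\<Delta> p = (\<lambda>W. der R (p W) \<oplus> L (\<lambda>i. p (i # W)))"

lemma \<Delta>_closed:
  assumes p: "p \<in> carrier FR"
  shows "\<Delta> p \<in> carrier FR"
proof -
  have z: "\<Delta> p W = \<zero>" if "p W = \<zero>" "\<And>i. p (i # W) = \<zero>" for W
    using that by (simp add: \<Delta>_def L_zero)
  \<comment> \<open>A word at which \<open>\<Delta> p\<close> is nonzero carries a coefficient of
    \<open>p\<close> or is the tail of a word that does, so the support stays finite.\<close>
  have "{W. \<Delta> p W \<noteq> \<zero>} \<subseteq> {W. p W \<noteq> \<zero>} \<union> tl ` {W. p W \<noteq> \<zero>}"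
  proof
    fix W assume "W \<in> {W. \<Delta> p W \<noteq> \<zero>}"
    hence "p W \<noteq> \<zero> \<or> (\<exists>i. p (i # W) \<noteq> \<zero>)" using z by blast
    thus "W \<in> {W. p W \<noteq> \<zero>} \<union> tl ` {W. p W \<noteq> \<zero>}" by force
  qed
  hence "finite {W. \<Delta> p W \<noteq> \<zero>}" using FR_finite[OF p] by (meson finite_UnI finite_imageI finite_subset)
  moreover have "\<Delta> p W = \<zero>" if "W \<notin> lists I" for W
    using that by (intro z FR_outside[OF p]) auto
  moreover have "\<Delta> p W \<in> carrier R" for W
    using FR_coeff[OF p] slice_L_closed[OF p] by (simp add: \<Delta>_def der_closed)
  ultimately show ?thesis by (simp add: free_module_simps)
qed

lemma \<Delta>_add:
  assumes p: "p \<in> carrier FR" and q: "q \<in> carrier FR"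
  shows "\<Delta> (p \<oplus>\<^bsub>FR\<^esub> q) = \<Delta> p \<oplus>\<^bsub>FR\<^esub> \<Delta> q"
proof
  fix W
  have "L (\<lambda>i. p (i # W) \<oplus> q (i # W)) = L (\<lambda>i. p (i # W)) \<oplus> L (\<lambda>i. q (i # W))"
    using linear_on_add[OF L_linear slice_closed[OF p, of W] slice_closed[OF q, of W]]
    by (simp add: free_module_simps)
  thus "\<Delta> (p \<oplus>\<^bsub>FR\<^esub> q) W = (\<Delta> p \<oplus>\<^bsub>FR\<^esub> \<Delta> q) W"
    using FR_coeff[OF p] FR_coeff[OF q] slice_L_closed[OF p] slice_L_closed[OF q]
    by (simp add: \<Delta>_def free_module_simps(3) der_add der_closed a_ac)
qed

lemma \<Delta>_single_Nil:
  assumes "r \<in> carrier R"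
  shows "\<Delta> (r \<odot>\<^bsub>FR\<^esub> single R []) = der R r \<odot>\<^bsub>FR\<^esub> single R []"
  using assms by (auto simp: \<Delta>_def free_module_simps(4) single_def L_zero der_closed)

lemma \<Delta>_single_Cons:
  assumes r: "r \<in> carrier R" and i: "i \<in> I"
  shows "\<Delta> (r \<odot>\<^bsub>FR\<^esub> single R (i # V)) =
    der R r \<odot>\<^bsub>FR\<^esub> single R (i # V) \<oplus>\<^bsub>FR\<^esub> (r \<otimes> a i) \<odot>\<^bsub>FR\<^esub> single R V"
proof
  fix U
  let ?FI = "free_module R I"
  have "L (\<lambda>k. (r \<odot>\<^bsub>FR\<^esub> single R (i # V)) (k # U)) = ((r \<otimes> a i) \<odot>\<^bsub>FR\<^esub> single R V) U"
  proof (cases "U = V")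
    case True
    have "(\<lambda>k. (r \<odot>\<^bsub>FR\<^esub> single R (i # V)) (k # U)) = r \<odot>\<^bsub>?FI\<^esub> single R i"
      using True by (auto simp: free_module_simps(4) single_def)
    moreover have "L (r \<odot>\<^bsub>?FI\<^esub> single R i) = r \<otimes> a i"
      using linear_on_smult[OF L_linear r single_closed[OF is_cring i]]
        lin_ext_single[OF module_MR_R _ i, of a] a_R by (simp add: L_def)
    ultimately show ?thesis using True r a_R[OF i] by (simp add: free_module_simps(4) single_def)
  next
    case False
    thus ?thesis using r a_R[OF i] by (simp add: free_module_simps(4) single_def L_zero)
  qed
  moreover have "der R ((r \<odot>\<^bsub>FR\<^esub> single R (i # V)) U) = (der R r \<odot>\<^bsub>FR\<^esub> single R (i # V)) U"
    using r by (simp add: free_module_simps(4) single_def der_closed)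
  ultimately show "\<Delta> (r \<odot>\<^bsub>FR\<^esub> single R (i # V)) U =
      (der R r \<odot>\<^bsub>FR\<^esub> single R (i # V) \<oplus>\<^bsub>FR\<^esub> (r \<otimes> a i) \<odot>\<^bsub>FR\<^esub> single R V) U"
    by (simp add: \<Delta>_def free_module_simps(3))
qed

text \<open>By additivity a single term suffices, where the Leibniz rule is combined with the fact
  that the derivation undoes the outermost integral.\<close>

lemma \<theta>S_\<Delta>:
  assumes "p \<in> carrier FR"
  shows "\<theta>S (\<Delta> p) = der S (\<theta>S p)"
  using is_cring assms
proof (induction rule: free_module_induct)
  case zero
  interpret F: module R FR by (rule module_FR)
  \<comment> \<open>Zero is written as a term at the empty word, for which \<open>\<Delta>\<close>
    is known.\<close>
  have z: "\<zero>\<^bsub>FR\<^esub> = \<zero> \<odot>\<^bsub>FR\<^esub> single R []"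
    using F.smult_l_null[OF single_closed[OF is_cring, of "[]" "lists I"]] by simp
  have "\<Delta> \<zero>\<^bsub>FR\<^esub> = \<zero>\<^bsub>FR\<^esub>" unfolding z by (subst \<Delta>_single_Nil) simp_all
  thus ?case using linear_on_zero[OF \<theta>S_linear module_FR module_SM] by simp
next
  case (single r W)
  have rS: "r \<in> carrier S" "der S r \<in> carrier S" "der S r = der R r"
    using single R_sub_S der_closed der_eq by auto
  show ?case
  proof (cases W)
    case Nil
    have "\<theta>S (der R r \<odot>\<^bsub>FR\<^esub> single R []) = der R r \<otimes>\<^bsub>S\<^esub> \<one>\<^bsub>S\<^esub>"
      using single by (simp add: \<theta>S_term der_closed)
    moreover have "\<theta>S (r \<odot>\<^bsub>FR\<^esub> single R []) = r \<otimes>\<^bsub>S\<^esub> \<one>\<^bsub>S\<^esub>"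
      using single by (simp add: \<theta>S_term)
    ultimately show ?thesis using single rS by (simp add: Nil \<Delta>_single_Nil)
  next
    case (Cons i V)
    have iV: "i \<in> I" "V \<in> lists I" "i # V \<in> lists I" using single Cons by auto
    have s: "nint V \<in> carrier S" "a i \<in> carrier S" using iV nint_closed a_R R_sub_S by auto
    have "\<theta>S (\<Delta> (r \<odot>\<^bsub>FR\<^esub> single R (i # V))) =
        \<theta>S (der R r \<odot>\<^bsub>FR\<^esub> single R (i # V)) \<oplus>\<^bsub>S\<^esub> \<theta>S ((r \<otimes> a i) \<odot>\<^bsub>FR\<^esub> single R V)"
      using single iV a_R \<Delta>_single_Cons single_closed[OF is_cring, of _ "lists I"]
        module.smult_closed[OF module_FR] linear_on_add[OF \<theta>S_linear]
      by (simp add: der_closed del: in_lists_conv_set)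
    also have "\<dots> = der R r \<otimes>\<^bsub>S\<^esub> nint (i # V) \<oplus>\<^bsub>S\<^esub> (r \<otimes> a i) \<otimes>\<^bsub>S\<^esub> nint V"
      using single iV a_R by (simp add: \<theta>S_term der_closed del: nested_integral.simps)
    also have "\<dots> = der S (r \<otimes>\<^bsub>S\<^esub> nint (i # V))"
      using single iV a_R rS s
      by (simp add: S.der_mult S.integ_closed S.der_integ mult_eq S.m_assoc)
    also have "r \<otimes>\<^bsub>S\<^esub> nint (i # V) = \<theta>S (r \<odot>\<^bsub>FR\<^esub> single R (i # V))"
      using single iV by (simp add: \<theta>S_term del: nested_integral.simps)
    finally show ?thesis using Cons by simp
  qed
next
  case (add p q)
  have "\<theta>S (\<Delta> (p \<oplus>\<^bsub>FR\<^esub> q)) = \<theta>S (\<Delta> p) \<oplus>\<^bsub>S\<^esub> \<theta>S (\<Delta> q)"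
    using add linear_on_add[OF \<theta>S_linear \<Delta>_closed \<Delta>_closed] by (simp add: \<Delta>_add)
  moreover have "\<theta>S (p \<oplus>\<^bsub>FR\<^esub> q) = \<theta>S p \<oplus>\<^bsub>S\<^esub> \<theta>S q"
    using add linear_on_add[OF \<theta>S_linear] by simp
  moreover have "\<theta>S p \<in> carrier S" "\<theta>S q \<in> carrier S"
    using add linear_on_closed[OF \<theta>S_linear] by auto
  ultimately show ?case using add by (simp add: S.der_add)
qed

text \<open>The two sums are taken in different structures; the inclusion of the submodule is linear
  and thus carries one to the other.\<close>

lemma finsum_RT:
  assumes "finite B" "f \<in> B \<rightarrow> RT R Q"
  shows "(\<Oplus>\<^bsub>MT\<^esub>i\<in>B. f i) = (\<Oplus>\<^bsub>MR\<^esub>i\<in>B. f i)"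
proof -
  have "linear_on K MT MR (\<lambda>x. x)" by (rule linear_onI) (auto simp: RT_closed)
  from linear_on_finsum_apply[OF module_MT module_MR this assms(1), of f] assms(2)
  show ?thesis by auto
qed

text \<open>A derivative that lies in the kernel of the quasi-integration vanishes, so the basis elements
  are linearly independent over the constants even modulo derivatives.\<close>

lemma L_eq_der_imp_zero:
  assumes c: "c \<in> carrier (free_module R I)" and const: "\<And>i. c i \<in> constants R"
    and y: "y \<in> carrier R" and eq: "L c = der R y"
  shows "c i = \<zero>"
proof (rule ccontr)
  assume i: "c i \<noteq> \<zero>"
  let ?B = "{i. c i \<noteq> \<zero>}"
  have B: "finite ?B" "?B \<subseteq> I" using c by (auto simp: free_module_simps)
  interpret MT: module K MT by (rule module_MT)
  have t: "(\<lambda>i. c i \<otimes> a i) \<in> ?B \<rightarrow> RT R Q"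
    using B(2) const a_RT MT.smult_closed by fastforce
  have L: "L c = (\<Oplus>\<^bsub>MT\<^esub>i\<in>?B. c i \<otimes> a i)"
    unfolding finsum_RT[OF B(1) t] by (simp add: L_def lin_ext_def)
  have "L c \<in> RT R Q"
    unfolding L using MT.finsum_closed[of "\<lambda>i. c i \<otimes> a i" ?B] t by simp
  hence "Q (der R y) = \<zero>" using eq by (simp add: RT_def)
  \<comment> \<open>Applying \<open>Q\<close> and then the derivation reproduces a derivative, so a
    derivative annihilated by \<open>Q\<close> is the derivative of 0.\<close>
  hence "der R y = \<zero>" using der_Q_der[OF y] by simp
  hence "(\<Oplus>\<^bsub>MT\<^esub>i\<in>?B. c i \<odot>\<^bsub>MT\<^esub> a i) = \<zero>\<^bsub>MT\<^esub>" using L eq by simp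
  moreover have "c \<in> ?B \<rightarrow> carrier K" using const by auto
  ultimately have "\<forall>i\<in>?B. c i = \<zero>\<^bsub>K\<^esub>"
    using basis B unfolding module_basis_def by blast
  thus False using i by simp
qed

end

locale nested_integrals_indep = nested_integrals +
  assumes const_in_diff_ideal: "\<And>x. \<lbrakk>x \<in> carrier R; x \<noteq> \<zero>\<rbrakk> \<Longrightarrow>
    \<exists>c\<in>gen_diff_ideal R {x}. c \<in> constants R \<and> c \<noteq> \<zero>"
begin

text \<open>The bound on the word length is strict, so that level 0 contains only the trivial
  relation and starts the induction, while at level \<open>Suc n\<close> the longest words possible
  have length \<open>n\<close>.\<close>

definition relations_below where
  "relations_below n = {p \<in> carrier FR. (\<forall>W. p W \<noteq> \<zero> \<longrightarrow> length W < n) \<and> \<theta>S p = \<zero>\<^bsub>S\<^esub>}"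

definition top_words where "top_words n p = {W. p W \<noteq> \<zero> \<and> length W = n}"

lemma relations_below_FR: "p \<in> relations_below n \<Longrightarrow> p \<in> carrier FR"
  by (simp add: relations_below_def)

lemma relations_below_outside: "\<lbrakk>p \<in> relations_below n; \<not> length W < n\<rbrakk> \<Longrightarrow> p W = \<zero>"
  by (auto simp: relations_below_def)

lemma relations_below_\<theta>: "p \<in> relations_below n \<Longrightarrow> \<theta>S p = \<zero>\<^bsub>S\<^esub>"
  by (simp add: relations_below_def)

lemma finite_top_words: "p \<in> carrier FR \<Longrightarrow> finite (top_words n p)"
  by (rule finite_subset[OF _ FR_finite]) (auto simp: top_words_def)

lemma relations_belowI:
  assumes "p \<in> carrier FR" "\<And>W. \<not> length W < n \<Longrightarrow> p W = \<zero>" "\<theta>S p = \<zero>\<^bsub>S\<^esub>"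
  shows "p \<in> relations_below n"
  using assms unfolding relations_below_def by blast

lemma relations_below_add:
  assumes p: "p \<in> relations_below n" and q: "q \<in> relations_below n"
  shows "p \<oplus>\<^bsub>FR\<^esub> q \<in> relations_below n"
proof (rule relations_belowI)
  interpret F: module R FR by (rule module_FR)
  note pq = p[THEN relations_below_FR] q[THEN relations_below_FR]
  show "p \<oplus>\<^bsub>FR\<^esub> q \<in> carrier FR" using pq by (rule F.a_closed)
  show "\<theta>S (p \<oplus>\<^bsub>FR\<^esub> q) = \<zero>\<^bsub>S\<^esub>"
    using linear_on_add[OF \<theta>S_linear pq] relations_below_\<theta>[OF p] relations_below_\<theta>[OF q] by simp
  show "(p \<oplus>\<^bsub>FR\<^esub> q) W = \<zero>" if "\<not> length W < n" for W
    using relations_below_outside[OF p that] relations_below_outside[OF q that]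
    by (simp add: free_module_simps(3))
qed

lemma relations_below_smult:
  assumes p: "p \<in> relations_below n" and r: "r \<in> carrier R"
  shows "r \<odot>\<^bsub>FR\<^esub> p \<in> relations_below n"
proof (rule relations_belowI)
  interpret F: module R FR by (rule module_FR)
  note p' = p[THEN relations_below_FR]
  show "r \<odot>\<^bsub>FR\<^esub> p \<in> carrier FR" using r p' by (rule F.smult_closed)
  show "\<theta>S (r \<odot>\<^bsub>FR\<^esub> p) = \<zero>\<^bsub>S\<^esub>"
    using linear_on_smult[OF \<theta>S_linear r p'] relations_below_\<theta>[OF p] R_sub_S[OF r] by simp
  show "(r \<odot>\<^bsub>FR\<^esub> p) W = \<zero>" if "\<not> length W < n" for W
    using relations_below_outside[OF p that] r by (simp add: free_module_simps(4))
qed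

text \<open>Words with one more letter lie beyond the length bound, so nothing but the derivative of
  the coefficient remains. Hence the derivative of a relation has no new top words, and constant top
  coefficients disappear.\<close>

lemma \<Delta>_outside:
  assumes "p \<in> relations_below (Suc n)" "\<not> length W < n"
  shows "\<Delta> p W = der R (p W)"
proof -
  have "(\<lambda>i. p (i # W)) = (\<lambda>i. \<zero>)"
    using assms(2) by (intro ext relations_below_outside[OF assms(1)]) simp
  thus ?thesis
    using FR_coeff[OF relations_below_FR[OF assms(1)], of W] by (simp add: \<Delta>_def L_zero der_closed)
qed

lemma relations_below_\<Delta>:
  assumes "p \<in> relations_below (Suc n)"
  shows "\<Delta> p \<in> relations_below (Suc n)"
proof -
  note p = relations_below_FR[OF assms]
  have "\<Delta> p W = \<zero>" if "\<not> length W < Suc n" for W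
    using that \<Delta>_outside[OF assms, of W] relations_below_outside[OF assms that] by simp
  moreover have "\<theta>S (\<Delta> p) = \<zero>\<^bsub>S\<^esub>"
    using \<theta>S_\<Delta>[OF p] relations_below_\<theta>[OF assms] by simp
  ultimately show ?thesis using \<Delta>_closed[OF p] unfolding relations_below_def by blast
qed

lemma top_words_\<Delta>:
  assumes "p \<in> relations_below (Suc n)"
  shows "top_words n (\<Delta> p) \<subseteq> top_words n p"
  using \<Delta>_outside[OF assms] by (auto simp: top_words_def)

text \<open>Among the relations with a nonzero coefficient at a word of length \<open>n\<close> take one with as few such
  coefficients as possible. The coefficients at one of these words of all relations with no
  further top words form a differential ideal, so one of these relations has a nonzero constant there.
  Its derivative has fewer top words, hence none, hence vanishes by induction.\<close>

lemma relations_below_trivial: "p \<in> relations_below n \<Longrightarrow> p = \<zero>\<^bsub>FR\<^esub>"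
proof (induction n arbitrary: p)
  case 0
  thus ?case by (auto simp: relations_below_def free_module_simps(2))
next
  case (Suc n)
  interpret F: module R FR by (rule module_FR)
  have "top_words n p = {}"
  proof (rule ccontr)
    assume "top_words n p \<noteq> {}"
    then obtain p where p: "p \<in> relations_below (Suc n)" "top_words n p \<noteq> {}"
      and least: "\<And>q. \<lbrakk>q \<in> relations_below (Suc n); top_words n q \<noteq> {}\<rbrakk> \<Longrightarrow>
        card (top_words n p) \<le> card (top_words n q)"
      using Suc.prems ex_has_least_nat[of "\<lambda>p. p \<in> relations_below (Suc n) \<and> top_words n p \<noteq> {}"
          p "\<lambda>p. card (top_words n p)"] by blast
    obtain W where W: "W \<in> top_words n p" using p(2) by blast
    define \<aa> where "\<aa> = {s W | s. s \<in> relations_below (Suc n) \<and> top_words n s \<subseteq> top_words n p}"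
    have \<aa>I: "s W \<in> \<aa>" if "s \<in> relations_below (Suc n)" "top_words n s \<subseteq> top_words n p" for s
      using that unfolding \<aa>_def by blast
    have \<aa>R: "\<aa> \<subseteq> carrier R" unfolding \<aa>_def using FR_coeff relations_below_FR by blast
    have \<aa>add: "x \<oplus> y \<in> \<aa>" if "x \<in> \<aa>" "y \<in> \<aa>" for x y
    proof -
      obtain s where s: "s \<in> relations_below (Suc n)" "top_words n s \<subseteq> top_words n p" "x = s W"
        using \<open>x \<in> \<aa>\<close> unfolding \<aa>_def by blast
      obtain t where t: "t \<in> relations_below (Suc n)" "top_words n t \<subseteq> top_words n p" "y = t W"
        using \<open>y \<in> \<aa>\<close> unfolding \<aa>_def by blast
      note st = s t
      have "top_words n (s \<oplus>\<^bsub>FR\<^esub> t) \<subseteq> top_words n s \<union> top_words n t"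
        by (auto simp: top_words_def free_module_simps(3))
      hence "(s \<oplus>\<^bsub>FR\<^esub> t) W \<in> \<aa>" using st by (intro \<aa>I relations_below_add) auto
      thus ?thesis using st by (simp add: free_module_simps(3))
    qed
    have \<aa>mult: "r \<otimes> x \<in> \<aa>" if "x \<in> \<aa>" "r \<in> carrier R" for x r
    proof -
      obtain s where s: "s \<in> relations_below (Suc n)" "top_words n s \<subseteq> top_words n p" "x = s W"
        using \<open>x \<in> \<aa>\<close> unfolding \<aa>_def by blast
      have "top_words n (r \<odot>\<^bsub>FR\<^esub> s) \<subseteq> top_words n s"
        using that by (auto simp: top_words_def free_module_simps(4))
      hence "(r \<odot>\<^bsub>FR\<^esub> s) W \<in> \<aa>" using s that by (intro \<aa>I relations_below_smult) auto
      thus ?thesis using s by (simp add: free_module_simps(4))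
    qed
    have pW: "p W \<in> \<aa>" by (rule \<aa>I) (use p in auto)
    have "ideal \<aa> R"
    proof (rule idealI[OF ring_axioms])
      show "subgroup \<aa> (add_monoid R)"
      proof (rule subgroup.intro)
        fix x assume x: "x \<in> \<aa>"
        have "(\<ominus> \<one>) \<otimes> x \<in> \<aa>" using x by (intro \<aa>mult) auto
        moreover have "(\<ominus> \<one>) \<otimes> x = \<ominus> x" using x \<aa>R by (auto simp: l_minus)
        ultimately show "inv\<^bsub>add_monoid R\<^esub> x \<in> \<aa>" by (simp add: a_inv_def)
      next
        have "\<zero> \<otimes> p W \<in> \<aa>" by (intro \<aa>mult pW) auto
        thus "\<one>\<^bsub>add_monoid R\<^esub> \<in> \<aa>" using pW \<aa>R by auto
      qed (use \<aa>R \<aa>add in auto)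
    next
      fix x r assume "x \<in> \<aa>" "r \<in> carrier R"
      thus "r \<otimes> x \<in> \<aa>" "x \<otimes> r \<in> \<aa>" using \<aa>mult \<aa>R m_comm[of x r] by auto
    qed
    moreover have "der R x \<in> \<aa>" if "x \<in> \<aa>" for x
    proof -
      obtain s where s: "s \<in> relations_below (Suc n)" "top_words n s \<subseteq> top_words n p" "x = s W"
        using \<open>x \<in> \<aa>\<close> unfolding \<aa>_def by blast
      have "\<Delta> s W \<in> \<aa>"
        using s top_words_\<Delta>[OF s(1)] by (intro \<aa>I relations_below_\<Delta>) auto
      thus ?thesis using \<Delta>_outside[OF s(1), of W] W s(3) by (simp add: top_words_def)
    qed
    ultimately have "diff_ideal \<aa> R" by (simp add: diff_ideal_def)
    hence sub: "gen_diff_ideal R {p W} \<subseteq> \<aa>"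
      using pW by (auto simp: gen_diff_ideal_def)
    have "p W \<in> carrier R" "p W \<noteq> \<zero>" using W pW \<aa>R by (auto simp: top_words_def)
    then obtain s where s: "s \<in> relations_below (Suc n)" "top_words n s \<subseteq> top_words n p"
      and c: "s W \<in> constants R" "s W \<noteq> \<zero>"
      using const_in_diff_ideal[of "p W"] sub unfolding \<aa>_def by blast
    have Wn: "length W = n" using W by (simp add: top_words_def)
    have "W \<notin> top_words n (\<Delta> s)"
      using \<Delta>_outside[OF s(1), of W] Wn constantsD[OF c(1)] by (simp add: top_words_def)
    hence "top_words n (\<Delta> s) \<subset> top_words n p"
      using top_words_\<Delta>[OF s(1)] s(2) W by blast
    hence "card (top_words n (\<Delta> s)) < card (top_words n p)"
      by (rule psubset_card_mono[OF finite_top_words[OF relations_below_FR[OF p(1)]]])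
    hence empty: "top_words n (\<Delta> s) = {}"
      using least[OF relations_below_\<Delta>[OF s(1)]] by linarith
    hence "\<Delta> s \<in> relations_below n"
      using relations_below_\<Delta>[OF s(1)] unfolding relations_below_def top_words_def
      by (auto simp: less_Suc_eq)
    hence \<Delta>s: "\<Delta> s = \<zero>\<^bsub>FR\<^esub>" by (rule Suc.IH)
    show False
    proof (cases W)
      case Nil
      \<comment> \<open>Here \<open>n\<close> is 0, so the relation says that a nonzero constant
        vanishes in \<open>S\<close>.\<close>
      have "s = s W \<odot>\<^bsub>FR\<^esub> single R []"
      proof
        fix V
        show "s V = (s W \<odot>\<^bsub>FR\<^esub> single R []) V"
          using Nil Wn relations_below_outside[OF s(1), of V] FR_coeff[OF relations_below_FR[OF s(1)]]
          by (auto simp: free_module_simps(4) single_def)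
      qed
      hence "\<theta>S s = s W \<otimes>\<^bsub>S\<^esub> \<one>\<^bsub>S\<^esub>"
        using \<theta>S_term[OF constants_closed[OF c(1)], of "[]"] by simp
      thus False
        using c relations_below_\<theta>[OF s(1)] R_sub_S[OF constants_closed[OF c(1)]] zero_eq by simp
    next
      case (Cons i V)
      \<comment> \<open>The words \<open>k # V\<close> all have the maximal length \<open>n\<close>,
        so the vanishing of \<open>\<Delta> s\<close> makes every coefficient at them constant, not
        only the one at \<open>W\<close>.\<close>
      have const: "s (k # V) \<in> constants R" for k
        using \<Delta>_outside[OF s(1), of "k # V"] \<Delta>s Wn Cons FR_coeff[OF relations_below_FR[OF s(1)]]
        by (simp add: constants_def free_module_simps(2))
      have sV: "s V \<in> carrier R" using FR_coeff[OF relations_below_FR[OF s(1)]] .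
      \<comment> \<open>The coefficient at the common tail \<open>V\<close> then presents a
        combination of the basis with constant coefficients as a derivative.\<close>
      have "der R (s V) \<oplus> L (\<lambda>k. s (k # V)) = \<zero>"
        using \<Delta>s by (simp add: \<Delta>_def free_module_simps(2) fun_eq_iff)
      hence "L (\<lambda>k. s (k # V)) = der R (\<ominus> s V)"
        using sV slice_L_closed[OF relations_below_FR[OF s(1)], of V]
        by (simp add: der_a_inv der_closed) (metis a_comm der_closed minus_equality)
      from L_eq_der_imp_zero[OF slice_closed[OF relations_below_FR[OF s(1)]] const _ this, of i]
      show False using sV c(2) Cons by simp
    qed
  qed
  hence "p \<in> relations_below n"
    using Suc.prems unfolding relations_below_def top_words_def by (auto simp: less_Suc_eq)
  thus ?case by (rule Suc.IH)
qed

lemma \<theta>S_injective: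
  assumes "p \<in> carrier FR" "\<theta>S p = \<zero>\<^bsub>S\<^esub>"
  shows "p = \<zero>\<^bsub>FR\<^esub>"
proof -
  obtain n where "\<forall>W\<in>{W. p W \<noteq> \<zero>}. length W < n"
    using finite_nat_set_iff_bounded[of "length ` {W. p W \<noteq> \<zero>}"] FR_finite[OF assms(1)] by auto
  hence "p \<in> relations_below n" using assms by (simp add: relations_below_def)
  thus ?thesis by (rule relations_below_trivial)
qed

end

section \<open>Tensors over the kernel of a quasi-integration\<close>

locale idr_setting = quasi_int
begin

sublocale T: tensor_algebra K MT
  by (intro tensor_algebra.intro module_MT)

abbreviation "T \<equiv> tensor_powers K MT"
abbreviation "tp \<equiv> pure_tensor_list K MT"

lemma T_mod_eq: "T_mod R Q = T" by (simp add: T_mod_def)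
lemma T_pure_eq: "T_pure R Q = tp" by (rule ext) (simp add: T_pure_def)

lemmas module_T = T.module_tensor_powers

lemma tp_closed: "l \<in> lists (RT R Q) \<Longrightarrow> tp l \<in> carrier T"
  by (rule T.tpure_closed) simp

lemma tp_linear:
  "\<lbrakk>us \<in> lists (RT R Q); vs \<in> lists (RT R Q)\<rbrakk> \<Longrightarrow> linear_on K MT T (\<lambda>x. tp (us @ [x] @ vs))"
  by (rule T.multilinear_on_linear[OF T.tpure_multilinear]) simp_all

text \<open>The recursion of the shuffle product prepends a letter to sums of pure tensors, so
  prepending is needed as an operation on tensors rather than on lists.\<close>

lemma cons_op_ex:
  "\<exists>\<kappa>. bilinear_on K MT T T \<kappa> \<and> (\<forall>x\<in>RT R Q. \<forall>l\<in>lists (RT R Q). \<kappa> x (tp l) = tp (x # l))"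
proof (rule T.tensor_powers_ext_bilinear[OF module_T module_MT, of "\<lambda>x l. tp (x # l)"])
  fix x assume x: "x \<in> carrier MT"
  show "multilinear_on K MT T (\<lambda>l. tp (x # l))"
  proof (rule T.multilinear_onI)
    fix us vs assume "us \<in> lists (carrier MT)" "vs \<in> lists (carrier MT)"
    thus "linear_on K MT T (\<lambda>y. tp (x # us @ [y] @ vs))"
      using tp_linear[of "x # us" vs] x by simp
  qed (use x tp_closed in auto)
next
  fix l assume "l \<in> lists (carrier MT)"
  thus "linear_on K MT T (\<lambda>x. tp (x # l))" using tp_linear[of "[]" l] by simp
qed fastforce

definition cons_op where
  "cons_op = (SOME \<kappa>. bilinear_on K MT T T \<kappa> \<and>
    (\<forall>x\<in>RT R Q. \<forall>l\<in>lists (RT R Q). \<kappa> x (tp l) = tp (x # l)))"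

lemma cons_op_bilinear: "bilinear_on K MT T T cons_op"
  and cons_op_tp: "\<lbrakk>x \<in> RT R Q; l \<in> lists (RT R Q)\<rbrakk> \<Longrightarrow> cons_op x (tp l) = tp (x # l)"
  using someI_ex[OF cons_op_ex] unfolding cons_op_def by blast+

lemma cons_op_linear_left: "t \<in> carrier T \<Longrightarrow> linear_on K MT T (\<lambda>x. cons_op x t)"
  and cons_op_linear_right: "x \<in> RT R Q \<Longrightarrow> linear_on K T T (cons_op x)"
  using cons_op_bilinear by (auto simp: bilinear_on_def)

subsection \<open>The shuffle product\<close>

lemma T_sum_Nil [simp]: "T_sum R Q [] = \<zero>\<^bsub>T\<^esub>"
  and T_sum_Cons [simp]: "T_sum R Q (w # ws) = tp w \<oplus>\<^bsub>T\<^esub> T_sum R Q ws"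
  by (simp_all add: T_sum_def T_mod_eq T_pure_eq)

lemma T_sum_closed: "set ws \<subseteq> lists (RT R Q) \<Longrightarrow> T_sum R Q ws \<in> carrier T"
  by (induction ws) (auto intro!: T.T.a_closed tp_closed)

lemma T_sum_append:
  "\<lbrakk>set vs \<subseteq> lists (RT R Q); set ws \<subseteq> lists (RT R Q)\<rbrakk> \<Longrightarrow>
    T_sum R Q (vs @ ws) = T_sum R Q vs \<oplus>\<^bsub>T\<^esub> T_sum R Q ws"
proof (induction vs)
  case (Cons v vs)
  have "tp v \<in> carrier T" "T_sum R Q vs \<in> carrier T" "T_sum R Q ws \<in> carrier T"
    using Cons by (auto intro!: T_sum_closed tp_closed simp del: in_lists_conv_set)
  thus ?case using Cons by (simp add: T.T.a_assoc)
qed (simp add: T_sum_closed)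

lemma T_sum_map_Cons:
  "\<lbrakk>x \<in> RT R Q; set ws \<subseteq> lists (RT R Q)\<rbrakk> \<Longrightarrow>
    T_sum R Q (map (Cons x) ws) = cons_op x (T_sum R Q ws)"
proof (induction ws)
  case Nil
  show ?case using linear_on_zero[OF cons_op_linear_right[OF Nil(1)] module_T module_T] by simp
next
  case (Cons w ws)
  have "tp w \<in> carrier T" "T_sum R Q ws \<in> carrier T"
    using Cons by (auto intro!: T_sum_closed tp_closed simp del: in_lists_conv_set)
  thus ?case using Cons linear_on_add[OF cons_op_linear_right[OF Cons(2)]] cons_op_tp by simp
qed

lemma shuffle_lists_set:
  "w \<in> set (shuffle_lists t s) \<Longrightarrow> set w = set t \<union> set s \<and> length w = length t + length s"
  by (induction t s arbitrary: w rule: shuffle_lists.induct) fastforce+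

text \<open>A shuffle of lists, valued in tensors. Its multilinearity has to be known first, since
  \<open>shuffle\<close> is a definite description and acquires its values only through
  \<open>shuffle_tp\<close>.\<close>

definition sh :: "'a list \<Rightarrow> 'a list \<Rightarrow> 'a tens" where "sh t s = T_sum R Q (shuffle_lists t s)"

lemma shuffle_lists_in_lists:
  "\<lbrakk>t \<in> lists Y; s \<in> lists Y\<rbrakk> \<Longrightarrow> set (shuffle_lists t s) \<subseteq> lists Y"
  using shuffle_lists_set by fastforce

lemma sh_closed: "\<lbrakk>t \<in> lists (RT R Q); s \<in> lists (RT R Q)\<rbrakk> \<Longrightarrow> sh t s \<in> carrier T"
  unfolding sh_def by (intro T_sum_closed shuffle_lists_in_lists)

lemma sh_Nil:
  "s \<in> lists (RT R Q) \<Longrightarrow> sh [] s = tp s" "s \<in> lists (RT R Q) \<Longrightarrow> sh s [] = tp s"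
  using tp_closed[of s] by (cases s; simp add: sh_def)+

lemma sh_Cons:
  assumes "x # t \<in> lists (RT R Q)" "y # s \<in> lists (RT R Q)"
  shows "sh (x # t) (y # s) = cons_op x (sh t (y # s)) \<oplus>\<^bsub>T\<^esub> cons_op y (sh (x # t) s)"
proof -
  have xy: "x \<in> RT R Q" "y \<in> RT R Q" using assms by auto
  have 1: "set (shuffle_lists t (y # s)) \<subseteq> lists (RT R Q)"
    "set (shuffle_lists (x # t) s) \<subseteq> lists (RT R Q)"
    by (rule shuffle_lists_in_lists; use assms in simp)+
  hence 2: "set (map (Cons x) (shuffle_lists t (y # s))) \<subseteq> lists (RT R Q)"
    "set (map (Cons y) (shuffle_lists (x # t) s)) \<subseteq> lists (RT R Q)"
    using xy by (auto simp: image_subset_iff subset_iff Ball_def in_lists_conv_set)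
  show ?thesis
    unfolding sh_def shuffle_lists.simps T_sum_append[OF 2]
    using T_sum_map_Cons[OF xy(1) 1(1)] T_sum_map_Cons[OF xy(2) 1(2)] by simp
qed

text \<open>The recursion is symmetric in the two lists up to the order of the two summands. With
  it, linearity in the left list gives linearity in the right one.\<close>

lemma sh_commute: "\<lbrakk>t \<in> lists (RT R Q); s \<in> lists (RT R Q)\<rbrakk> \<Longrightarrow> sh t s = sh s t"
proof (induction t s rule: shuffle_lists.induct)
  case (3 x t y s)
  have l: "t \<in> lists (RT R Q)" "s \<in> lists (RT R Q)" "x \<in> RT R Q" "y \<in> RT R Q"
    using 3 by auto
  have "cons_op x (sh t (y # s)) \<in> carrier T" "cons_op y (sh (x # t) s) \<in> carrier T"
    using l by (auto intro!: linear_on_closed[OF cons_op_linear_right] sh_closed)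
  thus ?case using 3 l by (simp add: sh_Cons T.T.a_comm)
qed (simp_all add: sh_Nil)

text \<open>The recursion shortens either list, hence the induction on \<open>s\<close> with an
  inner one on the part \<open>us\<close> before the marked entry. When \<open>us\<close> is empty,
  the marked entry itself is prepended in one summand, and linearity there is that of
  \<open>cons_op\<close>.\<close>

lemma sh_linear:
  assumes "us \<in> lists (RT R Q)" "vs \<in> lists (RT R Q)" "s \<in> lists (RT R Q)"
  shows "linear_on K MT T (\<lambda>x. sh (us @ [x] @ vs) s)"
  using assms
proof (induction s arbitrary: us vs)
  case Nil
  show ?case
    by (rule linear_on_cong[OF tp_linear[OF Nil(1,2)] module_MT])
      (use Nil in \<open>simp add: sh_Nil(2)\<close>)
next
  case (Cons y s)
  have y: "y \<in> RT R Q" and s: "s \<in> lists (RT R Q)" using Cons by auto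
  show ?case
    using Cons.prems(1)
  proof (induction us)
    case Nil
    have "sh vs (y # s) \<in> carrier T" using Cons by (intro sh_closed)
    hence "linear_on K MT T (\<lambda>x. cons_op x (sh vs (y # s)) \<oplus>\<^bsub>T\<^esub> cons_op y (sh ([] @ [x] @ vs) s))"
      using Cons y s
      by (intro linear_on_plus module_T cons_op_linear_left
          linear_on_comp[OF Cons.IH cons_op_linear_right]) auto
    thus ?case
      by (rule linear_on_cong[OF _ module_MT])
        (use Cons.prems in \<open>simp add: sh_Cons\<close>)
  next
    case (Cons u us)
    have u: "u \<in> RT R Q" "us \<in> lists (RT R Q)" "u # us \<in> lists (RT R Q)" using Cons by auto
    have "linear_on K MT T (\<lambda>x. cons_op u (sh (us @ [x] @ vs) (y # s)) \<oplus>\<^bsub>T\<^esub>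
        cons_op y (sh ((u # us) @ [x] @ vs) s))"
      using Cons u y s \<open>vs \<in> lists (RT R Q)\<close>
      by (intro linear_on_plus module_T linear_on_comp[OF Cons.IH cons_op_linear_right]
          linear_on_comp[OF \<open>\<And>vs us. us \<in> lists (RT R Q) \<Longrightarrow> vs \<in> lists (RT R Q) \<Longrightarrow>
            s \<in> lists (RT R Q) \<Longrightarrow> linear_on K MT T (\<lambda>x. sh (us @ [x] @ vs) s)\<close> cons_op_linear_right])
    thus ?case
      by (rule linear_on_cong[OF _ module_MT])
        (use u \<open>vs \<in> lists (RT R Q)\<close> \<open>y # s \<in> lists (RT R Q)\<close> in \<open>simp add: sh_Cons\<close>)
  qed
qed

lemma sh_linear_right:
  assumes "us \<in> lists (RT R Q)" "vs \<in> lists (RT R Q)" "s \<in> lists (RT R Q)"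
  shows "linear_on K MT T (\<lambda>x. sh s (us @ [x] @ vs))"
  by (rule linear_on_cong[OF sh_linear[OF assms] module_MT])
    (use assms in \<open>simp add: sh_commute\<close>)

lemma shuffle_tp:
  assumes "t \<in> lists (RT R Q)" "s \<in> lists (RT R Q)"
  shows "shuffle R Q (tp t) (tp s) = sh t s"
proof -
  obtain \<mu> where \<mu>: "bilinear_on K T T T \<mu>"
    and \<mu>p: "\<And>t s. \<lbrakk>t \<in> lists (carrier MT); s \<in> lists (carrier MT)\<rbrakk> \<Longrightarrow> \<mu> (tp t) (tp s) = sh t s"
    by (rule T.T_bilinear_ext[OF module_T, of sh])
      (auto intro!: T.multilinear_onI sh_closed sh_linear sh_linear_right
        simp del: in_lists_conv_set append_Cons)
  let ?P = "\<lambda>\<mu>. \<forall>t\<in>lists (RT R Q). \<forall>s\<in>lists (RT R Q).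
          \<mu> (T_pure R Q t) (T_pure R Q s) = T_sum R Q (shuffle_lists t s)"
  have "bilinear_map K (T_mod R Q) (T_mod R Q) (T_mod R Q) (shuffle R Q) \<and> ?P (shuffle R Q)"
    unfolding shuffle_def
  proof (rule the_bilinear_map)
    fix g assume "\<And>x y. \<lbrakk>x \<in> carrier (T_mod R Q); y \<in> carrier (T_mod R Q)\<rbrakk> \<Longrightarrow> g x y = \<mu> x y"
    thus "?P g" using \<mu>p tp_closed by (simp add: T_mod_eq T_pure_eq sh_def)
  next
    fix f g x y
    assume f: "bilinear_on K (T_mod R Q) (T_mod R Q) (T_mod R Q) f" "?P f"
      and g: "bilinear_on K (T_mod R Q) (T_mod R Q) (T_mod R Q) g" "?P g"
      and xy: "x \<in> carrier (T_mod R Q)" "y \<in> carrier (T_mod R Q)"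
    have l: "linear_on K T T (h u)" "linear_on K T T (\<lambda>x. h x u)"
      if "bilinear_on K (T_mod R Q) (T_mod R Q) (T_mod R Q) h" "u \<in> carrier T" for h u
      using that by (auto simp: bilinear_on_def T_mod_eq)
    note xy = xy[unfolded T_mod_eq]
    have 1: "f (tp t) y = g (tp t) y" if "t \<in> lists (RT R Q)" for t
      by (rule T.linear_on_tensor_powers_eqI[OF module_T l(1)[OF f(1)] l(1)[OF g(1)]])
        (use that xy f(2) g(2) tp_closed in \<open>auto simp: T_pure_eq\<close>)
    show "f x y = g x y"
      by (rule T.linear_on_tensor_powers_eqI[OF module_T l(2)[OF f(1)] l(2)[OF g(1)]])
        (use xy 1 in auto)
  qed (use \<mu> module_T in \<open>simp_all add: T_mod_eq\<close>)
  thus ?thesis using assms by (auto simp: T_mod_eq T_pure_eq sh_def)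
qed


subsection \<open>The algebras of constants\<close>

lemma in_lists_take: "l \<in> lists Y \<Longrightarrow> take i l \<in> lists Y"
  and in_lists_drop: "l \<in> lists Y \<Longrightarrow> drop i l \<in> lists Y"
  by (auto dest: in_set_takeD in_set_dropD)

abbreviation "TP \<equiv> T_pos R Q"

lemma TP_simps:
  "carrier TP = gen_submodule K T (tp ` (lists (RT R Q) - {[]}))"
  "ring.add TP = ring.add T" "smult TP = smult T" "ring.zero TP = ring.zero T"
  by (simp_all add: T_pos_def T_mod_eq T_pure_eq)

lemma submodule_TP: "submodule (carrier TP) K T"
  unfolding TP_simps by (rule gen_submodule_is_submodule[OF module_T]) (auto intro: tp_closed)

lemma module_TP: "module K TP"
  using submodule.submodule_is_module[OF submodule_TP module_T]
  by (simp add: T_pos_def T_mod_eq T_pure_eq)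

lemma TP_subset: "carrier TP \<subseteq> carrier T"
  using submodule_TP T.T.submoduleE(1) by blast

lemma tp_TP: "\<lbrakk>l \<in> lists (RT R Q); l \<noteq> []\<rbrakk> \<Longrightarrow> tp l \<in> carrier TP"
  unfolding TP_simps by (rule subsetD[OF gen_submodule_superset]) auto

text \<open>Lengths add up under shuffling, so the empty list does not occur among the
  shuffles.\<close>

lemma sh_TP:
  assumes "t \<in> lists (RT R Q)" "s \<in> lists (RT R Q)" "t \<noteq> [] \<or> s \<noteq> []"
  shows "sh t s \<in> carrier TP"
proof -
  have "T_sum R Q ws \<in> carrier TP" if "set ws \<subseteq> lists (RT R Q)" "[] \<notin> set ws" for ws
    using that
  proof (induction ws)
    case Nil
    show ?case using module.axioms(2)[OF module_TP] abelian_group.axioms(1)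
        abelian_monoid.zero_closed TP_simps(4) by (metis T_sum_Nil)
  next
    case (Cons w ws)
    hence "tp w \<in> carrier TP" by (intro tp_TP) auto
    thus ?case using Cons T.T.submoduleE(5)[OF submodule_TP] by auto
  qed
  moreover have "[] \<notin> set (shuffle_lists t s)"
    using assms(3) shuffle_lists_set[of "[]" t s] by auto
  ultimately show ?thesis
    unfolding sh_def using shuffle_lists_in_lists[OF assms(1,2)] by blast
qed

sublocale M1: tensor_product K MJ T
  by (intro tensor_product.intro module_MJ module_T)

lemma M1_eq: "M1 R Q = tensor K MJ T" by (simp add: M1_def T_mod_eq)

sublocale C1: symmetric_algebra K "M1 R Q"
  unfolding M1_eq by (intro symmetric_algebra.intro M1.module_tensor)

lemma C1_eq: "C1_alg R Q = sym_algebra K (M1 R Q)" by (simp add: C1_alg_def)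

lemma algebra_C1: "algebra K (C1_alg R Q)" unfolding C1_eq by (rule C1.algebra_sym)

lemma eps1_bilinear: "bilinear_on K MJ T (C1_alg R Q) (eps1 R Q)"
  using M1.pure_tensor_bilinear C1.sym_emb_linear
  unfolding bilinear_on_def C1_eq eps1_def T_mod_eq M1_eq
  by (auto intro: linear_on_comp)

sublocale M2: symmetric_square K TP by (intro symmetric_square.intro module_TP)

sublocale S2: symmetric_algebra K "M2 R Q"
  unfolding M2_def by (intro symmetric_algebra.intro M2.module_sym_square)

lemma S2_eq: "Sym_M2 R Q = sym_algebra K (M2 R Q)" by (simp add: Sym_M2_def)

sublocale S2: algebra K "Sym_M2 R Q" unfolding S2_eq by (rule S2.algebra_sym)

lemma pre_eps2_bilinear: "bilinear_on K TP TP (Sym_M2 R Q) (pre_eps2 R Q)"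
  using M2.sym_tensor_bilinear S2.sym_emb_linear
  unfolding bilinear_on_def S2_eq pre_eps2_def M2_def
  by (auto intro: linear_on_comp)

lemma pre_eps2_closed:
  "\<lbrakk>s \<in> carrier TP; t \<in> carrier TP\<rbrakk> \<Longrightarrow> pre_eps2 R Q s t \<in> carrier (Sym_M2 R Q)"
  using pre_eps2_bilinear by (auto simp: bilinear_on_def linear_on_def)

text \<open>The generators have to lie in the carrier before they generate an ideal. The lower
  summation bound \<open>1 - j\<close> excludes \<open>i = j = 0\<close> and
  \<open>j = k = 0\<close>, so the shuffles of prefixes have positive length, and the strict upper
  bounds keep the suffixes nonempty; hence all arguments of epsilon lie in
  \<open>TP\<close>.\<close>

lemma J2_gen_closed:
  assumes f: "f \<in> lists (RT R Q) - {[]}" and g: "g \<in> lists (RT R Q) - {[]}"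
    and h: "h \<in> lists (RT R Q) - {[]}"
  shows "J2_gen R Q f g h \<in> carrier (Sym_M2 R Q)"
proof -
  have td: "take i l \<in> lists (RT R Q)" "drop i l \<in> lists (RT R Q)" if "l \<in> lists (RT R Q)" for i l
    using that by (auto dest: in_set_takeD in_set_dropD)
  have tk: "sh (take i u) (take j v) \<in> carrier TP"
    if "u \<in> lists (RT R Q) - {[]}" "v \<in> lists (RT R Q) - {[]}" "i \<in> {1 - j..<length u}" for i j u v
    using that td by (intro sh_TP) auto
  have dr: "tp (drop i u) \<in> carrier TP" if "u \<in> lists (RT R Q)" "i < length u" for u i
    using that td by (intro tp_TP) auto
  have shf: "shuffle R Q (tp (take i u)) (tp (take j v)) = sh (take i u) (take j v)"
    if "u \<in> lists (RT R Q)" "v \<in> lists (RT R Q)" for i j u v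
    using that td by (intro shuffle_tp)
  have shf0: "shuffle R Q (tp u) (tp v) = sh u v"
    if "u \<in> lists (RT R Q)" "v \<in> lists (RT R Q)" for u v
    using that by (intro shuffle_tp)
  have tk': "sh (take j v) (take i u) \<in> carrier TP"
    if "u \<in> lists (RT R Q) - {[]}" "v \<in> lists (RT R Q) - {[]}" "i \<in> {1 - j..<length u}" for i j u v
    using tk[OF that] sh_commute td that by simp
  show ?thesis
    unfolding J2_gen_def Let_def T_pure_eq
    using f g h
    by (intro S2.M.a_closed S2.M.minus_closed S2.M.finsum_closed funcsetI S2.A_m_closed pre_eps2_closed)
      (auto simp: shf shf0 simp del: in_lists_conv_set intro!: tk tk' dr sh_TP tp_TP
        dest: in_set_takeD in_set_dropD)
qed

sublocale C2: algebra_quotient K "Sym_M2 R Q" "J2 R Q"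
proof (intro algebra_quotient.intro S2.algebra_axioms algebra_quotient_axioms.intro)
  show "ideal (J2 R Q) (Sym_M2 R Q)"
    unfolding J2_def
    by (rule ring.genideal_ideal[OF cring.axioms(1)[OF S2.M_cring]]) (use J2_gen_closed in blast)
qed

abbreviation "C2 \<equiv> C2_alg R Q"
abbreviation "C1 \<equiv> C1_alg R Q"

lemma algebra_C2: "algebra K C2" unfolding C2_alg_def by (rule C2.algebra_quot)

sublocale C2: algebra K C2 by (rule algebra_C2)
sublocale C1: algebra K C1 by (rule algebra_C1)

lemma C2_proj_linear: "linear_on K (Sym_M2 R Q) C2 (\<lambda>x. J2 R Q +>\<^bsub>Sym_M2 R Q\<^esub> x)"
  unfolding C2_alg_def by (rule C2.quot.quot_proj)

lemma eps2_bilinear: "bilinear_on K TP TP C2 (eps2 R Q)"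
  using pre_eps2_bilinear C2_proj_linear
  unfolding bilinear_on_def eps2_def
  by (auto intro: linear_on_comp)

lemma eps2_linear_left: "t \<in> carrier TP \<Longrightarrow> linear_on K TP C2 (\<lambda>s. eps2 R Q s t)"
  and eps2_linear_right: "s \<in> carrier TP \<Longrightarrow> linear_on K TP C2 (eps2 R Q s)"
  using eps2_bilinear by (auto simp: bilinear_on_def)

lemma eps2_closed: "\<lbrakk>s \<in> carrier TP; t \<in> carrier TP\<rbrakk> \<Longrightarrow> eps2 R Q s t \<in> carrier C2"
  using eps2_linear_right linear_on_closed by metis

lemma tp_linear_TP:
  assumes "us \<in> lists (RT R Q)" "vs \<in> lists (RT R Q)"
  shows "linear_on K MT TP (\<lambda>x. tp (us @ [x] @ vs))"
  using tp_linear[OF assms] assms tp_TP by (simp add: linear_on_def TP_simps(2,3))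

end

section \<open>The product on the tensor product of \<open>C2\<close> with the tensors\<close>

context idr_setting begin

sublocale C2T: tensor_with_powers K MT C2
  by (intro tensor_with_powers.intro T.tensor_algebra_axioms C2.module_axioms)

abbreviation "CT \<equiv> tensor K C2 T"
abbreviation "ctp \<equiv> \<lambda>c l. pure_tensor K C2 T c (tp l)"

lemma C2T_mod_eq: "C2T_mod R Q = CT" by (simp add: C2T_mod_def T_mod_eq)
lemma C2T_pure_eq: "C2T_pure R Q = pure_tensor K C2 T"
  by (intro ext) (simp add: C2T_pure_def T_mod_eq)

lemma module_CT: "module K CT" by (rule C2T.AT.module_tensor)

text \<open>One correction term of the product: \<open>u\<close>, \<open>v\<close> are the two parts
  of the left list and \<open>w\<close>, \<open>z\<close> those of the right one. Keeping the parts
  as separate arguments gives the form that \<open>linear_take_drop\<close> expects.\<close>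

definition ct_term where
  "ct_term e u v w z = pure_tensor K C2 T (e \<otimes>\<^bsub>C2\<^esub> eps2 R Q (tp v) (tp z)) (sh u w)"

text \<open>The coefficients of the two factors enter only through their product, here
  \<open>e\<close>.\<close>

definition ct_prod where
  "ct_prod e t s = pure_tensor K C2 T e (sh t s) \<oplus>\<^bsub>CT\<^esub>
    (\<Oplus>\<^bsub>CT\<^esub>i\<in>{0..<length t}. \<Oplus>\<^bsub>CT\<^esub>j\<in>{0..<length s}.
      ct_term e (take i t) (drop i t) (take j s) (drop j s))"

lemma eps2_tp_closed:
  "\<lbrakk>v \<in> lists (RT R Q); z \<in> lists (RT R Q); v \<noteq> []; z \<noteq> []\<rbrakk> \<Longrightarrow> eps2 R Q (tp v) (tp z) \<in> carrier C2"
  by (intro eps2_closed tp_TP)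

lemma ct_term_closed:
  "\<lbrakk>e \<in> carrier C2; u \<in> lists (RT R Q); v \<in> lists (RT R Q); w \<in> lists (RT R Q);
    z \<in> lists (RT R Q); v \<noteq> []; z \<noteq> []\<rbrakk> \<Longrightarrow> ct_term e u v w z \<in> carrier CT"
  unfolding ct_term_def
  by (intro C2T.AT.pure_tensor_closed C2.A_m_closed eps2_tp_closed sh_closed)

lemma ct_term_closed':
  "\<lbrakk>e \<in> carrier C2; t \<in> lists (RT R Q); s \<in> lists (RT R Q); i < length t; j < length s\<rbrakk> \<Longrightarrow>
    ct_term e (take i t) (drop i t) (take j s) (drop j s) \<in> carrier CT"
  by (intro ct_term_closed in_lists_take in_lists_drop) auto

lemma ct_prod_closed:
  "\<lbrakk>e \<in> carrier C2; t \<in> lists (RT R Q); s \<in> lists (RT R Q)\<rbrakk> \<Longrightarrow> ct_prod e t s \<in> carrier CT"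
  unfolding ct_prod_def
  by (intro C2T.AT.T.a_closed C2T.AT.pure_tensor_closed sh_closed C2T.AT.T.finsum_closed funcsetI ct_term_closed')
    auto

lemma ct_prod_linear:
  assumes "t \<in> lists (RT R Q)" "s \<in> lists (RT R Q)"
  shows "linear_on K C2 CT (\<lambda>e. ct_prod e t s)"
  unfolding ct_prod_def ct_term_def
  using assms
  by (intro linear_on_plus module_CT C2T.AT.pure_tensor_linear_left sh_closed linear_on_finsum
      finite_atLeastLessThan in_lists_take in_lists_drop
      linear_on_comp[OF C2.mult_linear(1) C2T.AT.pure_tensor_linear_left] eps2_tp_closed) auto

text \<open>Each correction term cuts the list. A marked entry before the cut acts through the
  shuffle, one after it through \<open>eps2\<close>; both are linear.\<close>

lemma ct_prod_linear_left:
  assumes e: "e \<in> carrier C2" and us: "us \<in> lists (RT R Q)" "vs \<in> lists (RT R Q)"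
    and s: "s \<in> lists (RT R Q)"
  shows "linear_on K MT CT (\<lambda>x. ct_prod e (us @ [x] @ vs) s)"
proof -
  have "linear_on K MT CT (\<lambda>x. ct_term e (take i (us @ [x] @ vs)) (drop i (us @ [x] @ vs))
      (take j s) (drop j s))"
    if "i < Suc (length us + length vs)" "j < length s" for i j
  proof (rule T.linear_take_drop)
    fix us vs v assume "us \<in> lists (carrier MT)" "vs \<in> lists (carrier MT)"
      "v \<in> lists (carrier MT)" "v \<noteq> []"
    thus "linear_on K MT CT (\<lambda>x. ct_term e (us @ [x] @ vs) v (take j s) (drop j s))"
      unfolding ct_term_def using e s that
      by (intro linear_on_comp[OF sh_linear C2T.AT.pure_tensor_linear_right]
          C2.A_m_closed eps2_tp_closed in_lists_take in_lists_drop) auto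
  next
    fix us vs u assume "us \<in> lists (carrier MT)" "vs \<in> lists (carrier MT)" "u \<in> lists (carrier MT)"
    thus "linear_on K MT CT (\<lambda>x. ct_term e u (us @ [x] @ vs) (take j s) (drop j s))"
      unfolding ct_term_def using e s that
      by (intro linear_on_comp[OF linear_on_comp[OF linear_on_comp[OF tp_linear_TP
                eps2_linear_left] C2.mult_linear(2)] C2T.AT.pure_tensor_linear_left]
          sh_closed tp_TP in_lists_take in_lists_drop) auto
  qed (use us that in auto)
  note lin = this
  \<comment> \<open>The length does not depend on the marked entry, so the sum has a fixed index
    range.\<close>
  have len: "length (us @ [x] @ vs) = Suc (length us + length vs)" for x :: 'a by simp
  show ?thesis
    unfolding ct_prod_def len using e us s
    by (intro linear_on_plus module_CT linear_on_finsum lin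
        linear_on_comp[OF sh_linear C2T.AT.pure_tensor_linear_right]) auto
qed

lemma ct_prod_linear_right:
  assumes e: "e \<in> carrier C2" and us: "us \<in> lists (RT R Q)" "vs \<in> lists (RT R Q)"
    and t: "t \<in> lists (RT R Q)"
  shows "linear_on K MT CT (\<lambda>x. ct_prod e t (us @ [x] @ vs))"
proof -
  have "linear_on K MT CT (\<lambda>x. ct_term e (take i t) (drop i t)
      (take j (us @ [x] @ vs)) (drop j (us @ [x] @ vs)))"
    if "j < Suc (length us + length vs)" "i < length t" for i j
  proof (rule T.linear_take_drop)
    fix us vs v assume "us \<in> lists (carrier MT)" "vs \<in> lists (carrier MT)"
      "v \<in> lists (carrier MT)" "v \<noteq> []"
    thus "linear_on K MT CT (\<lambda>x. ct_term e (take i t) (drop i t) (us @ [x] @ vs) v)"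
      unfolding ct_term_def using e t that
      by (intro linear_on_comp[OF sh_linear_right C2T.AT.pure_tensor_linear_right]
          C2.A_m_closed eps2_tp_closed in_lists_take in_lists_drop) auto
  next
    fix us vs u assume "us \<in> lists (carrier MT)" "vs \<in> lists (carrier MT)" "u \<in> lists (carrier MT)"
    thus "linear_on K MT CT (\<lambda>x. ct_term e (take i t) (drop i t) u (us @ [x] @ vs))"
      unfolding ct_term_def using e t that
      by (intro linear_on_comp[OF linear_on_comp[OF linear_on_comp[OF tp_linear_TP
                eps2_linear_right] C2.mult_linear(2)] C2T.AT.pure_tensor_linear_left]
          sh_closed tp_TP in_lists_take in_lists_drop) auto
  qed (use us that in auto)
  note lin = this
  have len: "length (us @ [x] @ vs) = Suc (length us + length vs)" for x :: 'a by simp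
  show ?thesis
    unfolding ct_prod_def len using e us t
    by (intro linear_on_plus module_CT linear_on_finsum lin
        linear_on_comp[OF sh_linear_right C2T.AT.pure_tensor_linear_right]) auto
qed

lemma C2T_mult_spec:
  shows "bilinear_on K CT CT CT (C2T_mult R Q)"
    and C2T_mult_ctp: "\<lbrakk>c \<in> carrier C2; d \<in> carrier C2; f \<in> lists (RT R Q); g \<in> lists (RT R Q)\<rbrakk> \<Longrightarrow>
      C2T_mult R Q (ctp c f) (ctp d g) = ct_prod (c \<otimes>\<^bsub>C2\<^esub> d) f g"
proof -
  obtain \<mu> where \<mu>: "bilinear_on K CT CT CT \<mu>"
    and \<mu>p: "\<And>c t d s. \<lbrakk>c \<in> carrier C2; t \<in> lists (carrier MT); d \<in> carrier C2;
      s \<in> lists (carrier MT)\<rbrakk> \<Longrightarrow> \<mu> (ctp c t) (ctp d s) = ct_prod (c \<otimes>\<^bsub>C2\<^esub> d) t s"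
    by (rule C2T.AT_bilinear_ext[OF module_CT, of "\<lambda>c t d s. ct_prod (c \<otimes>\<^bsub>C2\<^esub> d) t s"])
      (auto intro!: T.multilinear_onI ct_prod_closed ct_prod_linear_left ct_prod_linear_right
        linear_on_comp[OF C2.mult_linear(1) ct_prod_linear]
        linear_on_comp[OF C2.mult_linear(2) ct_prod_linear]
        simp del: in_lists_conv_set append_Cons)
  let ?P = "\<lambda>\<mu>. \<forall>c\<in>carrier C2. \<forall>d\<in>carrier C2. \<forall>f\<in>lists (RT R Q). \<forall>g\<in>lists (RT R Q).
          \<mu> (C2T_pure R Q c (T_pure R Q f)) (C2T_pure R Q d (T_pure R Q g)) =
            C2T_pure R Q (c \<otimes>\<^bsub>C2\<^esub> d) (shuffle R Q (T_pure R Q f) (T_pure R Q g))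
            \<oplus>\<^bsub>C2T_mod R Q\<^esub>
            (\<Oplus>\<^bsub>C2T_mod R Q\<^esub>i\<in>{0..<length f}. \<Oplus>\<^bsub>C2T_mod R Q\<^esub>j\<in>{0..<length g}.
               C2T_pure R Q
                 (c \<otimes>\<^bsub>C2\<^esub> d \<otimes>\<^bsub>C2\<^esub> eps2 R Q (T_pure R Q (drop i f)) (T_pure R Q (drop j g)))
                 (shuffle R Q (T_pure R Q (take i f)) (T_pure R Q (take j g))))"
  \<comment> \<open>On lists over \<open>RT R Q\<close> the described \<open>shuffle\<close> has the
    values \<open>sh\<close>, which brings the specification into the form of
    \<open>ct_prod\<close>.\<close>
  have P: "?P h \<longleftrightarrow> (\<forall>c\<in>carrier C2. \<forall>d\<in>carrier C2. \<forall>f\<in>lists (RT R Q). \<forall>g\<in>lists (RT R Q).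
      h (ctp c f) (ctp d g) = ct_prod (c \<otimes>\<^bsub>C2\<^esub> d) f g)" for h
    by (simp add: ct_prod_def ct_term_def C2T_pure_eq C2T_mod_eq T_pure_eq shuffle_tp in_lists_take
        in_lists_drop del: in_lists_conv_set cong: ball_cong)
  have "bilinear_map K (C2T_mod R Q) (C2T_mod R Q) (C2T_mod R Q) (C2T_mult R Q) \<and> ?P (C2T_mult R Q)"
    unfolding C2T_mult_def
  proof (rule the_bilinear_map)
    fix g assume "\<And>x y. \<lbrakk>x \<in> carrier (C2T_mod R Q); y \<in> carrier (C2T_mod R Q)\<rbrakk> \<Longrightarrow> g x y = \<mu> x y"
    thus "?P g" unfolding P using \<mu>p C2T.atp_closed by (simp add: C2T_mod_eq)
  next
    fix f g x y
    assume f: "bilinear_on K (C2T_mod R Q) (C2T_mod R Q) (C2T_mod R Q) f" "?P f"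
      and g: "bilinear_on K (C2T_mod R Q) (C2T_mod R Q) (C2T_mod R Q) g" "?P g"
      and xy: "x \<in> carrier (C2T_mod R Q)" "y \<in> carrier (C2T_mod R Q)"
    have l: "linear_on K CT CT (h u)" "linear_on K CT CT (\<lambda>x. h x u)"
      if "bilinear_on K (C2T_mod R Q) (C2T_mod R Q) (C2T_mod R Q) h" "u \<in> carrier CT" for h u
      using that by (auto simp: bilinear_on_def C2T_mod_eq)
    note xy = xy[unfolded C2T_mod_eq]
    note fg = f(2)[unfolded P] g(2)[unfolded P]
    have 1: "f (ctp c t) y = g (ctp c t) y" if "c \<in> carrier C2" "t \<in> lists (RT R Q)" for c t
      by (rule C2T.linear_on_AT_eqI[OF l(1)[OF f(1)] l(1)[OF g(1)]])
        (use that xy fg C2T.atp_closed in auto)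
    show "f x y = g x y"
      by (rule C2T.linear_on_AT_eqI[OF l(2)[OF f(1)] l(2)[OF g(1)]])
        (use xy 1 in auto)
  qed (use \<mu> module_CT in \<open>simp_all add: C2T_mod_eq\<close>)
  hence "bilinear_map K CT CT CT (C2T_mult R Q)" and "?P (C2T_mult R Q)"
    by (simp_all add: C2T_mod_eq)
  thus "bilinear_on K CT CT CT (C2T_mult R Q)"
    and "\<lbrakk>c \<in> carrier C2; d \<in> carrier C2; f \<in> lists (RT R Q); g \<in> lists (RT R Q)\<rbrakk> \<Longrightarrow>
      C2T_mult R Q (ctp c f) (ctp d g) = ct_prod (c \<otimes>\<^bsub>C2\<^esub> d) f g"
    unfolding P using bilinear_map_imp_bilinear_on by blast+
qed

end

section \<open>The integro-differential structure on generators\<close>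

context idr_setting begin

abbreviation "CTA \<equiv> C2T_alg R Q"
abbreviation "CCT \<equiv> C1C2T_alg R Q"
abbreviation "A \<equiv> IDR_alg R Q"

lemma CTA_simps:
  "carrier CTA = carrier CT" "ring.add CTA = ring.add CT" "ring.zero CTA = ring.zero CT"
  "smult CTA = smult CT" "monoid.mult CTA = C2T_mult R Q" "\<one>\<^bsub>CTA\<^esub> = ctp \<one>\<^bsub>C2\<^esub> []"
  by (simp_all add: C2T_alg_def C2T_mod_eq C2T_pure_eq T_pure_eq)

lemma linear_on_CTA:
  "linear_on K CTA N f \<longleftrightarrow> linear_on K CT N f" "linear_on K N CTA g \<longleftrightarrow> linear_on K N CT g"
  by (simp_all add: linear_on_def CTA_simps)

lemma module_CTA: "module K CTA"
  by (rule module_cong[OF module_CT]) (simp_all add: CTA_simps)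

sublocale CCT: tensor_product K C1 CTA
  by (intro tensor_product.intro C1.module_axioms module_CTA)

lemma CCT_simps:
  "carrier CCT = carrier (tensor K C1 CTA)" "ring.add CCT = ring.add (tensor K C1 CTA)"
  "ring.zero CCT = ring.zero (tensor K C1 CTA)" "smult CCT = smult (tensor K C1 CTA)"
  "monoid.mult CCT = tensor_algebra_mult K C1 CTA"
  by (simp_all add: C1C2T_alg_def tensor_algebras_def)

lemma linear_on_CCT:
  "linear_on K CCT N f \<longleftrightarrow> linear_on K (tensor K C1 CTA) N f"
  "linear_on K N CCT g \<longleftrightarrow> linear_on K N (tensor K C1 CTA) g"
  by (simp_all add: linear_on_def CCT_simps)

lemma module_CCT: "module K CCT"
  by (rule module_cong[OF CCT.module_tensor]) (simp_all add: CCT_simps)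

sublocale A: tensor_product K MR CCT
  by (intro tensor_product.intro module_MR module_CCT)

lemma A_simps:
  "carrier A = carrier (tensor K MR CCT)" "ring.add A = ring.add (tensor K MR CCT)"
  "ring.zero A = ring.zero (tensor K MR CCT)" "smult A = smult (tensor K MR CCT)"
  "monoid.mult A = tensor_algebra_mult K MR CCT"
  by (simp_all add: IDR_alg_def tensor_algebras_def)

lemma linear_on_A:
  "linear_on K A N f \<longleftrightarrow> linear_on K (tensor K MR CCT) N f"
  "linear_on K N A g \<longleftrightarrow> linear_on K N (tensor K MR CCT) g"
  by (simp_all add: linear_on_def A_simps)

lemma module_A: "module K A"
  by (rule module_cong[OF A.module_tensor]) (simp_all add: A_simps)

definition ip where "ip f0 c1 c2 l = IDR_pure R Q f0 c1 c2 (tp l)"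

lemma ip_eq: "ip f0 c1 c2 l = pure_tensor K MR CCT f0 (pure_tensor K C1 CTA c1 (ctp c2 l))"
  by (simp add: ip_def IDR_pure_def C2T_pure_eq)

lemma ctp_CTA: "\<lbrakk>c2 \<in> carrier C2; l \<in> lists (RT R Q)\<rbrakk> \<Longrightarrow> ctp c2 l \<in> carrier CTA"
  unfolding CTA_simps by (rule C2T.atp_closed) simp_all

lemma CCT_pure_closed:
  "\<lbrakk>c1 \<in> carrier C1; z \<in> carrier CTA\<rbrakk> \<Longrightarrow> pure_tensor K C1 CTA c1 z \<in> carrier CCT"
  unfolding CCT_simps by (rule CCT.pure_tensor_closed)

lemma A_pure_linear_right:
  "f0 \<in> carrier R \<Longrightarrow> c1 \<in> carrier C1 \<Longrightarrow>
    linear_on K CT A (\<lambda>z. pure_tensor K MR CCT f0 (pure_tensor K C1 CTA c1 z))"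
  unfolding linear_on_A
  by (rule linear_on_comp[OF _ A.pure_tensor_linear_right[unfolded linear_on_CCT]])
    (simp_all add: CCT.pure_tensor_linear_right[unfolded linear_on_CTA])

lemma ip_linear0:
  "\<lbrakk>c1 \<in> carrier C1; c2 \<in> carrier C2; l \<in> lists (RT R Q)\<rbrakk> \<Longrightarrow>
    linear_on K MR A (\<lambda>f0. ip f0 c1 c2 l)"
  unfolding ip_eq linear_on_A by (intro A.pure_tensor_linear_left CCT_pure_closed ctp_CTA)

lemma ip_linear1:
  "\<lbrakk>f0 \<in> carrier R; c2 \<in> carrier C2; l \<in> lists (RT R Q)\<rbrakk> \<Longrightarrow>
    linear_on K C1 A (\<lambda>c1. ip f0 c1 c2 l)"
  unfolding ip_eq linear_on_A
  by (rule linear_on_comp[OF _ A.pure_tensor_linear_right[unfolded linear_on_CCT]])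
    (simp_all add: CCT.pure_tensor_linear_left ctp_CTA)

lemma ip_linear2:
  "\<lbrakk>f0 \<in> carrier R; c1 \<in> carrier C1; l \<in> lists (RT R Q)\<rbrakk> \<Longrightarrow>
    linear_on K C2 A (\<lambda>c2. ip f0 c1 c2 l)"
  unfolding ip_eq by (rule linear_on_comp[OF C2T.atp_linear_left A_pure_linear_right]) simp_all

lemma IDR_pure_linear:
  "\<lbrakk>f0 \<in> carrier R; c1 \<in> carrier C1; c2 \<in> carrier C2\<rbrakk> \<Longrightarrow>
    linear_on K T A (IDR_pure R Q f0 c1 c2)"
  using linear_on_comp[OF C2T.AT.pure_tensor_linear_right A_pure_linear_right]
  unfolding IDR_pure_def C2T_pure_eq by blast

lemma ip_linear3:
  "\<lbrakk>f0 \<in> carrier R; c1 \<in> carrier C1; c2 \<in> carrier C2; us \<in> lists (RT R Q); vs \<in> lists (RT R Q)\<rbrakk>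
    \<Longrightarrow> linear_on K MT A (\<lambda>x. ip f0 c1 c2 (us @ [x] @ vs))"
  unfolding ip_def by (rule linear_on_comp[OF tp_linear IDR_pure_linear])

lemma ip_closed [simp]:
  "\<lbrakk>f0 \<in> carrier R; c1 \<in> carrier C1; c2 \<in> carrier C2; l \<in> lists (RT R Q)\<rbrakk> \<Longrightarrow>
    ip f0 c1 c2 l \<in> carrier A"
  using linear_on_closed[OF ip_linear0] by simp

text \<open>Three tensor products are nested; scalars are absorbed at every level, so sums of
  elements built from one list exhaust the algebra.\<close>

lemma A_induct [consumes 1, case_names pure add]:
  assumes x: "x \<in> carrier A"
    and pure: "\<And>f0 c1 c2 l. \<lbrakk>f0 \<in> carrier R; c1 \<in> carrier C1; c2 \<in> carrier C2; l \<in> lists (RT R Q)\<rbrakk>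
      \<Longrightarrow> p (ip f0 c1 c2 l)"
    and add: "\<And>x y. \<lbrakk>x \<in> carrier A; y \<in> carrier A; p x; p y\<rbrakk> \<Longrightarrow> p (x \<oplus>\<^bsub>A\<^esub> y)"
  shows "p x"
  using x[unfolded A_simps]
proof (induction rule: A.tensor_induct)
  case (pure f0 w)
  have f0: "f0 \<in> carrier R" using pure by simp
  note lin = A.pure_tensor_linear_right[OF pure(1), unfolded linear_on_A[symmetric]]
  show ?case
    using pure(2)[unfolded CCT_simps]
  proof (induction rule: CCT.tensor_induct)
    case (pure c1 z)
    show ?case
      using pure(2)[unfolded CTA_simps]
    proof (induction rule: C2T.AT_induct)
      case (pure c2 l)
      thus ?case using assms(2)[OF f0 \<open>c1 \<in> carrier C1\<close>, of c2 l] by (simp add: ip_eq)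
    next
      case (add s t)
      note l = A_pure_linear_right[OF f0 \<open>c1 \<in> carrier C1\<close>]
      show ?case
        unfolding linear_on_add[OF l add(1,2)]
        by (intro assms(3) linear_on_closed[OF l] add)
    qed
  next
    case (add s t)
    note l = lin[unfolded linear_on_CCT]
    show ?case
      unfolding linear_on_add[OF l add(1,2)]
      by (intro assms(3) linear_on_closed[OF l] add)
  qed
next
  case (add s t)
  thus ?case using assms(3) by (simp add: A_simps)
qed

lemma linear_on_A_eqI:
  assumes "linear_on K A P f" "linear_on K A P g"
    and "\<And>f0 c1 c2 l. \<lbrakk>f0 \<in> carrier R; c1 \<in> carrier C1; c2 \<in> carrier C2; l \<in> lists (RT R Q)\<rbrakk>
      \<Longrightarrow> f (ip f0 c1 c2 l) = g (ip f0 c1 c2 l)"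
    and "x \<in> carrier A"
  shows "f x = g x"
  using assms(4)
  by (induction rule: A_induct)
    (simp_all add: assms(3) linear_on_add[OF assms(1)] linear_on_add[OF assms(2)])

text \<open>The extension works from the inside out: over \<open>C2\<close> and the tensors, then
  \<open>C1\<close>, then \<open>R\<close>. At each level the maps remain linear in the variables
  that are still to be extended.\<close>

lemma A_ext:
  assumes P: "module K P"
    and l0: "\<And>c1 c2 l. \<lbrakk>c1 \<in> carrier C1; c2 \<in> carrier C2; l \<in> lists (RT R Q)\<rbrakk> \<Longrightarrow>
      linear_on K MR P (\<lambda>f0. f f0 c1 c2 l)"
    and l1: "\<And>f0 c2 l. \<lbrakk>f0 \<in> carrier R; c2 \<in> carrier C2; l \<in> lists (RT R Q)\<rbrakk> \<Longrightarrow>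
      linear_on K C1 P (\<lambda>c1. f f0 c1 c2 l)"
    and l2: "\<And>f0 c1 l. \<lbrakk>f0 \<in> carrier R; c1 \<in> carrier C1; l \<in> lists (RT R Q)\<rbrakk> \<Longrightarrow>
      linear_on K C2 P (\<lambda>c2. f f0 c1 c2 l)"
    and l3: "\<And>f0 c1 c2. \<lbrakk>f0 \<in> carrier R; c1 \<in> carrier C1; c2 \<in> carrier C2\<rbrakk> \<Longrightarrow>
      multilinear_on K MT P (f f0 c1 c2)"
  obtains \<phi> where "linear_on K A P \<phi>"
    and "\<And>f0 c1 c2 l. \<lbrakk>f0 \<in> carrier R; c1 \<in> carrier C1; c2 \<in> carrier C2; l \<in> lists (RT R Q)\<rbrakk>
      \<Longrightarrow> \<phi> (ip f0 c1 c2 l) = f f0 c1 c2 l"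
proof -
  have L: "lists (carrier MT) = lists (RT R Q)" by simp
  have "\<exists>\<phi>. linear_on K CT P \<phi> \<and> (\<forall>c\<in>carrier C2. \<forall>l\<in>lists (RT R Q). \<phi> (ctp c l) = f f0 c1 c l)"
    if "f0 \<in> carrier R" "c1 \<in> carrier C1" for f0 c1
  proof (rule C2T.AT_ext[OF P l2[OF that] l3[OF that]])
    fix \<phi> assume "linear_on K CT P \<phi>"
      "\<And>c l. \<lbrakk>c \<in> carrier C2; l \<in> lists (carrier MT)\<rbrakk> \<Longrightarrow> \<phi> (ctp c l) = f f0 c1 c l"
    thus "\<exists>\<phi>. linear_on K CT P \<phi> \<and>
        (\<forall>c\<in>carrier C2. \<forall>l\<in>lists (RT R Q). \<phi> (ctp c l) = f f0 c1 c l)"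
      unfolding L by blast
  qed simp_all
  then obtain \<rho> where \<rho>: "\<And>f0 c1. \<lbrakk>f0 \<in> carrier R; c1 \<in> carrier C1\<rbrakk> \<Longrightarrow> linear_on K CT P (\<rho> f0 c1)"
    and \<rho>p: "\<And>f0 c1 c l. \<lbrakk>f0 \<in> carrier R; c1 \<in> carrier C1; c \<in> carrier C2; l \<in> lists (RT R Q)\<rbrakk> \<Longrightarrow>
      \<rho> f0 c1 (ctp c l) = f f0 c1 c l"
    by metis
  have \<rho>1: "linear_on K C1 P (\<lambda>c1. \<rho> f0 c1 z)" if "f0 \<in> carrier R" "z \<in> carrier CT" for f0 z
  proof (rule C2T.param_linear_AT[OF P C1.module_axioms \<rho>[OF that(1)] _ that(2)])
    fix c l assume cl: "c \<in> carrier C2" "l \<in> lists (carrier MT)"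
    show "linear_on K C1 P (\<lambda>c1. \<rho> f0 c1 (ctp c l))"
      by (rule linear_on_cong[OF l1[OF that(1) cl(1) cl(2)[unfolded L]] C1.module_axioms])
        (use that cl in \<open>simp add: \<rho>p\<close>)
  qed
  have \<rho>0: "linear_on K MR P (\<lambda>f0. \<rho> f0 c1 z)" if "c1 \<in> carrier C1" "z \<in> carrier CT" for c1 z
  proof (rule C2T.param_linear_AT[OF P module_MR _ _ that(2)])
    fix c l assume cl: "c \<in> carrier C2" "l \<in> lists (carrier MT)"
    show "linear_on K MR P (\<lambda>f0. \<rho> f0 c1 (ctp c l))"
      by (rule linear_on_cong[OF l0[OF that(1) cl(1) cl(2)[unfolded L]] module_MR])
        (use that cl in \<open>simp add: \<rho>p\<close>)
  qed (use \<rho> that in simp)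
  have "bilinear_on K C1 CTA P (\<rho> f0)" if "f0 \<in> carrier R" for f0
    unfolding bilinear_on_def linear_on_CTA CTA_simps using that \<rho> \<rho>1 by blast
  hence "\<exists>\<phi>. linear_on K (tensor K C1 CTA) P \<phi> \<and>
      (\<forall>c\<in>carrier C1. \<forall>z\<in>carrier CTA. \<phi> (pure_tensor K C1 CTA c z) = \<rho> f0 c z)"
    if "f0 \<in> carrier R" for f0
    using that CCT.tensor_ext[OF P, of "\<rho> f0"] by metis
  then obtain \<sigma> where \<sigma>: "\<And>f0. f0 \<in> carrier R \<Longrightarrow> linear_on K (tensor K C1 CTA) P (\<sigma> f0)"
    and \<sigma>p: "\<And>f0 c z. \<lbrakk>f0 \<in> carrier R; c \<in> carrier C1; z \<in> carrier CTA\<rbrakk> \<Longrightarrow>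
      \<sigma> f0 (pure_tensor K C1 CTA c z) = \<rho> f0 c z"
    by metis
  have \<sigma>0: "linear_on K MR P (\<lambda>f0. \<sigma> f0 w)" if "w \<in> carrier (tensor K C1 CTA)" for w
  proof (rule CCT.param_linear_tensor[OF P module_MR _ _ that])
    fix c z assume cz: "c \<in> carrier C1" "z \<in> carrier CTA"
    show "linear_on K MR P (\<lambda>f0. \<sigma> f0 (pure_tensor K C1 CTA c z))"
      by (rule linear_on_cong[OF \<rho>0[OF cz(1) cz(2)[unfolded CTA_simps]] module_MR])
        (use cz in \<open>simp add: \<sigma>p\<close>)
  qed (use \<sigma> in simp)
  have "bilinear_on K MR CCT P \<sigma>"
    unfolding bilinear_on_def linear_on_CCT CCT_simps using \<sigma> \<sigma>0 by simp
  from A.tensor_ext[OF P this]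
  obtain \<phi> where \<phi>: "linear_on K A P \<phi>"
    and \<phi>p: "\<And>x y. \<lbrakk>x \<in> carrier R; y \<in> carrier CCT\<rbrakk> \<Longrightarrow> \<phi> (pure_tensor K MR CCT x y) = \<sigma> x y"
    unfolding linear_on_A by (metis ring_submodule_simps(1))
  show ?thesis
    by (rule that[OF \<phi>]) (simp add: ip_eq \<phi>p \<sigma>p \<rho>p CCT_pure_closed ctp_CTA)
qed

lemma MR_mult_bilinear: "bilinear_on K MR MR MR (\<lambda>x y. x \<otimes>\<^bsub>MR\<^esub> y)"
  by (auto simp: bilinear_on_def linear_on_def l_distr r_distr constants_closed m_ac)

lemma CTA_mult_bilinear: "bilinear_on K CTA CTA CTA (\<lambda>x y. x \<otimes>\<^bsub>CTA\<^esub> y)"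
  using C2T_mult_spec(1) unfolding bilinear_on_def linear_on_CTA CTA_simps .

lemmas CCT_mult_spec = CCT.tensor_algebra_mult_spec[OF C1.mult_bilinear CTA_mult_bilinear]

lemma CCT_mult_bilinear: "bilinear_on K CCT CCT CCT (\<lambda>x y. x \<otimes>\<^bsub>CCT\<^esub> y)"
  using CCT_mult_spec(1) unfolding bilinear_on_def linear_on_CCT CCT_simps .

lemmas A_mult_spec = A.tensor_algebra_mult_spec[OF MR_mult_bilinear CCT_mult_bilinear]

lemma A_mult_ip:
  assumes "f0 \<in> carrier R" "c1 \<in> carrier C1" "c2 \<in> carrier C2" "l \<in> lists (RT R Q)"
    and "g0 \<in> carrier R" "d1 \<in> carrier C1" "d2 \<in> carrier C2" "s \<in> lists (RT R Q)"
  shows "ip f0 c1 c2 l \<otimes>\<^bsub>A\<^esub> ip g0 d1 d2 s =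
    pure_tensor K MR CCT (f0 \<otimes> g0)
      (pure_tensor K C1 CTA (c1 \<otimes>\<^bsub>C1\<^esub> d1) (ct_prod (c2 \<otimes>\<^bsub>C2\<^esub> d2) l s))"
proof -
  have "pure_tensor K C1 CTA c1 (ctp c2 l) \<otimes>\<^bsub>CCT\<^esub> pure_tensor K C1 CTA d1 (ctp d2 s) =
      pure_tensor K C1 CTA (c1 \<otimes>\<^bsub>C1\<^esub> d1) (ct_prod (c2 \<otimes>\<^bsub>C2\<^esub> d2) l s)"
    unfolding CCT_simps using assms
    by (subst CCT_mult_spec(2)) (simp_all add: ctp_CTA CTA_simps(5) C2T_mult_ctp)
  thus ?thesis
    unfolding ip_eq A_simps using assms
    by (subst A_mult_spec(2)) (simp_all add: CCT_pure_closed ctp_CTA)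
qed

lemma ct_prod_Nil:
  "\<lbrakk>e \<in> carrier C2; l \<in> lists (RT R Q)\<rbrakk> \<Longrightarrow> ct_prod e [] l = ctp e l"
  "\<lbrakk>e \<in> carrier C2; l \<in> lists (RT R Q)\<rbrakk> \<Longrightarrow> ct_prod e l [] = ctp e l"
  using C2T.atp_closed[of e l] by (simp_all add: ct_prod_def sh_Nil)

text \<open>With one list empty no correction term occurs, and the shuffle is the other
  list.\<close>

lemma A_mult_ip_Nil:
  assumes "f0 \<in> carrier R" "c1 \<in> carrier C1" "c2 \<in> carrier C2" "l \<in> lists (RT R Q)"
    and "g0 \<in> carrier R" "d1 \<in> carrier C1" "d2 \<in> carrier C2"
  shows "ip g0 d1 d2 [] \<otimes>\<^bsub>A\<^esub> ip f0 c1 c2 l = ip (g0 \<otimes> f0) (d1 \<otimes>\<^bsub>C1\<^esub> c1) (d2 \<otimes>\<^bsub>C2\<^esub> c2) l"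
  using assms by (subst A_mult_ip) (simp_all add: ct_prod_Nil C2.A_m_closed ip_eq)

text \<open>The inner algebra maps linearly into the outer one, so its product formula survives
  summand by summand. In this shape the evaluation can be applied termwise.\<close>

lemma A_mult_ip_words:
  assumes "l \<in> lists (RT R Q)" "s \<in> lists (RT R Q)"
  shows "ip \<one> \<one>\<^bsub>C1\<^esub> \<one>\<^bsub>C2\<^esub> l \<otimes>\<^bsub>A\<^esub> ip \<one> \<one>\<^bsub>C1\<^esub> \<one>\<^bsub>C2\<^esub> s =
    IDR_pure R Q \<one> \<one>\<^bsub>C1\<^esub> \<one>\<^bsub>C2\<^esub> (sh l s) \<oplus>\<^bsub>A\<^esub>
    (\<Oplus>\<^bsub>A\<^esub>i\<in>{0..<length l}. \<Oplus>\<^bsub>A\<^esub>j\<in>{0..<length s}.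
      IDR_pure R Q \<one> \<one>\<^bsub>C1\<^esub> (eps2 R Q (tp (drop i l)) (tp (drop j s))) (sh (take i l) (take j s)))"
proof -
  interpret A': module K A by (rule module_A)
  let ?L = "\<lambda>z. pure_tensor K MR CCT \<one> (pure_tensor K C1 CTA \<one>\<^bsub>C1\<^esub> z)"
  have one: "\<one>\<^bsub>C1\<^esub> \<in> carrier C1" "\<one>\<^bsub>C2\<^esub> \<in> carrier C2" by (rule C1.A_one_closed C2.A_one_closed)+
  have oo: "\<one>\<^bsub>C1\<^esub> \<otimes>\<^bsub>C1\<^esub> \<one>\<^bsub>C1\<^esub> = \<one>\<^bsub>C1\<^esub>" "\<one>\<^bsub>C2\<^esub> \<otimes>\<^bsub>C2\<^esub> x = x" if "x \<in> carrier C2" for x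
    using one that cring.cring_simprules(12)[OF C1.M_cring] cring.cring_simprules(12)[OF C2.M_cring]
    by auto
  have lin: "linear_on K CT A ?L" using one by (intro A_pure_linear_right) auto
  note fs = linear_on_finsum_apply[OF module_CT module_A lin]
  have tm: "ct_term \<one>\<^bsub>C2\<^esub> (take i l) (drop i l) (take j s) (drop j s) \<in> carrier CT"
    if "i \<in> {0..<length l}" "j \<in> {0..<length s}" for i j
    using that assms one by (intro ct_term_closed') auto
  have "?L (ct_prod \<one>\<^bsub>C2\<^esub> l s) = ?L (pure_tensor K C2 T \<one>\<^bsub>C2\<^esub> (sh l s)) \<oplus>\<^bsub>A\<^esub>
    (\<Oplus>\<^bsub>A\<^esub>i\<in>{0..<length l}. \<Oplus>\<^bsub>A\<^esub>j\<in>{0..<length s}.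
      ?L (ct_term \<one>\<^bsub>C2\<^esub> (take i l) (drop i l) (take j s) (drop j s)))"
  proof -
    have "?L (\<Oplus>\<^bsub>CT\<^esub>i\<in>{0..<length l}. \<Oplus>\<^bsub>CT\<^esub>j\<in>{0..<length s}.
        ct_term \<one>\<^bsub>C2\<^esub> (take i l) (drop i l) (take j s) (drop j s)) =
      (\<Oplus>\<^bsub>A\<^esub>i\<in>{0..<length l}. ?L (\<Oplus>\<^bsub>CT\<^esub>j\<in>{0..<length s}.
        ct_term \<one>\<^bsub>C2\<^esub> (take i l) (drop i l) (take j s) (drop j s)))"
      using tm by (intro fs) (auto intro!: C2T.AT.T.finsum_closed)
    also have "\<dots> = (\<Oplus>\<^bsub>A\<^esub>i\<in>{0..<length l}. \<Oplus>\<^bsub>A\<^esub>j\<in>{0..<length s}.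
      ?L (ct_term \<one>\<^bsub>C2\<^esub> (take i l) (drop i l) (take j s) (drop j s)))"
      using tm linear_on_closed[OF lin]
      by (intro A'.finsum_cong' fs) (auto intro!: A'.finsum_closed)
    finally show ?thesis
      unfolding ct_prod_def
      using tm assms one
      by (subst linear_on_add[OF lin])
        (auto intro!: C2T.AT.T.finsum_closed C2T.AT.pure_tensor_closed sh_closed)
  qed
  moreover have L: "?L (pure_tensor K C2 T e t) = IDR_pure R Q \<one> \<one>\<^bsub>C1\<^esub> e t" for e t
    by (simp add: IDR_pure_def C2T_pure_eq)
  moreover have tm_eq: "?L (ct_term \<one>\<^bsub>C2\<^esub> (take i l) (drop i l) (take j s) (drop j s)) =
      IDR_pure R Q \<one> \<one>\<^bsub>C1\<^esub> (eps2 R Q (tp (drop i l)) (tp (drop j s))) (sh (take i l) (take j s))"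
    if "i \<in> {0..<length l}" "j \<in> {0..<length s}" for i j
    unfolding ct_term_def L using that assms
    by (subst oo(2)) (auto intro!: eps2_tp_closed in_lists_drop simp del: in_lists_conv_set)
  have "(\<Oplus>\<^bsub>A\<^esub>i\<in>{0..<length l}. \<Oplus>\<^bsub>A\<^esub>j\<in>{0..<length s}.
      ?L (ct_term \<one>\<^bsub>C2\<^esub> (take i l) (drop i l) (take j s) (drop j s))) =
    (\<Oplus>\<^bsub>A\<^esub>i\<in>{0..<length l}. \<Oplus>\<^bsub>A\<^esub>j\<in>{0..<length s}.
      IDR_pure R Q \<one> \<one>\<^bsub>C1\<^esub> (eps2 R Q (tp (drop i l)) (tp (drop j s))) (sh (take i l) (take j s)))"
    using tm linear_on_closed[OF lin]
    by (intro A'.finsum_cong' funcsetI A'.finsum_closed) (auto simp flip: tm_eq)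
  ultimately have "?L (ct_prod \<one>\<^bsub>C2\<^esub> l s) = IDR_pure R Q \<one> \<one>\<^bsub>C1\<^esub> \<one>\<^bsub>C2\<^esub> (sh l s) \<oplus>\<^bsub>A\<^esub>
    (\<Oplus>\<^bsub>A\<^esub>i\<in>{0..<length l}. \<Oplus>\<^bsub>A\<^esub>j\<in>{0..<length s}.
      IDR_pure R Q \<one> \<one>\<^bsub>C1\<^esub> (eps2 R Q (tp (drop i l)) (tp (drop j s))) (sh (take i l) (take j s)))"
    by simp
  thus ?thesis
    using assms one by (simp add: A_mult_ip oo)
qed


end

text \<open>The description of the derivation treats the empty list and the nonempty lists
  separately; this joins the two cases.\<close>

lemma ball_lists_iff:
  "(\<forall>l\<in>lists Y. p l) \<longleftrightarrow> p [] \<and> (\<forall>x\<in>Y. \<forall>l\<in>lists Y. p (x # l))"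
proof
  assume r: "p [] \<and> (\<forall>x\<in>Y. \<forall>l\<in>lists Y. p (x # l))"
  show "\<forall>l\<in>lists Y. p l"
  proof
    fix l assume "l \<in> lists Y"
    thus "p l" using r by (cases l) auto
  qed
qed simp

context idr_setting begin

subsection \<open>The derivation\<close>

lemma linear_der: "linear_on K MR MR (der R)"
  by (rule linear_onI) (auto simp: der_closed der_add der_const_mult)

lemma linear_Q: "linear_on K MR MR Q" "linear_on K MR MJ Q"
  by (rule linear_onI; auto simp: Q_add Q_const RJ_def)+

lemma linear_mult_RT:
  "f0 \<in> carrier R \<Longrightarrow> linear_on K MT MR (\<lambda>x. f0 \<otimes> x)"
  "x \<in> RT R Q \<Longrightarrow> linear_on K MR MR (\<lambda>f0. f0 \<otimes> x)"
  by (rule linear_onI; auto simp: RT_closed r_distr l_distr constants_closed m_ac)+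

fun kder where
  "kder f0 c1 c2 [] = ip (der R f0) c1 c2 []"
| "kder f0 c1 c2 (f1 # f) = ip (der R f0) c1 c2 (f1 # f) \<oplus>\<^bsub>A\<^esub> ip (f0 \<otimes> f1) c1 c2 f"

lemma kder_closed:
  "\<lbrakk>f0 \<in> carrier R; c1 \<in> carrier C1; c2 \<in> carrier C2; l \<in> lists (RT R Q)\<rbrakk> \<Longrightarrow>
    kder f0 c1 c2 l \<in> carrier A"
  using module.axioms(2)[OF module_A, THEN abelian_group.axioms(1), THEN abelian_monoid.a_closed]
  by (cases l) (simp_all add: der_closed RT_closed)

lemma kder_linear:
  shows "\<lbrakk>c1 \<in> carrier C1; c2 \<in> carrier C2; l \<in> lists (RT R Q)\<rbrakk> \<Longrightarrow>
      linear_on K MR A (\<lambda>f0. kder f0 c1 c2 l)"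
    and "\<lbrakk>f0 \<in> carrier R; c2 \<in> carrier C2; l \<in> lists (RT R Q)\<rbrakk> \<Longrightarrow>
      linear_on K C1 A (\<lambda>c1. kder f0 c1 c2 l)"
    and "\<lbrakk>f0 \<in> carrier R; c1 \<in> carrier C1; l \<in> lists (RT R Q)\<rbrakk> \<Longrightarrow>
      linear_on K C2 A (\<lambda>c2. kder f0 c1 c2 l)"
    and "\<lbrakk>f0 \<in> carrier R; c1 \<in> carrier C1; c2 \<in> carrier C2\<rbrakk> \<Longrightarrow> multilinear_on K MT A (kder f0 c1 c2)"
proof -
  show "linear_on K MR A (\<lambda>f0. kder f0 c1 c2 l)"
    if "c1 \<in> carrier C1" "c2 \<in> carrier C2" "l \<in> lists (RT R Q)"
    using that
    by (cases l) (auto intro!: linear_on_plus module_A linear_on_comp[OF linear_der ip_linear0]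
        linear_on_comp[OF linear_mult_RT(2) ip_linear0])
  show "linear_on K C1 A (\<lambda>c1. kder f0 c1 c2 l)"
    if "f0 \<in> carrier R" "c2 \<in> carrier C2" "l \<in> lists (RT R Q)"
    using that by (cases l) (auto intro!: linear_on_plus module_A ip_linear1 der_closed
        simp: RT_closed)
  show "linear_on K C2 A (\<lambda>c2. kder f0 c1 c2 l)"
    if "f0 \<in> carrier R" "c1 \<in> carrier C1" "l \<in> lists (RT R Q)"
    using that by (cases l) (auto intro!: linear_on_plus module_A ip_linear2 der_closed
        simp: RT_closed)
  show "multilinear_on K MT A (kder f0 c1 c2)"
    if that: "f0 \<in> carrier R" "c1 \<in> carrier C1" "c2 \<in> carrier C2"
  proof (rule T.multilinear_onI)
    fix us vs assume us: "us \<in> lists (carrier MT)" "vs \<in> lists (carrier MT)"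
    hence us': "us \<in> lists (RT R Q)" "vs \<in> lists (RT R Q)" by simp_all
    show "linear_on K MT A (\<lambda>x. kder f0 c1 c2 (us @ [x] @ vs))"
    proof (cases us)
      case Nil
      \<comment> \<open>The marked entry is the first tensor factor; in the second summand it
        becomes a factor of the coefficient in \<open>R\<close>.\<close>
      show ?thesis
        unfolding Nil append_Nil append_Cons kder.simps
        using that us' ip_linear3[of "der R f0" c1 c2 "[]" vs]
        by (intro linear_on_plus module_A linear_on_comp[OF linear_mult_RT(1) ip_linear0])
          (simp_all add: der_closed)
    next
      case (Cons u ws)
      hence u: "u \<in> RT R Q" "ws \<in> lists (RT R Q)" using us' by auto
      show ?thesis
        unfolding Cons append_Cons kder.simps
        using that us' u ip_linear3[of "der R f0" c1 c2 "u # ws" vs]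
          ip_linear3[of "f0 \<otimes> u" c1 c2 ws vs]
        by (intro linear_on_plus module_A) (simp_all add: der_closed RT_closed)
    qed
  qed (use that kder_closed in auto)
qed

lemma IDR_der_spec:
  shows "linear_on K A A (IDR_der R Q)"
    and IDR_der_ip: "\<lbrakk>f0 \<in> carrier R; c1 \<in> carrier C1; c2 \<in> carrier C2; l \<in> lists (RT R Q)\<rbrakk> \<Longrightarrow>
      IDR_der R Q (ip f0 c1 c2 l) = kder f0 c1 c2 l"
proof -
  obtain \<phi> where \<phi>: "linear_on K A A \<phi>"
    and \<phi>p: "\<And>f0 c1 c2 l. \<lbrakk>f0 \<in> carrier R; c1 \<in> carrier C1; c2 \<in> carrier C2; l \<in> lists (RT R Q)\<rbrakk>
      \<Longrightarrow> \<phi> (ip f0 c1 c2 l) = kder f0 c1 c2 l"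
    by (rule A_ext[OF module_A kder_linear]) (assumption | rule that)+
  let ?P = "\<lambda>D. \<forall>f0\<in>carrier R. \<forall>c1\<in>carrier C1. \<forall>c2\<in>carrier C2.
          D (IDR_pure R Q f0 c1 c2 (T_pure R Q [])) =
            IDR_pure R Q (der R f0) c1 c2 (T_pure R Q []) \<and>
          (\<forall>f1\<in>RT R Q. \<forall>f\<in>lists (RT R Q).
             D (IDR_pure R Q f0 c1 c2 (T_pure R Q (f1 # f))) =
               IDR_pure R Q (der R f0) c1 c2 (T_pure R Q (f1 # f)) \<oplus>\<^bsub>A\<^esub>
               IDR_pure R Q (f0 \<otimes> f1) c1 c2 (T_pure R Q f))"
  have kd: "(\<forall>l\<in>lists (RT R Q). D (ip f0 c1 c2 l) = kder f0 c1 c2 l) \<longleftrightarrow>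
      D (ip f0 c1 c2 []) = ip (der R f0) c1 c2 [] \<and>
      (\<forall>f1\<in>RT R Q. \<forall>f\<in>lists (RT R Q). D (ip f0 c1 c2 (f1 # f)) =
        ip (der R f0) c1 c2 (f1 # f) \<oplus>\<^bsub>A\<^esub> ip (f0 \<otimes> f1) c1 c2 f)" for D f0 c1 c2
    by (subst ball_lists_iff) (simp only: kder.simps)
  have P: "?P D \<longleftrightarrow> (\<forall>f0\<in>carrier R. \<forall>c1\<in>carrier C1. \<forall>c2\<in>carrier C2. \<forall>l\<in>lists (RT R Q).
      D (ip f0 c1 c2 l) = kder f0 c1 c2 l)" for D
    unfolding kd unfolding T_pure_eq ip_def ..
  have "linear_map K A A (IDR_der R Q) \<and> ?P (IDR_der R Q)"
    unfolding IDR_der_def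
  proof (rule the_linear_map[OF module_A \<phi>])
    show "?P (restrict \<phi> (carrier A))" unfolding P using \<phi>p by simp
  next
    fix f g x assume f: "linear_on K A A f" "?P f" and g: "linear_on K A A g" "?P g"
      and x: "x \<in> carrier A"
    show "f x = g x"
      by (rule linear_on_A_eqI[OF f(1) g(1) _ x]) (use f(2)[unfolded P] g(2)[unfolded P] in simp)
  qed
  thus "linear_on K A A (IDR_der R Q)"
    and "\<lbrakk>f0 \<in> carrier R; c1 \<in> carrier C1; c2 \<in> carrier C2; l \<in> lists (RT R Q)\<rbrakk> \<Longrightarrow>
      IDR_der R Q (ip f0 c1 c2 l) = kder f0 c1 c2 l"
    unfolding P using linear_map_imp_linear_on by blast+
qed

subsection \<open>The integral\<close>

text \<open>The projection of \<open>R\<close> onto \<open>RT R Q\<close> along the image of the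
  derivation.\<close>

definition rem where "rem f0 = f0 \<ominus> der R (Q f0)"

lemma MR_minus: "y \<in> carrier R \<Longrightarrow> x \<ominus>\<^bsub>MR\<^esub> y = x \<ominus> y"
  by (rule a_minus_cong[OF abelian_group_axioms]) (simp_all add: fun_eq_iff)

lemma linear_rem: "linear_on K MR MT rem"
proof -
  have "rem x \<in> RT R Q" if "x \<in> carrier R" for x
  proof -
    have "Q (x \<ominus> der R (Q x)) = Q x \<ominus> Q (der R (Q x))"
      using linear_on_diff[OF linear_Q(1) module_MR module_MR, of x "der R (Q x)"] that
      by (simp add: der_closed MR_minus)
    thus ?thesis using that by (simp add: RT_def rem_def der_closed Q_der_Q r_right_minus_eq)
  qed
  moreover have "linear_on K MR MR rem"
  proof -
    have id: "linear_on K MR MR (\<lambda>x. x)" by (rule linear_onI) auto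
    show ?thesis
      by (rule linear_on_cong[OF linear_on_minus[OF module_MR id
              linear_on_comp[OF linear_Q(1) linear_der]] module_MR])
        (simp add: rem_def der_closed MR_minus)
  qed
  ultimately show ?thesis by (simp add: linear_on_def)
qed

lemma rem_RT: "x \<in> carrier R \<Longrightarrow> rem x \<in> RT R Q"
  using linear_on_closed[OF linear_rem] by simp

lemma Q_RJ: "x \<in> carrier R \<Longrightarrow> Q x \<in> RJ R Q" by (simp add: RJ_def)

lemma eps1_linear_left: "t \<in> carrier T \<Longrightarrow> linear_on K MJ C1 (\<lambda>r. eps1 R Q r t)"
  and eps1_linear_right: "r \<in> RJ R Q \<Longrightarrow> linear_on K T C1 (eps1 R Q r)"
  using eps1_bilinear by (auto simp: bilinear_on_def)

lemma eps1_closed: "\<lbrakk>r \<in> RJ R Q; t \<in> carrier T\<rbrakk> \<Longrightarrow> eps1 R Q r t \<in> carrier C1"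
  using eps1_linear_right linear_on_closed by metis

text \<open>This is integration by parts: \<open>Q f0\<close> integrates the derivative part of
  \<open>f0\<close>, the term with \<open>eps1\<close> subtracts the evaluation, and the recursive
  call integrates \<open>Q f0\<close> against the derivative of the tensor. The remaining part
  \<open>rem f0\<close> is stored as a new first factor.\<close>

primrec kint where
  "kint f0 c1 c2 [] = ip (Q f0) c1 c2 []
      \<ominus>\<^bsub>A\<^esub> ip \<one> (c1 \<otimes>\<^bsub>C1\<^esub> eps1 R Q (Q f0) (tp [])) c2 []
      \<oplus>\<^bsub>A\<^esub> ip \<one> c1 c2 [rem f0]"
| "kint f0 c1 c2 (f1 # f) = ip (Q f0) c1 c2 (f1 # f)
      \<ominus>\<^bsub>A\<^esub> ip \<one> (c1 \<otimes>\<^bsub>C1\<^esub> eps1 R Q (Q f0) (tp (f1 # f))) c2 []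
      \<ominus>\<^bsub>A\<^esub> kint (Q f0 \<otimes> f1) c1 c2 f
      \<oplus>\<^bsub>A\<^esub> ip \<one> c1 c2 (rem f0 # f1 # f)"

lemma kint_linear0:
  assumes "c1 \<in> carrier C1" "c2 \<in> carrier C2" "l \<in> lists (RT R Q)"
  shows "linear_on K MR A (\<lambda>f0. kint f0 c1 c2 l)"
  using assms(3)
proof (induction l)
  case Nil
  show ?case
    unfolding kint.simps
    using assms tp_closed[of "[]"] ip_linear3[of \<one> c1 c2 "[]" "[]"]
    by (intro linear_on_plus linear_on_minus module_A linear_on_comp[OF linear_Q(1) ip_linear0]
        linear_on_comp[OF linear_on_comp[OF linear_on_comp[OF linear_Q(2) eps1_linear_left]
            C1.mult_linear(2)] ip_linear1]
        linear_on_comp[OF linear_rem]) simp_all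
next
  case (Cons x l)
  hence x: "x \<in> RT R Q" "l \<in> lists (RT R Q)" "x # l \<in> lists (RT R Q)" by auto
  show ?case
    unfolding kint.simps
    using assms(1,2) x tp_closed[OF x(3)] ip_linear3[of \<one> c1 c2 "[]" "x # l"]
    by (intro linear_on_plus linear_on_minus module_A linear_on_comp[OF linear_Q(1) ip_linear0]
        linear_on_comp[OF linear_on_comp[OF linear_on_comp[OF linear_Q(2) eps1_linear_left]
            C1.mult_linear(2)] ip_linear1]
        linear_on_comp[OF linear_on_comp[OF linear_Q(1) linear_mult_RT(2)] Cons.IH]
        linear_on_comp[OF linear_rem]) simp_all
qed

lemma kint_closed:
  "\<lbrakk>f0 \<in> carrier R; c1 \<in> carrier C1; c2 \<in> carrier C2; l \<in> lists (RT R Q)\<rbrakk> \<Longrightarrow>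
    kint f0 c1 c2 l \<in> carrier A"
  using linear_on_closed[OF kint_linear0] by simp

text \<open>The coefficient varies in the induction, because the recursive call replaces
  \<open>f0\<close> by \<open>Q f0\<close> times the first tensor factor.\<close>

lemma kint_linear1:
  assumes "f0 \<in> carrier R" "c2 \<in> carrier C2" "l \<in> lists (RT R Q)"
  shows "linear_on K C1 A (\<lambda>c1. kint f0 c1 c2 l)"
  using assms(1,3)
proof (induction l arbitrary: f0)
  case Nil
  thus ?case
    unfolding kint.simps
    using assms(2) tp_closed[of "[]"] rem_RT[of f0]
    by (intro linear_on_plus linear_on_minus module_A ip_linear1
        linear_on_comp[OF C1.mult_linear(1) ip_linear1] eps1_closed Q_RJ) simp_all
next
  case (Cons x l)
  hence x: "x \<in> RT R Q" "l \<in> lists (RT R Q)" "x # l \<in> lists (RT R Q)" by auto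
  show ?case
    unfolding kint.simps
    using assms(2) x Cons.prems tp_closed[OF x(3)] rem_RT[of f0]
    by (intro linear_on_plus linear_on_minus module_A ip_linear1 Cons.IH
        linear_on_comp[OF C1.mult_linear(1) ip_linear1] eps1_closed Q_RJ)
      (simp_all add: RT_closed)
qed

lemma kint_linear2:
  assumes "f0 \<in> carrier R" "c1 \<in> carrier C1" "l \<in> lists (RT R Q)"
  shows "linear_on K C2 A (\<lambda>c2. kint f0 c1 c2 l)"
  using assms(1,3)
proof (induction l arbitrary: f0)
  case Nil
  thus ?case
    unfolding kint.simps
    using assms(2) tp_closed[of "[]"] rem_RT[of f0]
    by (intro linear_on_plus linear_on_minus module_A ip_linear2 C1.A_m_closed eps1_closed Q_RJ)
      simp_all
next
  case (Cons x l)
  hence x: "x \<in> RT R Q" "l \<in> lists (RT R Q)" "x # l \<in> lists (RT R Q)" by auto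
  show ?case
    unfolding kint.simps
    using assms(2) x Cons.prems tp_closed[OF x(3)] rem_RT[of f0]
    by (intro linear_on_plus linear_on_minus module_A ip_linear2 Cons.IH C1.A_m_closed
        eps1_closed Q_RJ)
      (simp_all add: RT_closed)
qed

text \<open>While entries stand before the marked one, the recursion strips them. When the marked
  entry comes first, it becomes a factor of the coefficient of the recursive call, where
  \<open>kint_linear0\<close> applies.\<close>

lemma kint_linear3:
  assumes "f0 \<in> carrier R" "c1 \<in> carrier C1" "c2 \<in> carrier C2"
    and "us \<in> lists (RT R Q)" "vs \<in> lists (RT R Q)"
  shows "linear_on K MT A (\<lambda>x. kint f0 c1 c2 (us @ [x] @ vs))"
  using assms(1,4)
proof (induction us arbitrary: f0)
  case Nil
  show ?case
    unfolding append_Nil append_Cons kint.simps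
    using assms(2-) Nil rem_RT[of f0] tp_linear[of "[]" vs] ip_linear3[of "Q f0" c1 c2 "[]" vs]
      ip_linear3[of \<one> c1 c2 "[rem f0]" vs]
    by (intro linear_on_plus linear_on_minus module_A
        linear_on_comp[OF linear_on_comp[OF linear_on_comp[OF _ eps1_linear_right]
            C1.mult_linear(2)] ip_linear1]
        linear_on_comp[OF linear_mult_RT(1) kint_linear0] Q_RJ) simp_all
next
  case (Cons u us)
  hence u: "u \<in> RT R Q" "us \<in> lists (RT R Q)" by auto
  show ?case
    unfolding append_Cons kint.simps
    using assms(2-) u Cons.prems rem_RT[of f0] tp_linear[of "u # us" vs]
      ip_linear3[of "Q f0" c1 c2 "u # us" vs] ip_linear3[of \<one> c1 c2 "rem f0 # u # us" vs]
      Cons.IH[of "Q f0 \<otimes> u"]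
    by (intro linear_on_plus linear_on_minus module_A
        linear_on_comp[OF linear_on_comp[OF linear_on_comp[OF _ eps1_linear_right]
            C1.mult_linear(2)] ip_linear1] Q_RJ) (simp_all add: RT_closed)
qed

text \<open>The description of the integral mentions the integral itself on shorter tensors.
  \<open>P1\<close> unfolds it by induction on the list, so that every map fulfilling it has the
  values \<open>kint\<close>; \<open>P2\<close> is the converse.\<close>

lemma IDR_integ_spec:
  shows "linear_on K A A (IDR_integ R Q)"
    and IDR_integ_ip: "\<lbrakk>f0 \<in> carrier R; c1 \<in> carrier C1; c2 \<in> carrier C2; l \<in> lists (RT R Q)\<rbrakk> \<Longrightarrow>
      IDR_integ R Q (ip f0 c1 c2 l) = kint f0 c1 c2 l"
proof -
  have ml: "multilinear_on K MT A (kint f0 c1 c2)"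
    if "f0 \<in> carrier R" "c1 \<in> carrier C1" "c2 \<in> carrier C2" for f0 c1 c2
    using that
    by (intro T.multilinear_onI kint_linear3) (simp_all add: kint_closed)
  obtain \<phi> where \<phi>: "linear_on K A A \<phi>"
    and \<phi>p: "\<And>f0 c1 c2 l. \<lbrakk>f0 \<in> carrier R; c1 \<in> carrier C1; c2 \<in> carrier C2; l \<in> lists (RT R Q)\<rbrakk>
      \<Longrightarrow> \<phi> (ip f0 c1 c2 l) = kint f0 c1 c2 l"
    by (rule A_ext[OF module_A kint_linear0 kint_linear1 kint_linear2 ml]) (assumption | rule that)+
  let ?P = "\<lambda>J. \<forall>f0\<in>carrier R. \<forall>c1\<in>carrier C1. \<forall>c2\<in>carrier C2.
          J (IDR_pure R Q f0 c1 c2 (T_pure R Q [])) =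
            IDR_pure R Q (Q f0) c1 c2 (T_pure R Q [])
            \<ominus>\<^bsub>A\<^esub> IDR_pure R Q \<one> (c1 \<otimes>\<^bsub>C1\<^esub> eps1 R Q (Q f0) (T_pure R Q [])) c2 (T_pure R Q [])
            \<oplus>\<^bsub>A\<^esub> IDR_pure R Q \<one> c1 c2 (T_pure R Q [f0 \<ominus> der R (Q f0)]) \<and>
          (\<forall>f1\<in>RT R Q. \<forall>f\<in>lists (RT R Q).
             J (IDR_pure R Q f0 c1 c2 (T_pure R Q (f1 # f))) =
               IDR_pure R Q (Q f0) c1 c2 (T_pure R Q (f1 # f))
               \<ominus>\<^bsub>A\<^esub> IDR_pure R Q \<one> (c1 \<otimes>\<^bsub>C1\<^esub> eps1 R Q (Q f0) (T_pure R Q (f1 # f)))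
                 c2 (T_pure R Q [])
               \<ominus>\<^bsub>A\<^esub> J (IDR_pure R Q (Q f0 \<otimes> f1) c1 c2 (T_pure R Q f))
               \<oplus>\<^bsub>A\<^esub> IDR_pure R Q \<one> c1 c2 (T_pure R Q ((f0 \<ominus> der R (Q f0)) # f1 # f)))"
  have P1: "J (ip f0 c1 c2 l) = kint f0 c1 c2 l"
    if "?P J" "f0 \<in> carrier R" "c1 \<in> carrier C1" "c2 \<in> carrier C2" "l \<in> lists (RT R Q)"
    for J f0 c1 c2 l
    using that(2,5)
  proof (induction l arbitrary: f0)
    case Nil
    thus ?case using that(1,3,4) by (simp add: ip_def T_pure_eq rem_def)
  next
    case (Cons x l)
    hence "Q f0 \<otimes> x \<in> carrier R" "x \<in> RT R Q" "l \<in> lists (RT R Q)" by (auto simp: RT_closed)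
    moreover from this have "J (ip (Q f0 \<otimes> x) c1 c2 l) = kint (Q f0 \<otimes> x) c1 c2 l"
      using Cons.IH by blast
    ultimately show ?case using that(1,3,4) Cons.prems by (simp add: ip_def T_pure_eq rem_def)
  qed
  have P2: "?P J"
    if "\<And>f0 c1 c2 l. \<lbrakk>f0 \<in> carrier R; c1 \<in> carrier C1; c2 \<in> carrier C2; l \<in> lists (RT R Q)\<rbrakk>
      \<Longrightarrow> J (ip f0 c1 c2 l) = kint f0 c1 c2 l" for J
    unfolding T_pure_eq ip_def[symmetric] rem_def[symmetric]
    by (simp add: that RT_closed)
  have "linear_map K A A (IDR_integ R Q) \<and> ?P (IDR_integ R Q)"
    unfolding IDR_integ_def
  proof (rule the_linear_map[OF module_A \<phi>])
    show "?P (restrict \<phi> (carrier A))" by (rule P2) (use \<phi>p in simp)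
  next
    fix f g x assume f: "linear_on K A A f" "?P f" and g: "linear_on K A A g" "?P g"
      and x: "x \<in> carrier A"
    show "f x = g x"
      by (rule linear_on_A_eqI[OF f(1) g(1) _ x]) (simp only: P1[OF f(2)] P1[OF g(2)])
  qed
  hence 1: "linear_map K A A (IDR_integ R Q)" and 2: "?P (IDR_integ R Q)" by blast+
  show "linear_on K A A (IDR_integ R Q)" using 1 by (rule linear_map_imp_linear_on)
  show "\<lbrakk>f0 \<in> carrier R; c1 \<in> carrier C1; c2 \<in> carrier C2; l \<in> lists (RT R Q)\<rbrakk> \<Longrightarrow>
      IDR_integ R Q (ip f0 c1 c2 l) = kint f0 c1 c2 l"
    by (rule P1[OF 2])
qed

end

section \<open>Evaluations\<close>

text \<open>The two shapes in which an element minus the integral of its derivative arises below.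
  The zero is the term whose first factor is \<open>rem (der R f)\<close>; \<open>z\<close> is the
  recursive integral, which the second summand of the derivative contributes with the opposite
  sign.\<close>

lemma (in abelian_group) minus_minus_cancel:
  assumes "x \<in> carrier G" "y \<in> carrier G"
  shows "x \<ominus> (x \<ominus> y \<oplus> \<zero>) = y" "z \<in> carrier G \<Longrightarrow> x \<ominus> ((x \<ominus> y \<ominus> z \<oplus> \<zero>) \<oplus> z) = y"
proof -
  have 1: "x \<ominus> (x \<ominus> y) = y"
    using assms by (simp add: a_minus_def minus_add r_neg2)
  thus "x \<ominus> (x \<ominus> y \<oplus> \<zero>) = y" using assms by simp
  assume "z \<in> carrier G"
  hence "x \<ominus> y \<ominus> z \<oplus> \<zero> \<oplus> z = x \<ominus> y"
    using assms by (simp add: a_minus_def a_assoc l_neg)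
  thus "x \<ominus> ((x \<ominus> y \<ominus> z \<oplus> \<zero>) \<oplus> z) = y" using 1 by simp
qed

context idr_setting begin

sublocale AM: module K A by (rule module_A)

lemma units_closed: "\<one>\<^bsub>C1\<^esub> \<in> carrier C1" "\<one>\<^bsub>C2\<^esub> \<in> carrier C2"
  by (rule C1.A_one_closed C2.A_one_closed)+

lemma units_mult:
  "c \<in> carrier C1 \<Longrightarrow> \<one>\<^bsub>C1\<^esub> \<otimes>\<^bsub>C1\<^esub> c = c" "c \<in> carrier C1 \<Longrightarrow> c \<otimes>\<^bsub>C1\<^esub> \<one>\<^bsub>C1\<^esub> = c"
  "d \<in> carrier C2 \<Longrightarrow> \<one>\<^bsub>C2\<^esub> \<otimes>\<^bsub>C2\<^esub> d = d" "d \<in> carrier C2 \<Longrightarrow> d \<otimes>\<^bsub>C2\<^esub> \<one>\<^bsub>C2\<^esub> = d"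
  using cring.cring_simprules(12)[OF C1.M_cring] cring.cring_simprules(12)[OF C2.M_cring]
    C1.A_m_comm C2.A_m_comm units_closed by metis+

lemma ip_zero:
  assumes "c1 \<in> carrier C1" "c2 \<in> carrier C2" "l \<in> lists (RT R Q)"
  shows "ip \<zero> c1 c2 l = \<zero>\<^bsub>A\<^esub>"
  using linear_on_zero[OF ip_linear0[OF assms] module_MR module_A] by simp

lemma rem_der: "f \<in> carrier R \<Longrightarrow> rem (der R f) = \<zero>"
  by (simp add: rem_def der_Q_der der_closed r_right_minus_eq)

text \<open>Here \<open>Q x = 0\<close> and \<open>rem x = x\<close>, so every other term of the
  integral vanishes. Integration thus turns the coefficient into a first tensor factor, which is why
  words correspond to nested integrals.\<close>

lemma kint_RT:
  assumes x: "x \<in> RT R Q" and c: "c1 \<in> carrier C1" "c2 \<in> carrier C2" and l: "l \<in> lists (RT R Q)"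
  shows "kint x c1 c2 l = ip \<one> c1 c2 (x # l)"
proof -
  have xR: "x \<in> carrier R" and Qx: "Q x = \<zero>" using x by (auto simp: RT_def)
  have rx: "rem x = x" using xR by (simp add: rem_def Qx a_minus_def)
  have e: "eps1 R Q \<zero> t = \<zero>\<^bsub>C1\<^esub>" if "t \<in> carrier T" for t
    using linear_on_zero[OF eps1_linear_left[OF that] module_MJ C1.module_axioms] by simp
  have m: "c1 \<otimes>\<^bsub>C1\<^esub> \<zero>\<^bsub>C1\<^esub> = \<zero>\<^bsub>C1\<^esub>"
    by (rule linear_on_zero[OF C1.mult_linear(2)[OF c(1)] C1.module_axioms C1.module_axioms])
  have i: "ip \<one> \<zero>\<^bsub>C1\<^esub> c2 [] = \<zero>\<^bsub>A\<^esub>"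
    using c by (intro linear_on_zero[OF ip_linear1 C1.module_axioms module_A]) auto
  have k: "kint \<zero> c1 c2 l = \<zero>\<^bsub>A\<^esub>" if "l \<in> lists (RT R Q)" for l
    using linear_on_zero[OF kint_linear0[OF c that] module_MR module_A] by simp
  have n: "\<zero>\<^bsub>A\<^esub> \<ominus>\<^bsub>A\<^esub> \<zero>\<^bsub>A\<^esub> = \<zero>\<^bsub>A\<^esub>"
    by (simp add: minus_eq_zero_iff[OF AM.abelian_group_axioms])
  show ?thesis
  proof (cases l)
    case Nil
    have "ip \<one> c1 c2 [x] \<in> carrier A" using x c by simp
    thus ?thesis unfolding Nil kint.simps Qx rx using c tp_closed[of "[]"]
      by (simp add: e m i ip_zero n)
  next
    case (Cons y ys)
    have ys: "y \<in> carrier R" "ys \<in> lists (RT R Q)" "y # ys \<in> lists (RT R Q)"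
      using l Cons RT_closed by auto
    have "ip \<one> c1 c2 (x # y # ys) \<in> carrier A" using x c ys by (intro ip_closed) auto
    thus ?thesis unfolding Cons kint.simps Qx rx using c ys tp_closed[OF ys(3)]
      by (simp add: e m i ip_zero n k del: in_lists_conv_set)
  qed
qed

definition EA where "EA x = x \<ominus>\<^bsub>A\<^esub> IDR_integ R Q (IDR_der R Q x)"

lemma EA_linear: "linear_on K A A EA"
proof -
  have "linear_on K A A (\<lambda>x. x)" by (rule linear_onI) auto
  thus ?thesis
    unfolding EA_def
    by (intro linear_on_minus module_A linear_on_comp[OF IDR_der_spec(1) IDR_integ_spec(1)])
qed

text \<open>For \<open>f\<close> in \<open>RJ R Q\<close> the quasi-integration undoes the
  derivation, \<open>Q (der R f) = f\<close>, and \<open>rem (der R f)\<close> is zero. So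
  integrating the derivative returns the element up to the epsilon term, and the recursive integral
  cancels against the second summand of the derivative.\<close>

lemma EA_RJ:
  assumes f: "f \<in> RJ R Q" and l: "l \<in> lists (RT R Q)"
  shows "EA (ip f \<one>\<^bsub>C1\<^esub> \<one>\<^bsub>C2\<^esub> l) = ip \<one> (eps1 R Q f (tp l)) \<one>\<^bsub>C2\<^esub> []"
proof -
  have fR: "f \<in> carrier R" and Qf: "Q (der R f) = f" using f by (auto simp: RJ_def Q_der_Q)
  note u = units_closed
  have e: "eps1 R Q f (tp l) \<in> carrier C1" using f l by (intro eps1_closed tp_closed)
  have z: "ip \<one> \<one>\<^bsub>C1\<^esub> \<one>\<^bsub>C2\<^esub> (\<zero> # l) = \<zero>\<^bsub>A\<^esub>"
    using linear_on_zero[OF ip_linear3[OF one_closed u lists.Nil l] module_MT module_A] by simp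
  show ?thesis
  proof (cases l)
    case Nil
    have "IDR_integ R Q (IDR_der R Q (ip f \<one>\<^bsub>C1\<^esub> \<one>\<^bsub>C2\<^esub> l)) =
        ip f \<one>\<^bsub>C1\<^esub> \<one>\<^bsub>C2\<^esub> l \<ominus>\<^bsub>A\<^esub> ip \<one> (eps1 R Q f (tp l)) \<one>\<^bsub>C2\<^esub> [] \<oplus>\<^bsub>A\<^esub> \<zero>\<^bsub>A\<^esub>"
      using fR u e z Nil
      by (simp add: IDR_der_ip IDR_integ_ip der_closed Qf rem_der units_mult)
    thus ?thesis
      unfolding EA_def using fR u e l AM.minus_minus_cancel(1) by simp
  next
    case (Cons x k)
    have x: "x \<in> RT R Q" "k \<in> lists (RT R Q)" "x \<in> carrier R" using l Cons RT_closed by auto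
    let ?Z = "kint (f \<otimes> x) \<one>\<^bsub>C1\<^esub> \<one>\<^bsub>C2\<^esub> k"
    have Z: "?Z \<in> carrier A" using fR u x by (intro kint_closed) auto
    have d: "IDR_der R Q (ip f \<one>\<^bsub>C1\<^esub> \<one>\<^bsub>C2\<^esub> l) =
        ip (der R f) \<one>\<^bsub>C1\<^esub> \<one>\<^bsub>C2\<^esub> l \<oplus>\<^bsub>A\<^esub> ip (f \<otimes> x) \<one>\<^bsub>C1\<^esub> \<one>\<^bsub>C2\<^esub> k"
      using fR u l Cons IDR_der_ip[OF fR u l] by simp
    have "IDR_integ R Q (IDR_der R Q (ip f \<one>\<^bsub>C1\<^esub> \<one>\<^bsub>C2\<^esub> l)) =
        kint (der R f) \<one>\<^bsub>C1\<^esub> \<one>\<^bsub>C2\<^esub> l \<oplus>\<^bsub>A\<^esub> ?Z"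
      unfolding d using fR u l x
      by (subst linear_on_add[OF IDR_integ_spec(1)])
        (simp_all add: IDR_integ_ip der_closed del: in_lists_conv_set)
    also have "kint (der R f) \<one>\<^bsub>C1\<^esub> \<one>\<^bsub>C2\<^esub> l =
        ip f \<one>\<^bsub>C1\<^esub> \<one>\<^bsub>C2\<^esub> l \<ominus>\<^bsub>A\<^esub> ip \<one> (eps1 R Q f (tp l)) \<one>\<^bsub>C2\<^esub> [] \<ominus>\<^bsub>A\<^esub> ?Z \<oplus>\<^bsub>A\<^esub> \<zero>\<^bsub>A\<^esub>"
      using e z Cons fR by (simp add: Qf rem_der units_mult)
    finally show ?thesis
      unfolding EA_def using fR u e l Z AM.minus_minus_cancel(2) by simp
  qed
qed

lemma IDR_der_ip_Nil:
  assumes "c1 \<in> carrier C1" "c2 \<in> carrier C2"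
  shows "IDR_der R Q (ip \<one> c1 c2 []) = \<zero>\<^bsub>A\<^esub>"
  using assms by (simp add: IDR_der_ip ip_zero)

lemma EA_Nil:
  assumes "c1 \<in> carrier C1" "c2 \<in> carrier C2"
  shows "EA (ip \<one> c1 c2 []) = ip \<one> c1 c2 []"
  using assms linear_on_zero[OF IDR_integ_spec(1) module_A module_A]
  by (simp add: EA_def IDR_der_ip_Nil a_minus_def)

text \<open>Differentiating a tensor with coefficient 1 moves \<open>x\<close> into the coefficient,
  and by \<open>kint_RT\<close> integration moves it back.\<close>

lemma EA_Cons:
  assumes c: "c1 \<in> carrier C1" "c2 \<in> carrier C2" and x: "x \<in> RT R Q" "l \<in> lists (RT R Q)"
  shows "EA (ip \<one> c1 c2 (x # l)) = \<zero>\<^bsub>A\<^esub>"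
proof -
  have xl: "x # l \<in> lists (RT R Q)" "x \<in> carrier R" using x RT_closed by auto
  have "IDR_der R Q (ip \<one> c1 c2 (x # l)) = ip x c1 c2 l"
    using c x xl by (simp add: IDR_der_ip ip_zero del: in_lists_conv_set)
  hence "IDR_integ R Q (IDR_der R Q (ip \<one> c1 c2 (x # l))) = ip \<one> c1 c2 (x # l)"
    using c x xl by (simp add: IDR_integ_ip kint_RT)
  thus ?thesis
    unfolding EA_def using c xl by (simp add: minus_eq_zero_iff[OF AM.abelian_group_axioms] del: in_lists_conv_set)
qed

text \<open>By linearity from the pure tensors; it is applied to shuffles, which are sums of
  such.\<close>

lemma EA_TP:
  assumes c: "c1 \<in> carrier C1" "c2 \<in> carrier C2" and t: "t \<in> carrier TP"
  shows "EA (IDR_pure R Q \<one> c1 c2 t) = \<zero>\<^bsub>A\<^esub>"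
proof -
  note lin = linear_on_comp[OF IDR_pure_linear[OF one_closed c] EA_linear]
  have sub: "tp ` (lists (RT R Q) - {[]}) \<subseteq> carrier T" by (auto intro: tp_closed)
  show ?thesis
    using module_T sub t[unfolded TP_simps]
  proof (induction rule: gen_submodule_induct)
    case zero
    show ?case by (rule linear_on_zero[OF lin module_T module_A])
  next
    case (gen y)
    then obtain l where l: "y = tp l" "l \<in> lists (RT R Q)" "l \<noteq> []" by blast
    then obtain x k where "l = x # k" "x \<in> RT R Q" "k \<in> lists (RT R Q)" by (cases l) auto
    thus ?case using EA_Cons[OF c] l by (simp add: ip_def)
  next
    case (add x y)
    thus ?case by (simp add: linear_on_add[OF lin])
  next
    case (smult k x)
    thus ?case by (simp add: linear_on_smult[OF lin])
  qed
qed

text \<open>The evaluation removes every summand of the product whose tensor has positive length.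
  Only the correction term with \<open>i = j = 0\<close> remains, in which both lists have gone
  entirely into the constant.\<close>

lemma EA_words:
  assumes U: "U \<in> lists (RT R Q)" "U \<noteq> []" and V: "V \<in> lists (RT R Q)" "V \<noteq> []"
  shows "EA (ip \<one> \<one>\<^bsub>C1\<^esub> \<one>\<^bsub>C2\<^esub> U \<otimes>\<^bsub>A\<^esub> ip \<one> \<one>\<^bsub>C1\<^esub> \<one>\<^bsub>C2\<^esub> V) =
    ip \<one> \<one>\<^bsub>C1\<^esub> (eps2 R Q (tp U) (tp V)) []"
proof -
  note u = units_closed
  define e where "e = ip \<one> \<one>\<^bsub>C1\<^esub> (eps2 R Q (tp U) (tp V)) []"
  define g where "g i j = IDR_pure R Q \<one> \<one>\<^bsub>C1\<^esub> (eps2 R Q (tp (drop i U)) (tp (drop j V)))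
    (sh (take i U) (take j V))" for i j
  have eps: "eps2 R Q (tp (drop i U)) (tp (drop j V)) \<in> carrier C2"
    if "i < length U" "j < length V" for i j
    using that U V by (intro eps2_tp_closed in_lists_drop) auto
  have g: "g i j \<in> carrier A" if "i < length U" "j < length V" for i j
    unfolding g_def using that U V u eps
    by (intro linear_on_closed[OF IDR_pure_linear] sh_closed in_lists_take) auto
  have e: "e \<in> carrier A" unfolding e_def using U V u by (intro ip_closed eps2_tp_closed) auto
  have s: "IDR_pure R Q \<one> \<one>\<^bsub>C1\<^esub> \<one>\<^bsub>C2\<^esub> (sh U V) \<in> carrier A"
    using U V u by (intro linear_on_closed[OF IDR_pure_linear] sh_closed) auto
  \<comment> \<open>The nested case distinction lets the double sum collapse one index at a
    time.\<close>
  have Eg: "EA (g i j) = (if 0 = i then if 0 = j then e else \<zero>\<^bsub>A\<^esub> else \<zero>\<^bsub>A\<^esub>)"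
    if "i < length U" "j < length V" for i j
  proof (cases "i = 0 \<and> j = 0")
    case True
    hence "g i j = e" unfolding g_def e_def ip_def by (simp add: sh_Nil)
    moreover have "EA e = e" unfolding e_def using eps[of 0 0] U V u by (intro EA_Nil) auto
    ultimately show ?thesis using True by simp
  next
    case False
    hence "sh (take i U) (take j V) \<in> carrier TP"
      using U V that by (intro sh_TP in_lists_take) auto
    hence "EA (g i j) = \<zero>\<^bsub>A\<^esub>" unfolding g_def using eps[OF that] u by (intro EA_TP)
    thus ?thesis using False by auto
  qed
  have inner: "(\<Oplus>\<^bsub>A\<^esub>j\<in>{0..<length V}. EA (g i j)) = (if 0 = i then e else \<zero>\<^bsub>A\<^esub>)"
    if i: "i < length U" for i
  proof -
    have "(\<Oplus>\<^bsub>A\<^esub>j\<in>{0..<length V}. EA (g i j)) =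
        (\<Oplus>\<^bsub>A\<^esub>j\<in>{0..<length V}. if 0 = j then (if 0 = i then e else \<zero>\<^bsub>A\<^esub>) else \<zero>\<^bsub>A\<^esub>)"
      using i e Eg by (intro AM.finsum_cong') auto
    also have "\<dots> = (if 0 = i then e else \<zero>\<^bsub>A\<^esub>)"
      using V e by (intro AM.add.finprod_singleton[of 0 _ "\<lambda>_. if 0 = i then e else \<zero>\<^bsub>A\<^esub>"]) auto
    finally show ?thesis .
  qed
  have "(\<Oplus>\<^bsub>A\<^esub>i\<in>{0..<length U}. \<Oplus>\<^bsub>A\<^esub>j\<in>{0..<length V}. EA (g i j)) =
      (\<Oplus>\<^bsub>A\<^esub>i\<in>{0..<length U}. if 0 = i then e else \<zero>\<^bsub>A\<^esub>)"
    using e inner by (intro AM.finsum_cong') auto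
  also have "\<dots> = e"
    using U e by (intro AM.add.finprod_singleton[of 0 _ "\<lambda>_. e"]) auto
  finally have sum: "(\<Oplus>\<^bsub>A\<^esub>i\<in>{0..<length U}. \<Oplus>\<^bsub>A\<^esub>j\<in>{0..<length V}. EA (g i j)) = e" .
  note fs = linear_on_finsum_apply[OF module_A module_A EA_linear]
  have Ecl: "EA (g i j) \<in> carrier A" if "i < length U" "j < length V" for i j
    using linear_on_closed[OF EA_linear g[OF that]] .
  have "EA (\<Oplus>\<^bsub>A\<^esub>i\<in>{0..<length U}. \<Oplus>\<^bsub>A\<^esub>j\<in>{0..<length V}. g i j) =
      (\<Oplus>\<^bsub>A\<^esub>i\<in>{0..<length U}. EA (\<Oplus>\<^bsub>A\<^esub>j\<in>{0..<length V}. g i j))"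
    using g by (intro fs) (auto intro!: AM.finsum_closed)
  also have "\<dots> = (\<Oplus>\<^bsub>A\<^esub>i\<in>{0..<length U}. \<Oplus>\<^bsub>A\<^esub>j\<in>{0..<length V}. EA (g i j))"
    using g Ecl by (intro AM.finsum_cong' fs) (auto intro!: AM.finsum_closed)
  finally have Esum: "EA (\<Oplus>\<^bsub>A\<^esub>i\<in>{0..<length U}. \<Oplus>\<^bsub>A\<^esub>j\<in>{0..<length V}. g i j) = e"
    using sum by simp
  have "EA (IDR_pure R Q \<one> \<one>\<^bsub>C1\<^esub> \<one>\<^bsub>C2\<^esub> (sh U V)) = \<zero>\<^bsub>A\<^esub>"
    using U V u by (intro EA_TP sh_TP) auto
  moreover have "(\<Oplus>\<^bsub>A\<^esub>i\<in>{0..<length U}. \<Oplus>\<^bsub>A\<^esub>j\<in>{0..<length V}. g i j) \<in> carrier A"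
    using g by (intro AM.finsum_closed) (auto intro!: AM.finsum_closed)
  ultimately show ?thesis
    unfolding A_mult_ip_words[OF U(1) V(1)] g_def[symmetric]
    using s Esum e by (simp add: linear_on_add[OF EA_linear] e_def)
qed

end

section \<open>The kernel of the homomorphism\<close>

locale idr_hom = idr_setting R Q + nested_integrals_indep R Q S I a
  for R :: "'a diff_ring" (structure) and Q :: "'a \<Rightarrow> 'a" and S :: "'a integro_diff_ring"
    and I :: "'i set" and a :: "'i \<Rightarrow> 'a" +
  fixes \<eta> :: "'a idr \<Rightarrow> 'a"
  assumes hom: "integro_diff_ring_hom (IDR R Q) S \<eta>"
    and \<eta>_iota: "\<And>f. f \<in> carrier R \<Longrightarrow> \<eta> (iota R Q f) = f"
    and constants_image: "constants (S\<lparr>carrier := \<eta> ` carrier (IDR R Q)\<rparr>) = constants R"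
begin

abbreviation "D \<equiv> IDR R Q"

lemma D_simps:
  "carrier D = carrier A" "ring.add D = ring.add A" "ring.zero D = ring.zero A"
  "monoid.mult D = monoid.mult A" "\<one>\<^bsub>D\<^esub> = \<one>\<^bsub>A\<^esub>" "der D = IDR_der R Q" "integ D = IDR_integ R Q"
  by (simp_all add: IDR_def)

sublocale D: integro_diff_ring D
  using hom by (simp add: integro_diff_ring_hom_def)

text \<open>The hypothesis on \<open>\<eta>\<close> contains that IDR(R) is an integro-differential
  ring; \<open>A\<close> is the same ring in another record type.\<close>

lemma cring_A: "cring A"
  by (rule cring_cong[OF D.is_cring]) (simp_all add: D_simps)

sublocale AC: cring A by (rule cring_A)

lemma
  shows \<eta>_closed: "x \<in> carrier A \<Longrightarrow> \<eta> x \<in> carrier S"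
    and \<eta>_add: "\<lbrakk>x \<in> carrier A; y \<in> carrier A\<rbrakk> \<Longrightarrow> \<eta> (x \<oplus>\<^bsub>A\<^esub> y) = \<eta> x \<oplus>\<^bsub>S\<^esub> \<eta> y"
    and \<eta>_mult: "\<lbrakk>x \<in> carrier A; y \<in> carrier A\<rbrakk> \<Longrightarrow> \<eta> (x \<otimes>\<^bsub>A\<^esub> y) = \<eta> x \<otimes>\<^bsub>S\<^esub> \<eta> y"
    and \<eta>_one: "\<eta> \<one>\<^bsub>A\<^esub> = \<one>\<^bsub>S\<^esub>"
    and \<eta>_der: "x \<in> carrier A \<Longrightarrow> \<eta> (IDR_der R Q x) = der S (\<eta> x)"
    and \<eta>_integ: "x \<in> carrier A \<Longrightarrow> \<eta> (IDR_integ R Q x) = integ S (\<eta> x)"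
  using hom
  by (auto simp: integro_diff_ring_hom_def integro_diff_ring_hom_axioms_def ring_hom_def D_simps)

lemma \<eta>_minus:
  assumes "x \<in> carrier A" "y \<in> carrier A"
  shows "\<eta> (x \<ominus>\<^bsub>A\<^esub> y) = \<eta> x \<ominus>\<^bsub>S\<^esub> \<eta> y"
proof -
  have "x \<ominus>\<^bsub>A\<^esub> y \<oplus>\<^bsub>A\<^esub> y = x"
    using assms by (simp add: a_minus_def AM.a_assoc AM.l_neg)
  hence "\<eta> x = \<eta> (x \<ominus>\<^bsub>A\<^esub> y) \<oplus>\<^bsub>S\<^esub> \<eta> y"
    using \<eta>_add[of "x \<ominus>\<^bsub>A\<^esub> y" y] assms by simp
  thus ?thesis
    using assms \<eta>_closed by (simp add: a_minus_def S.a_assoc S.r_neg)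
qed

lemma \<eta>_EA:
  assumes "x \<in> carrier A" shows "\<eta> (EA x) = evaluation S (\<eta> x)"
  using assms linear_on_closed[OF IDR_integ_spec(1)] linear_on_closed[OF IDR_der_spec(1)]
  by (simp add: EA_def evaluation_def \<eta>_minus \<eta>_integ \<eta>_der)

end

context idr_hom begin

abbreviation "emb r \<equiv> ip r \<one>\<^bsub>C1\<^esub> \<one>\<^bsub>C2\<^esub> []"
abbreviation "word l \<equiv> ip \<one> \<one>\<^bsub>C1\<^esub> \<one>\<^bsub>C2\<^esub> l"
abbreviation "const1 c \<equiv> ip \<one> c \<one>\<^bsub>C2\<^esub> []"
abbreviation "const2 c \<equiv> ip \<one> \<one>\<^bsub>C1\<^esub> c []"

lemma iota_eq: "iota R Q f = emb f"
  by (simp add: iota_def ip_def T_pure_eq)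

lemma one_A_eq: "\<one>\<^bsub>A\<^esub> = emb \<one>"
  by (simp add: IDR_alg_def tensor_algebras_def C1C2T_alg_def C2T_alg_def ip_eq C2T_pure_eq T_pure_eq)

lemma map_a_RT: "V \<in> lists I \<Longrightarrow> map a V \<in> lists (RT R Q)"
  using a_RT by auto

lemma emb_closed: "r \<in> carrier R \<Longrightarrow> emb r \<in> carrier A"
  using units_closed by simp

lemma word_closed: "l \<in> lists (RT R Q) \<Longrightarrow> word l \<in> carrier A"
  using units_closed by (intro ip_closed) auto

lemma const_closed: "c \<in> carrier C1 \<Longrightarrow> const1 c \<in> carrier A" "d \<in> carrier C2 \<Longrightarrow> const2 d \<in> carrier A"
  using units_closed by simp_all

text \<open>Each of the four factors can then be treated modulo \<open>J\<close> on its own.\<close>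

lemma ip_decomp:
  assumes "f0 \<in> carrier R" "c1 \<in> carrier C1" "c2 \<in> carrier C2" "l \<in> lists (RT R Q)"
  shows "ip f0 c1 c2 l = emb f0 \<otimes>\<^bsub>A\<^esub> (const1 c1 \<otimes>\<^bsub>A\<^esub> (const2 c2 \<otimes>\<^bsub>A\<^esub> word l))"
  using assms units_closed
  by (simp add: A_mult_ip_Nil units_mult C1.A_m_closed C2.A_m_closed del: in_lists_conv_set)

lemma emb_word: "\<lbrakk>r \<in> carrier R; l \<in> lists (RT R Q)\<rbrakk> \<Longrightarrow> emb r \<otimes>\<^bsub>A\<^esub> word l = ip r \<one>\<^bsub>C1\<^esub> \<one>\<^bsub>C2\<^esub> l"
  using units_closed by (simp add: A_mult_ip_Nil units_mult del: in_lists_conv_set)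

lemma emb_add: "\<lbrakk>r \<in> carrier R; s \<in> carrier R\<rbrakk> \<Longrightarrow> emb (r \<oplus> s) = emb r \<oplus>\<^bsub>A\<^esub> emb s"
  using linear_on_add[OF ip_linear0[OF units_closed lists.Nil]] by simp

lemma emb_mult: "\<lbrakk>r \<in> carrier R; s \<in> carrier R\<rbrakk> \<Longrightarrow> emb (r \<otimes> s) = emb r \<otimes>\<^bsub>A\<^esub> emb s"
  using units_closed by (simp add: A_mult_ip_Nil units_mult)

lemma const1_linear: "linear_on K C1 A (\<lambda>c. const1 c)"
  and const2_linear: "linear_on K C2 A (\<lambda>c. const2 c)"
  using units_closed by (auto intro!: ip_linear1 ip_linear2)

lemma const1_mult: "\<lbrakk>c \<in> carrier C1; d \<in> carrier C1\<rbrakk> \<Longrightarrow>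
    const1 (c \<otimes>\<^bsub>C1\<^esub> d) = const1 c \<otimes>\<^bsub>A\<^esub> const1 d"
  and const2_mult: "\<lbrakk>c' \<in> carrier C2; d' \<in> carrier C2\<rbrakk> \<Longrightarrow>
    const2 (c' \<otimes>\<^bsub>C2\<^esub> d') = const2 c' \<otimes>\<^bsub>A\<^esub> const2 d'"
  using units_closed by (simp_all add: A_mult_ip_Nil units_mult)

lemma smult_ip:
  "\<lbrakk>\<gamma> \<in> constants R; f0 \<in> carrier R; c1 \<in> carrier C1; c2 \<in> carrier C2; l \<in> lists (RT R Q)\<rbrakk> \<Longrightarrow>
    \<gamma> \<odot>\<^bsub>A\<^esub> ip f0 c1 c2 l = ip (\<gamma> \<otimes> f0) c1 c2 l"
  using linear_on_smult[OF ip_linear0, of c1 c2 l \<gamma> f0] by simp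

text \<open>On pure elements both sides multiply the coefficient in \<open>R\<close>. This links the
  module structure over the constants with the ring structure, in which \<open>J\<close> is an
  ideal.\<close>

lemma smult_emb:
  assumes "\<gamma> \<in> constants R" "x \<in> carrier A"
  shows "\<gamma> \<odot>\<^bsub>A\<^esub> x = emb \<gamma> \<otimes>\<^bsub>A\<^esub> x"
  using assms(2)
proof (induction rule: A_induct)
  case (pure f0 c1 c2 l)
  thus ?case using assms(1) constants_closed units_closed
    by (simp add: smult_ip A_mult_ip_Nil units_mult del: in_lists_conv_set)
next
  case (add x y)
  thus ?case using assms(1) emb_closed constants_closed by (simp add: AM.smult_r_distr AC.r_distr)
qed

lemma const_scalar:
  "\<gamma> \<in> constants R \<Longrightarrow> const1 (\<gamma> \<odot>\<^bsub>C1\<^esub> \<one>\<^bsub>C1\<^esub>) = emb \<gamma>"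
  "\<gamma> \<in> constants R \<Longrightarrow> const2 (\<gamma> \<odot>\<^bsub>C2\<^esub> \<one>\<^bsub>C2\<^esub>) = emb \<gamma>"
  using linear_on_smult[OF const1_linear, of \<gamma> "\<one>\<^bsub>C1\<^esub>"] linear_on_smult[OF const2_linear, of \<gamma> "\<one>\<^bsub>C2\<^esub>"]
    units_closed constants_closed by (simp_all add: smult_ip)

lemma \<eta>_emb: "f \<in> carrier R \<Longrightarrow> \<eta> (emb f) = f"
  using \<eta>_iota by (simp add: iota_eq)

text \<open>Formulated for an arbitrary \<open>h\<close>, since it serves for \<open>\<eta>\<close>
  and again for the competing homomorphism in the uniqueness proof. A word is an iterated integral
  of its letters by \<open>kint_RT\<close>, and \<open>h\<close> commutes with products and
  integrals.\<close>

lemma word_image: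
  assumes mult: "\<And>x y. \<lbrakk>x \<in> carrier A; y \<in> carrier A\<rbrakk> \<Longrightarrow> h (x \<otimes>\<^bsub>A\<^esub> y) = h x \<otimes>\<^bsub>S\<^esub> h y"
    and int: "\<And>x. x \<in> carrier A \<Longrightarrow> h (IDR_integ R Q x) = integ S (h x)"
    and emb: "\<And>r. r \<in> carrier R \<Longrightarrow> h (emb r) = r"
    and V: "V \<in> lists I"
  shows "h (word (map a V)) = nint V"
  using V
proof (induction V)
  case Nil
  show ?case using emb[OF one_closed] by (simp add: one_eq)
next
  case (Cons i V)
  have l: "map a V \<in> lists (RT R Q)" using map_a_RT Cons(2) by blast
  note i = a_R[OF Cons(1)] a_RT[OF Cons(1)]
  have "word (map a (i # V)) = IDR_integ R Q (ip (a i) \<one>\<^bsub>C1\<^esub> \<one>\<^bsub>C2\<^esub> (map a V))"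
    using i l units_closed by (simp add: IDR_integ_ip kint_RT del: in_lists_conv_set)
  also have "h \<dots> = integ S (h (ip (a i) \<one>\<^bsub>C1\<^esub> \<one>\<^bsub>C2\<^esub> (map a V)))"
    using i l units_closed by (intro int ip_closed)
  also have "ip (a i) \<one>\<^bsub>C1\<^esub> \<one>\<^bsub>C2\<^esub> (map a V) = emb (a i) \<otimes>\<^bsub>A\<^esub> word (map a V)"
    using i l by (simp add: emb_word)
  also have "h \<dots> = a i \<otimes>\<^bsub>S\<^esub> nint V"
    using i l Cons.IH by (simp add: mult emb_closed word_closed emb)
  finally show ?case by simp
qed

lemma \<eta>_word: "V \<in> lists I \<Longrightarrow> \<eta> (word (map a V)) = nint V"
  by (rule word_image) (simp_all add: \<eta>_mult \<eta>_integ \<eta>_emb)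

subsection \<open>The generators of the ideal\<close>

abbreviation "J \<equiv> eval_ideal R Q S I a"
abbreviation "tw V \<equiv> tp (map a V)"

lemma tw_closed: "V \<in> lists I \<Longrightarrow> tw V \<in> carrier T"
  by (intro tp_closed map_a_RT)

definition gens1 where
  "gens1 = {const1 (eps1 R Q f (tw V) \<ominus>\<^bsub>C1\<^esub> evaluation S (f \<otimes>\<^bsub>S\<^esub> nint V) \<odot>\<^bsub>C1\<^esub> \<one>\<^bsub>C1\<^esub>) | f V.
    f \<in> RJ R Q \<and> V \<in> lists I}"

definition gens2 where
  "gens2 = {const2 (eps2 R Q (tw U) (tw V) \<ominus>\<^bsub>C2\<^esub> evaluation S (nint U \<otimes>\<^bsub>S\<^esub> nint V) \<odot>\<^bsub>C2\<^esub> \<one>\<^bsub>C2\<^esub>)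
    | U V. U \<in> lists I - {[]} \<and> V \<in> lists I - {[]}}"

lemma J_eq: "J = Idl\<^bsub>D\<^esub> (gens1 \<union> gens2)"
  unfolding eval_ideal_def Let_def gens1_def gens2_def word_tensor_def T_pure_eq ip_def ..

lemma \<eta>_zero: "\<eta> \<zero>\<^bsub>A\<^esub> = \<zero>\<^bsub>S\<^esub>"
  using \<eta>_minus[of "\<zero>\<^bsub>A\<^esub>" "\<zero>\<^bsub>A\<^esub>"] \<eta>_closed[of "\<zero>\<^bsub>A\<^esub>"]
  by (simp add: minus_eq_zero_iff[OF AM.abelian_group_axioms] minus_eq_zero_iff[OF S.abelian_group_axioms])
    (metis AM.zero_closed AM.minus_closed S.minus_eq S.r_neg minus_eq_zero_iff[OF AM.abelian_group_axioms])

text \<open>Such elements are constants of IDR(R), so their images are constants of the image ring,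
  which by hypothesis are those of \<open>R\<close>.\<close>

lemma \<eta>_ip_const:
  assumes "c1 \<in> carrier C1" "c2 \<in> carrier C2"
  shows "\<eta> (ip \<one> c1 c2 []) \<in> constants R"
proof -
  have cl: "ip \<one> c1 c2 [] \<in> carrier A" using assms by simp
  have "der S (\<eta> (ip \<one> c1 c2 [])) = \<zero>\<^bsub>S\<^esub>"
    using \<eta>_der[OF cl] IDR_der_ip_Nil[OF assms] \<eta>_zero by simp
  hence "\<eta> (ip \<one> c1 c2 []) \<in> constants (S\<lparr>carrier := \<eta> ` carrier D\<rparr>)"
    using cl by (simp add: constants_def D_simps)
  thus ?thesis unfolding constants_image .
qed

text \<open>A homomorphism commutes with evaluation, so applying \<open>\<eta>\<close> to
  \<open>EA_RJ\<close> identifies the evaluation in \<open>S\<close> with the image of a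
  constant.\<close>

lemma evaluation1:
  assumes f: "f \<in> RJ R Q" and V: "V \<in> lists I"
  shows "eps1 R Q f (tw V) \<in> carrier C1"
    and "evaluation S (f \<otimes>\<^bsub>S\<^esub> nint V) = \<eta> (const1 (eps1 R Q f (tw V)))"
    and "evaluation S (f \<otimes>\<^bsub>S\<^esub> nint V) \<in> constants R"
proof -
  have l: "map a V \<in> lists (RT R Q)" and fR: "f \<in> carrier R"
    using map_a_RT V RJ_closed f by auto
  show e: "eps1 R Q f (tw V) \<in> carrier C1" using f tw_closed[OF V] by (rule eps1_closed)
  have cl: "ip f \<one>\<^bsub>C1\<^esub> \<one>\<^bsub>C2\<^esub> (map a V) \<in> carrier A" using fR l units_closed by (intro ip_closed)
  have "\<eta> (ip f \<one>\<^bsub>C1\<^esub> \<one>\<^bsub>C2\<^esub> (map a V)) = f \<otimes>\<^bsub>S\<^esub> nint V"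
    using fR l \<eta>_word[OF V] unfolding emb_word[OF fR l, symmetric]
    by (simp add: \<eta>_mult emb_closed word_closed \<eta>_emb)
  thus 2: "evaluation S (f \<otimes>\<^bsub>S\<^esub> nint V) = \<eta> (const1 (eps1 R Q f (tw V)))"
    using \<eta>_EA[OF cl] EA_RJ[OF f l] by simp
  show "evaluation S (f \<otimes>\<^bsub>S\<^esub> nint V) \<in> constants R"
    unfolding 2 using e units_closed by (intro \<eta>_ip_const)
qed

lemma evaluation2:
  assumes U: "U \<in> lists I" "U \<noteq> []" and V: "V \<in> lists I" "V \<noteq> []"
  shows "eps2 R Q (tw U) (tw V) \<in> carrier C2"
    and "evaluation S (nint U \<otimes>\<^bsub>S\<^esub> nint V) = \<eta> (const2 (eps2 R Q (tw U) (tw V)))"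
    and "evaluation S (nint U \<otimes>\<^bsub>S\<^esub> nint V) \<in> constants R"
proof -
  have l: "map a U \<in> lists (RT R Q)" "map a V \<in> lists (RT R Q)" "map a U \<noteq> []" "map a V \<noteq> []"
    using map_a_RT U V by auto
  show e: "eps2 R Q (tw U) (tw V) \<in> carrier C2" using l by (intro eps2_tp_closed)
  have cl: "word (map a U) \<otimes>\<^bsub>A\<^esub> word (map a V) \<in> carrier A"
    using l word_closed by (intro AC.m_closed)
  have "\<eta> (word (map a U) \<otimes>\<^bsub>A\<^esub> word (map a V)) = nint U \<otimes>\<^bsub>S\<^esub> nint V"
    using l U V by (simp add: \<eta>_mult word_closed \<eta>_word)
  thus 2: "evaluation S (nint U \<otimes>\<^bsub>S\<^esub> nint V) = \<eta> (const2 (eps2 R Q (tw U) (tw V)))"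
    using \<eta>_EA[OF cl] EA_words[OF l(1,3,2,4)] by simp
  show "evaluation S (nint U \<otimes>\<^bsub>S\<^esub> nint V) \<in> constants R"
    unfolding 2 using e units_closed by (intro \<eta>_ip_const)
qed

lemma const_gen:
  "\<lbrakk>c \<in> carrier C1; \<gamma> \<in> constants R\<rbrakk> \<Longrightarrow>
    const1 (c \<ominus>\<^bsub>C1\<^esub> \<gamma> \<odot>\<^bsub>C1\<^esub> \<one>\<^bsub>C1\<^esub>) = const1 c \<ominus>\<^bsub>A\<^esub> emb \<gamma>"
  "\<lbrakk>d \<in> carrier C2; \<gamma> \<in> constants R\<rbrakk> \<Longrightarrow>
    const2 (d \<ominus>\<^bsub>C2\<^esub> \<gamma> \<odot>\<^bsub>C2\<^esub> \<one>\<^bsub>C2\<^esub>) = const2 d \<ominus>\<^bsub>A\<^esub> emb \<gamma>"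
  using linear_on_diff[OF const1_linear C1.module_axioms module_A, of c "\<gamma> \<odot>\<^bsub>C1\<^esub> \<one>\<^bsub>C1\<^esub>"]
    linear_on_diff[OF const2_linear C2.module_axioms module_A, of d "\<gamma> \<odot>\<^bsub>C2\<^esub> \<one>\<^bsub>C2\<^esub>"] units_closed
  by (simp_all add: const_scalar C1.smult_closed C2.smult_closed)

definition ker where "ker = {x \<in> carrier A. \<eta> x = \<zero>\<^bsub>S\<^esub>}"

lemma gens_ker: "gens1 \<union> gens2 \<subseteq> ker"
proof
  \<comment> \<open>Both kinds of generators have the shape \<open>x\<close> minus the embedded
    constant \<open>\<eta> x\<close>, and \<open>\<eta>\<close> takes an embedded constant back to
    that constant.\<close>
  have z: "const \<ominus>\<^bsub>A\<^esub> emb (\<eta> const) \<in> ker" if "const \<in> carrier A" "\<eta> const \<in> constants R" for const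
    using that emb_closed[OF constants_closed] \<eta>_minus[of const "emb (\<eta> const)"]
      \<eta>_emb[OF constants_closed] \<eta>_closed
    by (simp add: ker_def minus_eq_zero_iff[OF S.abelian_group_axioms])
  fix x assume "x \<in> gens1 \<union> gens2"
  then consider f V where "f \<in> RJ R Q" "V \<in> lists I"
      "x = const1 (eps1 R Q f (tw V) \<ominus>\<^bsub>C1\<^esub> evaluation S (f \<otimes>\<^bsub>S\<^esub> nint V) \<odot>\<^bsub>C1\<^esub> \<one>\<^bsub>C1\<^esub>)"
    | U V where "U \<in> lists I" "U \<noteq> []" "V \<in> lists I" "V \<noteq> []"
      "x = const2 (eps2 R Q (tw U) (tw V) \<ominus>\<^bsub>C2\<^esub> evaluation S (nint U \<otimes>\<^bsub>S\<^esub> nint V) \<odot>\<^bsub>C2\<^esub> \<one>\<^bsub>C2\<^esub>)"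
    unfolding gens1_def gens2_def by blast
  thus "x \<in> ker"
  proof cases
    case 1
    note e = evaluation1[OF 1(1,2)]
    show ?thesis unfolding 1(3) const_gen(1)[OF e(1,3)] unfolding e(2)
      by (rule z[OF const_closed(1)[OF e(1)] e(3)[unfolded e(2)]])
  next
    case 2
    note e = evaluation2[OF 2(1-4)]
    show ?thesis unfolding 2(5) const_gen(2)[OF e(1,3)] unfolding e(2)
      by (rule z[OF const_closed(2)[OF e(1)] e(3)[unfolded e(2)]])
  qed
qed

lemma ring_hom_\<eta>: "ring_hom_ring D S \<eta>"
  using hom by (intro ring_hom_ringI2 D.ring_axioms S.ring_axioms)
    (simp add: integro_diff_ring_hom_def integro_diff_ring_hom_axioms_def)

lemma ideal_ker: "ideal ker D"
  using ring_hom_ring.kernel_is_ideal[OF ring_hom_\<eta>]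
  by (simp add: a_kernel_def' ker_def D_simps)

lemma gens_closed: "gens1 \<union> gens2 \<subseteq> carrier D"
  using gens_ker by (auto simp: ker_def D_simps)

lemma ideal_J: "ideal J D"
  unfolding J_eq by (rule D.genideal_ideal[OF gens_closed])

lemma J_ker: "J \<subseteq> ker"
  unfolding J_eq by (rule D.genideal_minimal[OF ideal_ker gens_ker])

sublocale J: ideal J D by (rule ideal_J)

abbreviation "q x \<equiv> J +>\<^bsub>D\<^esub> x"
abbreviation "QR \<equiv> D Quot J"

lemma q_mult: "\<lbrakk>x \<in> carrier A; y \<in> carrier A\<rbrakk> \<Longrightarrow> q (x \<otimes>\<^bsub>A\<^esub> y) = q x \<otimes>\<^bsub>QR\<^esub> q y"
  and q_add: "\<lbrakk>x \<in> carrier A; y \<in> carrier A\<rbrakk> \<Longrightarrow> q (x \<oplus>\<^bsub>A\<^esub> y) = q x \<oplus>\<^bsub>QR\<^esub> q y"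
  using J.rcos_ring_hom by (auto simp: ring_hom_def D_simps)

lemma q_memE:
  assumes "y \<in> q x"
  obtains h where "h \<in> J" "y = h \<oplus>\<^bsub>A\<^esub> x"
  using assms by (auto simp: a_r_coset_def' D_simps)

lemma q_self: "x \<in> carrier A \<Longrightarrow> x \<in> q x"
  using J.a_rcos_self by (simp add: D_simps)

lemma q_eqI:
  assumes x: "x \<in> carrier A" and y: "y \<in> carrier A" and J: "x \<ominus>\<^bsub>A\<^esub> y \<in> J"
  shows "q x = q y"
proof -
  have "x = (x \<ominus>\<^bsub>A\<^esub> y) \<oplus>\<^bsub>A\<^esub> y" using x y by (simp add: a_minus_def AM.a_assoc AM.l_neg)
  hence "x \<in> q y" using J by (auto simp: a_r_coset_def' D_simps)
  thus ?thesis using J.a_repr_independence'[of x y] y by (simp add: D_simps)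
qed

subsection \<open>The constants modulo the ideal\<close>

definition scalar_mod where "scalar_mod x \<longleftrightarrow> (\<exists>\<gamma>\<in>constants R. q x = q (emb \<gamma>))"

lemma constants_ops:
  "\<lbrakk>c \<in> constants R; d \<in> constants R\<rbrakk> \<Longrightarrow> c \<oplus> d \<in> constants R"
  "\<lbrakk>c \<in> constants R; d \<in> constants R\<rbrakk> \<Longrightarrow> c \<otimes> d \<in> constants R"
  by (simp_all add: constants_def der_add der_mult)

lemma scalar_mod_emb: "\<gamma> \<in> constants R \<Longrightarrow> scalar_mod (emb \<gamma>)"
  unfolding scalar_mod_def by blast

lemma scalar_mod_add:
  assumes "scalar_mod x" "scalar_mod y" "x \<in> carrier A" "y \<in> carrier A"
  shows "scalar_mod (x \<oplus>\<^bsub>A\<^esub> y)"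
proof -
  obtain \<gamma> \<delta> where g: "\<gamma> \<in> constants R" "q x = q (emb \<gamma>)" "\<delta> \<in> constants R" "q y = q (emb \<delta>)"
    using assms unfolding scalar_mod_def by blast
  have "q (x \<oplus>\<^bsub>A\<^esub> y) = q (emb (\<gamma> \<oplus> \<delta>))"
    using assms g constants_closed by (simp add: q_add emb_add emb_closed)
  thus ?thesis unfolding scalar_mod_def using constants_ops(1)[OF g(1,3)] by blast
qed

lemma scalar_mod_mult:
  assumes "scalar_mod x" "scalar_mod y" "x \<in> carrier A" "y \<in> carrier A"
  shows "scalar_mod (x \<otimes>\<^bsub>A\<^esub> y)"
proof -
  obtain \<gamma> \<delta> where g: "\<gamma> \<in> constants R" "q x = q (emb \<gamma>)" "\<delta> \<in> constants R" "q y = q (emb \<delta>)"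
    using assms unfolding scalar_mod_def by blast
  have "q (x \<otimes>\<^bsub>A\<^esub> y) = q (emb (\<gamma> \<otimes> \<delta>))"
    using assms g constants_closed by (simp add: q_mult emb_mult emb_closed)
  thus ?thesis unfolding scalar_mod_def using constants_ops(2)[OF g(1,3)] by blast
qed

lemma scalar_mod_smult:
  assumes "\<gamma> \<in> constants R" "scalar_mod x" "x \<in> carrier A"
  shows "scalar_mod (\<gamma> \<odot>\<^bsub>A\<^esub> x)"
  using assms scalar_mod_mult[OF scalar_mod_emb] emb_closed constants_closed by (simp add: smult_emb)

lemma scalar_mod_zero: "scalar_mod \<zero>\<^bsub>A\<^esub>"
proof -
  have "emb \<zero> = \<zero>\<^bsub>A\<^esub>" using units_closed by (intro ip_zero) auto
  moreover have "\<zero> \<in> constants R" by (simp add: constants_def)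
  ultimately show ?thesis using scalar_mod_emb by metis
qed

text \<open>Elements that are scalar modulo \<open>J\<close> are closed under the module operations.
  This allows restricting attention to words, for which \<open>J\<close> has generators.\<close>

lemma scalar_mod_linear:
  assumes lin: "linear_on K N A f" and N: "module K N" "Y \<subseteq> carrier N"
    and gen: "\<And>y. y \<in> Y \<Longrightarrow> scalar_mod (f y)" and x: "x \<in> gen_submodule K N Y"
  shows "scalar_mod (f x)"
  using N x
proof (induction rule: gen_submodule_induct)
  case zero
  show ?case using linear_on_zero[OF lin N(1) module_A] scalar_mod_zero by simp
next
  case (gen y)
  thus ?case by (rule assms(4))
next
  case (add x y)
  thus ?case by (simp add: linear_on_add[OF lin] scalar_mod_add linear_on_closed[OF lin])
next
  case (smult c x)
  thus ?case by (simp add: linear_on_smult[OF lin] scalar_mod_smult linear_on_closed[OF lin])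
qed

text \<open>The entries \<open>map a V\<close> are already basis elements, those of \<open>l\<close>
  still arbitrary. Expanding the first entry of \<open>l\<close> in the basis moves a letter to
  \<open>V\<close>. The length is recorded so that tensors of positive length are spanned by
  nonempty words.\<close>

lemma tp_span_words:
  assumes "l \<in> lists (RT R Q)" "V \<in> lists I"
  shows "tp (map a V @ l) \<in> gen_submodule K T {tw U | U. U \<in> lists I \<and> length U = length V + length l}"
  using assms
proof (induction l arbitrary: V)
  case Nil
  have "tw V \<in> {tw U | U. U \<in> lists I \<and> length U = length V + length []}" using Nil by auto
  from subsetD[OF gen_submodule_superset this] show ?case by simp
next
  case (Cons x l)
  let ?G = "{tw U | U. U \<in> lists I \<and> length U = length V + Suc (length l)}"
  have G: "?G \<subseteq> carrier T" using tw_closed by auto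
  note sub = gen_submodule_is_submodule[OF module_T G]
  have l: "map a V \<in> lists (RT R Q)" using map_a_RT Cons by blast
  note lin = tp_linear[OF l Cons(2)]
  have x: "x \<in> gen_submodule K MT (a ` I)" using Cons(1) basis by (simp add: module_basis_def)
  have aI: "a ` I \<subseteq> carrier MT" using a_RT by auto
  have "tp (map a V @ [x] @ l) \<in> gen_submodule K T ?G"
    using module_MT aI x
  proof (induction rule: gen_submodule_induct)
    case zero
    show ?case
      unfolding linear_on_zero[OF lin module_MT module_T]
      using subgroup.one_closed[OF submodule.axioms(1)[OF sub]] by simp
  next
    case (gen y)
    then obtain i where i: "i \<in> I" "y = a i" by blast
    have "tp (map a (V @ [i]) @ l) \<in>
        gen_submodule K T {tw U | U. U \<in> lists I \<and> length U = length (V @ [i]) + length l}"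
      using i Cons by (intro Cons.IH) auto
    thus ?case using i by simp
  next
    case (add y z)
    thus ?case unfolding linear_on_add[OF lin add(1,2)] using T.T.submoduleE(5)[OF sub] by blast
  next
    case (smult c y)
    thus ?case unfolding linear_on_smult[OF lin smult(1,2)] using T.T.submoduleE(4)[OF sub] by blast
  qed
  thus ?case by simp
qed

lemma T_span: "gen_submodule K T (tw ` lists I) = carrier T"
proof
  have sub: "tw ` lists I \<subseteq> carrier T" using tw_closed by auto
  note H = gen_submodule_is_submodule[OF module_T sub]
  show "gen_submodule K T (tw ` lists I) \<subseteq> carrier T" by (rule gen_submodule_closed[OF module_T sub])
  show "carrier T \<subseteq> gen_submodule K T (tw ` lists I)"
  proof
    fix t assume "t \<in> carrier T"
    thus "t \<in> gen_submodule K T (tw ` lists I)"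
    proof (induction rule: T.tensor_powers_induct)
      case zero
      show ?case using subgroup.one_closed[OF submodule.axioms(1)[OF H]] by simp
    next
      case (pure c l)
      have "gen_submodule K T {tw U | U. U \<in> lists I \<and> length U = length [] + length l}
          \<subseteq> gen_submodule K T (tw ` lists I)"
        by (rule gen_submodule_minimal[OF H subset_trans[OF _ gen_submodule_superset]]) auto
      hence "tp l \<in> gen_submodule K T (tw ` lists I)"
        using tp_span_words[of l "[]"] pure by auto
      thus ?case using T.T.submoduleE(4)[OF H] pure(1) by blast
    next
      case (add s t)
      thus ?case using T.T.submoduleE(5)[OF H] by blast
    qed
  qed
qed

lemma TP_span: "carrier TP \<subseteq> gen_submodule K T (tw ` (lists I - {[]}))"
proof -
  have sub: "tw ` (lists I - {[]}) \<subseteq> carrier T" using tw_closed by auto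
  note H = gen_submodule_is_submodule[OF module_T sub]
  have "tp l \<in> gen_submodule K T (tw ` (lists I - {[]}))" if "l \<in> lists (RT R Q)" "l \<noteq> []" for l
  proof -
    have "gen_submodule K T {tw U | U. U \<in> lists I \<and> length U = length [] + length l}
        \<subseteq> gen_submodule K T (tw ` (lists I - {[]}))"
      using that(2) by (intro gen_submodule_minimal[OF H subset_trans[OF _ gen_submodule_superset]]) auto
    thus ?thesis using tp_span_words[of l "[]"] that by auto
  qed
  thus ?thesis unfolding TP_simps by (intro gen_submodule_minimal[OF H]) auto
qed

text \<open>Generated submodules depend formally on the ambient module, and linearity of
  \<open>eps2\<close> is stated over \<open>TP\<close>; so the span in \<open>T\<close> is carried
  over to \<open>TP\<close>.\<close>

lemma TP_span': "gen_submodule K TP (tw ` (lists I - {[]})) = carrier TP"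
proof
  have sub: "tw ` (lists I - {[]}) \<subseteq> carrier TP" using map_a_RT by (auto intro!: tp_TP)
  show "gen_submodule K TP (tw ` (lists I - {[]})) \<subseteq> carrier TP"
    by (rule gen_submodule_closed[OF module_TP sub])
  note H = gen_submodule_is_submodule[OF module_TP sub]
  have "submodule (gen_submodule K TP (tw ` (lists I - {[]}))) K T"
  proof (rule submoduleI'[OF module_T])
    show "gen_submodule K TP (tw ` (lists I - {[]})) \<subseteq> carrier T"
      using gen_submodule_closed[OF module_TP sub] TP_subset by blast
    show "\<zero>\<^bsub>T\<^esub> \<in> gen_submodule K TP (tw ` (lists I - {[]}))"
      using subgroup.one_closed[OF submodule.axioms(1)[OF H]] by (simp add: TP_simps)
  qed (use module.submoduleE(4,5)[OF module_TP H] in \<open>simp_all add: TP_simps\<close>)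
  from gen_submodule_minimal[OF this gen_submodule_superset] TP_span
  show "carrier TP \<subseteq> gen_submodule K TP (tw ` (lists I - {[]}))" by blast
qed

text \<open>Induction over the symmetric algebra leaves the elements \<open>eps1 R Q f t\<close>. As
  \<open>t\<close> is a combination of words, generators of \<open>J\<close> replace these by
  evaluations, which are constants by \<open>evaluation1\<close>.\<close>

lemma const1_scalar_mod:
  assumes "c \<in> carrier C1"
  shows "scalar_mod (const1 c)"
  using assms[unfolded C1_eq]
proof (induction rule: C1.sym_algebra_induct)
  case (scalar \<gamma>)
  thus ?case using const_scalar(1)[of \<gamma>] scalar_mod_emb by (simp add: C1_eq)
next
  case (emb m)
  note lin = linear_on_comp[OF C1.sym_emb_linear[folded C1_eq] const1_linear]
  show ?case
    using emb[unfolded M1_eq]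
  proof (induction rule: M1.tensor_induct)
    case (pure f t)
    have f: "f \<in> RJ R Q" using pure by simp
    have "scalar_mod (const1 (eps1 R Q f t))"
    proof (rule scalar_mod_linear[OF linear_on_comp[OF eps1_linear_right[OF f] const1_linear] module_T])
      show "t \<in> gen_submodule K T (tw ` lists I)" using pure T_span by simp
      fix y assume "y \<in> tw ` lists I"
      then obtain V where V: "V \<in> lists I" "y = tw V" by blast
      note e = evaluation1[OF f V(1)]
      have "const1 (eps1 R Q f (tw V)) \<ominus>\<^bsub>A\<^esub> emb (evaluation S (f \<otimes>\<^bsub>S\<^esub> nint V)) \<in> gens1"
        unfolding gens1_def const_gen(1)[OF e(1,3), symmetric] using f V by blast
      hence "const1 (eps1 R Q f (tw V)) \<ominus>\<^bsub>A\<^esub> emb (evaluation S (f \<otimes>\<^bsub>S\<^esub> nint V)) \<in> J"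
        using D.genideal_self[OF gens_closed] unfolding J_eq by blast
      hence "q (const1 (eps1 R Q f (tw V))) = q (emb (evaluation S (f \<otimes>\<^bsub>S\<^esub> nint V)))"
        by (intro q_eqI const_closed e emb_closed constants_closed)
      thus "scalar_mod (const1 (eps1 R Q f y))" unfolding scalar_mod_def V using e(3) by blast
    qed (use tw_closed in auto)
    thus ?case by (simp add: eps1_def T_mod_eq)
  next
    case (add s t)
    thus ?case using linear_on_add[OF lin[unfolded M1_eq]] linear_on_closed[OF lin[unfolded M1_eq]]
      by (simp add: scalar_mod_add M1_eq)
  qed
next
  case (add x y)
  thus ?case using linear_on_add[OF const1_linear, of x y]
    by (simp add: scalar_mod_add const_closed flip: C1_eq)
next
  case (mult x y)
  thus ?case using const1_mult[of x y]
    by (simp add: scalar_mod_mult const_closed flip: C1_eq)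
qed

text \<open>Both arguments of the bilinear map are expanded in words: the left one while a word
  stands on the right, and afterwards the right one.\<close>

lemma const2_eps2_scalar_mod:
  assumes "s \<in> carrier TP" "t \<in> carrier TP"
  shows "scalar_mod (const2 (eps2 R Q s t))"
proof -
  have sub: "tw ` (lists I - {[]}) \<subseteq> carrier TP" using map_a_RT by (auto intro!: tp_TP)
  have "scalar_mod (const2 (eps2 R Q (tw U) (tw V)))"
    if U: "U \<in> lists I" "U \<noteq> []" and V: "V \<in> lists I" "V \<noteq> []" for U V
  proof -
    note e = evaluation2[OF that]
    have "const2 (eps2 R Q (tw U) (tw V)) \<ominus>\<^bsub>A\<^esub> emb (evaluation S (nint U \<otimes>\<^bsub>S\<^esub> nint V)) \<in> gens2"
      unfolding gens2_def const_gen(2)[OF e(1,3), symmetric] using U V by blast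
    hence "const2 (eps2 R Q (tw U) (tw V)) \<ominus>\<^bsub>A\<^esub> emb (evaluation S (nint U \<otimes>\<^bsub>S\<^esub> nint V)) \<in> J"
      using D.genideal_self[OF gens_closed] unfolding J_eq by blast
    hence "q (const2 (eps2 R Q (tw U) (tw V))) = q (emb (evaluation S (nint U \<otimes>\<^bsub>S\<^esub> nint V)))"
      by (intro q_eqI const_closed e emb_closed constants_closed)
    thus ?thesis unfolding scalar_mod_def using e(3) by blast
  qed
  note words = this
  have 1: "scalar_mod (const2 (eps2 R Q u (tw V)))"
    if u: "u \<in> carrier TP" and V: "V \<in> lists I" "V \<noteq> []" for u V
  proof (rule scalar_mod_linear[OF linear_on_comp[OF eps2_linear_left const2_linear] module_TP sub])
    show "tw V \<in> carrier TP" using sub V by blast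
    show "u \<in> gen_submodule K TP (tw ` (lists I - {[]}))" unfolding TP_span' by (rule u)
    fix y assume "y \<in> tw ` (lists I - {[]})"
    thus "scalar_mod (const2 (eps2 R Q y (tw V)))" using words V by blast
  qed
  show ?thesis
  proof (rule scalar_mod_linear[OF linear_on_comp[OF eps2_linear_right const2_linear] module_TP sub])
    show "s \<in> carrier TP" by (rule assms(1))
    show "t \<in> gen_submodule K TP (tw ` (lists I - {[]}))" unfolding TP_span' by (rule assms(2))
    fix y assume "y \<in> tw ` (lists I - {[]})"
    thus "scalar_mod (const2 (eps2 R Q s y))" using 1[OF assms(1)] by blast
  qed
qed

text \<open>\<open>C2\<close> is a quotient of a symmetric algebra; the induction takes place in
  that algebra, through the projection \<open>pr\<close>.\<close>

lemma const2_scalar_mod: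
  assumes "c \<in> carrier C2"
  shows "scalar_mod (const2 c)"
proof -
  define pr where "pr x = J2 R Q +>\<^bsub>Sym_M2 R Q\<^esub> x" for x
  obtain x where x: "x \<in> carrier (Sym_M2 R Q)" "c = pr x"
    using assms unfolding C2_alg_def C2.quot.quot_carrier pr_def by blast
  have prlin: "linear_on K (Sym_M2 R Q) C2 pr" unfolding pr_def by (rule C2_proj_linear)
  note lin = linear_on_comp[OF prlin const2_linear]
  have prone: "pr \<one>\<^bsub>Sym_M2 R Q\<^esub> = \<one>\<^bsub>C2\<^esub>"
    unfolding pr_def C2_alg_def C2.quot_one ..
  have prmult: "pr (u \<otimes>\<^bsub>Sym_M2 R Q\<^esub> v) = pr u \<otimes>\<^bsub>C2\<^esub> pr v"
    if "u \<in> carrier (Sym_M2 R Q)" "v \<in> carrier (Sym_M2 R Q)" for u v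
    unfolding pr_def C2_alg_def using C2.quot_mult[OF that] by simp
  have "scalar_mod (const2 (pr x))"
    using x(1)[unfolded S2_eq]
  proof (induction rule: S2.sym_algebra_induct)
    case (scalar \<gamma>)
    have "pr (\<gamma> \<odot>\<^bsub>Sym_M2 R Q\<^esub> \<one>\<^bsub>Sym_M2 R Q\<^esub>) = \<gamma> \<odot>\<^bsub>C2\<^esub> \<one>\<^bsub>C2\<^esub>"
      using linear_on_smult[OF prlin, of \<gamma> "\<one>\<^bsub>Sym_M2 R Q\<^esub>"] scalar S2.A_one_closed prone by simp
    thus ?case using const_scalar(2)[of \<gamma>] scalar scalar_mod_emb by (simp add: S2_eq)
  next
    case (emb m)
    note lin' = linear_on_comp[OF S2.sym_emb_linear[folded S2_eq] lin, unfolded M2_def]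
    show ?case
      using emb[unfolded M2_def]
    proof (induction rule: M2.sym_square_induct)
      case zero
      show ?case
        using linear_on_zero[OF lin' M2.module_sym_square module_A] scalar_mod_zero
        by (simp add: M2_def)
    next
      case (pure s t)
      thus ?case using const2_eps2_scalar_mod[OF pure]
        by (simp add: eps2_def pre_eps2_def pr_def S2_eq)
    next
      case (add s t)
      thus ?case using linear_on_add[OF lin'] linear_on_closed[OF lin']
        by (simp add: scalar_mod_add M2_def)
    qed
  next
    case (add x y)
    thus ?case using linear_on_add[OF lin, of x y] linear_on_closed[OF lin]
      by (simp add: scalar_mod_add flip: S2_eq)
  next
    case (mult x y)
    hence xy: "pr x \<in> carrier C2" "pr y \<in> carrier C2"
      using linear_on_closed[OF prlin] by (auto simp flip: S2_eq)
    thus ?case using const2_mult[OF xy] prmult[of x y] mult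
      by (simp add: scalar_mod_mult const_closed flip: S2_eq)
  qed
  thus ?thesis using x by simp
qed

end

context idr_hom begin

subsection \<open>Normal forms modulo the ideal\<close>

text \<open>IDR(R) as a module over \<open>R\<close> rather than over the constants, so that
  combinations of words can have coefficients in \<open>R\<close>.\<close>

definition DM :: "('a, 'a idr) module" where
  "DM = \<lparr>carrier = carrier A, monoid.mult = monoid.mult A, monoid.one = \<one>\<^bsub>A\<^esub>,
    ring.zero = \<zero>\<^bsub>A\<^esub>, ring.add = ring.add A, smult = (\<lambda>r x. emb r \<otimes>\<^bsub>A\<^esub> x)\<rparr>"

lemma DM_simps:
  "carrier DM = carrier A" "ring.add DM = ring.add A" "ring.zero DM = ring.zero A"
  "r \<odot>\<^bsub>DM\<^esub> x = emb r \<otimes>\<^bsub>A\<^esub> x"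
  by (simp_all add: DM_def)

lemma module_DM: "module R DM"
proof (rule moduleI[OF is_cring])
  show "abelian_group DM"
    by (rule abelian_group_cong[OF AM.abelian_group_axioms]) (simp_all add: DM_simps)
  fix x assume "x \<in> carrier DM"
  thus "\<one> \<odot>\<^bsub>DM\<^esub> x = x" using AC.l_one[of x] by (simp add: DM_simps one_A_eq)
qed (use emb_closed in \<open>simp_all add: DM_simps emb_add emb_mult AC.l_distr AC.r_distr AC.m_assoc\<close>)

text \<open>The lift of \<open>\<theta>S\<close> to IDR(R), with words in place of nested
  integrals.\<close>

definition \<theta>D where "\<theta>D = lin_ext R DM (\<lambda>V. word (map a V))"

lemma words_DM: "(\<lambda>V. word (map a V)) \<in> lists I \<rightarrow> carrier DM"
proof
  fix V assume "V \<in> lists I"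
  thus "word (map a V) \<in> carrier DM" unfolding DM_simps by (intro word_closed map_a_RT)
qed

lemma \<theta>D_linear: "linear_on R FR DM \<theta>D"
  unfolding \<theta>D_def by (rule linear_on_lin_ext[OF module_DM words_DM])

lemma \<theta>D_single: "V \<in> lists I \<Longrightarrow> \<theta>D (single R V) = word (map a V)"
  unfolding \<theta>D_def by (rule lin_ext_single[OF module_DM words_DM])

lemma \<theta>D_closed: "p \<in> carrier FR \<Longrightarrow> \<theta>D p \<in> carrier A"
  using linear_on_closed[OF \<theta>D_linear] by (simp add: DM_simps)

text \<open>Two \<open>R\<close>-linear maps on a free module coincide if they agree on its basis,
  which here consists of the words. As in \<open>word_image\<close>, \<open>h\<close> is arbitrary
  for the sake of uniqueness.\<close>

lemma hom_\<theta>D: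
  assumes closed: "\<And>x. x \<in> carrier A \<Longrightarrow> h x \<in> carrier S"
    and add: "\<And>x y. \<lbrakk>x \<in> carrier A; y \<in> carrier A\<rbrakk> \<Longrightarrow> h (x \<oplus>\<^bsub>A\<^esub> y) = h x \<oplus>\<^bsub>S\<^esub> h y"
    and mult: "\<And>x y. \<lbrakk>x \<in> carrier A; y \<in> carrier A\<rbrakk> \<Longrightarrow> h (x \<otimes>\<^bsub>A\<^esub> y) = h x \<otimes>\<^bsub>S\<^esub> h y"
    and int: "\<And>x. x \<in> carrier A \<Longrightarrow> h (IDR_integ R Q x) = integ S (h x)"
    and emb: "\<And>r. r \<in> carrier R \<Longrightarrow> h (emb r) = r"
    and p: "p \<in> carrier FR"
  shows "h (\<theta>D p) = \<theta>S p"
proof (rule linear_on_free_eqI[OF module_SM _ \<theta>S_linear _ p])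
  have "linear_on R DM SM h"
    by (rule linear_onI) (simp_all add: DM_simps closed add mult emb emb_closed)
  thus "linear_on R FR SM (\<lambda>p. h (\<theta>D p))" by (rule linear_on_comp[OF \<theta>D_linear])
  fix V assume "V \<in> lists I"
  thus "h (\<theta>D (single R V)) = \<theta>S (single R V)"
    using word_image[of h V] mult int emb by (simp add: \<theta>D_single \<theta>S_single)
qed

lemma \<eta>_\<theta>D: "p \<in> carrier FR \<Longrightarrow> \<eta> (\<theta>D p) = \<theta>S p"
  by (rule hom_\<theta>D) (simp_all add: \<eta>_closed \<eta>_add \<eta>_mult \<eta>_integ \<eta>_emb)

text \<open>The equality holds in IDR(R) itself, not only modulo \<open>J\<close>: a tensor with
  arbitrary entries is expanded in basis words with constant coefficients.\<close>

lemma word_in_image: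
  assumes "l \<in> lists (RT R Q)"
  shows "\<exists>p\<in>carrier FR. word l = \<theta>D p"
proof -
  interpret FR: module R FR by (rule module_FR)
  note lin = IDR_pure_linear[OF one_closed units_closed]
  have sub: "tw ` lists I \<subseteq> carrier T" using tw_closed by auto
  have l: "tp l \<in> gen_submodule K T (tw ` lists I)" unfolding T_span by (rule tp_closed[OF assms])
  have "\<exists>p\<in>carrier FR. IDR_pure R Q \<one> \<one>\<^bsub>C1\<^esub> \<one>\<^bsub>C2\<^esub> (tp l) = \<theta>D p"
    using module_T sub l
  proof (induction rule: gen_submodule_induct)
    case zero
    have "\<theta>D \<zero>\<^bsub>FR\<^esub> = \<zero>\<^bsub>A\<^esub>"
      using linear_on_zero[OF \<theta>D_linear module_FR module_DM] by (simp add: DM_simps)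
    thus ?case using linear_on_zero[OF lin module_T module_A] FR.zero_closed by metis
  next
    case (gen y)
    then obtain V where V: "V \<in> lists I" "y = tw V" by blast
    thus ?case using \<theta>D_single[OF V(1)] single_closed[OF is_cring V(1)] by (metis ip_def)
  next
    case (add x y)
    then obtain u v where uv: "u \<in> carrier FR" "v \<in> carrier FR"
      "IDR_pure R Q \<one> \<one>\<^bsub>C1\<^esub> \<one>\<^bsub>C2\<^esub> x = \<theta>D u" "IDR_pure R Q \<one> \<one>\<^bsub>C1\<^esub> \<one>\<^bsub>C2\<^esub> y = \<theta>D v" by blast
    have "IDR_pure R Q \<one> \<one>\<^bsub>C1\<^esub> \<one>\<^bsub>C2\<^esub> (x \<oplus>\<^bsub>T\<^esub> y) = \<theta>D (u \<oplus>\<^bsub>FR\<^esub> v)"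
      using linear_on_add[OF lin add(1,2)] linear_on_add[OF \<theta>D_linear uv(1,2)] uv(3,4)
      by (simp add: DM_simps)
    thus ?case using FR.a_closed[OF uv(1,2)] by blast
  next
    case (smult c x)
    then obtain u where u: "u \<in> carrier FR" "IDR_pure R Q \<one> \<one>\<^bsub>C1\<^esub> \<one>\<^bsub>C2\<^esub> x = \<theta>D u" by blast
    have c: "c \<in> constants R" "c \<in> carrier R" using smult(1) constants_closed by auto
    have "IDR_pure R Q \<one> \<one>\<^bsub>C1\<^esub> \<one>\<^bsub>C2\<^esub> (c \<odot>\<^bsub>T\<^esub> x) = \<theta>D (c \<odot>\<^bsub>FR\<^esub> u)"
      using linear_on_smult[OF lin smult(1,2)] linear_on_smult[OF \<theta>D_linear c(2) u(1)] u
        smult_emb[OF c(1) \<theta>D_closed[OF u(1)]]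
      by (simp add: DM_simps)
    thus ?case using FR.smult_closed[OF c(2) u(1)] by blast
  qed
  thus ?thesis by (simp add: ip_def)
qed

lemma normal_form:
  assumes "x \<in> carrier A"
  shows "\<exists>p\<in>carrier FR. q x = q (\<theta>D p)"
proof -
  interpret FR: module R FR by (rule module_FR)
  show ?thesis
    using assms
  proof (induction rule: A_induct)
    case (pure f0 c1 c2 l)
    obtain \<gamma> where g: "\<gamma> \<in> carrier R" "q (const1 c1) = q (emb \<gamma>)"
      using const1_scalar_mod[OF pure(2)] constants_closed unfolding scalar_mod_def by blast
    obtain \<delta> where d: "\<delta> \<in> carrier R" "q (const2 c2) = q (emb \<delta>)"
      using const2_scalar_mod[OF pure(3)] constants_closed unfolding scalar_mod_def by blast
    obtain p where p: "p \<in> carrier FR" "word l = \<theta>D p" using word_in_image[OF pure(4)] by blast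
    \<comment> \<open>The constants from \<open>C1\<close> and \<open>C2\<close> have become scalars
      and merge with \<open>f0\<close>.\<close>
    let ?r = "f0 \<otimes> (\<gamma> \<otimes> \<delta>)"
    have r: "?r \<in> carrier R" using pure g d by simp
    note cl = emb_closed[OF pure(1)] emb_closed[OF g(1)] emb_closed[OF d(1)] word_closed[OF pure(4)]
      const_closed(1)[OF pure(2)] const_closed(2)[OF pure(3)]
    have "q (ip f0 c1 c2 l) = q (emb f0 \<otimes>\<^bsub>A\<^esub> (emb \<gamma> \<otimes>\<^bsub>A\<^esub> (emb \<delta> \<otimes>\<^bsub>A\<^esub> word l)))"
      unfolding ip_decomp[OF pure] using cl g(2) d(2) by (simp add: q_mult AC.m_closed)
    also have "emb f0 \<otimes>\<^bsub>A\<^esub> (emb \<gamma> \<otimes>\<^bsub>A\<^esub> (emb \<delta> \<otimes>\<^bsub>A\<^esub> word l)) = emb ?r \<otimes>\<^bsub>A\<^esub> word l"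
      using cl pure(1) g(1) d(1) by (simp add: emb_mult AC.m_assoc)
    also have "\<dots> = \<theta>D (?r \<odot>\<^bsub>FR\<^esub> p)"
      using linear_on_smult[OF \<theta>D_linear r p(1)] p(2) by (simp add: DM_simps)
    finally show ?case using FR.smult_closed[OF r p(1)] by blast
  next
    case (add x y)
    then obtain u v where uv: "u \<in> carrier FR" "v \<in> carrier FR" "q x = q (\<theta>D u)" "q y = q (\<theta>D v)"
      by blast
    have "q (x \<oplus>\<^bsub>A\<^esub> y) = q (\<theta>D (u \<oplus>\<^bsub>FR\<^esub> v))"
      using add uv linear_on_add[OF \<theta>D_linear uv(1,2)] by (simp add: q_add \<theta>D_closed DM_simps)
    thus ?case using FR.a_closed[OF uv(1,2)] by blast
  qed
qed

lemma J_closed: "h \<in> J \<Longrightarrow> h \<in> carrier A" "h \<in> J \<Longrightarrow> \<eta> h = \<zero>\<^bsub>S\<^esub>"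
  using J_ker by (auto simp: ker_def)

lemma coset_image:
  assumes "x \<in> carrier A" "y \<in> q x"
  shows "y \<in> carrier A" "\<eta> y = \<eta> x"
proof -
  obtain h where h: "h \<in> J" "y = h \<oplus>\<^bsub>A\<^esub> x" using q_memE[OF assms(2)] .
  show "y \<in> carrier A" using h J_closed assms(1) by simp
  show "\<eta> y = \<eta> x" using h J_closed assms(1) \<eta>_closed by (simp add: \<eta>_add)
qed

lemma ker_eq_J: "ker = J"
proof
  show "ker \<subseteq> J"
  proof
    fix x assume "x \<in> ker"
    hence x: "x \<in> carrier A" "\<eta> x = \<zero>\<^bsub>S\<^esub>" by (auto simp: ker_def)
    obtain p where p: "p \<in> carrier FR" "q x = q (\<theta>D p)" using normal_form[OF x(1)] by blast
    have xp: "x \<in> q (\<theta>D p)" using q_self[OF x(1)] p(2) by simp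
    have "\<theta>S p = \<zero>\<^bsub>S\<^esub>"
      using coset_image(2)[OF \<theta>D_closed[OF p(1)] xp] x(2) \<eta>_\<theta>D[OF p(1)] by simp
    hence "p = \<zero>\<^bsub>FR\<^esub>" by (rule \<theta>S_injective[OF p(1)])
    hence "\<theta>D p = \<zero>\<^bsub>A\<^esub>"
      using linear_on_zero[OF \<theta>D_linear module_FR module_DM] by (simp add: DM_simps)
    moreover obtain h where "h \<in> J" "x = h \<oplus>\<^bsub>A\<^esub> \<theta>D p" using q_memE[OF xp] .
    ultimately show "x \<in> J" using J_closed by simp
  qed
qed (rule J_ker)

text \<open>Since the kernel is \<open>J\<close>, the cosets are the fibres of
  \<open>\<eta>\<close>. From here on identities in the quotient are verified by applying
  \<open>\<eta>\<close> and computing in \<open>S\<close>.\<close>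

lemma q_eq_iff:
  assumes x: "x \<in> carrier A" and y: "y \<in> carrier A"
  shows "q x = q y \<longleftrightarrow> \<eta> x = \<eta> y"
proof
  assume "q x = q y"
  hence "x \<in> q y" using q_self[OF x] by simp
  thus "\<eta> x = \<eta> y" by (rule coset_image(2)[OF y])
next
  assume "\<eta> x = \<eta> y"
  hence "x \<ominus>\<^bsub>A\<^esub> y \<in> ker"
    using x y \<eta>_closed by (simp add: ker_def \<eta>_minus minus_eq_zero_iff[OF S.abelian_group_axioms])
  thus "q x = q y" unfolding ker_eq_J by (rule q_eqI[OF x y])
qed

subsection \<open>The isomorphism\<close>

abbreviation "QD \<equiv> integro_diff_quot D J"
abbreviation "Rb \<equiv> S\<lparr>carrier := \<eta> ` carrier D\<rparr>"

lemma IDR_der_closed: "x \<in> carrier A \<Longrightarrow> IDR_der R Q x \<in> carrier A"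
  and IDR_integ_closed: "x \<in> carrier A \<Longrightarrow> IDR_integ R Q x \<in> carrier A"
  using linear_on_closed[OF IDR_der_spec(1)] linear_on_closed[OF IDR_integ_spec(1)] by auto

lemma QD_carrier: "carrier QD = q ` carrier A"
  by (auto simp: integro_diff_quot_def FactRing_def A_RCOSETS_def RCOSETS_def a_r_coset_def D_simps)

lemma QD_cring: "cring QD"
  by (rule cring_cong[OF J.quotient_is_cring[OF D.is_cring]]) (simp_all add: integro_diff_quot_def)

lemma QD_add: "\<lbrakk>x \<in> carrier A; y \<in> carrier A\<rbrakk> \<Longrightarrow> q x \<oplus>\<^bsub>QD\<^esub> q y = q (x \<oplus>\<^bsub>A\<^esub> y)"
  and QD_mult: "\<lbrakk>x \<in> carrier A; y \<in> carrier A\<rbrakk> \<Longrightarrow> q x \<otimes>\<^bsub>QD\<^esub> q y = q (x \<otimes>\<^bsub>A\<^esub> y)"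
  by (simp_all add: integro_diff_quot_def q_add q_mult)

lemma QD_one: "\<one>\<^bsub>QD\<^esub> = q \<one>\<^bsub>A\<^esub>"
  by (simp add: integro_diff_quot_def FactRing_def D_simps)

text \<open>Zero is the only solution of \<open>z = z + z\<close>, and \<open>\<eta>\<close> carries
  this equation to \<open>S\<close>.\<close>

lemma QD_zero: "\<zero>\<^bsub>QD\<^esub> = q \<zero>\<^bsub>A\<^esub>"
proof -
  interpret QD: cring QD by (rule QD_cring)
  obtain z where z: "z \<in> carrier A" "\<zero>\<^bsub>QD\<^esub> = q z" using QD.zero_closed unfolding QD_carrier by blast
  have "q z = q z \<oplus>\<^bsub>QD\<^esub> \<zero>\<^bsub>QD\<^esub>" using QD.r_zero z unfolding QD_carrier by blast
  also have "\<dots> = q (z \<oplus>\<^bsub>A\<^esub> z)" using z by (simp add: QD_add)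
  finally have "\<eta> z = \<eta> z \<oplus>\<^bsub>S\<^esub> \<eta> z" using z by (simp add: q_eq_iff \<eta>_add)
  hence "\<eta> z = \<zero>\<^bsub>S\<^esub>" using \<eta>_closed[OF z(1)] by (simp add: S.add.r_cancel_one')
  thus ?thesis using z by (simp add: q_eq_iff \<eta>_zero)
qed

text \<open>Derivation and integral of the quotient are unions over a coset. All its members have
  the same image under \<open>\<eta>\<close>, which commutes with both operations, so they yield one
  and the same coset.\<close>

lemma QD_der: "x \<in> carrier A \<Longrightarrow> der QD (q x) = q (IDR_der R Q x)"
  and QD_integ: "x \<in> carrier A \<Longrightarrow> integ QD (q x) = q (IDR_integ R Q x)"
proof -
  assume x: "x \<in> carrier A"
  have "(\<lambda>y. q (IDR_der R Q y)) ` q x = {q (IDR_der R Q x)}"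
    "(\<lambda>y. q (IDR_integ R Q y)) ` q x = {q (IDR_integ R Q x)}"
  proof -
    have "q (IDR_der R Q y) = q (IDR_der R Q x)" "q (IDR_integ R Q y) = q (IDR_integ R Q x)"
      if "y \<in> q x" for y
      using coset_image[OF x that] x
      by (simp_all add: q_eq_iff IDR_der_closed IDR_integ_closed \<eta>_der \<eta>_integ)
    thus "(\<lambda>y. q (IDR_der R Q y)) ` q x = {q (IDR_der R Q x)}"
      "(\<lambda>y. q (IDR_integ R Q y)) ` q x = {q (IDR_integ R Q x)}"
      using q_self[OF x] by blast+
  qed
  thus "der QD (q x) = q (IDR_der R Q x)" "integ QD (q x) = q (IDR_integ R Q x)"
    by (simp_all add: integro_diff_quot_def D_simps)
qed

text \<open>The derivative of a representative lies in the coset of zero, hence in the fibre over 0.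
  Linearity of the integral over the constants of the quotient can thus be taken from
  \<open>S\<close>.\<close>

lemma \<eta>_constants:
  assumes x: "x \<in> carrier A" and c: "q x \<in> constants QD"
  shows "\<eta> x \<in> constants S"
proof -
  have "q (IDR_der R Q x) = q \<zero>\<^bsub>A\<^esub>" using c x by (simp add: constants_def QD_der QD_zero)
  hence "der S (\<eta> x) = \<zero>\<^bsub>S\<^esub>"
    using x by (simp add: q_eq_iff IDR_der_closed \<eta>_der \<eta>_zero)
  thus ?thesis using \<eta>_closed[OF x] by (simp add: constants_def)
qed

lemma QD_integro_diff_ring: "integro_diff_ring QD"
proof (intro integro_diff_ring.intro diff_ring.intro diff_ring_axioms.intro
    integro_diff_ring_axioms.intro QD_cring)
  note cl = IDR_der_closed IDR_integ_closed
  fix u assume "u \<in> carrier QD"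
  then obtain x where x: "x \<in> carrier A" "u = q x" unfolding QD_carrier by blast
  show "der QD u \<in> carrier QD" "integ QD u \<in> carrier QD"
    unfolding x(2) QD_der[OF x(1)] QD_integ[OF x(1)] QD_carrier using x(1) cl by blast+
  show "der QD (integ QD u) = u"
    using x cl by (simp add: QD_der QD_integ q_eq_iff \<eta>_der \<eta>_integ S.der_integ \<eta>_closed)
  { fix v assume "v \<in> carrier QD"
    then obtain y where y: "y \<in> carrier A" "v = q y" unfolding QD_carrier by blast
    show "der QD (u \<oplus>\<^bsub>QD\<^esub> v) = der QD u \<oplus>\<^bsub>QD\<^esub> der QD v"
      "integ QD (u \<oplus>\<^bsub>QD\<^esub> v) = integ QD u \<oplus>\<^bsub>QD\<^esub> integ QD v"
      using x y cl
      by (simp_all add: QD_add QD_der QD_integ q_eq_iff \<eta>_der \<eta>_integ \<eta>_add S.der_add S.integ_add \<eta>_closed)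
    show "der QD (u \<otimes>\<^bsub>QD\<^esub> v) = der QD u \<otimes>\<^bsub>QD\<^esub> v \<oplus>\<^bsub>QD\<^esub> u \<otimes>\<^bsub>QD\<^esub> der QD v"
      using x y cl
      by (simp add: QD_add QD_mult QD_der q_eq_iff \<eta>_der \<eta>_add \<eta>_mult S.der_mult \<eta>_closed AC.m_closed) }
  fix c assume c: "c \<in> constants QD"
  then obtain y where y: "y \<in> carrier A" "c = q y"
    unfolding constants_def QD_carrier by blast
  have "\<eta> y \<in> constants S" using \<eta>_constants[OF y(1)] c y(2) by simp
  thus "integ QD (c \<otimes>\<^bsub>QD\<^esub> u) = c \<otimes>\<^bsub>QD\<^esub> integ QD u"
    using x y cl
    by (simp add: QD_mult QD_integ q_eq_iff \<eta>_integ \<eta>_mult S.integ_const \<eta>_closed AC.m_closed)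
qed

text \<open>The image is closed under all operations because \<open>\<eta>\<close> commutes with
  them; the laws are inherited from \<open>S\<close>.\<close>

lemma Rb_integro_diff_ring: "integro_diff_ring Rb"
proof -
  have cl: "\<eta> x \<in> carrier Rb" if "x \<in> carrier A" for x using that by (simp add: D_simps)
  have ex: "\<exists>x\<in>carrier A. u = \<eta> x" if "u \<in> carrier Rb" for u using that by (auto simp: D_simps)
  have S: "u \<in> carrier S" if "u \<in> carrier Rb" for u using ex[OF that] \<eta>_closed by auto
  have ops: "u \<oplus>\<^bsub>S\<^esub> v \<in> carrier Rb" "u \<otimes>\<^bsub>S\<^esub> v \<in> carrier Rb" "\<ominus>\<^bsub>S\<^esub> u \<in> carrier Rb"
    "der S u \<in> carrier Rb" "integ S u \<in> carrier Rb"
    if uv: "u \<in> carrier Rb" "v \<in> carrier Rb" for u v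
  proof -
    obtain x y where x: "x \<in> carrier A" "u = \<eta> x" and y: "y \<in> carrier A" "v = \<eta> y"
      using ex uv by metis
    show "u \<oplus>\<^bsub>S\<^esub> v \<in> carrier Rb" "u \<otimes>\<^bsub>S\<^esub> v \<in> carrier Rb" "der S u \<in> carrier Rb"
      "integ S u \<in> carrier Rb"
      using cl[OF AM.a_closed[OF x(1) y(1)]] cl[OF AC.m_closed[OF x(1) y(1)]]
        cl[OF IDR_der_closed[OF x(1)]] cl[OF IDR_integ_closed[OF x(1)]] x y
      by (simp_all only: \<eta>_add \<eta>_mult \<eta>_der \<eta>_integ)
    \<comment> \<open>Negation is expressed as a difference, which \<open>\<eta>\<close> is known to
      preserve.\<close>
    have "\<eta> (\<zero>\<^bsub>A\<^esub> \<ominus>\<^bsub>A\<^esub> x) = \<ominus>\<^bsub>S\<^esub> u"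
      using x \<eta>_closed by (simp add: \<eta>_minus \<eta>_zero S.minus_eq)
    thus "\<ominus>\<^bsub>S\<^esub> u \<in> carrier Rb" using cl[of "\<zero>\<^bsub>A\<^esub> \<ominus>\<^bsub>A\<^esub> x"] x by simp
  qed
  have zo: "\<zero>\<^bsub>S\<^esub> \<in> carrier Rb" "\<one>\<^bsub>S\<^esub> \<in> carrier Rb"
    using cl[of "\<zero>\<^bsub>A\<^esub>"] cl[of "\<one>\<^bsub>A\<^esub>"] AC.one_closed by (simp_all add: \<eta>_zero \<eta>_one)
  have S_ops: "u \<oplus>\<^bsub>Rb\<^esub> v = u \<oplus>\<^bsub>S\<^esub> v" "u \<otimes>\<^bsub>Rb\<^esub> v = u \<otimes>\<^bsub>S\<^esub> v" "\<zero>\<^bsub>Rb\<^esub> = \<zero>\<^bsub>S\<^esub>" "\<one>\<^bsub>Rb\<^esub> = \<one>\<^bsub>S\<^esub>"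
    "der Rb = der S" "integ Rb = integ S" for u v by simp_all
  have "abelian_group Rb"
  proof (rule abelian_groupI, unfold S_ops)
    fix u assume u: "u \<in> carrier Rb"
    show "\<exists>v\<in>carrier Rb. v \<oplus>\<^bsub>S\<^esub> u = \<zero>\<^bsub>S\<^esub>"
      using ops(3)[OF u u] S[OF u] S.l_neg by blast
    show "\<zero>\<^bsub>S\<^esub> \<oplus>\<^bsub>S\<^esub> u = u" using S[OF u] by simp
  next
    fix u v w assume "u \<in> carrier Rb" "v \<in> carrier Rb" "w \<in> carrier Rb"
    thus "u \<oplus>\<^bsub>S\<^esub> v \<oplus>\<^bsub>S\<^esub> w = u \<oplus>\<^bsub>S\<^esub> (v \<oplus>\<^bsub>S\<^esub> w)" by (intro S.a_assoc S)
  next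
    fix u v assume "u \<in> carrier Rb" "v \<in> carrier Rb"
    thus "u \<oplus>\<^bsub>S\<^esub> v \<in> carrier Rb" "u \<oplus>\<^bsub>S\<^esub> v = v \<oplus>\<^bsub>S\<^esub> u"
      using ops(1) S.a_comm[OF S S] by blast+
  qed (rule zo)
  moreover have "Group.comm_monoid Rb"
  proof (rule comm_monoidI, unfold S_ops)
    fix u v w assume "u \<in> carrier Rb" "v \<in> carrier Rb" "w \<in> carrier Rb"
    thus "u \<otimes>\<^bsub>S\<^esub> v \<otimes>\<^bsub>S\<^esub> w = u \<otimes>\<^bsub>S\<^esub> (v \<otimes>\<^bsub>S\<^esub> w)" by (intro S.m_assoc S)
  next
    fix u v assume "u \<in> carrier Rb" "v \<in> carrier Rb"
    thus "u \<otimes>\<^bsub>S\<^esub> v \<in> carrier Rb" "u \<otimes>\<^bsub>S\<^esub> v = v \<otimes>\<^bsub>S\<^esub> u"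
      using ops(2) S.m_comm[OF S S] by blast+
  next
    fix u assume "u \<in> carrier Rb"
    thus "\<one>\<^bsub>S\<^esub> \<otimes>\<^bsub>S\<^esub> u = u" by (intro S.l_one S)
  qed (rule zo)
  ultimately have cr: "cring Rb"
  proof (rule cringI, unfold S_ops)
    fix u v w assume "u \<in> carrier Rb" "v \<in> carrier Rb" "w \<in> carrier Rb"
    thus "(u \<oplus>\<^bsub>S\<^esub> v) \<otimes>\<^bsub>S\<^esub> w = u \<otimes>\<^bsub>S\<^esub> w \<oplus>\<^bsub>S\<^esub> v \<otimes>\<^bsub>S\<^esub> w" by (intro S.l_distr S)
  qed
  show ?thesis
  proof (intro integro_diff_ring.intro diff_ring.intro diff_ring_axioms.intro
      integro_diff_ring_axioms.intro cr, unfold S_ops)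
    fix u assume u: "u \<in> carrier Rb"
    show "der S u \<in> carrier Rb" "integ S u \<in> carrier Rb" by (rule ops(4,5)[OF u u])+
    show "der S (integ S u) = u" by (rule S.der_integ[OF S[OF u]])
    { fix v assume v: "v \<in> carrier Rb"
      show "der S (u \<oplus>\<^bsub>S\<^esub> v) = der S u \<oplus>\<^bsub>S\<^esub> der S v"
        "der S (u \<otimes>\<^bsub>S\<^esub> v) = der S u \<otimes>\<^bsub>S\<^esub> v \<oplus>\<^bsub>S\<^esub> u \<otimes>\<^bsub>S\<^esub> der S v"
        "integ S (u \<oplus>\<^bsub>S\<^esub> v) = integ S u \<oplus>\<^bsub>S\<^esub> integ S v"
        by (rule S.der_add S.der_mult S.integ_add; intro S u v)+ }
    fix c assume c: "c \<in> constants Rb"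
    hence "c \<in> constants S" using S[of c] unfolding constants_def S_ops by simp
    thus "integ S (c \<otimes>\<^bsub>S\<^esub> u) = c \<otimes>\<^bsub>S\<^esub> integ S u" by (rule S.integ_const[OF _ S[OF u]])
  qed
qed

definition \<eta>' where "\<eta>' Y = the_elem (\<eta> ` Y)"

lemma \<eta>'_q: "x \<in> carrier A \<Longrightarrow> \<eta>' (q x) = \<eta> x"
proof -
  assume x: "x \<in> carrier A"
  have "\<eta> ` q x = {\<eta> x}" using coset_image(2)[OF x] q_self[OF x] by blast
  thus ?thesis by (simp add: \<eta>'_def)
qed

lemma iso: "integro_diff_ring_iso QD Rb \<eta>'"
proof (intro integro_diff_ring_iso.intro integro_diff_ring_hom.intro
    integro_diff_ring_hom_axioms.intro integro_diff_ring_iso_axioms.intro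
    QD_integro_diff_ring Rb_integro_diff_ring)
  show "\<eta>' \<in> ring_hom QD Rb"
  proof (rule ring_hom_memI)
    fix u assume "u \<in> carrier QD"
    then obtain x where x: "x \<in> carrier A" "u = q x" unfolding QD_carrier by blast
    show "\<eta>' u \<in> carrier Rb" using x by (simp add: \<eta>'_q D_simps)
    fix v assume "v \<in> carrier QD"
    then obtain y where y: "y \<in> carrier A" "v = q y" unfolding QD_carrier by blast
    show "\<eta>' (u \<otimes>\<^bsub>QD\<^esub> v) = \<eta>' u \<otimes>\<^bsub>Rb\<^esub> \<eta>' v" "\<eta>' (u \<oplus>\<^bsub>QD\<^esub> v) = \<eta>' u \<oplus>\<^bsub>Rb\<^esub> \<eta>' v"
      using x y by (simp_all add: QD_mult QD_add \<eta>'_q \<eta>_mult \<eta>_add AC.m_closed)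
  next
    show "\<eta>' \<one>\<^bsub>QD\<^esub> = \<one>\<^bsub>Rb\<^esub>" by (simp add: QD_one \<eta>'_q AC.one_closed \<eta>_one)
  qed
next
  fix u assume "u \<in> carrier QD"
  then obtain x where x: "x \<in> carrier A" "u = q x" unfolding QD_carrier by blast
  show "\<eta>' (der QD u) = der Rb (\<eta>' u)" "\<eta>' (integ QD u) = integ Rb (\<eta>' u)"
    using x by (simp_all add: QD_der QD_integ \<eta>'_q IDR_der_closed IDR_integ_closed \<eta>_der \<eta>_integ)
next
  show "bij_betw \<eta>' (carrier QD) (carrier Rb)"
    unfolding bij_betw_def QD_carrier
  proof
    show "inj_on \<eta>' (q ` carrier A)"
    proof (rule inj_onI)
      fix u v assume "u \<in> q ` carrier A" "v \<in> q ` carrier A" and eq: "\<eta>' u = \<eta>' v"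
      then obtain x y where "x \<in> carrier A" "u = q x" "y \<in> carrier A" "v = q y" by blast
      thus "u = v" using eq by (simp add: \<eta>'_q q_eq_iff)
    qed
    show "\<eta>' ` q ` carrier A = carrier Rb"
      by (auto simp: \<eta>'_q D_simps image_image cong: image_cong)
  qed
qed

text \<open>Every coset contains a normal form \<open>\<theta>D p\<close>. Composing
  \<open>\<psi>\<close> with the projection gives a map to which \<open>hom_\<theta>D\<close>
  applies, so \<open>\<psi>\<close> takes the value \<open>\<theta>S p\<close> there, exactly as the
  induced map does.\<close>

lemma iso_unique:
  assumes \<psi>: "integro_diff_ring_hom QD Rb \<psi>"
    and \<psi>_iota: "\<And>f. f \<in> carrier R \<Longrightarrow> \<psi> (q (iota R Q f)) = f" and Y: "Y \<in> carrier QD"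
  shows "\<psi> Y = \<eta>' Y"
proof -
  obtain x where x: "x \<in> carrier A" "Y = q x" using Y unfolding QD_carrier by blast
  obtain p where p: "p \<in> carrier FR" "q x = q (\<theta>D p)" using normal_form[OF x(1)] by blast
  have qcl: "q y \<in> carrier QD" if "y \<in> carrier A" for y using that unfolding QD_carrier by blast
  have \<psi>_hom: "\<psi> \<in> ring_hom QD Rb" using \<psi> by (simp add: integro_diff_ring_hom_def integro_diff_ring_hom_axioms_def)
  have "\<psi> (q (\<theta>D p)) = \<theta>S p"
  proof (rule hom_\<theta>D[of "\<lambda>y. \<psi> (q y)"])
    fix y assume y: "y \<in> carrier A"
    have "\<psi> (q y) \<in> carrier Rb" by (rule ring_hom_closed[OF \<psi>_hom qcl[OF y]])
    thus "\<psi> (q y) \<in> carrier S" using \<eta>_closed by (auto simp: D_simps)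
    show "\<psi> (q (IDR_integ R Q y)) = integ S (\<psi> (q y))"
      using integro_diff_ring_hom.hom_integ[OF \<psi> qcl[OF y]] by (simp add: QD_integ y)
    fix z assume z: "z \<in> carrier A"
    show "\<psi> (q (y \<oplus>\<^bsub>A\<^esub> z)) = \<psi> (q y) \<oplus>\<^bsub>S\<^esub> \<psi> (q z)" "\<psi> (q (y \<otimes>\<^bsub>A\<^esub> z)) = \<psi> (q y) \<otimes>\<^bsub>S\<^esub> \<psi> (q z)"
      using ring_hom_add[OF \<psi>_hom qcl[OF y] qcl[OF z]] ring_hom_mult[OF \<psi>_hom qcl[OF y] qcl[OF z]]
      by (simp_all add: QD_add QD_mult y z)
  qed (use \<psi>_iota p(1) in \<open>simp_all add: iota_eq\<close>)
  thus ?thesis using x p \<eta>_\<theta>D[OF p(1)] \<theta>D_closed[OF p(1)] by (simp add: \<eta>'_q)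
qed

end

theorem theorem59:
  fixes R :: "'a diff_ring" and Q :: "'a \<Rightarrow> 'a"
    and S :: "'a integro_diff_ring" and \<eta> :: "'a idr \<Rightarrow> 'a"
    and I :: "'i set" and a :: "'i \<Rightarrow> 'a"
  defines "Rbar \<equiv> S\<lparr>carrier := \<eta> ` carrier (IDR R Q)\<rparr>"
    and "J \<equiv> eval_ideal R Q S I a"
    and "\<eta>' \<equiv> (\<lambda>Y. the_elem (\<eta> ` Y))"
  assumes "diff_ring R"
    and "quasi_integration R Q"
    and "integro_diff_ring S"
    and "diff_ring_extension R S"
    and "integro_diff_ring_hom (IDR R Q) S \<eta>"
    and "\<forall>f\<in>carrier R. \<eta> (iota R Q f) = f"
    and "constants Rbar = constants R"
    and "module_basis (const_ring R) (ring_submodule R (RT R Q)) I a"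
    and "\<forall>x\<in>carrier R. x \<noteq> \<zero>\<^bsub>R\<^esub> \<longrightarrow>
      (\<exists>c\<in>gen_diff_ideal R {x}. c \<in> constants R \<and> c \<noteq> \<zero>\<^bsub>R\<^esub>)"
  shows "integro_diff_ring_iso (integro_diff_quot (IDR R Q) J) Rbar \<eta>' \<and>
    (\<forall>x\<in>carrier (IDR R Q). \<eta>' (J +>\<^bsub>IDR R Q\<^esub> x) = \<eta> x) \<and>
    (\<forall>f\<in>carrier R. \<eta>' (J +>\<^bsub>IDR R Q\<^esub> iota R Q f) = f) \<and>
    (\<forall>\<psi>. integro_diff_ring_hom (integro_diff_quot (IDR R Q) J) Rbar \<psi> \<and>
      (\<forall>f\<in>carrier R. \<psi> (J +>\<^bsub>IDR R Q\<^esub> iota R Q f) = f) \<longrightarrow>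
      (\<forall>Y\<in>carrier (integro_diff_quot (IDR R Q) J). \<psi> Y = \<eta>' Y))"
proof -
  have quasi: "quasi_int R Q"
    using assms(4,5) by (intro quasi_int.intro quasi_int_axioms.intro)
  interpret X: idr_hom R Q S I a \<eta>
    using assms(6-) unfolding Rbar_def
    by (intro idr_hom.intro idr_hom_axioms.intro idr_setting.intro nested_integrals_indep.intro
        nested_integrals_indep_axioms.intro nested_integrals.intro nested_integrals_axioms.intro quasi)
      blast+
  have \<eta>': "\<eta>' = X.\<eta>'" unfolding \<eta>'_def by (rule ext) (simp add: X.\<eta>'_def)
  have \<eta>'_q: "\<eta>' (J +>\<^bsub>IDR R Q\<^esub> x) = \<eta> x" if "x \<in> carrier (IDR R Q)" for x
    using X.\<eta>'_q[of x] that unfolding \<eta>' J_def X.D_simps .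
  show ?thesis
  proof (intro conjI ballI allI impI)
    show "integro_diff_ring_iso (integro_diff_quot (IDR R Q) J) Rbar \<eta>'"
      unfolding \<eta>' J_def Rbar_def by (rule X.iso)
  next
    fix x assume "x \<in> carrier (IDR R Q)"
    thus "\<eta>' (J +>\<^bsub>IDR R Q\<^esub> x) = \<eta> x" by (rule \<eta>'_q)
  next
    fix f assume f: "f \<in> carrier R"
    have "iota R Q f \<in> carrier (IDR R Q)"
      using X.emb_closed[OF f] by (simp only: X.iota_eq X.D_simps)
    thus "\<eta>' (J +>\<^bsub>IDR R Q\<^esub> iota R Q f) = f" using \<eta>'_q X.\<eta>_iota[OF f] by metis
  next
    fix \<psi> Y assume "integro_diff_ring_hom (integro_diff_quot (IDR R Q) J) Rbar \<psi> \<and>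
        (\<forall>f\<in>carrier R. \<psi> (J +>\<^bsub>IDR R Q\<^esub> iota R Q f) = f)"
      and "Y \<in> carrier (integro_diff_quot (IDR R Q) J)"
    thus "\<psi> Y = \<eta>' Y" unfolding \<eta>' J_def Rbar_def by (intro X.iso_unique) blast+
  qed
qed

end
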